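(* Assume the setting and assumptions of the context, with $D=D_n<n$. Let $\mathcal R$ be the $1-\alpha$ bootstrap confidence rectangle for $\sigma$ and let $\mathcal T=\{G(a):a\in\mathcal R\}$, where $\theta=G(\sigma)$ is the map from vectorized covariances to vectorized partial correlations. Then $$P(\theta\in\mathcal T)\ge1-\alpha-O\left(\frac{\log D}{n^{1/8}}\right)-O\left(\Big(\frac{\log D}{n}\Big)^{1/6}\right).$$
   Context: Data: $Y_1,\dots,Y_n\in\mathbb R^D$ i.i.d. from $P$, $D=D_n$ may grow with $n$, $D<n$; $\mu=\mathbb E(Y)$, $\Sigma=\mathrm{Cov}(Y)$, $\Omega=\Sigma^{-1}$, $S_n=\frac1n\sum_i(Y_i-\overline Y)(Y_i-\overline Y)^T$. $\mathrm{vec}$ stacks columns; $\sigma=\mathrm{vec}(\Sigma)$, $s=\mathrm{vec}(S_n)$. $\Theta$ is the matrix of partial correlations $\Theta_{jk}=-\Omega_{jk}/\sqrt{\Omega_{jj}\Omega_{kk}}$, $\theta=\mathrm{vec}(\Theta)$, and $\theta=G(\sigma)$ defines $G$ (on vectorizations of matrices for which this formula makes sense); $L$ is the Jacobian of $G$ at $\sigma$. Bootstrap rectangle for $\sigma$: $Y_1^*,\dots,Y_n^*$ is an i.i.d. sample from the empirical distribution of $Y_1,\dots,Y_n$, $s^*$ is its vectorized sample covariance, $Z_\alpha$ is defined by $P(\sqrt n\|s^*-s\|_\infty>Z_\alpha\mid Y_1,\dots,Y_n)=\alpha$, and $\mathcal R=\{a\in\mathbb R^{D^2}:\|a-s\|_\infty\le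 Z_\alpha/\sqrt n\}$. A random vector $X$ with mean $m$ is sub-Gaussian if for some $\zeta>0$, $\mathbb E e^{t^T(X-m)}\le e^{\|t\|^2\zeta^2/2}$ for all $t$. Assumptions: $\max_j|Y(j)|\le B$ for some finite constant $B$; and (A1) $Y$ and $\mathrm{vec}(YY^T)$ are sub-Gaussian. (A2) $0<a\le\lambda_{\min}(\Sigma)\le\lambda_{\max}(\Sigma)\le A<\infty$ for constants $a,A$. (A3) $\lambda_{\min}(T)\ge c_0>0$, where $T=\mathbb E(\epsilon\epsilon^T\otimes\epsilon\epsilon^T)-\sigma\sigma^T$ with $\epsilon\sim N(0,\Sigma)$ is the asymptotic covariance of $\sqrt n(s-\sigma)$, and $\min_j\gamma_{jj}>0$, where $\gamma=\mathrm{diag}(\mathrm{Var}(\sqrt nL(s-\sigma)))$. (A4) $\max_j\mathbb E|V_i(j)|^3\le C$, where $V_i=\mathrm{vec}[(Y_i-\mu)(Y_i-\mu)^T]-\sigma$.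
   Formalization: As written, (A3) cannot hold: T is singular for D ≥ 2 and γ is 0 at diagonal positions as Θ_jj = −1. Here λ_min(T) is taken over vectorized symmetric matrices and γ > 0 is required only off the diagonal; Z_α is the upper bootstrap quantile, since equality to α may be unattainable. *)

theory Defs
  imports
    "HOL-Probability.Probability"
    "HOL-Library.Landau_Symbols"
    "Jordan_Normal_Form.Gauss_Jordan_Elimination"
    "Jordan_Normal_Form.Determinant"
    "Jordan_Normal_Form.Spectral_Radius"
begin

(* Vectors and matrices are those of Jordan_Normal_Form, because the dimension D varies with
   the sample size n. *)
unbundle no vec_syntax
hide_type (open) Finite_Cartesian_Product.vec
hide_const (open) Finite_Cartesian_Product.vec Determinants.det Finite_Cartesian_Product.mat
  Finite_Cartesian_Product.transpose

section \<open>Vectors and matrices\<close>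

definition outer :: "real vec \<Rightarrow> real vec \<Rightarrow> real mat" where
  "outer v w = mat (dim_vec v) (dim_vec w) (\<lambda>(j, k). v $ j * w $ k)"

definition kron :: "real mat \<Rightarrow> real mat \<Rightarrow> real mat" where
  "kron A B = mat (dim_row A * dim_row B) (dim_col A * dim_col B)
     (\<lambda>(p, q). A $$ (p div dim_row B, q div dim_col B) * B $$ (p mod dim_row B, q mod dim_col B))"

(* Column stacking: entry (j, k) of M goes to position k * dim_row M + j. *)
definition vectorize :: "real mat \<Rightarrow> real vec" where
  "vectorize M = vec (dim_row M * dim_col M) (\<lambda>p. M $$ (p mod dim_row M, p div dim_row M))"

definition unvectorize :: "nat \<Rightarrow> real vec \<Rightarrow> real mat" where
  "unvectorize D a = mat D D (\<lambda>(j, k). a $ (k * D + j))"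

definition sup_norm :: "real vec \<Rightarrow> real" where
  "sup_norm v = Max ((\<lambda>p. \<bar>v $ p\<bar>) ` {..<dim_vec v})"

definition jacobian :: "nat \<Rightarrow> (real vec \<Rightarrow> real vec) \<Rightarrow> real vec \<Rightarrow> real mat" where
  "jacobian m F x = mat m (dim_vec x)
     (\<lambda>(p, q). deriv (\<lambda>h. F (x + h \<cdot>\<^sub>v unit_vec (dim_vec x) q) $ p) 0)"

definition lambda_min :: "real mat \<Rightarrow> real" where
  "lambda_min M = Min (spectrum M)"

definition lambda_max :: "real mat \<Rightarrow> real" where
  "lambda_max M = Max (spectrum M)"

(* Smallest eigenvalue of a (D*D) x (D*D) matrix acting on the vectorizations of symmetric
   D x D matrices. A covariance matrix of the vectorization of a random symmetric matrix leaves
   this space invariant and annihilates its orthogonal complement (the coordinates (j, k) and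
   (k, j) agree), so for D \<ge> 2 its smallest eigenvalue on the whole space is always 0. *)
definition lambda_min_sym :: "nat \<Rightarrow> real mat \<Rightarrow> real" where
  "lambda_min_sym D M = Min {k. \<exists>S \<in> carrier_mat D D.
     transpose_mat S = S \<and> eigenvector M (vectorize S) k}"

section \<open>Random vectors\<close>

definition vec_borel :: "nat \<Rightarrow> real vec measure" where
  "vec_borel D = vimage_algebra (carrier_vec D) (\<lambda>v. \<lambda>j\<in>{..<D}. v $ j)
     (Pi\<^sub>M {..<D} (\<lambda>_. borel))"

definition mean_vec :: "nat \<Rightarrow> 'w measure \<Rightarrow> ('w \<Rightarrow> real vec) \<Rightarrow> real vec" where
  "mean_vec d M X = vec d (\<lambda>j. \<integral>\<omega>. X \<omega> $ j \<partial>M)"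

definition cov_mat :: "nat \<Rightarrow> 'w measure \<Rightarrow> ('w \<Rightarrow> real vec) \<Rightarrow> real mat" where
  "cov_mat d M X = mat d d (\<lambda>(j, k). \<integral>\<omega>. (X \<omega> $ j - mean_vec d M X $ j) *
     (X \<omega> $ k - mean_vec d M X $ k) \<partial>M)"

definition sub_gaussian :: "nat \<Rightarrow> 'w measure \<Rightarrow> ('w \<Rightarrow> real vec) \<Rightarrow> bool" where
  "sub_gaussian d M X \<longleftrightarrow> (\<exists>\<zeta>>0. \<forall>t \<in> carrier_vec d.
     integrable M (\<lambda>\<omega>. exp (t \<bullet> (X \<omega> - mean_vec d M X))) \<and>
     (\<integral>\<omega>. exp (t \<bullet> (X \<omega> - mean_vec d M X)) \<partial>M) \<le> exp ((t \<bullet> t) * \<zeta>\<^sup>2 / 2))"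

(* N(0, S) for a positive definite D x D matrix S. *)
definition mv_normal :: "nat \<Rightarrow> real mat \<Rightarrow> real vec measure" where
  "mv_normal D S = distr
     (density (Pi\<^sub>M {..<D} (\<lambda>_. lborel))
       (\<lambda>x. ennreal (exp (- (vec D x \<bullet> (the (mat_inverse S) *\<^sub>v vec D x)) / 2) /
         sqrt ((2 * pi) ^ D * det S))))
     (vec_borel D) (\<lambda>x. vec D x)"

definition iid_sample ::
  "nat \<Rightarrow> nat \<Rightarrow> real vec measure \<Rightarrow> 'w measure \<Rightarrow> (nat \<Rightarrow> 'w \<Rightarrow> real vec) \<Rightarrow> bool" where
  "iid_sample n D P M Y \<longleftrightarrow> prob_space M \<and>
     prob_space.indep_vars M (\<lambda>_. vec_borel D) Y {..<n} \<and>
     (\<forall>i<n. distr M (vec_borel D) (Y i) = P)"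

section \<open>Population quantities\<close>

definition pop_cov :: "nat \<Rightarrow> real vec measure \<Rightarrow> real mat" where
  "pop_cov D P = cov_mat D P (\<lambda>y. y)"

definition pop_cov_vec :: "nat \<Rightarrow> real vec measure \<Rightarrow> real vec" where
  "pop_cov_vec D P = vectorize (pop_cov D P)"

definition centred_square :: "nat \<Rightarrow> real vec measure \<Rightarrow> real vec \<Rightarrow> real vec" where
  "centred_square D P y =
     (let u = y - mean_vec D P (\<lambda>x. x) in vectorize (outer u u) - pop_cov_vec D P)"

definition T_mat :: "nat \<Rightarrow> real mat \<Rightarrow> real mat" where
  "T_mat D S =
     mat (D * D) (D * D)
       (\<lambda>pq. \<integral>e. kron (outer e e) (outer e e) $$ pq \<partial>(mv_normal D S))
     - outer (vectorize S) (vectorize S)"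

section \<open>Partial correlations\<close>

definition partial_corr :: "nat \<Rightarrow> real mat \<Rightarrow> real mat" where
  "partial_corr D S = (let Om = the (mat_inverse S) in
     mat D D (\<lambda>(j, k). - (Om $$ (j, k)) / sqrt (Om $$ (j, j) * Om $$ (k, k))))"

definition G_map :: "nat \<Rightarrow> real vec \<Rightarrow> real vec" where
  "G_map D a = vectorize (partial_corr D (unvectorize D a))"

(* The vectorized matrices, not necessarily symmetric, for which the formula defining G_map
   makes sense. This is an open set, so that G_map has a Jacobian there. *)
definition G_dom :: "nat \<Rightarrow> real vec set" where
  "G_dom D = {a \<in> carrier_vec (D * D). \<exists>Om. mat_inverse (unvectorize D a) = Some Om \<and>
     (\<forall>j<D. \<forall>k<D. Om $$ (j, j) * Om $$ (k, k) > 0)}"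

section \<open>Sample quantities and the bootstrap\<close>

definition sample_mean :: "nat \<Rightarrow> nat \<Rightarrow> (nat \<Rightarrow> real vec) \<Rightarrow> real vec" where
  "sample_mean n D y = vec D (\<lambda>j. (\<Sum>i<n. y i $ j) / real n)"

definition sample_cov :: "nat \<Rightarrow> nat \<Rightarrow> (nat \<Rightarrow> real vec) \<Rightarrow> real mat" where
  "sample_cov n D y = mat D D (\<lambda>(j, k).
     (\<Sum>i<n. (y i $ j - sample_mean n D y $ j) * (y i $ k - sample_mean n D y $ k)) / real n)"

definition sample_cov_vec :: "nat \<Rightarrow> nat \<Rightarrow> (nat \<Rightarrow> real vec) \<Rightarrow> real vec" where
  "sample_cov_vec n D y = vectorize (sample_cov n D y)"

definition empirical_pmf :: "nat \<Rightarrow> (nat \<Rightarrow> real vec) \<Rightarrow> real vec pmf" where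
  "empirical_pmf n y = map_pmf y (pmf_of_set {..<n})"

definition bootstrap_pmf :: "nat \<Rightarrow> (nat \<Rightarrow> real vec) \<Rightarrow> (nat \<Rightarrow> real vec) pmf" where
  "bootstrap_pmf n y = Pi_pmf {..<n} undefined (\<lambda>_. empirical_pmf n y)"

(* Given the data, the bootstrap law is discrete, so the tail probability need not attain the
   value alpha; the upper alpha-quantile is the least z whose tail probability is at most alpha. *)
definition bootstrap_quantile :: "nat \<Rightarrow> nat \<Rightarrow> real \<Rightarrow> (nat \<Rightarrow> real vec) \<Rightarrow> real" where
  "bootstrap_quantile n D \<alpha> y = Inf {z. measure_pmf.prob (bootstrap_pmf n y)
     {y'. sqrt (real n) * sup_norm (sample_cov_vec n D y' - sample_cov_vec n D y) > z} \<le> \<alpha>}"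

definition bootstrap_rectangle :: "nat \<Rightarrow> nat \<Rightarrow> real \<Rightarrow> (nat \<Rightarrow> real vec) \<Rightarrow> real vec set" where
  "bootstrap_rectangle n D \<alpha> y = {a \<in> carrier_vec (D * D).
     sup_norm (a - sample_cov_vec n D y) \<le> bootstrap_quantile n D \<alpha> y / sqrt (real n)}"

definition partial_corr_region :: "nat \<Rightarrow> nat \<Rightarrow> real \<Rightarrow> (nat \<Rightarrow> real vec) \<Rightarrow> real vec set" where
  "partial_corr_region n D \<alpha> y = G_map D ` (bootstrap_rectangle n D \<alpha> y \<inter> G_dom D)"

definition delta_cov ::
  "nat \<Rightarrow> nat \<Rightarrow> real vec measure \<Rightarrow> 'w measure \<Rightarrow> (nat \<Rightarrow> 'w \<Rightarrow> real vec) \<Rightarrow> real mat" where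
  "delta_cov n D P M Y = cov_mat (D * D) M (\<lambda>\<omega>. sqrt (real n) \<cdot>\<^sub>v
     (jacobian (D * D) (G_map D) (pop_cov_vec D P) *\<^sub>v
       (sample_cov_vec n D (\<lambda>i. Y i \<omega>) - pop_cov_vec D P)))"

end

theory Submission
  imports Defs "HOL-Real_Asymp.Real_Asymp"
begin

text \<open>
  On the domain of \<open>G_map\<close> the region is the image of the rectangle, so it suffices to bound the coverage of the
  rectangle for the covariances from below; the second error term is taken to be 0.

  The maximum over all coordinates of the centred products and of their negatives is smoothed by
  \<open>exp (- (\<Sum>j. exp (\<beta> * (w j - t))))\<close>, whose fourth derivatives in any direction are of order \<open>\<beta> ^ 4\<close>
  independently of the dimension. With \<open>\<beta> = n powr (1/6)\<close>, Lindeberg's replacement argument compares the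
  distribution function of the maximum of the normalised sums with that of the bootstrap, whose second and third
  moments are within \<open>O (ln n / sqrt n)\<close> with high probability.
  A second replacement by Gaussian multipliers, which match three moments exactly, yields anti-concentration:
  conditionally on the data and on the discrete part of the multipliers the sums are Gaussian, and the shift
  formula of Cameron and Martin bounds the probability that their maximum lies in a short interval.
  Coordinates of small variance are discarded beforehand. This is harmless above any fixed positive level, and
  the relevant quantiles do stay above such a level, since for \<open>D \<ge> 2\<close> positive definiteness of the
  covariance matrix forces one of the products to have variance at least \<open>a^2 / 2\<close>.

  For \<open>D = 1\<close> the only partial correlation is - 1, and it is covered as soon as the sample variance is positive.
\<close>

section \<open>Gumbel smoothing\<close>

text \<open>At \<open>\<beta> = n powr (1/6)\<close> the smoothing width
  \<open>ln n / \<beta>\<close> and the price \<open>\<beta>^2 * ln n / sqrt n\<close> of the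
  second-moment error of the bootstrap are both of order \<open>ln n * n powr (-1/6)\<close>. The
  powers of \<open>ln n\<close> that anti-concentration adds are absorbed in passing to the exponent
  1/8. A comparison of two moments only would leave a remainder \<open>\<beta>^3 / sqrt n\<close>;
  balanced with \<open>1 / \<beta>\<close> it gives \<open>n powr (-1/8)\<close> at best, with no
  room for logarithms. Hence three moments are compared throughout. Since \<open>D < n\<close>,
  union bounds run over polynomially many events and cost only multiples of \<open>ln n\<close> in
  the exponents. The first error term carries the factor \<open>ln D\<close>: for
  \<open>D \<ge> 2\<close> it dominates a fixed multiple of \<open>n powr (-1/8)\<close>, whereas
  for \<open>D = 1\<close> it vanishes and coverage of at least \<open>1 - \<alpha>\<close> must
  hold exactly for large n. No Gaussian vector with a prescribed covariance matrix is constructed;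
  the conditional Gaussian vectors are linear images of independent standard normals, and only their
  offsets and coordinate variances have to be controlled.\<close>

lemma exp_ge_power_div_fact:
  fixes u :: real assumes "0 \<le> u" shows "u ^ k * exp (- u) \<le> fact k"
proof -
  have "u ^ k / fact k \<le> exp u"
  proof -
    have s: "summable (\<lambda>n. u ^ n / fact n)" using summable_exp[of u] by (simp add: divide_inverse mult.commute)
    have "(\<Sum>n\<in>{k}. u ^ n / fact n) \<le> (\<Sum>n. u ^ n / fact n)"
      by (rule sum_le_suminf[OF s]) (use assms in auto)
    thus ?thesis by (simp add: exp_def scaleR_conv_of_real divide_inverse mult.commute)
  qed
  thus ?thesis by (simp add: exp_minus field_simps)
qed

text \<open>The left-hand side is the fourth derivative of \<open>exp (- U)\<close>, with
  \<open>U1\<close> to \<open>U4\<close> standing for the derivatives of \<open>U\<close>. When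
  \<open>U\<close> is a sum of positive exponentials each derivative is controlled by
  \<open>U\<close> itself, and the factor \<open>exp (- U)\<close> absorbs every power of
  \<open>U\<close>; so the number of summands does not matter. The constant is
  \<open>fact 1 + 7 * fact 2 + 6 * fact 3 + fact 4 = 75\<close>.\<close>

lemma gumbel_derivative_bound:
  fixes U U1 U2 U3 U4 r :: real
  assumes "0 \<le> U" "0 \<le> r" "\<bar>U1\<bar> \<le> r * U" "\<bar>U2\<bar> \<le> r^2 * U" "\<bar>U3\<bar> \<le> r^3 * U" "\<bar>U4\<bar> \<le> r^4 * U"
  shows "\<bar>(- U4 + 4 * U1 * U3 + 3 * U2^2 - 6 * U1^2 * U2 + U1^4) * exp (- U)\<bar> \<le> 75 * r^4"
proof -
  have a1: "\<bar>U1 * U3\<bar> \<le> r^4 * U^2"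
    using mult_mono[OF assms(3,5)] assms by (simp add: abs_mult power2_eq_square power_numeral_reduce ac_simps)
  have a2: "\<bar>U2^2\<bar> \<le> r^4 * U^2"
    using mult_mono[OF assms(4,4)] assms by (simp add: abs_mult power2_eq_square power_numeral_reduce ac_simps)
  have a11: "\<bar>U1^2\<bar> \<le> r^2 * U^2"
    using mult_mono[OF assms(3,3)] assms by (simp add: abs_mult power2_eq_square power_numeral_reduce ac_simps)
  have a3: "\<bar>U1^2 * U2\<bar> \<le> r^4 * U^3"
    using mult_mono[OF a11 assms(4)] assms by (simp add: abs_mult power2_eq_square power_numeral_reduce ac_simps)
  have a4: "\<bar>U1^4\<bar> \<le> r^4 * U^4"
    using mult_mono[OF a11 a11] assms by (simp add: abs_mult power2_eq_square power_numeral_reduce ac_simps)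
  have "\<bar>- U4 + 4 * U1 * U3 + 3 * U2^2 - 6 * U1^2 * U2 + U1^4\<bar> \<le>
     r^4 * U + 4 * (r^4 * U^2) + 3 * (r^4 * U^2) + 6 * (r^4 * U^3) + r^4 * U^4"
    using assms(6) a1 a2 a3 a4 by linarith
  hence "\<bar>- U4 + 4 * U1 * U3 + 3 * U2^2 - 6 * U1^2 * U2 + U1^4\<bar> * exp (-U) \<le>
     (r^4 * U + 4 * (r^4 * U^2) + 3 * (r^4 * U^2) + 6 * (r^4 * U^3) + r^4 * U^4) * exp (-U)"
    by (rule mult_right_mono) simp
  also have "\<dots> = r^4 * (U^1 * exp (-U)) + 7 * r^4 * (U^2 * exp(-U)) + 6 * r^4 * (U^3 * exp (-U)) + r^4 * (U^4 * exp (-U))"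
    by (simp add: algebra_simps)
  also have "\<dots> \<le> r^4 * fact 1 + 7 * r^4 * fact 2 + 6 * r^4 * fact 3 + r^4 * fact 4"
    by (intro add_mono mult_left_mono exp_ge_power_div_fact) (use assms in auto)
  also have "\<dots> = 75 * r^4" by (simp add: fact_numeral)
  finally show ?thesis by (simp add: abs_mult)
qed

text \<open>Taylor's formula in the scalar \<open>s\<close> for
  \<open>exp (- (\<Sum>j\<in>J. e j * exp (s * z j)))\<close> between 0 and 1. The number
  \<open>V k\<close> is the \<open>k\<close>-th derivative of the inner sum at 0.\<close>

lemma gumbel_taylor:
  fixes e z :: "nat \<Rightarrow> real"
  assumes J: "finite J" and e: "\<And>j. j \<in> J \<Longrightarrow> 0 \<le> e j" and z: "\<And>j. j \<in> J \<Longrightarrow> \<bar>z j\<bar> \<le> r" and r: "0 \<le> r"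
  defines "V \<equiv> \<lambda>k. \<Sum>j\<in>J. e j * z j ^ k"
  shows "\<bar>exp (- (\<Sum>j\<in>J. e j * exp (z j))) -
      exp (- V 0) * (1 - V 1 + ((V 1)^2 - V 2) / 2 + (- V 3 + 3 * V 1 * V 2 - (V 1)^3) / 6)\<bar> \<le> 75/24 * r^4"
proof -
  define U where "U = (\<lambda>k s. \<Sum>j\<in>J. e j * z j ^ k * exp (s * z j))"
  have U0: "U k 0 = V k" for k by (simp add: U_def V_def)
  have D: "(U k has_real_derivative U (Suc k) s) (at s)" for k s
    unfolding U_def by (auto intro!: derivative_eq_intros sum.cong simp: ac_simps)
  \<comment> \<open>The successive derivatives of \<open>exp (- U 0 s)\<close>, written out; the
    last branch is the fourth one, the highest that is used.\<close>
  define diff :: "nat \<Rightarrow> real \<Rightarrow> real" where "diff = (\<lambda>m s.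
     (if m = 0 then 1 else if m = 1 then - U 1 s else if m = 2 then (U 1 s)^2 - U 2 s
      else if m = 3 then - U 3 s + 3 * U 1 s * U 2 s - (U 1 s)^3
      else - U 4 s + 4 * U 1 s * U 3 s + 3 * (U 2 s)^2 - 6 * (U 1 s)^2 * U 2 s + (U 1 s)^4) * exp (- U 0 s))"
  have dd: "DERIV (diff m) t :> diff (Suc m) t" if m4: "m < 4" for m t
  proof -
    have DD: "(U 0 has_real_derivative U 1 s) (at s)" "(U 1 has_real_derivative U 2 s) (at s)"
      "(U 2 has_real_derivative U 3 s) (at s)" "(U 3 has_real_derivative U 4 s) (at s)" for s
      using D[of 0 s] D[of 1 s] D[of 2 s] D[of 3 s] by (simp_all add: numeral_eq_Suc)
    consider "m = 0" | "m = 1" | "m = 2" | "m = 3" using m4 by (auto simp: numeral_eq_Suc less_Suc_eq)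
    thus ?thesis
    proof cases
      case 1 show ?thesis unfolding diff_def 1 by (auto intro!: derivative_eq_intros DD DD(2)[unfolded One_nat_def])
    next
      case 2 show ?thesis unfolding diff_def 2
        by (auto intro!: derivative_eq_intros DD DD(2)[unfolded One_nat_def] simp: algebra_simps power2_eq_square)
    next
      case 3 show ?thesis unfolding diff_def 3
        by (auto intro!: derivative_eq_intros DD DD(2)[unfolded One_nat_def] simp: algebra_simps power2_eq_square power3_eq_cube)
    next
      case 4 show ?thesis unfolding diff_def 4
        by (auto intro!: derivative_eq_intros DD DD(2)[unfolded One_nat_def] simp: algebra_simps power2_eq_square power3_eq_cube power_numeral_reduce)
    qed
  qed
  obtain t where t: "0 < t" "t < 1" "diff 0 1 = (\<Sum>m<4. (diff m 0 / fact m) * (1 - 0)^m) + (diff 4 t / fact 4) * (1 - 0)^4"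
    using Taylor_up[of 4 diff "diff 0" 0 1 0] dd by auto
  have d4: "\<bar>diff 4 t\<bar> \<le> 75 * r^4"
  proof -
    have Uk: "\<bar>U k t\<bar> \<le> r ^ k * U 0 t" for k
    proof -
      have "\<bar>U k t\<bar> \<le> (\<Sum>j\<in>J. \<bar>e j * z j ^ k * exp (t * z j)\<bar>)" unfolding U_def by (rule sum_abs)
      also have "\<dots> \<le> (\<Sum>j\<in>J. r ^ k * (e j * z j ^ 0 * exp (t * z j)))"
      proof (rule sum_mono)
        fix j assume j: "j \<in> J"
        have "\<bar>z j\<bar> ^ k \<le> r ^ k" using z[OF j] by (intro power_mono) auto
        hence "(e j * exp (t * z j)) * \<bar>z j\<bar> ^ k \<le> (e j * exp (t * z j)) * r ^ k"
          using e[OF j] by (intro mult_left_mono) auto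
        thus "\<bar>e j * z j ^ k * exp (t * z j)\<bar> \<le> r ^ k * (e j * z j ^ 0 * exp (t * z j))"
          using e[OF j] by (simp add: abs_mult power_abs ac_simps)
      qed
      finally show ?thesis by (simp add: U_def sum_distrib_left)
    qed
    have "0 \<le> U 0 t" unfolding U_def by (intro sum_nonneg) (use e in auto)
    from gumbel_derivative_bound[OF this r, of "U 1 t" "U 2 t" "U 3 t" "U 4 t"] Uk[of 1] Uk[of 2] Uk[of 3] Uk[of 4]
    show ?thesis unfolding diff_def by simp
  qed
  have "diff 0 1 = exp (- (\<Sum>j\<in>J. e j * exp (z j)))" by (simp add: diff_def U_def)
  moreover have "(\<Sum>m<4. (diff m 0 / fact m) * (1 - 0)^m) =
     exp (- V 0) * (1 - V 1 + ((V 1)^2 - V 2) / 2 + (- V 3 + 3 * V 1 * V 2 - (V 1)^3) / 6)"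
    by (simp add: numeral_eq_Suc diff_def U0 fact_numeral)
       (simp add: algebra_simps add_divide_distrib diff_divide_distrib fact_numeral)?
  ultimately have eq: "exp (- (\<Sum>j\<in>J. e j * exp (z j))) -
      exp (- V 0) * (1 - V 1 + ((V 1)^2 - V 2) / 2 + (- V 3 + 3 * V 1 * V 2 - (V 1)^3) / 6) = diff 4 t / 24"
    using t(3) by (simp add: fact_numeral)
  have "\<bar>diff 4 t / 24\<bar> \<le> 75/24 * r^4" using d4 by (simp add: abs_divide)
  thus ?thesis unfolding eq .
qed

section \<open>Lindeberg's replacement argument\<close>

text \<open>Vectors are indexed by all of \<open>nat\<close>, so that the dimension, which grows
  with the sample size, never enters a type; only a finite set of coordinates is ever
  inspected.\<close>

abbreviation RV :: "(nat \<Rightarrow> real) measure" where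
  "RV \<equiv> PiM UNIV (\<lambda>_. borel)"

text \<open>The convolution operator of the law of \<open>c * X\<close>, acting on test functions.
  Its \<open>n\<close>-th iterate is the expectation over a sum of \<open>n\<close> independent
  copies, so that Lindeberg's replacement becomes a statement about powers of two operators.\<close>

definition cv :: "real \<Rightarrow> 'a measure \<Rightarrow> ('a \<Rightarrow> nat \<Rightarrow> real) \<Rightarrow> ((nat \<Rightarrow> real) \<Rightarrow> real) \<Rightarrow> (nat \<Rightarrow> real) \<Rightarrow> real" where
  "cv c N X h w = (\<integral>a. h (\<lambda>j. w j + c * X a j) \<partial>N)"

declare measurable_abs_UNIV [measurable (raw)]

lemma RV_component:
  "f \<in> M \<rightarrow>\<^sub>M RV \<Longrightarrow> (\<lambda>x. f x j) \<in> borel_measurable M"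
  by (rule measurable_compose[OF _ measurable_component_singleton]) auto

lemma cv_measurable:
  assumes N: "prob_space N" and X[measurable]: "X \<in> N \<rightarrow>\<^sub>M RV" and h[measurable]: "h \<in> borel_measurable RV"
  shows "cv c N X h \<in> borel_measurable RV"
proof -
  interpret prob_space N by (rule N)
  have [measurable]: "(\<lambda>a. X a j) \<in> borel_measurable N" for j by (rule RV_component[OF X])
  show ?thesis unfolding cv_def by measurable
qed

lemma bounded_integrable:
  assumes "prob_space N" "f \<in> borel_measurable N" "\<And>x. \<bar>f x\<bar> \<le> (K::real)"
  shows "integrable N f"
proof -
  interpret prob_space N by fact
  show ?thesis by (rule integrable_const_bound[where B=K]) (use assms in auto)
qed

lemma abs_integral_le:
  assumes "prob_space N" "f \<in> borel_measurable N" "\<And>x. \<bar>f x\<bar> \<le> (K::real)"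
  shows "\<bar>\<integral>x. f x \<partial>N\<bar> \<le> K"
proof -
  interpret prob_space N by fact
  have i: "integrable N f" by (rule bounded_integrable[OF assms])
  have "(\<integral>x. f x \<partial>N) \<le> K" by (rule integral_le_const[OF i]) (use assms(3) in \<open>auto simp: abs_le_iff\<close>)
  moreover have "- K \<le> (\<integral>x. f x \<partial>N)" by (rule integral_ge_const[OF i]) (use assms(3) in \<open>auto simp: abs_le_iff minus_le_iff\<close>)
  ultimately show ?thesis by auto
qed

lemma cv_bounded:
  assumes N: "prob_space N" and X[measurable]: "X \<in> N \<rightarrow>\<^sub>M RV" and h[measurable]: "h \<in> borel_measurable RV"
    and K: "\<And>w. \<bar>h w\<bar> \<le> K"
  shows "\<bar>cv c N X h w\<bar> \<le> K"
proof -
  have [measurable]: "(\<lambda>a. X a j) \<in> borel_measurable N" for j by (rule RV_component[OF X])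
  have "(\<lambda>a. h (\<lambda>j. w j + c * X a j)) \<in> borel_measurable N" by measurable
  thus ?thesis unfolding cv_def by (intro abs_integral_le[OF N] K)
qed

lemma cv_diff_bounded:
  assumes N: "prob_space N" and X[measurable]: "X \<in> N \<rightarrow>\<^sub>M RV"
    and h[measurable]: "h \<in> borel_measurable RV" "h' \<in> borel_measurable RV"
    and K: "\<And>w. \<bar>h w\<bar> \<le> K" "\<And>w. \<bar>h' w\<bar> \<le> K" and d: "\<And>w. \<bar>h w - h' w\<bar> \<le> d"
  shows "\<bar>cv c N X h w - cv c N X h' w\<bar> \<le> d"
proof -
  have [measurable]: "(\<lambda>a. X a j) \<in> borel_measurable N" for j by (rule RV_component[OF X])
  have m1: "(\<lambda>a. h (\<lambda>j. w j + c * X a j)) \<in> borel_measurable N" by measurable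
  have m2: "(\<lambda>a. h' (\<lambda>j. w j + c * X a j)) \<in> borel_measurable N" by measurable
  have "cv c N X h w - cv c N X h' w = (\<integral>a. h (\<lambda>j. w j + c * X a j) - h' (\<lambda>j. w j + c * X a j) \<partial>N)"
    unfolding cv_def
    by (subst Bochner_Integration.integral_diff) (auto intro!: bounded_integrable[OF N, where K=K] K m1 m2)
  also have "\<bar>\<dots>\<bar> \<le> d" by (rule abs_integral_le[OF N]) (use d m1 m2 in auto)
  finally show ?thesis .
qed

lemma funpow_cv_measurable:
  assumes "prob_space N" "X \<in> N \<rightarrow>\<^sub>M RV" "h \<in> borel_measurable RV"
  shows "(cv c N X ^^ k) h \<in> borel_measurable RV"
  by (induction k) (auto intro: cv_measurable assms)

lemma funpow_cv_bounded:
  assumes "prob_space N" "X \<in> N \<rightarrow>\<^sub>M RV" "h \<in> borel_measurable RV" "\<And>w. \<bar>h w\<bar> \<le> K"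
  shows "\<bar>(cv c N X ^^ k) h w\<bar> \<le> K"
  using assms by (induction k arbitrary: w) (auto intro!: cv_bounded funpow_cv_measurable)

text \<open>Fubini's theorem, since the order of two translations does not matter; boundedness of
  \<open>h\<close> supplies integrability.\<close>

lemma cv_commute:
  assumes N: "prob_space N" and N': "prob_space N'"
    and X[measurable]: "X \<in> N \<rightarrow>\<^sub>M RV" and X'[measurable]: "X' \<in> N' \<rightarrow>\<^sub>M RV"
    and h[measurable]: "h \<in> borel_measurable RV" and K: "\<And>w. \<bar>h w\<bar> \<le> K"
  shows "cv c N X (cv c N' X' h) = cv c N' X' (cv c N X h)"
proof
  fix w
  interpret N: prob_space N by (rule N)
  interpret N': prob_space N' by (rule N')
  interpret P: pair_prob_space N N' ..
  have [measurable]: "(\<lambda>a. X a j) \<in> borel_measurable N" for j by (rule RV_component[OF X])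
  have [measurable]: "(\<lambda>a. X' a j) \<in> borel_measurable N'" for j by (rule RV_component[OF X'])
  have m: "(\<lambda>p. h (\<lambda>j. w j + c * X (fst p) j + c * X' (snd p) j)) \<in> borel_measurable (N \<Otimes>\<^sub>M N')" by measurable
  have "integrable (N \<Otimes>\<^sub>M N') (\<lambda>(a, a'). h (\<lambda>j. w j + c * X a j + c * X' a' j))"
    by (rule bounded_integrable[where K=K]) (use m K P.prob_space_axioms in \<open>auto simp: split_def\<close>)
  from P.Fubini_integral[OF this]
  show "cv c N X (cv c N' X' h) w = cv c N' X' (cv c N X h) w"
    unfolding cv_def by (simp add: add.assoc add.commute add.left_commute)
qed

text \<open>For commuting operators \<open>A\<close> and \<open>B\<close>, the difference of the
  powers of order \<open>n + 1\<close> is \<open>A^n (A - B) + B (A^n - B^n)\<close>. Both operators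
  are contractions for the supremum norm, so every replacement costs at most
  \<open>\<epsilon>\<close>, and partially replaced sums never have to be written down.\<close>

lemma lindeberg_telescope:
  assumes N: "prob_space N" and N': "prob_space N'"
    and X: "X \<in> N \<rightarrow>\<^sub>M RV" and X': "X' \<in> N' \<rightarrow>\<^sub>M RV"
    and h: "h \<in> borel_measurable RV" and K: "\<And>w. \<bar>h w\<bar> \<le> K"
    and eps: "\<And>w. \<bar>cv c N X h w - cv c N' X' h w\<bar> \<le> \<epsilon>"
  shows "\<bar>(cv c N X ^^ n) h w - (cv c N' X' ^^ n) h w\<bar> \<le> real n * \<epsilon>"
proof (induction n arbitrary: w)
  case 0 show ?case by simp
next
  case (Suc n)
  let ?A = "cv c N X" and ?B = "cv c N' X'"
  note m = funpow_cv_measurable[OF N X h] funpow_cv_measurable[OF N' X' h]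
  note b = funpow_cv_bounded[OF N X h K] funpow_cv_bounded[OF N' X' h K]
  have comm: "(?A ^^ k) (?B h) = ?B ((?A ^^ k) h)" for k
  proof (induction k)
    case (Suc k)
    have "(?A ^^ Suc k) (?B h) = ?A (?B ((?A ^^ k) h))" using Suc by simp
    also have "\<dots> = ?B (?A ((?A ^^ k) h))" by (rule cv_commute[OF N N' X X' m(1) b(1)])
    finally show ?case by simp
  qed simp
  have 1: "\<bar>(?A ^^ k) (?A h) v - (?A ^^ k) (?B h) v\<bar> \<le> \<epsilon>" for k v
  proof (induction k arbitrary: v)
    case 0 show ?case using eps by simp
  next
    case (Suc k)
    show ?case
      by (simp, rule cv_diff_bounded[OF N X, where K=K])
         (auto intro!: funpow_cv_measurable funpow_cv_bounded cv_measurable cv_bounded N X N' X' h K Suc)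
  qed
  have 2: "\<bar>?B ((?A ^^ n) h) w - ?B ((?B ^^ n) h) w\<bar> \<le> real n * \<epsilon>"
    by (rule cv_diff_bounded[OF N' X', where K=K]) (auto intro: m b Suc)
  have "(?A ^^ Suc n) h w - (?B ^^ Suc n) h w =
    ((?A ^^ n) (?A h) w - (?A ^^ n) (?B h) w) + (?B ((?A ^^ n) h) w - ?B ((?B ^^ n) h) w)"
    by (simp add: comm funpow_swap1)
  thus ?case using 1[of n w] 2 by (simp add: algebra_simps)
qed

lemma integral_PiM_eq_funpow_cv:
  assumes P: "prob_space P" and X[measurable]: "X \<in> P \<rightarrow>\<^sub>M RV"
    and h: "h \<in> borel_measurable RV" and K: "\<And>w. \<bar>h w\<bar> \<le> K"
  shows "(\<integral>x. h (\<lambda>j. w j + c * (\<Sum>i<n. X (x i) j)) \<partial>(Pi\<^sub>M {..<n} (\<lambda>_. P))) = (cv c P X ^^ n) h w"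
  using h K
proof (induction n arbitrary: h)
  case 0
  interpret product_prob_space "\<lambda>_::nat. P" by (simp add: product_prob_space_def product_prob_space_axioms_def product_sigma_finite_def assms(1) prob_space_imp_sigma_finite)
  show ?case by (simp add: PiM_empty lebesgue_integral_count_space_finite)
next
  case (Suc n)
  interpret product_prob_space "\<lambda>_::nat. P" by (simp add: product_prob_space_def product_prob_space_axioms_def product_sigma_finite_def assms(1) prob_space_imp_sigma_finite)
  note [measurable] = Suc.prems(1)
  have [measurable]: "(\<lambda>a. X a j) \<in> borel_measurable P" for j by (rule RV_component[OF X])
  have pp: "prob_space (Pi\<^sub>M I (\<lambda>_. P))" for I :: "nat set" by (rule prob_space_PiM) (rule assms(1))
  have "(\<integral>x. h (\<lambda>j. w j + c * (\<Sum>i<Suc n. X (x i) j)) \<partial>(Pi\<^sub>M {..<Suc n} (\<lambda>_. P))) =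
    (\<integral>x. (\<integral>y. h (\<lambda>j. w j + c * (\<Sum>i<Suc n. X ((x(n:=y)) i) j)) \<partial>P) \<partial>(Pi\<^sub>M {..<n} (\<lambda>_. P)))"
    unfolding lessThan_Suc
    by (rule product_integral_insert)
       (auto intro!: bounded_integrable[OF pp, where K=K] Suc.prems(2))
  also have "\<dots> = (\<integral>x. cv c P X h (\<lambda>j. w j + c * (\<Sum>i<n. X (x i) j)) \<partial>(Pi\<^sub>M {..<n} (\<lambda>_. P)))"
    unfolding cv_def by (simp add: algebra_simps)
  also have "\<dots> = (cv c P X ^^ n) (cv c P X h) w"
    by (rule Suc.IH) (auto intro!: cv_measurable cv_bounded assms(1) X Suc.prems)
  finally show ?case by (simp add: funpow_swap1)
qed

lemma iid_integral_eq_funpow_cv: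
  assumes M: "prob_space M" and ind: "prob_space.indep_vars M (\<lambda>_. S) Y {..<n}"
    and law: "\<And>i. i < n \<Longrightarrow> distr M S (Y i) = P" and P: "prob_space P" and sP: "sets P = sets S"
    and X: "X \<in> P \<rightarrow>\<^sub>M RV"
    and h[measurable]: "h \<in> borel_measurable RV" and K: "\<And>w. \<bar>h w\<bar> \<le> K"
  shows "(\<integral>\<omega>. h (\<lambda>j. w j + c * (\<Sum>i<n. X (Y i \<omega>) j)) \<partial>M) = (cv c P X ^^ n) h w"
proof -
  interpret M: prob_space M by (rule M)
  have rv[measurable]: "Y i \<in> M \<rightarrow>\<^sub>M S" if "i < n" for i using ind that unfolding M.indep_vars_def by auto
  have X': "X \<in> S \<rightarrow>\<^sub>M RV" using X measurable_cong_sets[OF sP refl] by blast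
  have [measurable]: "(\<lambda>a. X a j) \<in> borel_measurable S" for j by (rule RV_component[OF X'])
  have mY: "(\<lambda>\<omega>. \<lambda>i\<in>{..<n}. Y i \<omega>) \<in> M \<rightarrow>\<^sub>M Pi\<^sub>M {..<n} (\<lambda>_. S)"
    by (rule measurable_restrict) (use rv in auto)
  have "distr M (Pi\<^sub>M {..<n} (\<lambda>_. S)) (\<lambda>\<omega>. \<lambda>i\<in>{..<n}. Y i \<omega>) = Pi\<^sub>M {..<n} (\<lambda>i. distr M S (Y i))"
  proof (cases "n = 0")
    case False
    thus ?thesis using M.indep_vars_iff_distr_eq_PiM'[of "{..<n}" Y "\<lambda>_. S"] ind rv by auto
  next
    \<comment> \<open>The product characterisation of independence concerns nonempty index sets; for
      \<open>n = 0\<close> both sides are the point mass at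
      \<open>\<lambda>_. undefined\<close>.\<close>
    case True
    interpret D: prob_space "distr M (Pi\<^sub>M {..<n} (\<lambda>_. S)) (\<lambda>\<omega>. \<lambda>i\<in>{..<n}. Y i \<omega>)" by (rule M.prob_space_distr[OF mY])
    show ?thesis
    proof (rule measure_eqI)
      fix A assume A: "A \<in> sets (distr M (Pi\<^sub>M {..<n} (\<lambda>_. S)) (\<lambda>\<omega>. \<lambda>i\<in>{..<n}. Y i \<omega>))"
      hence "A \<subseteq> {\<lambda>_. undefined}" using sets.sets_into_space[OF A] True by (auto simp: space_PiM)
      hence "A = {} \<or> A = {\<lambda>_. undefined}" by blast
      thus "emeasure (distr M (Pi\<^sub>M {..<n} (\<lambda>_. S)) (\<lambda>\<omega>. \<lambda>i\<in>{..<n}. Y i \<omega>)) A = emeasure (Pi\<^sub>M {..<n} (\<lambda>i. distr M S (Y i))) A"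
        using D.emeasure_space_1 True by (auto simp: space_PiM PiM_empty)
    qed (simp add: True PiM_empty)
  qed
  also have "\<dots> = Pi\<^sub>M {..<n} (\<lambda>_. P)" by (rule PiM_cong) (auto simp: law)
  finally have eq: "distr M (Pi\<^sub>M {..<n} (\<lambda>_. S)) (\<lambda>\<omega>. \<lambda>i\<in>{..<n}. Y i \<omega>) = Pi\<^sub>M {..<n} (\<lambda>_. P)" .
  have "(\<integral>\<omega>. h (\<lambda>j. w j + c * (\<Sum>i<n. X (Y i \<omega>) j)) \<partial>M) =
     (\<integral>\<omega>. h (\<lambda>j. w j + c * (\<Sum>i<n. X ((\<lambda>i\<in>{..<n}. Y i \<omega>) i) j)) \<partial>M)"
    by (rule Bochner_Integration.integral_cong) auto
  also have "\<dots> = (\<integral>x. h (\<lambda>j. w j + c * (\<Sum>i<n. X (x i) j)) \<partial>(distr M (Pi\<^sub>M {..<n} (\<lambda>_. S)) (\<lambda>\<omega>. \<lambda>i\<in>{..<n}. Y i \<omega>)))"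
    by (rule integral_distr[symmetric]) (use mY in measurable)
  also have "\<dots> = (cv c P X ^^ n) h w"
    unfolding eq by (rule integral_PiM_eq_funpow_cv[OF P X h K])
  finally show ?thesis .
qed

text \<open>The observations \<open>x\<close> and the multipliers \<open>g\<close> stay in two
  separate product measures because anti-concentration is later applied to \<open>g\<close> for
  fixed \<open>x\<close>. The induction peels off the last coordinate of each product and merges the
  two into one pair with law \<open>R \<Otimes>\<^sub>M G\<close>.\<close>

lemma multiplier_integral_eq_funpow_cv:
  assumes R: "prob_space R" and G: "prob_space G" and sG: "sets G = sets borel"
    and u[measurable]: "u \<in> R \<rightarrow>\<^sub>M RV" and v[measurable]: "v \<in> R \<rightarrow>\<^sub>M RV"
    and h: "h \<in> borel_measurable RV" and K: "\<And>w. \<bar>h w\<bar> \<le> K"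
  shows "(\<integral>x. (\<integral>g. h (\<lambda>j. w j + c * (\<Sum>i<n. v (x i) j + g i * u (x i) j)) \<partial>(Pi\<^sub>M {..<n} (\<lambda>_. G))) \<partial>(Pi\<^sub>M {..<n} (\<lambda>_. R)))
    = (cv c (R \<Otimes>\<^sub>M G) (\<lambda>(x, g) j. v x j + g * u x j) ^^ n) h w"
  using h K
proof (induction n arbitrary: h)
  case 0
  show ?case by (simp add: PiM_empty lebesgue_integral_count_space_finite)
next
  case (Suc n)
  interpret R: prob_space R by (rule R)
  interpret G: prob_space G by (rule G)
  interpret RG: pair_prob_space R G ..
  interpret PR: product_prob_space "\<lambda>_::nat. R" by unfold_locales
  interpret PG: product_prob_space "\<lambda>_::nat. G" by unfold_locales
  note [measurable] = Suc.prems(1)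
  note sG[measurable_cong]
  have [measurable]: "(\<lambda>a. u a j) \<in> borel_measurable R" "(\<lambda>a. v a j) \<in> borel_measurable R" for j
    by (rule RV_component, fact)+
  have pR: "prob_space (Pi\<^sub>M I (\<lambda>_. R))" and pG: "prob_space (Pi\<^sub>M I (\<lambda>_. G))" for I :: "nat set" using R G by (auto intro: prob_space_PiM)
  interpret QR: prob_space "Pi\<^sub>M {..<n} (\<lambda>_. R)" by (rule pR)
  interpret QG: prob_space "Pi\<^sub>M {..<n} (\<lambda>_. G)" by (rule pG)
  interpret QG': prob_space "Pi\<^sub>M {..<Suc n} (\<lambda>_. G)" by (rule pG)
  interpret RQ: pair_prob_space R "Pi\<^sub>M {..<n} (\<lambda>_. G)" ..
  let ?X = "\<lambda>(x, g) j. v x j + g * u x j"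
  have X[measurable]: "?X \<in> (R \<Otimes>\<^sub>M G) \<rightarrow>\<^sub>M RV"
    unfolding split_def by (rule measurable_abs_UNIV) measurable
  let ?T = "\<lambda>x y g z. h (\<lambda>j. w j + c * (\<Sum>i<n. v (x i) j + g i * u (x i) j) + c * (v y j + z * u y j))"
  let ?s = "\<lambda>x g n. (\<lambda>j. w j + c * (\<Sum>i<n. v (x i) j + g i * u (x i) j))"
  have 1: "(\<integral>x. (\<integral>g. h (?s x g (Suc n)) \<partial>(Pi\<^sub>M {..<Suc n} (\<lambda>_. G))) \<partial>(Pi\<^sub>M {..<Suc n} (\<lambda>_. R))) =
    (\<integral>x. (\<integral>y. (\<integral>g. h (?s (x(n:=y)) g (Suc n)) \<partial>(Pi\<^sub>M {..<Suc n} (\<lambda>_. G))) \<partial>R) \<partial>(Pi\<^sub>M {..<n} (\<lambda>_. R)))"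
    unfolding lessThan_Suc
    by (rule PR.product_integral_insert)
       (auto simp: lessThan_Suc[symmetric] intro!: bounded_integrable[OF pR, where K=K] abs_integral_le[OF pG] Suc.prems(2))
  also have "\<dots> = (\<integral>x. (\<integral>y. (\<integral>g. (\<integral>z. h (?s (x(n:=y)) (g(n:=z)) (Suc n)) \<partial>G) \<partial>(Pi\<^sub>M {..<n} (\<lambda>_. G))) \<partial>R) \<partial>(Pi\<^sub>M {..<n} (\<lambda>_. R)))"
  proof (rule Bochner_Integration.integral_cong[OF refl], rule Bochner_Integration.integral_cong[OF refl])
    fix x y assume x: "x \<in> space (Pi\<^sub>M {..<n} (\<lambda>_. R))" and y: "y \<in> space R"
    have xy: "x(n := y) \<in> space (Pi\<^sub>M {..<Suc n} (\<lambda>_. R))"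
      using x y by (auto simp: space_PiM PiE_iff extensional_def)
    have "(\<lambda>p. h (?s (fst p) (snd p) (Suc n))) \<in> borel_measurable (Pi\<^sub>M {..<Suc n} (\<lambda>_. R) \<Otimes>\<^sub>M Pi\<^sub>M {..<Suc n} (\<lambda>_. G))"
      by measurable
    from measurable_compose[OF measurable_Pair1'[OF xy] this]
    have m: "(\<lambda>g. h (?s (x(n:=y)) g (Suc n))) \<in> borel_measurable (Pi\<^sub>M {..<Suc n} (\<lambda>_. G))" by simp
    show "(\<integral>g. h (?s (x(n:=y)) g (Suc n)) \<partial>(Pi\<^sub>M {..<Suc n} (\<lambda>_. G))) =
      (\<integral>g. (\<integral>z. h (?s (x(n:=y)) (g(n:=z)) (Suc n)) \<partial>G) \<partial>(Pi\<^sub>M {..<n} (\<lambda>_. G)))"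
    proof -
      have k: "finite {..<n}" "n \<notin> {..<n}" by auto
      have i: "integrable (Pi\<^sub>M (insert n {..<n}) (\<lambda>_. G)) (\<lambda>g. h (?s (x(n:=y)) g (Suc n)))"
        unfolding lessThan_Suc[symmetric] by (rule bounded_integrable[OF pG, where K=K]) (use m Suc.prems(2) in auto)
      show ?thesis
        using PG.product_integral_insert[OF k i] by (simp only: lessThan_Suc[symmetric])
    qed
  qed
  also have "\<dots> = (\<integral>x. (\<integral>y. (\<integral>g. (\<integral>z. ?T x y g z \<partial>G) \<partial>(Pi\<^sub>M {..<n} (\<lambda>_. G))) \<partial>R) \<partial>(Pi\<^sub>M {..<n} (\<lambda>_. R)))"
    by (simp add: algebra_simps)
  \<comment> \<open>The new observation \<open>y\<close> moves inside the integral over the old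
    multipliers, to stand next to its own multiplier \<open>z\<close>.\<close>
  also have "\<dots> = (\<integral>x. (\<integral>g. (\<integral>y. (\<integral>z. ?T x y g z \<partial>G) \<partial>R) \<partial>(Pi\<^sub>M {..<n} (\<lambda>_. G))) \<partial>(Pi\<^sub>M {..<n} (\<lambda>_. R)))"
  proof (rule Bochner_Integration.integral_cong[OF refl])
    fix x assume x: "x \<in> space (Pi\<^sub>M {..<n} (\<lambda>_. R))"
    have [measurable]: "(\<lambda>_. x) \<in> L \<rightarrow>\<^sub>M Pi\<^sub>M {..<n} (\<lambda>_. R)" for L :: "('a \<times> (nat \<Rightarrow> real)) measure"
      using x by simp
    have mm: "(\<lambda>q. \<integral>z. ?T (fst q) (fst (snd q)) (snd (snd q)) z \<partial>G)
       \<in> borel_measurable (Pi\<^sub>M {..<n} (\<lambda>_. R) \<Otimes>\<^sub>M (R \<Otimes>\<^sub>M Pi\<^sub>M {..<n} (\<lambda>_. G)))"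
      by measurable
    have m: "(\<lambda>p. \<integral>z. ?T x (fst p) (snd p) z \<partial>G) \<in> borel_measurable (R \<Otimes>\<^sub>M Pi\<^sub>M {..<n} (\<lambda>_. G))"
      using measurable_compose[OF measurable_Pair1'[OF x] mm] by simp
    show "(\<integral>y. (\<integral>g. (\<integral>z. ?T x y g z \<partial>G) \<partial>(Pi\<^sub>M {..<n} (\<lambda>_. G))) \<partial>R) =
       (\<integral>g. (\<integral>y. (\<integral>z. ?T x y g z \<partial>G) \<partial>R) \<partial>(Pi\<^sub>M {..<n} (\<lambda>_. G)))"
    proof (rule RQ.Fubini_integral[symmetric], rule bounded_integrable[where K=K])
      show "prob_space (R \<Otimes>\<^sub>M Pi\<^sub>M {..<n} (\<lambda>_. G))"
        using RQ.P.emeasure_space_1 by (intro prob_spaceI) (simp add: RQ.P.emeasure_space_1)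
      show "(\<lambda>(y, g). \<integral>z. ?T x y g z \<partial>G) \<in> borel_measurable (R \<Otimes>\<^sub>M Pi\<^sub>M {..<n} (\<lambda>_. G))"
        using m by (simp add: split_def)
      fix p :: "'a \<times> (nat \<Rightarrow> real)"
      show "\<bar>case p of (y, g) \<Rightarrow> \<integral>z. ?T x y g z \<partial>G\<bar> \<le> K"
      proof (cases "(\<lambda>z. ?T x (fst p) (snd p) z) \<in> borel_measurable G")
        case True
        from abs_integral_le[OF G this Suc.prems(2)] show ?thesis by (simp add: split_def)
      next
        case False
        \<comment> \<open>Here \<open>p\<close> ranges over the whole type, and outside the
          underlying spaces measurability may fail; the integral is then 0 by convention and the
          bound holds because \<open>0 \<le> K\<close>.\<close>
        hence "(\<integral>z. ?T x (fst p) (snd p) z \<partial>G) = 0"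
          by (intro not_integrable_integral_eq) (auto dest: borel_measurable_integrable)
        moreover have "0 \<le> K" using Suc.prems(2)[of undefined] by linarith
        ultimately show ?thesis by (simp add: split_def)
      qed
    qed
  qed
  also have "\<dots> = (\<integral>x. (\<integral>g. cv c (R \<Otimes>\<^sub>M G) ?X h (?s x g n) \<partial>(Pi\<^sub>M {..<n} (\<lambda>_. G))) \<partial>(Pi\<^sub>M {..<n} (\<lambda>_. R)))"
  proof (rule Bochner_Integration.integral_cong[OF refl], rule Bochner_Integration.integral_cong[OF refl])
    fix x g
    let ?w = "?s x g n"
    have Xp: "prob_space (R \<Otimes>\<^sub>M G)" by (rule RG.prob_space_axioms)
    have int: "integrable (R \<Otimes>\<^sub>M G) (\<lambda>p. h (\<lambda>j. ?w j + c * (v (fst p) j + snd p * u (fst p) j)))"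
      by (rule bounded_integrable[OF Xp, where K=K]) (measurable, rule Suc.prems(2))
    have "(\<integral>y. (\<integral>z. ?T x y g z \<partial>G) \<partial>R) = (\<integral>p. h (\<lambda>j. ?w j + c * (v (fst p) j + snd p * u (fst p) j)) \<partial>(R \<Otimes>\<^sub>M G))"
      using RG.integral_fst'[OF int] by (simp only: fst_conv snd_conv)
    thus "(\<integral>y. (\<integral>z. ?T x y g z \<partial>G) \<partial>R) = cv c (R \<Otimes>\<^sub>M G) ?X h ?w"
      by (simp only: cv_def split_def)
  qed
  also have "\<dots> = (cv c (R \<Otimes>\<^sub>M G) ?X ^^ n) (cv c (R \<Otimes>\<^sub>M G) ?X h) w"
    by (rule Suc.IH) (auto intro!: cv_measurable cv_bounded RG.prob_space_axioms X Suc.prems)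
  finally show ?case by (simp add: funpow_swap1)
qed

section \<open>Smoothed indicators of maxima and their comparison by moments\<close>

definition gum :: "nat set \<Rightarrow> real \<Rightarrow> real \<Rightarrow> (nat \<Rightarrow> real) \<Rightarrow> real" where
  "gum J \<beta> t w = exp (- (\<Sum>j\<in>J. exp (\<beta> * (w j - t))))"

lemma gum_measurable [measurable]: "gum J \<beta> t \<in> borel_measurable RV"
  unfolding gum_def by measurable

lemma gum_nonneg: "0 \<le> gum J \<beta> t w" and gum_le_1: "gum J \<beta> t w \<le> 1"
  unfolding gum_def by (auto intro!: sum_nonneg)

lemma gum_abs: "\<bar>gum J \<beta> t w\<bar> \<le> 1"
  using gum_nonneg[of J \<beta> t w] gum_le_1[of J \<beta> t w] by simp

text \<open>The envelope \<open>r\<close> may be random because Gaussian multipliers are unbounded;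
  only its fourth moment enters, through the Taylor remainder.\<close>

locale dominated_vector = prob_space N for N :: "'a measure" +
  fixes X :: "'a \<Rightarrow> nat \<Rightarrow> real" and J :: "nat set" and r :: "'a \<Rightarrow> real" and K :: real
  assumes X_measurable: "X \<in> N \<rightarrow>\<^sub>M RV" and finite_J: "finite J"
    and dom: "AE a in N. \<forall>j\<in>J. \<bar>X a j\<bar> \<le> r a"
    and r_nonneg: "\<And>a. 0 \<le> r a" and r4: "integrable N (\<lambda>a. r a ^ 4)" and K: "(\<integral>a. r a ^ 4 \<partial>N) \<le> K"
begin

lemma coordinate_measurable [measurable]: "(\<lambda>a. X a j) \<in> borel_measurable N"
  by (rule RV_component[OF X_measurable])

lemma power_le_1_plus_4: "(x::real) \<ge> 0 \<Longrightarrow> k \<le> 4 \<Longrightarrow> x ^ k \<le> 1 + x ^ 4"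
proof (cases "x \<le> 1")
  case True
  assume "x \<ge> 0" "k \<le> 4"
  thus ?thesis using power_le_one[of x k] zero_le_power[of x 4] True by linarith
next
  case False
  assume "x \<ge> 0" "k \<le> 4"
  thus ?thesis using power_increasing[of k 4 x] False by linarith
qed

lemma int1: "j \<in> J \<Longrightarrow> integrable N (\<lambda>a. X a j)"
  and int2: "j \<in> J \<Longrightarrow> k \<in> J \<Longrightarrow> integrable N (\<lambda>a. X a j * X a k)"
  and int3: "j \<in> J \<Longrightarrow> k \<in> J \<Longrightarrow> l \<in> J \<Longrightarrow> integrable N (\<lambda>a. X a j * X a k * X a l)"
proof -
  have i: "integrable N (\<lambda>a. 1 + r a ^ 4)" using r4 by simp
  show "integrable N (\<lambda>a. X a j)" if j: "j \<in> J"
    apply (rule Bochner_Integration.integrable_bound[OF i]) apply measurable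
    using dom
  proof eventually_elim
    case (elim a)
    show ?case using elim j power_le_1_plus_4[OF r_nonneg, of 1 a] by fastforce
  qed
  show "integrable N (\<lambda>a. X a j * X a k)" if j: "j \<in> J" "k \<in> J"
    apply (rule Bochner_Integration.integrable_bound[OF i]) apply measurable
    using dom
  proof eventually_elim
    case (elim a)
    have "\<bar>X a j\<bar> * \<bar>X a k\<bar> \<le> r a * r a" using elim j by (intro mult_mono) (auto simp: r_nonneg)
    thus ?case using power_le_1_plus_4[OF r_nonneg, of 2 a] by (simp add: abs_mult power2_eq_square)
  qed
  show "integrable N (\<lambda>a. X a j * X a k * X a l)" if j: "j \<in> J" "k \<in> J" "l \<in> J"
    apply (rule Bochner_Integration.integrable_bound[OF i]) apply measurable
    using dom
  proof eventually_elim
    case (elim a)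
    have "\<bar>X a j\<bar> * \<bar>X a k\<bar> * \<bar>X a l\<bar> \<le> r a * r a * r a" using elim j by (intro mult_mono) (auto simp: r_nonneg)
    thus ?case using power_le_1_plus_4[OF r_nonneg, of 3 a] by (simp add: abs_mult power3_eq_cube)
  qed
qed

text \<open>\<open>gumbel_taylor\<close> with \<open>z j = \<beta> * c * X a j\<close>, integrated
  over \<open>a\<close>. Products of linear forms are opened into multiple sums against mixed
  moments, the shape in which two laws can be subtracted.\<close>

lemma gum_expansion:
  fixes t :: real
  assumes \<beta>: "0 \<le> \<beta>" and c: "0 \<le> c"
  defines "e \<equiv> \<lambda>w j. exp (\<beta> * (w j - t))"
  defines "m1 \<equiv> \<lambda>j. \<integral>a. X a j \<partial>N" and "m2 \<equiv> \<lambda>j k. \<integral>a. X a j * X a k \<partial>N"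
    and "m3 \<equiv> \<lambda>j k l. \<integral>a. X a j * X a k * X a l \<partial>N"
  shows "\<bar>cv c N X (gum J \<beta> t) w - gum J \<beta> t w * (1 - \<beta> * c * (\<Sum>j\<in>J. e w j * m1 j)
      + (\<beta> * c)^2 / 2 * ((\<Sum>j\<in>J. \<Sum>k\<in>J. e w j * e w k * m2 j k) - (\<Sum>j\<in>J. e w j * m2 j j))
      + (\<beta> * c)^3 / 6 * (- (\<Sum>j\<in>J. e w j * m3 j j j) + 3 * (\<Sum>j\<in>J. \<Sum>k\<in>J. e w j * e w k * m3 j k k)
          - (\<Sum>j\<in>J. \<Sum>k\<in>J. \<Sum>l\<in>J. e w j * e w k * e w l * m3 j k l)))\<bar> \<le> 75/24 * (\<beta> * c)^4 * K"
proof -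
  define \<kappa> where "\<kappa> = \<beta> * c"
  have \<kappa>: "0 \<le> \<kappa>" using \<beta> c by (simp add: \<kappa>_def)
  define E where "E = e w"
  have E0: "0 \<le> E j" for j by (simp add: E_def e_def)
  define f0 where "f0 = gum J \<beta> t w"
  have f0: "f0 = exp (- (\<Sum>j\<in>J. E j))" by (simp add: f0_def gum_def E_def e_def)
  define S1 where "S1 = (\<lambda>a. \<Sum>j\<in>J. E j * X a j)"
  define S2 where "S2 = (\<lambda>a. (\<Sum>j\<in>J. \<Sum>k\<in>J. E j * E k * (X a j * X a k)) - (\<Sum>j\<in>J. E j * (X a j * X a j)))"
  define S3 where "S3 = (\<lambda>a. - (\<Sum>j\<in>J. E j * (X a j * X a j * X a j)) + 3 * (\<Sum>j\<in>J. \<Sum>k\<in>J. E j * E k * (X a j * X a k * X a k))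
          - (\<Sum>j\<in>J. \<Sum>k\<in>J. \<Sum>l\<in>J. E j * E k * E l * (X a j * X a k * X a l)))"
  define P where "P = (\<lambda>a. f0 * (1 - \<kappa> * S1 a + \<kappa>^2 / 2 * S2 a + \<kappa>^3 / 6 * S3 a))"
  have iS1: "integrable N S1" unfolding S1_def by (intro Bochner_Integration.integrable_sum integrable_mult_right int1)
  have iS2: "integrable N S2" unfolding S2_def
    by (intro Bochner_Integration.integrable_diff Bochner_Integration.integrable_sum integrable_mult_right int2)
  have iS3: "integrable N S3" unfolding S3_def
    by (intro Bochner_Integration.integrable_diff Bochner_Integration.integrable_add
      Bochner_Integration.integrable_minus Bochner_Integration.integrable_sum integrable_mult_right int3)
  have iP: "integrable N P" unfolding P_def
    by (intro integrable_mult_right Bochner_Integration.integrable_add Bochner_Integration.integrable_diff iS1 iS2 iS3) simp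
  have e1: "(\<integral>a. S1 a \<partial>N) = (\<Sum>j\<in>J. E j * m1 j)"
    unfolding S1_def m1_def by (subst Bochner_Integration.integral_sum) (auto intro!: int1)
  have s2a: "(\<integral>a. (\<Sum>j\<in>J. \<Sum>k\<in>J. E j * E k * (X a j * X a k)) \<partial>N) = (\<Sum>j\<in>J. \<Sum>k\<in>J. E j * E k * m2 j k)"
    unfolding m2_def
    by (subst Bochner_Integration.integral_sum, (intro Bochner_Integration.integrable_sum integrable_mult_right int2; assumption),
        intro sum.cong refl, subst Bochner_Integration.integral_sum) (auto intro!: int2)
  have s2b: "(\<integral>a. (\<Sum>j\<in>J. E j * (X a j * X a j)) \<partial>N) = (\<Sum>j\<in>J. E j * m2 j j)"
    unfolding m2_def by (subst Bochner_Integration.integral_sum) (auto intro!: int2)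
  have e2: "(\<integral>a. S2 a \<partial>N) = (\<Sum>j\<in>J. \<Sum>k\<in>J. E j * E k * m2 j k) - (\<Sum>j\<in>J. E j * m2 j j)"
    unfolding S2_def s2a[symmetric] s2b[symmetric]
    by (rule Bochner_Integration.integral_diff) (intro Bochner_Integration.integrable_sum integrable_mult_right int2; assumption)+
  have s3a: "(\<integral>a. (\<Sum>j\<in>J. E j * (X a j * X a j * X a j)) \<partial>N) = (\<Sum>j\<in>J. E j * m3 j j j)"
    unfolding m3_def by (subst Bochner_Integration.integral_sum) (auto intro!: int3)
  have s3b: "(\<integral>a. (\<Sum>j\<in>J. \<Sum>k\<in>J. E j * E k * (X a j * X a k * X a k)) \<partial>N) = (\<Sum>j\<in>J. \<Sum>k\<in>J. E j * E k * m3 j k k)"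
    unfolding m3_def
    by (subst Bochner_Integration.integral_sum, (intro Bochner_Integration.integrable_sum integrable_mult_right int3; assumption),
        intro sum.cong refl, subst Bochner_Integration.integral_sum) (auto intro!: int3)
  have s3c: "(\<integral>a. (\<Sum>j\<in>J. \<Sum>k\<in>J. \<Sum>l\<in>J. E j * E k * E l * (X a j * X a k * X a l)) \<partial>N) =
      (\<Sum>j\<in>J. \<Sum>k\<in>J. \<Sum>l\<in>J. E j * E k * E l * m3 j k l)"
    unfolding m3_def
    by (subst Bochner_Integration.integral_sum, (intro Bochner_Integration.integrable_sum integrable_mult_right int3; assumption),
        intro sum.cong refl, subst Bochner_Integration.integral_sum,
        (intro Bochner_Integration.integrable_sum integrable_mult_right int3; assumption),
        intro sum.cong refl, subst Bochner_Integration.integral_sum) (auto intro!: int3)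
  have e3: "(\<integral>a. S3 a \<partial>N) = - (\<Sum>j\<in>J. E j * m3 j j j) + 3 * (\<Sum>j\<in>J. \<Sum>k\<in>J. E j * E k * m3 j k k)
          - (\<Sum>j\<in>J. \<Sum>k\<in>J. \<Sum>l\<in>J. E j * E k * E l * m3 j k l)"
  proof -
    have i: "integrable N (\<lambda>a. \<Sum>j\<in>J. E j * (X a j * X a j * X a j))"
      "integrable N (\<lambda>a. \<Sum>j\<in>J. \<Sum>k\<in>J. E j * E k * (X a j * X a k * X a k))"
      "integrable N (\<lambda>a. \<Sum>j\<in>J. \<Sum>k\<in>J. \<Sum>l\<in>J. E j * E k * E l * (X a j * X a k * X a l))"
      by (intro Bochner_Integration.integrable_sum integrable_mult_right int3; assumption)+
    show ?thesis unfolding S3_def s3a[symmetric] s3b[symmetric] s3c[symmetric]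
      using i by simp
  qed
  have IP: "(\<integral>a. P a \<partial>N) = f0 * (1 - \<kappa> * (\<integral>a. S1 a \<partial>N) + \<kappa>^2 / 2 * (\<integral>a. S2 a \<partial>N) + \<kappa>^3 / 6 * (\<integral>a. S3 a \<partial>N))"
    unfolding P_def using iS1 iS2 iS3 by (simp add: prob_space)
  have bnd: "AE a in N. \<bar>gum J \<beta> t (\<lambda>j. w j + c * X a j) - P a\<bar> \<le> 75/24 * \<kappa>^4 * r a ^ 4"
    using dom
  proof eventually_elim
    case (elim a)
    have z: "\<bar>\<kappa> * X a j\<bar> \<le> \<kappa> * r a" if "j \<in> J" for j
      using elim that \<kappa> by (auto simp: abs_mult intro!: mult_left_mono)
    have kr: "0 \<le> \<kappa> * r a" using \<kappa> r_nonneg by simp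
    have g: "gum J \<beta> t (\<lambda>j. w j + c * X a j) = exp (- (\<Sum>j\<in>J. E j * exp (\<kappa> * X a j)))"
      unfolding gum_def E_def e_def \<kappa>_def by (simp add: algebra_simps flip: exp_add)
    have V1: "(\<Sum>j\<in>J. E j * (\<kappa> * X a j) ^ 1) = \<kappa> * S1 a" by (simp add: S1_def sum_distrib_left ac_simps)
    have V2: "(\<Sum>j\<in>J. E j * (\<kappa> * X a j) ^ 2) = \<kappa>^2 * (\<Sum>j\<in>J. E j * (X a j * X a j))"
      by (simp add: sum_distrib_left power2_eq_square ac_simps)
    have V3: "(\<Sum>j\<in>J. E j * (\<kappa> * X a j) ^ 3) = \<kappa>^3 * (\<Sum>j\<in>J. E j * (X a j * X a j * X a j))"
      by (simp add: sum_distrib_left power3_eq_cube ac_simps)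
    have S2': "S2 a = (S1 a)^2 - (\<Sum>j\<in>J. E j * (X a j * X a j))"
      unfolding S2_def S1_def by (simp add: power2_eq_square sum_product ac_simps)
    have S3': "S3 a = - (\<Sum>j\<in>J. E j * (X a j * X a j * X a j)) + 3 * (S1 a * (\<Sum>j\<in>J. E j * (X a j * X a j))) - (S1 a)^3"
    proof -
      have a1: "S1 a * (\<Sum>j\<in>J. E j * (X a j * X a j)) = (\<Sum>j\<in>J. \<Sum>k\<in>J. E j * E k * (X a j * X a k * X a k))"
        unfolding S1_def by (simp add: sum_product ac_simps)
      have a2: "(S1 a)^3 = (\<Sum>j\<in>J. \<Sum>k\<in>J. \<Sum>l\<in>J. E j * E k * E l * (X a j * X a k * X a l))"
        unfolding S1_def power3_eq_cube sum_product sum_distrib_right sum_distrib_left by (simp add: ac_simps)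
      show ?thesis unfolding S3_def a1 a2 by simp
    qed
    have "P a = exp (- (\<Sum>j\<in>J. E j * (\<kappa> * X a j) ^ 0)) * (1 - (\<Sum>j\<in>J. E j * (\<kappa> * X a j) ^ 1) +
       ((\<Sum>j\<in>J. E j * (\<kappa> * X a j) ^ 1)^2 - (\<Sum>j\<in>J. E j * (\<kappa> * X a j) ^ 2)) / 2 +
       (- (\<Sum>j\<in>J. E j * (\<kappa> * X a j) ^ 3) + 3 * (\<Sum>j\<in>J. E j * (\<kappa> * X a j) ^ 1) * (\<Sum>j\<in>J. E j * (\<kappa> * X a j) ^ 2) - (\<Sum>j\<in>J. E j * (\<kappa> * X a j) ^ 1)^3) / 6)"
      unfolding V1 V2 V3 P_def f0 S2' S3' by (simp add: algebra_simps power2_eq_square power3_eq_cube add_divide_distrib diff_divide_distrib)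
    hence "\<bar>gum J \<beta> t (\<lambda>j. w j + c * X a j) - P a\<bar> \<le> 75/24 * (\<kappa> * r a)^4"
      unfolding g using gumbel_taylor[OF finite_J E0 z kr] by simp
    thus ?case by (simp add: power_mult_distrib)
  qed
  have m: "(\<lambda>a. gum J \<beta> t (\<lambda>j. w j + c * X a j)) \<in> borel_measurable N" by measurable
  have ig: "integrable N (\<lambda>a. gum J \<beta> t (\<lambda>j. w j + c * X a j))"
    by (rule bounded_integrable[OF prob_space_axioms m gum_abs])
  have "\<bar>cv c N X (gum J \<beta> t) w - (\<integral>a. P a \<partial>N)\<bar> = \<bar>\<integral>a. gum J \<beta> t (\<lambda>j. w j + c * X a j) - P a \<partial>N\<bar>"
    unfolding cv_def using ig iP by simp
  also have "\<dots> \<le> (\<integral>a. \<bar>gum J \<beta> t (\<lambda>j. w j + c * X a j) - P a\<bar> \<partial>N)" by (rule integral_abs_bound)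
  also have "\<dots> \<le> (\<integral>a. 75/24 * \<kappa>^4 * r a ^ 4 \<partial>N)"
    by (rule integral_mono_AE) (use ig iP r4 bnd in auto)
  also have "\<dots> = 75/24 * \<kappa>^4 * (\<integral>a. r a ^ 4 \<partial>N)" by simp
  also have "\<dots> \<le> 75/24 * \<kappa>^4 * K" using K \<kappa> by (intro mult_left_mono) auto
  finally show ?thesis unfolding IP e1 e2 e3 f0_def E_def \<kappa>_def .
qed

end

text \<open>In the difference of two expansions the weights are positive with sum \<open>U\<close>,
  so a sum of order \<open>k\<close> is at most \<open>U^k\<close> times the largest moment
  difference. The prefactor \<open>exp (- U)\<close> absorbs this as
  \<open>u ^ k * exp (- u) \<le> fact k\<close>, whence the numerators \<open>1 + 2 = 3\<close> and
  \<open>1 + 3 * 2 + 6 = 13\<close>, independently of \<open>card J\<close>.\<close>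

lemma gum_moment_comparison:
  assumes A: "dominated_vector N X J r K" and A': "dominated_vector N' X' J r' K'"
    and \<beta>: "0 \<le> \<beta>" and c: "0 \<le> c"
    and m1: "\<And>j. j \<in> J \<Longrightarrow> (\<integral>a. X a j \<partial>N) = (\<integral>a. X' a j \<partial>N')"
    and m2: "\<And>j k. j \<in> J \<Longrightarrow> k \<in> J \<Longrightarrow> \<bar>(\<integral>a. X a j * X a k \<partial>N) - (\<integral>a. X' a j * X' a k \<partial>N')\<bar> \<le> \<Delta>2"
    and m3: "\<And>j k l. j \<in> J \<Longrightarrow> k \<in> J \<Longrightarrow> l \<in> J \<Longrightarrow>
        \<bar>(\<integral>a. X a j * X a k * X a l \<partial>N) - (\<integral>a. X' a j * X' a k * X' a l \<partial>N')\<bar> \<le> \<Delta>3"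
    and \<Delta>: "0 \<le> \<Delta>2" "0 \<le> \<Delta>3"
  shows "\<bar>cv c N X (gum J \<beta> t) w - cv c N' X' (gum J \<beta> t) w\<bar> \<le>
     3/2 * (\<beta> * c)^2 * \<Delta>2 + 13/6 * (\<beta> * c)^3 * \<Delta>3 + 75/24 * (\<beta> * c)^4 * (K + K')"
proof -
  interpret A: dominated_vector N X J r K by (rule A)
  interpret A': dominated_vector N' X' J r' K' by (rule A')
  define \<kappa> where "\<kappa> = \<beta> * c"
  have \<kappa>: "0 \<le> \<kappa>" using \<beta> c by (simp add: \<kappa>_def)
  define E where "E = (\<lambda>j. exp (\<beta> * (w j - t)))"
  have E0: "0 \<le> E j" for j by (simp add: E_def)
  define U where "U = (\<Sum>j\<in>J. E j)"
  have U0: "0 \<le> U" unfolding U_def by (intro sum_nonneg E0)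
  define f where "f = gum J \<beta> t w"
  have f: "f = exp (- U)" by (simp add: f_def gum_def U_def E_def)
  have f0: "0 \<le> f" by (simp add: f)
  define d2 where "d2 = (\<lambda>j k. (\<integral>a. X a j * X a k \<partial>N) - (\<integral>a. X' a j * X' a k \<partial>N'))"
  define d3 where "d3 = (\<lambda>j k l. (\<integral>a. X a j * X a k * X a l \<partial>N) - (\<integral>a. X' a j * X' a k * X' a l \<partial>N'))"
  define Q where "Q = (\<lambda>m2 m3. f * (1 - \<kappa> * (\<Sum>j\<in>J. E j * (\<integral>a. X a j \<partial>N))
      + \<kappa>^2 / 2 * ((\<Sum>j\<in>J. \<Sum>k\<in>J. E j * E k * m2 j k) - (\<Sum>j\<in>J. E j * m2 j j))
      + \<kappa>^3 / 6 * (- (\<Sum>j\<in>J. E j * m3 j j j) + 3 * (\<Sum>j\<in>J. \<Sum>k\<in>J. E j * E k * m3 j k k)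
          - (\<Sum>j\<in>J. \<Sum>k\<in>J. \<Sum>l\<in>J. E j * E k * E l * m3 j k l))))"
  have q: "\<bar>cv c N X (gum J \<beta> t) w - Q (\<lambda>j k. \<integral>a. X a j * X a k \<partial>N) (\<lambda>j k l. \<integral>a. X a j * X a k * X a l \<partial>N)\<bar> \<le> 75/24 * \<kappa>^4 * K"
    unfolding Q_def f_def E_def \<kappa>_def by (rule A.gum_expansion[OF \<beta> c])
  have m1': "(\<Sum>j\<in>J. E j * (\<integral>a. X a j \<partial>N)) = (\<Sum>j\<in>J. E j * (\<integral>a. X' a j \<partial>N'))"
    by (intro sum.cong refl) (simp add: m1)
  have q': "\<bar>cv c N' X' (gum J \<beta> t) w - Q (\<lambda>j k. \<integral>a. X' a j * X' a k \<partial>N') (\<lambda>j k l. \<integral>a. X' a j * X' a k * X' a l \<partial>N')\<bar> \<le> 75/24 * \<kappa>^4 * K'"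
    unfolding Q_def m1' unfolding f_def E_def \<kappa>_def by (rule A'.gum_expansion[OF \<beta> c])
  have D: "Q (\<lambda>j k. \<integral>a. X a j * X a k \<partial>N) (\<lambda>j k l. \<integral>a. X a j * X a k * X a l \<partial>N)
     - Q (\<lambda>j k. \<integral>a. X' a j * X' a k \<partial>N') (\<lambda>j k l. \<integral>a. X' a j * X' a k * X' a l \<partial>N')
     = f * (\<kappa>^2 / 2 * ((\<Sum>j\<in>J. \<Sum>k\<in>J. E j * E k * d2 j k) - (\<Sum>j\<in>J. E j * d2 j j))
      + \<kappa>^3 / 6 * (- (\<Sum>j\<in>J. E j * d3 j j j) + 3 * (\<Sum>j\<in>J. \<Sum>k\<in>J. E j * E k * d3 j k k)
          - (\<Sum>j\<in>J. \<Sum>k\<in>J. \<Sum>l\<in>J. E j * E k * E l * d3 j k l)))"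
    unfolding Q_def d2_def d3_def right_diff_distrib sum_subtractf by (simp add: algebra_simps)
  have s1: "\<bar>\<Sum>j\<in>J. E j * g j\<bar> \<le> U * \<Delta>" if "\<And>j. j \<in> J \<Longrightarrow> \<bar>g j\<bar> \<le> \<Delta>" for g \<Delta>
  proof -
    have "\<bar>\<Sum>j\<in>J. E j * g j\<bar> \<le> (\<Sum>j\<in>J. \<bar>E j * g j\<bar>)" by (rule sum_abs)
    also have "\<dots> \<le> (\<Sum>j\<in>J. E j * \<Delta>)" using that E0 by (intro sum_mono) (auto simp: abs_mult intro!: mult_left_mono)
    finally show ?thesis by (simp add: U_def sum_distrib_right)
  qed
  have s2: "\<bar>\<Sum>j\<in>J. \<Sum>k\<in>J. E j * E k * g j k\<bar> \<le> U^2 * \<Delta>" if "\<And>j k. j \<in> J \<Longrightarrow> k \<in> J \<Longrightarrow> \<bar>g j k\<bar> \<le> \<Delta>" for g \<Delta>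
  proof -
    have "\<bar>\<Sum>j\<in>J. E j * (\<Sum>k\<in>J. E k * g j k)\<bar> \<le> U * (U * \<Delta>)" by (intro s1 that)
    thus ?thesis by (simp add: sum_distrib_left ac_simps power2_eq_square)
  qed
  have s3: "\<bar>\<Sum>j\<in>J. \<Sum>k\<in>J. \<Sum>l\<in>J. E j * E k * E l * g j k l\<bar> \<le> U^3 * \<Delta>"
    if "\<And>j k l. j \<in> J \<Longrightarrow> k \<in> J \<Longrightarrow> l \<in> J \<Longrightarrow> \<bar>g j k l\<bar> \<le> \<Delta>" for g \<Delta>
  proof -
    have "\<bar>\<Sum>j\<in>J. E j * (\<Sum>k\<in>J. \<Sum>l\<in>J. E k * E l * g j k l)\<bar> \<le> U * (U^2 * \<Delta>)" by (intro s1 s2 that)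
    thus ?thesis by (simp add: sum_distrib_left ac_simps power2_eq_square power3_eq_cube)
  qed
  have d2: "\<bar>d2 j k\<bar> \<le> \<Delta>2" if "j \<in> J" "k \<in> J" for j k unfolding d2_def using m2[OF that] .
  have d3: "\<bar>d3 j k l\<bar> \<le> \<Delta>3" if "j \<in> J" "k \<in> J" "l \<in> J" for j k l unfolding d3_def using m3[OF that] .
  define T2 where "T2 = (\<Sum>j\<in>J. \<Sum>k\<in>J. E j * E k * d2 j k) - (\<Sum>j\<in>J. E j * d2 j j)"
  define T3 where "T3 = - (\<Sum>j\<in>J. E j * d3 j j j) + 3 * (\<Sum>j\<in>J. \<Sum>k\<in>J. E j * E k * d3 j k k)
          - (\<Sum>j\<in>J. \<Sum>k\<in>J. \<Sum>l\<in>J. E j * E k * E l * d3 j k l)"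
  have t2: "\<bar>T2\<bar> \<le> (U^2 + U) * \<Delta>2"
    using s2[of d2 \<Delta>2] s1[of "\<lambda>j. d2 j j" \<Delta>2] d2 unfolding T2_def by (simp add: algebra_simps)
  have t3: "\<bar>T3\<bar> \<le> (U + 3 * U^2 + U^3) * \<Delta>3"
  proof -
    have "\<bar>\<Sum>j\<in>J. E j * d3 j j j\<bar> \<le> U * \<Delta>3" by (intro s1 d3)
    moreover have "\<bar>\<Sum>j\<in>J. \<Sum>k\<in>J. E j * E k * d3 j k k\<bar> \<le> U^2 * \<Delta>3" by (intro s2 d3)
    moreover have "\<bar>\<Sum>j\<in>J. \<Sum>k\<in>J. \<Sum>l\<in>J. E j * E k * E l * d3 j k l\<bar> \<le> U^3 * \<Delta>3" by (intro s3 d3)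
    ultimately show ?thesis unfolding T3_def ring_distribs by linarith
  qed
  have b2: "f * (U^2 + U) \<le> 3"
    using exp_ge_power_div_fact[OF U0, of 2] exp_ge_power_div_fact[OF U0, of 1] by (simp add: f fact_numeral algebra_simps)
  have b3: "f * (U + 3 * U^2 + U^3) \<le> 13"
    using exp_ge_power_div_fact[OF U0, of 2] exp_ge_power_div_fact[OF U0, of 1] exp_ge_power_div_fact[OF U0, of 3]
    by (simp add: f fact_numeral algebra_simps)
  have "\<bar>f * T2\<bar> \<le> 3 * \<Delta>2"
  proof -
    have "\<bar>f * T2\<bar> \<le> f * ((U^2 + U) * \<Delta>2)" using t2 f0 by (simp add: abs_mult mult_left_mono)
    also have "\<dots> = (f * (U^2 + U)) * \<Delta>2" by simp
    also have "\<dots> \<le> 3 * \<Delta>2" by (rule mult_right_mono[OF b2 \<Delta>(1)])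
    finally show ?thesis .
  qed
  hence u2: "\<bar>\<kappa>^2 / 2 * (f * T2)\<bar> \<le> \<kappa>^2 / 2 * (3 * \<Delta>2)"
    by (subst abs_mult) (use \<kappa> in \<open>auto intro: mult_left_mono\<close>)
  have "\<bar>f * T3\<bar> \<le> 13 * \<Delta>3"
  proof -
    have "\<bar>f * T3\<bar> \<le> f * ((U + 3 * U^2 + U^3) * \<Delta>3)" using t3 f0 by (simp add: abs_mult mult_left_mono)
    also have "\<dots> = (f * (U + 3 * U^2 + U^3)) * \<Delta>3" by simp
    also have "\<dots> \<le> 13 * \<Delta>3" by (rule mult_right_mono[OF b3 \<Delta>(2)])
    finally show ?thesis .
  qed
  hence u3: "\<bar>\<kappa>^3 / 6 * (f * T3)\<bar> \<le> \<kappa>^3 / 6 * (13 * \<Delta>3)"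
    by (subst abs_mult) (use \<kappa> in \<open>auto intro: mult_left_mono\<close>)
  have "Q (\<lambda>j k. \<integral>a. X a j * X a k \<partial>N) (\<lambda>j k l. \<integral>a. X a j * X a k * X a l \<partial>N)
     - Q (\<lambda>j k. \<integral>a. X' a j * X' a k \<partial>N') (\<lambda>j k l. \<integral>a. X' a j * X' a k * X' a l \<partial>N') = \<kappa>^2 / 2 * (f * T2) + \<kappa>^3 / 6 * (f * T3)"
    unfolding D T2_def[symmetric] T3_def[symmetric] by (simp add: algebra_simps)
  with u2 u3 have "\<bar>Q (\<lambda>j k. \<integral>a. X a j * X a k \<partial>N) (\<lambda>j k l. \<integral>a. X a j * X a k * X a l \<partial>N)
     - Q (\<lambda>j k. \<integral>a. X' a j * X' a k \<partial>N') (\<lambda>j k l. \<integral>a. X' a j * X' a k * X' a l \<partial>N')\<bar> \<le> \<kappa>^2 / 2 * (3 * \<Delta>2) + \<kappa>^3 / 6 * (13 * \<Delta>3)"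
    by linarith
  with q q' show ?thesis unfolding \<kappa>_def[symmetric] ring_distribs by linarith
qed

definition cdf_max :: "'w measure \<Rightarrow> ('w \<Rightarrow> nat \<Rightarrow> real) \<Rightarrow> nat set \<Rightarrow> real \<Rightarrow> real" where
  "cdf_max M S J t = measure M {\<omega> \<in> space M. \<forall>j\<in>J. S \<omega> j \<le> t}"

text \<open>The factor 4 in the margin makes each of at most \<open>n^3\<close> summands at most
  \<open>1 / n^4\<close>. For a single coordinate \<open>gum\<close> is a Gumbel distribution
  function of \<open>t\<close>; in general it is a soft maximum and a cut-off in one
  function.\<close>

lemma gum_ge:
  assumes J: "finite J" "real (card J) \<le> real n ^ 3" and n: "n \<ge> 1" and \<beta>: "\<beta> > 0"
    and w: "\<And>j. j \<in> J \<Longrightarrow> w j \<le> t - 4 * ln (real n) / \<beta>"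
  shows "1 - 1 / real n \<le> gum J \<beta> t w"
proof -
  have "(\<Sum>j\<in>J. exp (\<beta> * (w j - t))) \<le> (\<Sum>j\<in>J. 1 / real n ^ 4)"
  proof (rule sum_mono)
    fix j assume j: "j \<in> J"
    have "\<beta> * (w j - t) \<le> \<beta> * (- (4 * ln (real n) / \<beta>))" using w[OF j] \<beta> by (intro mult_left_mono) auto
    hence "\<beta> * (w j - t) \<le> - (4 * ln (real n))" using \<beta> by simp
    hence "exp (\<beta> * (w j - t)) \<le> exp (- (4 * ln (real n)))" by simp
    also have "4 * ln (real n) = ln (real n ^ 4)" using n by (simp add: ln_realpow)
    also have "exp (- ln (real n ^ 4)) = 1 / real n ^ 4" using n by (simp add: exp_minus divide_inverse)
    finally show "exp (\<beta> * (w j - t)) \<le> 1 / real n ^ 4" .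
  qed
  also have "\<dots> = real (card J) / real n ^ 4" by simp
  also have "\<dots> \<le> real n ^ 3 / real n ^ 4" using J by (intro divide_right_mono) auto
  also have "\<dots> = 1 / real n" using n by (simp add: field_simps power_numeral_reduce)
  finally have "(\<Sum>j\<in>J. exp (\<beta> * (w j - t))) \<le> 1 / real n" .
  thus ?thesis unfolding gum_def using exp_ge_add_one_self[of "- (\<Sum>j\<in>J. exp (\<beta> * (w j - t)))"] by linarith
qed

lemma gum_le:
  assumes J: "finite J" and n: "n \<ge> 1" and \<beta>: "\<beta> > 0"
    and j: "j \<in> J" "t + 4 * ln (real n) / \<beta> < w j"
  shows "gum J \<beta> t w \<le> 1 / real n"
proof -
  have "ln (real n) \<le> 4 * ln (real n)" using n by simp
  also have "\<dots> = \<beta> * (4 * ln (real n) / \<beta>)" using \<beta> by simp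
  also have "\<dots> \<le> \<beta> * (w j - t)" using j \<beta> by (intro mult_left_mono) auto
  finally have "exp (ln (real n)) \<le> exp (\<beta> * (w j - t))" by simp
  hence "real n \<le> exp (\<beta> * (w j - t))" using n by simp
  also have "\<dots> \<le> (\<Sum>j\<in>J. exp (\<beta> * (w j - t)))" by (rule member_le_sum) (use j J in auto)
  finally have "gum J \<beta> t w \<le> exp (- real n)" unfolding gum_def by simp
  also have "\<dots> = 1 / exp (real n)" by (simp add: exp_minus divide_inverse)
  also have "\<dots> \<le> 1 / real n"
    using exp_ge_add_one_self[of "real n"] n by (intro divide_left_mono) (auto intro: mult_pos_pos simp del: exp_ge_add_one_self)
  finally show ?thesis .
qed

text \<open>The test function is centred halfway, at \<open>t + 4 * ln n / \<beta>\<close>. Passing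
  from the indicator to it and back again costs a margin \<open>4 * ln n / \<beta>\<close> and an
  error \<open>1 / n\<close> each time.\<close>

lemma cdf_max_comparison:
  assumes M: "prob_space M" and M': "prob_space M'" and S: "S \<in> M \<rightarrow>\<^sub>M RV" and S': "S' \<in> M' \<rightarrow>\<^sub>M RV"
    and J: "finite J" "real (card J) \<le> real n ^ 3" and n: "n \<ge> 1" and \<beta>: "\<beta> > 0"
    and eps: "\<And>t. \<bar>(\<integral>\<omega>. gum J \<beta> t (S \<omega>) \<partial>M) - (\<integral>\<omega>. gum J \<beta> t (S' \<omega>) \<partial>M')\<bar> \<le> \<epsilon>"
  shows "cdf_max M S J t \<le> cdf_max M' S' J (t + 8 * ln (real n) / \<beta>) + \<epsilon> + 2 / real n"
proof -
  interpret M: prob_space M by (rule M)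
  interpret M': prob_space M' by (rule M')
  have [measurable]: "(\<lambda>\<omega>. S \<omega> j) \<in> borel_measurable M" for j by (rule RV_component[OF S])
  have [measurable]: "(\<lambda>\<omega>. S' \<omega> j) \<in> borel_measurable M'" for j by (rule RV_component[OF S'])
  note [measurable] = J(1) S S'
  let ?h = "4 * ln (real n) / \<beta>"
  let ?A = "{\<omega> \<in> space M. \<forall>j\<in>J. S \<omega> j \<le> t}"
  let ?A' = "{\<omega> \<in> space M'. \<forall>j\<in>J. S' \<omega> j \<le> t + 8 * ln (real n) / \<beta>}"
  have A[measurable]: "?A \<in> sets M" and A'[measurable]: "?A' \<in> sets M'" by measurable
  have g[measurable]: "(\<lambda>\<omega>. gum J \<beta> (t + ?h) (S \<omega>)) \<in> borel_measurable M" by measurable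
  have g'[measurable]: "(\<lambda>\<omega>. gum J \<beta> (t + ?h) (S' \<omega>)) \<in> borel_measurable M'" by measurable
  have ig: "integrable M (\<lambda>\<omega>. gum J \<beta> (t + ?h) (S \<omega>))" by (rule bounded_integrable[OF M g gum_abs])
  have ig': "integrable M' (\<lambda>\<omega>. gum J \<beta> (t + ?h) (S' \<omega>))" by (rule bounded_integrable[OF M' g' gum_abs])
  have "cdf_max M S J t = (\<integral>\<omega>. indicator ?A \<omega> \<partial>M)" unfolding cdf_max_def by simp
  also have "\<dots> \<le> (\<integral>\<omega>. gum J \<beta> (t + ?h) (S \<omega>) + 1 / real n \<partial>M)"
  proof (rule integral_mono)
    fix \<omega> assume "\<omega> \<in> space M"
    show "indicator ?A \<omega> \<le> gum J \<beta> (t + ?h) (S \<omega>) + 1 / real n"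
    proof (cases "\<omega> \<in> ?A")
      case True
      have "1 - 1 / real n \<le> gum J \<beta> (t + ?h) (S \<omega>)"
        by (rule gum_ge[OF J n \<beta>]) (use True in auto)
      thus ?thesis using True by (simp add: indicator_def)
    next
      case False
      hence "indicator ?A \<omega> = (0::real)" by (rule indicator_simps(2))
      thus ?thesis using gum_nonneg[of J \<beta> "t + ?h" "S \<omega>"] by (simp add: add_nonneg_nonneg)
    qed
  qed (use ig in \<open>auto simp: M.emeasure_eq_measure\<close>)
  also have "\<dots> = (\<integral>\<omega>. gum J \<beta> (t + ?h) (S \<omega>) \<partial>M) + 1 / real n" using ig by (simp add: M.prob_space)
  also have "\<dots> \<le> (\<integral>\<omega>. gum J \<beta> (t + ?h) (S' \<omega>) \<partial>M') + \<epsilon> + 1 / real n" using eps[of "t + ?h"] by simp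
  also have "(\<integral>\<omega>. gum J \<beta> (t + ?h) (S' \<omega>) \<partial>M') \<le> (\<integral>\<omega>. indicator ?A' \<omega> + 1 / real n \<partial>M')"
  proof (rule integral_mono)
    fix \<omega> assume o: "\<omega> \<in> space M'"
    show "gum J \<beta> (t + ?h) (S' \<omega>) \<le> indicator ?A' \<omega> + 1 / real n"
    proof (cases "\<omega> \<in> ?A'")
      case True
      thus ?thesis using gum_le_1[of J \<beta> "t + ?h" "S' \<omega>"] by (simp add: indicator_def add_increasing2)
    next
      case False
      then obtain j where "j \<in> J" "t + 8 * ln (real n) / \<beta> < S' \<omega> j" using o by auto
      hence "gum J \<beta> (t + ?h) (S' \<omega>) \<le> 1 / real n"
        by (intro gum_le[OF J(1) n \<beta>, of j]) (auto simp: algebra_simps add_divide_distrib[symmetric])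
      thus ?thesis using False by (simp add: indicator_def)
    qed
  qed (use ig' in \<open>auto simp: M'.emeasure_eq_measure\<close>)
  also have "\<dots> = cdf_max M' S' J (t + 8 * ln (real n) / \<beta>) + 1 / real n"
    unfolding cdf_max_def by (simp add: M'.prob_space M'.emeasure_eq_measure)
  finally show ?thesis by simp
qed

section \<open>An exponential tail bound for bounded independent summands\<close>

lemma exp_le_quadratic:
  fixes z :: real assumes "\<bar>z\<bar> \<le> 1" shows "exp z \<le> 1 + z + z^2"
proof (cases "0 \<le> z")
  case True thus ?thesis using exp_bound[of z] assms by simp
next
  case False
  define y where "y = - z"
  have y: "0 \<le> y" "y \<le> 1" using False assms by (auto simp: y_def)
  have "1 \<le> (1 - y + y^2) * (1 + y + y^2 / 2)"
  proof -
    have "(1 - y + y^2) * (1 + y + y^2 / 2) = 1 + y^2 * (1/2 + y/2 + y^2/2)"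
      by (simp add: field_simps power2_eq_square)
    thus ?thesis using y by (simp add: add_nonneg_nonneg)
  qed
  also have "\<dots> \<le> (1 - y + y^2) * exp y"
    using exp_lower_Taylor_quadratic[OF y(1)] y by (intro mult_left_mono) auto
  finally have "exp (- y) \<le> 1 - y + y^2" by (simp add: exp_minus field_simps)
  thus ?thesis by (simp add: y_def)
qed

text \<open>Chernoff's bound. The condition on \<open>l * b\<close> keeps the exponents in the range
  where \<open>exp z \<le> 1 + z + z^2\<close>, and the linear term vanishes in expectation. The
  parameter \<open>l\<close> stays free: 1 serves most purposes, but for coordinates of small
  variance it will be of order \<open>ln n\<close>.\<close>

lemma (in prob_space) sum_upper_tail:
  fixes Z :: "nat \<Rightarrow> 'a \<Rightarrow> real"
  assumes ind: "indep_vars (\<lambda>_. borel) Z {..<n}" and n: "n \<ge> 1"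
    and b: "\<And>i. i < n \<Longrightarrow> AE \<omega> in M. \<bar>Z i \<omega>\<bar> \<le> b"
    and mean: "\<And>i. i < n \<Longrightarrow> expectation (Z i) = 0"
    and var: "\<And>i. i < n \<Longrightarrow> expectation (\<lambda>\<omega>. (Z i \<omega>)^2) \<le> v"
    and l: "0 < l" "l * b \<le> sqrt (real n)"
  shows "prob {\<omega> \<in> space M. x \<le> (\<Sum>i<n. Z i \<omega>) / sqrt (real n)} \<le> exp (l^2 * v - l * x)"
proof -
  define c where "c = l / sqrt (real n)"
  have c: "0 < c" "c * b \<le> 1" using l n by (auto simp: c_def field_simps)
  have [measurable]: "Z i \<in> borel_measurable M" if "i < n" for i using ind that unfolding indep_vars_def by auto
  define W where "W = (\<lambda>i \<omega>. exp (c * Z i \<omega>))"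
  have mW: "W i \<in> borel_measurable M" if "i < n" for i unfolding W_def using that by measurable
  have indW: "indep_vars (\<lambda>_. borel) W {..<n}"
    unfolding W_def by (rule indep_vars_compose2[OF ind]) measurable
  have bz: "AE \<omega> in M. \<bar>c * Z i \<omega>\<bar> \<le> 1" if "i < n" for i
    using b[OF that]
  proof eventually_elim
    case (elim \<omega>)
    have "c * \<bar>Z i \<omega>\<bar> \<le> c * b" using elim c by (intro mult_left_mono) auto
    hence "c * \<bar>Z i \<omega>\<bar> \<le> 1" using c(2) by linarith
    thus ?case using c(1) by (simp add: abs_mult)
  qed
  have iZ: "integrable M (Z i)" "integrable M (\<lambda>\<omega>. (Z i \<omega>)^2)" if "i < n" for i
  proof -
    show "integrable M (Z i)" by (rule integrable_const_bound[OF _ ]) (use b[OF that] that in auto)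
    have "AE \<omega> in M. norm ((Z i \<omega>)^2) \<le> b^2" using b[OF that]
    proof eventually_elim
      case (elim \<omega>)
      have "\<bar>Z i \<omega>\<bar>^2 \<le> b^2" using elim by (intro power_mono) auto
      thus ?case by simp
    qed
    thus "integrable M (\<lambda>\<omega>. (Z i \<omega>)^2)" by (rule integrable_const_bound) (use that in auto)
  qed
  have iW: "integrable M (W i)" if "i < n" for i
  proof (rule integrable_const_bound[where B="exp 1"])
    show "AE \<omega> in M. norm (W i \<omega>) \<le> exp 1" using bz[OF that] by eventually_elim (auto simp: W_def)
  qed (rule mW[OF that])
  have EW: "expectation (W i) \<le> 1 + c^2 * v" if i: "i < n" for i
  proof -
    have "expectation (W i) \<le> expectation (\<lambda>\<omega>. 1 + c * Z i \<omega> + c^2 * (Z i \<omega>)^2)"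
    proof (rule integral_mono_AE)
      show "AE \<omega> in M. W i \<omega> \<le> 1 + c * Z i \<omega> + c^2 * (Z i \<omega>)^2"
        using bz[OF i]
      proof eventually_elim
        case (elim \<omega>)
        show ?case using exp_le_quadratic[OF elim] by (simp add: W_def power_mult_distrib)
      qed
    qed (use iW[OF i] iZ[OF i] in auto)
    also have "\<dots> = 1 + c^2 * expectation (\<lambda>\<omega>. (Z i \<omega>)^2)"
      using iZ[OF i] mean[OF i] by (simp add: prob_space)
    also have "\<dots> \<le> 1 + c^2 * v" using var[OF i] by (simp add: mult_left_mono)
    finally show ?thesis .
  qed
  have iP: "integrable M (\<lambda>\<omega>. \<Prod>i\<in>{..<n}. W i \<omega>)"
    by (rule indep_vars_integrable[OF _ indW]) (use iW in auto)
  have "expectation (\<lambda>\<omega>. \<Prod>i\<in>{..<n}. W i \<omega>) = (\<Prod>i\<in>{..<n}. expectation (W i))"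
    by (rule indep_vars_lebesgue_integral[OF _ indW]) (use iW in auto)
  also have "\<dots> \<le> (\<Prod>i\<in>{..<n}. exp (c^2 * v))"
  proof (rule prod_mono)
    fix i assume "i \<in> {..<n}"
    hence i: "i < n" by simp
    have "0 \<le> expectation (W i)" by (rule Bochner_Integration.integral_nonneg) (simp add: W_def)
    moreover have "expectation (W i) \<le> exp (c^2 * v)" using EW[OF i] exp_ge_add_one_self[of "c^2 * v"] by linarith
    ultimately show "0 \<le> expectation (W i) \<and> expectation (W i) \<le> exp (c^2 * v)" by simp
  qed
  also have "\<dots> = exp (l^2 * v)" using n by (simp add: c_def power_divide flip: exp_of_nat_mult)
  finally have E: "expectation (\<lambda>\<omega>. \<Prod>i\<in>{..<n}. W i \<omega>) \<le> exp (l^2 * v)" .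
  have eq: "(\<Prod>i\<in>{..<n}. W i \<omega>) = exp (l * ((\<Sum>i<n. Z i \<omega>) / sqrt (real n)))" for \<omega>
    unfolding W_def c_def by (simp add: exp_sum[symmetric] sum_distrib_left sum_divide_distrib)
  have "{\<omega> \<in> space M. x \<le> (\<Sum>i<n. Z i \<omega>) / sqrt (real n)} = {\<omega> \<in> space M. exp (l * x) \<le> (\<Prod>i\<in>{..<n}. W i \<omega>)}"
    unfolding eq exp_le_cancel_iff using l(1) by (simp only: mult_le_cancel_left_pos)
  also have "prob \<dots> \<le> expectation (\<lambda>\<omega>. \<Prod>i\<in>{..<n}. W i \<omega>) / exp (l * x)"
    by (rule integral_Markov_inequality_measure[OF iP, of "{}"]) (auto simp: W_def prod_nonneg)
  also have "\<dots> \<le> exp (l^2 * v) / exp (l * x)" by (rule divide_right_mono[OF E]) simp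
  finally show ?thesis by (simp add: exp_diff)
qed

section \<open>Anti-concentration of Gaussian maxima\<close>

abbreviation std_normal :: "real measure" where
  "std_normal \<equiv> density lborel (\<lambda>x. ennreal (std_normal_density x))"

lemma prob_space_std_normal: "prob_space std_normal"
  by (rule prob_space_normal_density) simp

lemma nn_integral_std_normal_shift:
  fixes H :: "real \<Rightarrow> ennreal"
  assumes [measurable]: "H \<in> borel_measurable borel"
  shows "(\<integral>\<^sup>+y. H (y - b) \<partial>std_normal) = (\<integral>\<^sup>+y. H y * ennreal (exp (- (b * y) - b^2 / 2)) \<partial>std_normal)"
proof -
  have "(\<integral>\<^sup>+y. H (y - b) \<partial>std_normal) = (\<integral>\<^sup>+y. ennreal (std_normal_density y) * H (y - b) \<partial>lborel)"
    by (subst nn_integral_density) auto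
  also have "\<dots> = (\<integral>\<^sup>+y. ennreal (std_normal_density (b + y)) * H y \<partial>lborel)"
    by (subst nn_integral_real_affine[where c=1 and t=b]) auto
  also have "\<dots> = (\<integral>\<^sup>+y. ennreal (std_normal_density y) * (H y * ennreal (exp (- (b * y) - b^2 / 2))) \<partial>lborel)"
  proof (rule nn_integral_cong)
    fix y :: real
    have "std_normal_density (b + y) = std_normal_density y * exp (- (b * y) - b^2 / 2)"
      unfolding std_normal_density_def by (simp add: power2_eq_square field_simps flip: exp_add)
    thus "ennreal (std_normal_density (b + y)) * H y = ennreal (std_normal_density y) * (H y * ennreal (exp (- (b * y) - b^2 / 2)))"
      by (simp add: ennreal_mult ac_simps)
  qed
  also have "\<dots> = (\<integral>\<^sup>+y. H y * ennreal (exp (- (b * y) - b^2 / 2)) \<partial>std_normal)"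
    by (subst nn_integral_density) auto
  finally show ?thesis .
qed

text \<open>Induction over the coordinates from the one-dimensional change of variables; nonnegative
  integrals avoid all integrability questions.\<close>

lemma cameron_martin:
  assumes "finite I" and "F \<in> borel_measurable (Pi\<^sub>M I (\<lambda>_. borel))"
  shows "(\<integral>\<^sup>+g. F (\<lambda>i\<in>I. g i - b i) \<partial>(Pi\<^sub>M I (\<lambda>_. std_normal))) =
     (\<integral>\<^sup>+g. F g * ennreal (exp (- (\<Sum>i\<in>I. b i * g i) - (\<Sum>i\<in>I. (b i)^2) / 2)) \<partial>(Pi\<^sub>M I (\<lambda>_. std_normal)))"
  using assms
proof (induction I arbitrary: F rule: finite_induct)
  case empty
  show ?case by (simp add: PiM_empty nn_integral_count_space_finite)
next
  case (insert k I)
  note [measurable] = insert.prems insert.hyps(1)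
  interpret G: prob_space std_normal by (rule prob_space_std_normal)
  interpret PG: product_prob_space "\<lambda>_. std_normal" by unfold_locales
  define e where "e = (\<lambda>y. ennreal (exp (- (b k * y) - (b k)^2 / 2)))"
  define eI where "eI = (\<lambda>g. ennreal (exp (- (\<Sum>i\<in>I. b i * g i) - (\<Sum>i\<in>I. (b i)^2) / 2)))"
  have [measurable]: "e \<in> borel_measurable borel" "eI \<in> borel_measurable (Pi\<^sub>M I (\<lambda>_. borel))"
    unfolding e_def eI_def by measurable
  \<comment> \<open>The new coordinate, already shifted and reweighted, is integrated out, so that
    the induction hypothesis can be applied to a function of the remaining coordinates.\<close>
  define F' where "F' = (\<lambda>z. \<integral>\<^sup>+y. F (z(k := y)) * e y \<partial>std_normal)"
  have up: "(\<lambda>(z, y). z(k := y)) \<in> (Pi\<^sub>M I (\<lambda>_. borel)) \<Otimes>\<^sub>M borel \<rightarrow>\<^sub>M Pi\<^sub>M (insert k I) (\<lambda>_. borel)"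
    by measurable
  have F'm[measurable]: "F' \<in> borel_measurable (Pi\<^sub>M I (\<lambda>_. borel))"
    unfolding F'_def by measurable
  have sb: "sets (Pi\<^sub>M I (\<lambda>_. std_normal)) = sets (Pi\<^sub>M I (\<lambda>_. borel))" for I :: "'a set"
    by (intro sets_PiM_cong) auto
  have "(\<integral>\<^sup>+g. F (\<lambda>i\<in>insert k I. g i - b i) \<partial>(Pi\<^sub>M (insert k I) (\<lambda>_. std_normal))) =
    (\<integral>\<^sup>+x. (\<integral>\<^sup>+y. F (\<lambda>i\<in>insert k I. (x(k := y)) i - b i) \<partial>std_normal) \<partial>(Pi\<^sub>M I (\<lambda>_. std_normal)))"
    by (rule PG.product_nn_integral_insert) (use insert.hyps in \<open>auto simp: measurable_cong_sets[OF sb refl]\<close>)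
  also have "\<dots> = (\<integral>\<^sup>+x. F' (\<lambda>i\<in>I. x i - b i) \<partial>(Pi\<^sub>M I (\<lambda>_. std_normal)))"
  proof (rule nn_integral_cong)
    fix x assume x: "x \<in> space (Pi\<^sub>M I (\<lambda>_. std_normal))"
    let ?z = "\<lambda>i\<in>I. x i - b i"
    have z: "?z \<in> space (Pi\<^sub>M I (\<lambda>_. borel))" by (auto simp: space_PiM)
    have upd: "(\<lambda>i\<in>insert k I. (x(k := y)) i - b i) = ?z(k := y - b k)" for y
      using insert.hyps by (auto simp: fun_eq_iff)
    have "(\<lambda>y. F (?z(k := y))) \<in> borel_measurable borel"
      using measurable_compose[OF measurable_Pair1'[OF z] measurable_compose[OF up insert.prems]] by simp
    from nn_integral_std_normal_shift[OF this, of "b k"]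
    show "(\<integral>\<^sup>+y. F (\<lambda>i\<in>insert k I. (x(k := y)) i - b i) \<partial>std_normal) = F' ?z"
      unfolding upd F'_def e_def .
  qed
  also have "\<dots> = (\<integral>\<^sup>+x. F' x * eI x \<partial>(Pi\<^sub>M I (\<lambda>_. std_normal)))"
    unfolding eI_def by (rule insert.IH[OF F'm])
  also have "\<dots> = (\<integral>\<^sup>+x. (\<integral>\<^sup>+y. F (x(k := y)) * (e y * eI x) \<partial>std_normal) \<partial>(Pi\<^sub>M I (\<lambda>_. std_normal)))"
  proof (rule nn_integral_cong)
    fix x assume "x \<in> space (Pi\<^sub>M I (\<lambda>_. std_normal))"
    hence x: "x \<in> space (Pi\<^sub>M I (\<lambda>_. borel))" by (simp add: space_PiM)
    have [measurable]: "(\<lambda>y. F (x(k := y))) \<in> borel_measurable borel"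
      using measurable_compose[OF measurable_Pair1'[OF x] measurable_compose[OF up insert.prems]] by (simp add: fun_upd_def)
    show "F' x * eI x = (\<integral>\<^sup>+y. F (x(k := y)) * (e y * eI x) \<partial>std_normal)"
      unfolding F'_def by (subst nn_integral_multc[symmetric]) (auto simp: ac_simps)
  qed
  also have "\<dots> = (\<integral>\<^sup>+x. (\<integral>\<^sup>+y. F (x(k := y)) * ennreal (exp (- (\<Sum>i\<in>insert k I. b i * (x(k := y)) i) - (\<Sum>i\<in>insert k I. (b i)^2) / 2)) \<partial>std_normal) \<partial>(Pi\<^sub>M I (\<lambda>_. std_normal)))"
  proof (intro nn_integral_cong arg_cong2[where f="(*)"] refl)
    fix x y
    have s: "(\<Sum>i\<in>I. b i * (if i = k then y else x i)) = (\<Sum>i\<in>I. b i * x i)"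
      by (rule sum.cong) (use insert.hyps in auto)
    show "e y * eI x = ennreal (exp (- (\<Sum>i\<in>insert k I. b i * (x(k := y)) i) - (\<Sum>i\<in>insert k I. (b i)^2) / 2))"
      unfolding e_def eI_def using insert.hyps
      by (simp add: s ennreal_mult[symmetric] add_divide_distrib algebra_simps flip: exp_add)
  qed
  also have "\<dots> = (\<integral>\<^sup>+g. F g * ennreal (exp (- (\<Sum>i\<in>insert k I. b i * g i) - (\<Sum>i\<in>insert k I. (b i)^2) / 2)) \<partial>(Pi\<^sub>M (insert k I) (\<lambda>_. std_normal)))"
    by (rule PG.product_nn_integral_insert[symmetric]) (use insert.hyps in \<open>auto simp: measurable_cong_sets[OF sb refl]\<close>)
  finally show ?case .
qed

text \<open>Cut the event by the index \<open>j\<close> that attains the maximum. Translating the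
  Gaussian vector along the unit vector \<open>a j\<close> raises \<open>u j\<close> by the full
  step and no other \<open>u k\<close> by more, so \<open>j\<close> still attains the maximum and
  the piece lands in a higher slab. By the shift formula it keeps at least the fraction
  \<open>exp (- 2)\<close> of its mass for about \<open>1 / (\<eta> * (T + \<eta> + 1))\<close>
  disjoint translates, whose total mass is at most 1. Neither \<open>card J\<close> nor the
  correlations enter.\<close>

lemma gaussian_max_anticoncentration:
  fixes a :: "nat \<Rightarrow> nat \<Rightarrow> real"
  assumes J: "finite J" and unit: "\<And>j. j \<in> J \<Longrightarrow> (\<Sum>i<n. (a j i)^2) = 1"
    and T: "\<And>j. j \<in> J \<Longrightarrow> \<bar>\<tau> j\<bar> \<le> T" "0 \<le> T" and \<eta>: "0 < \<eta>"
  shows "measure (Pi\<^sub>M {..<n} (\<lambda>_. std_normal)) {g \<in> space (Pi\<^sub>M {..<n} (\<lambda>_. std_normal)).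
     (\<exists>j\<in>J. 0 < (\<Sum>i<n. a j i * g i) - \<tau> j) \<and> (\<forall>j\<in>J. (\<Sum>i<n. a j i * g i) - \<tau> j \<le> \<eta>)} \<le> exp 2 * (\<eta> * (T + \<eta> + 1))"
proof -
  let ?P = "Pi\<^sub>M {..<n} (\<lambda>_. std_normal)"
  interpret prob_space ?P by (rule prob_space_PiM) (rule prob_space_std_normal)
  have sb: "sets ?P = sets (Pi\<^sub>M {..<n} (\<lambda>_. borel))" by (intro sets_PiM_cong) auto
  note sb[measurable_cong] note [measurable] = J
  define u where "u = (\<lambda>j g. (\<Sum>i<n. a j i * g i) - \<tau> j)"
  have [measurable]: "u j \<in> borel_measurable (Pi\<^sub>M {..<n} (\<lambda>_. borel))" for j unfolding u_def by measurable
  \<comment> \<open>\<open>B (m, j)\<close>: the maximum lies in the slab number \<open>m\<close>,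
    and \<open>j\<close> is the smallest index attaining it. Breaking ties this way makes the sets
    disjoint.\<close>
  define B where "B = (\<lambda>(m::nat, j). {g \<in> space ?P. real m * \<eta> < u j g \<and> u j g \<le> (real m + 1) * \<eta> \<and>
     (\<forall>k\<in>J. u k g \<le> u j g) \<and> (\<forall>k\<in>J. k < j \<longrightarrow> u k g < u j g)})"
  have um: "u j \<in> borel_measurable ?P" for j by measurable
  have B[measurable]: "B p \<in> sets ?P" for p
  proof -
    have *: "Measurable.pred ?P (\<lambda>g. u k g \<le> u j g)" "Measurable.pred ?P (\<lambda>g. k < j \<longrightarrow> u k g < u j g)" for k j
      subgoal unfolding pred_def by (rule borel_measurable_le[OF um um])
      subgoal by (intro pred_intros_logic) (auto simp: pred_def intro: borel_measurable_less[OF um um])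
      done
    have "Measurable.pred ?P (\<lambda>g. real m * \<eta> < u j g \<and> u j g \<le> (real m + 1) * \<eta> \<and>
     (\<forall>k\<in>J. u k g \<le> u j g) \<and> (\<forall>k\<in>J. k < j \<longrightarrow> u k g < u j g))" for m j
      by (intro pred_intros_logic pred_intros_finite J *) (use um[of j] in measurable)
    thus ?thesis unfolding B_def split_def pred_def by (simp add: Collect_conj_eq)
  qed
  have disj: "disjoint_family_on B ((UNIV :: nat set) \<times> J)"
    unfolding disjoint_family_on_def
  proof (intro ballI impI)
    fix p p' :: "nat \<times> nat" assume p: "p \<in> UNIV \<times> J" "p' \<in> UNIV \<times> J" "p \<noteq> p'"
    obtain m j m' j' where pp: "p = (m, j)" "p' = (m', j')" by (cases p, cases p') auto
    hence j: "j \<in> J" "j' \<in> J" and ne: "(m, j) \<noteq> (m', j')" using p by auto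
    have "B (m, j) \<inter> B (m', j') = {}"
    proof (rule ccontr)
      assume "B (m, j) \<inter> B (m', j') \<noteq> {}"
      then obtain g where g: "g \<in> B (m, j)" "g \<in> B (m', j')" by blast
      have jj: "j = j'" using g j unfolding B_def by simp (metis linorder_neqE_nat order.strict_iff_not)
      have r: "real m * \<eta> < (real m' + 1) * \<eta>" "real m' * \<eta> < (real m + 1) * \<eta>"
        using g jj unfolding B_def by auto
      hence "real m < real m' + 1" "real m' < real m + 1" using \<eta> by (auto simp only: mult_less_cancel_right_pos)
      hence "m = m'" by linarith
      with jj ne show False by simp
    qed
    thus "B p \<inter> B p' = {}" by (simp add: pp)
  qed
  define q where "q = \<eta> * (T + \<eta> + 1)"
  have q: "0 < q" unfolding q_def using \<eta> T by (intro mult_pos_pos) auto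
  \<comment> \<open>For \<open>m \<le> N\<close> the shift \<open>m * \<eta>\<close> is short enough
    that the exponent in the density factor stays above -2 on \<open>B (0, j)\<close>.\<close>
  define N where "N = nat \<lfloor>1 / q\<rfloor>"
  have N1: "1 / q \<le> real (Suc N)" unfolding N_def using q by (simp add: of_nat_nat) linarith
  have N2: "real m * q \<le> 1" if "m \<le> N" for m
  proof -
    have "real m \<le> real N" using that by simp
    also have "real N \<le> 1 / q" unfolding N_def using q by (simp add: of_nat_nat)
    finally show ?thesis using q by (simp add: field_simps)
  qed
  have shift: "prob (B (0, j)) * exp (- 2) \<le> prob (B (m, j))" if j: "j \<in> J" and m: "m \<le> N" for j m
  proof -
    define b where "b = (\<lambda>i. real m * \<eta> * a j i)"
    \<comment> \<open>The inner product of two unit vectors is at most 1; this is why the shift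
      along \<open>a j\<close> favours \<open>j\<close> over every other index.\<close>
    have ip: "(\<Sum>i<n. a k i * a j i) \<le> 1" if k: "k \<in> J" for k
    proof -
      have "0 \<le> (\<Sum>i<n. (a k i - a j i)^2)" by (intro sum_nonneg) auto
      also have "\<dots> = (\<Sum>i<n. (a k i)^2) + (\<Sum>i<n. (a j i)^2) - 2 * (\<Sum>i<n. a k i * a j i)"
        by (simp add: power2_diff sum.distrib sum_subtractf sum_distrib_left algebra_simps)
      finally show ?thesis using unit[OF k] unit[OF j] by simp
    qed
    have me: "0 \<le> real m * \<eta>" using \<eta> by simp
    have s: "real m * \<eta> * (T + \<eta> + 1) \<le> 1" using N2[OF m] by (simp add: q_def ac_simps)
    have me1: "real m * \<eta> \<le> 1"
    proof -
      have "real m * \<eta> * 1 \<le> real m * \<eta> * (T + \<eta> + 1)" using me \<eta> T by (intro mult_left_mono) auto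
      thus ?thesis using s by simp
    qed
    have me2: "real m * \<eta> * (T + \<eta>) \<le> 1" using s me by (simp add: algebra_simps)
    have ub: "u k g = u k (\<lambda>i\<in>{..<n}. g i - b i) + real m * \<eta> * (\<Sum>i<n. a k i * a j i)" for k g
      unfolding u_def b_def by (simp add: algebra_simps sum_subtractf sum_distrib_left)
    have sub: "indicator (B (0, j)) (\<lambda>i\<in>{..<n}. g i - b i) \<le> (indicator (B (m, j)) g :: ennreal)" if g: "g \<in> space ?P" for g
    proof (cases "(\<lambda>i\<in>{..<n}. g i - b i) \<in> B (0, j)")
      case True
      let ?g = "\<lambda>i\<in>{..<n}. g i - b i"
      have h: "0 < u j ?g" "u j ?g \<le> \<eta>" "\<And>k. k \<in> J \<Longrightarrow> u k ?g \<le> u j ?g" "\<And>k. k \<in> J \<Longrightarrow> k < j \<Longrightarrow> u k ?g < u j ?g"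
        using True unfolding B_def by auto
      have uj: "u j g = u j ?g + real m * \<eta>" using ub[of j g] unit[OF j] by (simp add: power2_eq_square)
      have uk: "u k g \<le> u k ?g + real m * \<eta>" if "k \<in> J" for k
        using ub[of k g] mult_left_mono[OF ip[OF that] me] by simp
      have "g \<in> B (m, j)" unfolding B_def using g uj h uk by (auto simp: algebra_simps) (smt (verit))+
      thus ?thesis by (simp add: indicator_def)
    qed (simp add: indicator_def)
    have "ennreal (prob (B (0, j)) * exp (- 2)) = (\<integral>\<^sup>+g. indicator (B (0, j)) g * ennreal (exp (- 2)) \<partial>?P)"
      by (simp add: nn_integral_multc emeasure_eq_measure ennreal_mult)
    also have "\<dots> \<le> (\<integral>\<^sup>+g. indicator (B (0, j)) g * ennreal (exp (- (\<Sum>i<n. b i * g i) - (\<Sum>i<n. (b i)^2) / 2)) \<partial>?P)"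
    proof (rule nn_integral_mono)
      fix g assume "g \<in> space ?P"
      show "indicator (B (0, j)) g * ennreal (exp (- 2)) \<le> indicator (B (0, j)) g * ennreal (exp (- (\<Sum>i<n. b i * g i) - (\<Sum>i<n. (b i)^2) / 2))"
      proof (cases "g \<in> B (0, j)")
        case True
        hence uj: "u j g \<le> \<eta>" unfolding B_def by auto
        have "(\<Sum>i<n. b i * g i) = real m * \<eta> * (u j g + \<tau> j)"
          unfolding b_def u_def by (simp add: sum_distrib_left ac_simps)
        also have "\<dots> \<le> real m * \<eta> * (T + \<eta>)" using uj T(1)[OF j] me by (intro mult_left_mono) auto
        finally have 1: "(\<Sum>i<n. b i * g i) \<le> 1" using me2 by linarith
        have "(\<Sum>i<n. (b i)^2) = (real m * \<eta>)^2"
          unfolding b_def using unit[OF j] by (simp add: power_mult_distrib sum_distrib_left[symmetric])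
        also have "\<dots> \<le> 1" using me me1 by (simp add: power_le_one)
        finally have "- 2 \<le> - (\<Sum>i<n. b i * g i) - (\<Sum>i<n. (b i)^2) / 2" using 1 by simp
        thus ?thesis by (intro mult_left_mono ennreal_leI) auto
      qed simp
    qed
    also have "\<dots> = (\<integral>\<^sup>+g. indicator (B (0, j)) (\<lambda>i\<in>{..<n}. g i - b i) \<partial>?P)"
      by (rule cameron_martin[symmetric]) (use B[of "(0, j)"] in auto)
    also have "\<dots> \<le> (\<integral>\<^sup>+g. indicator (B (m, j)) g \<partial>?P)" by (rule nn_integral_mono) (rule sub)
    also have "\<dots> = ennreal (prob (B (m, j)))" by (simp add: emeasure_eq_measure)
    finally show ?thesis by (simp add: ennreal_le_iff)
  qed
  let ?E = "{g \<in> space ?P. (\<exists>j\<in>J. 0 < u j g) \<and> (\<forall>j\<in>J. u j g \<le> \<eta>)}"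
  have "?E \<subseteq> (\<Union>j\<in>J. B (0, j))"
  proof
    fix g assume g: "g \<in> ?E"
    have J0: "J \<noteq> {}" using g by auto
    define mx where "mx = Max ((\<lambda>j. u j g) ` J)"
    have mx: "u k g \<le> mx" if "k \<in> J" for k unfolding mx_def using that J by simp
    have "mx \<in> (\<lambda>j. u j g) ` J" unfolding mx_def using J J0 by (intro Max_in) auto
    hence ex: "\<exists>j. j \<in> J \<and> u j g = mx" by auto
    define j where "j = (LEAST j. j \<in> J \<and> u j g = mx)"
    have j: "j \<in> J" "u j g = mx" using LeastI_ex[OF ex] unfolding j_def by auto
    have l: "u k g < u j g" if "k \<in> J" "k < j" for k
      using not_less_Least[of k "\<lambda>j. j \<in> J \<and> u j g = mx"] that mx[OF that(1)] j(2) unfolding j_def[symmetric] by force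
    have "0 < mx" using g mx by force
    hence "g \<in> B (0, j)" unfolding B_def using g j l mx by auto
    thus "g \<in> (\<Union>j\<in>J. B (0, j))" using j by blast
  qed
  hence "prob ?E \<le> prob (\<Union>j\<in>J. B (0, j))" by (rule finite_measure_mono) measurable
  also have "\<dots> \<le> (\<Sum>j\<in>J. prob (B (0, j)))" by (rule finite_measure_subadditive_finite) (use J in auto)
  finally have E: "prob ?E \<le> (\<Sum>j\<in>J. prob (B (0, j)))" .
  have "real (Suc N) * ((\<Sum>j\<in>J. prob (B (0, j))) * exp (- 2)) = (\<Sum>m\<le>N. \<Sum>j\<in>J. prob (B (0, j)) * exp (- 2))"
    by (simp add: sum_distrib_right)
  also have "\<dots> \<le> (\<Sum>m\<le>N. \<Sum>j\<in>J. prob (B (m, j)))" by (intro sum_mono shift) auto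
  also have "\<dots> = (\<Sum>p\<in>{..N} \<times> J. prob (B p))" by (simp add: sum.cartesian_product)
  also have "\<dots> = prob (\<Union>p\<in>{..N} \<times> J. B p)"
  proof (rule finite_measure_finite_Union[symmetric])
    show "disjoint_family_on B ({..N} \<times> J)" by (rule disjoint_family_on_mono[OF _ disj]) auto
  qed (use J in auto)
  also have "\<dots> \<le> 1" by simp
  finally have "real (Suc N) * ((\<Sum>j\<in>J. prob (B (0, j))) * exp (- 2)) \<le> 1" .
  moreover have "1 / q * ((\<Sum>j\<in>J. prob (B (0, j))) * exp (- 2)) \<le> real (Suc N) * ((\<Sum>j\<in>J. prob (B (0, j))) * exp (- 2))"
    by (rule mult_right_mono[OF N1]) (auto intro!: mult_nonneg_nonneg sum_nonneg)
  ultimately have "1 / q * ((\<Sum>j\<in>J. prob (B (0, j))) * exp (- 2)) \<le> 1" by linarith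
  hence "(\<Sum>j\<in>J. prob (B (0, j))) \<le> exp 2 * q" using q by (simp add: exp_minus field_simps)
  with E have "prob ?E \<le> exp 2 * q" by linarith
  thus ?thesis unfolding u_def q_def .
qed

section \<open>Gaussian multipliers\<close>

lemma integrable_product_pair:
  fixes f :: "'a \<Rightarrow> real" and h :: "'b \<Rightarrow> real"
  assumes A: "prob_space A" and B: "prob_space B" and f: "integrable A f" and h: "integrable B h"
  shows "integrable (A \<Otimes>\<^sub>M B) (\<lambda>p. f (fst p) * h (snd p))"
    and "(\<integral>p. f (fst p) * h (snd p) \<partial>(A \<Otimes>\<^sub>M B)) = (\<integral>x. f x \<partial>A) * (\<integral>y. h y \<partial>B)"
proof -
  interpret A: prob_space A by (rule A)
  interpret B: prob_space B by (rule B)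
  interpret AB: pair_prob_space A B ..
  have [measurable]: "f \<in> borel_measurable A" "h \<in> borel_measurable B" using f h by auto
  show i: "integrable (A \<Otimes>\<^sub>M B) (\<lambda>p. f (fst p) * h (snd p))"
    by (rule AB.Fubini_integrable) (use f h in \<open>auto simp: abs_mult\<close>)
  show "(\<integral>p. f (fst p) * h (snd p) \<partial>(A \<Otimes>\<^sub>M B)) = (\<integral>x. f x \<partial>A) * (\<integral>y. h y \<partial>B)"
    by (subst AB.integral_fst'[OF i, symmetric]) simp
qed

lemma std_normal_moments:
  "integrable std_normal (\<lambda>x. x ^ k)" "(\<integral>x. x \<partial>std_normal) = 0" "(\<integral>x. x^2 \<partial>std_normal) = 1"
  "(\<integral>x. x^3 \<partial>std_normal) = 0" "(\<integral>x. x^4 \<partial>std_normal) = 3"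
proof -
  show "integrable std_normal (\<lambda>x. x ^ k)" by (rule integrable_std_normal_distribution_moment)
  show "(\<integral>x. x \<partial>std_normal) = 0" "(\<integral>x. x^2 \<partial>std_normal) = 1" "(\<integral>x. x^3 \<partial>std_normal) = 0" "(\<integral>x. x^4 \<partial>std_normal) = 3"
    using integral_std_normal_moment_odd[of 0] integral_std_normal_moment_even[of 1]
      integral_std_normal_moment_odd[of 1] integral_std_normal_moment_even[of 2]
    by (simp_all add: integral_density numeral_eq_Suc fact_numeral mult.commute)
qed

text \<open>
  The multiplier \<open>xi + g / sqrt 2\<close>, with \<open>g\<close> standard normal, has mean 0, variance 1 and third moment 1, so
  multiplying a centred vector by it changes none of its first three moments.
\<close>

definition xi :: "nat \<Rightarrow> real" where
  "xi k = (if k = 0 then 3 else if k < 4 then - 1 else 0)"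

text \<open>Together with \<open>xi\<close> this yields the values 3, -1 and 0 with weights 1/24,
  3/24 and 20/24. The variance is 1/2, leaving 1/2 to the Gaussian part, and the third moment is
  \<open>(27 - 3) / 24 = 1\<close>.\<close>

definition xi_pmf :: "nat pmf" where
  "xi_pmf = pmf_of_set {..<24}"

lemma xi_abs: "\<bar>xi k\<bar> \<le> 3" by (simp add: xi_def)

lemma xi_moments:
  "integrable (measure_pmf xi_pmf) (\<lambda>k. xi k ^ m)"
  "(\<integral>k. xi k \<partial>xi_pmf) = 0" "(\<integral>k. xi k ^ 2 \<partial>xi_pmf) = 1/2"
  "(\<integral>k. xi k ^ 3 \<partial>xi_pmf) = 1" "(\<integral>k. xi k ^ 4 \<partial>xi_pmf) = 7/2"
proof -
  have ne: "{..<24::nat} \<noteq> {}" "finite {..<24::nat}" by (auto simp: lessThan_empty_iff)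
  show "integrable (measure_pmf xi_pmf) (\<lambda>k. xi k ^ m)"
    by (rule integrable_measure_pmf_finite) (simp add: xi_pmf_def set_pmf_of_set[OF ne])
  have e: "(\<integral>k. f k \<partial>xi_pmf) = (\<Sum>k<24. f k) / 24" for f :: "nat \<Rightarrow> real"
    unfolding xi_pmf_def by (subst integral_pmf_of_set[OF ne]) simp
  show "(\<integral>k. xi k \<partial>xi_pmf) = 0" "(\<integral>k. xi k ^ 2 \<partial>xi_pmf) = 1/2"
    "(\<integral>k. xi k ^ 3 \<partial>xi_pmf) = 1" "(\<integral>k. xi k ^ 4 \<partial>xi_pmf) = 7/2"
    unfolding e by (simp_all add: xi_def lessThan_nat_numeral)
qed

locale centred_bounded_vector = prob_space N for N :: "'a measure" +
  fixes X :: "'a \<Rightarrow> nat \<Rightarrow> real" and J :: "nat set" and b :: real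
  assumes X_measurable: "X \<in> N \<rightarrow>\<^sub>M RV" and finite_J: "finite J"
    and bound: "\<And>a j. j \<in> J \<Longrightarrow> \<bar>X a j\<bar> \<le> b" and b_nonneg: "0 \<le> b"
    and centred: "\<And>j. j \<in> J \<Longrightarrow> (\<integral>a. X a j \<partial>N) = 0"
begin

text \<open>The multiplied vector is split into an offset \<open>v\<close> and a Gaussian variable
  times a direction \<open>u\<close>; given the component in \<open>R\<close>, it is
  Gaussian.\<close>

abbreviation "R \<equiv> measure_pmf xi_pmf \<Otimes>\<^sub>M N"
abbreviation "v \<equiv> \<lambda>(k, a) j. xi k * X a j"
abbreviation "u \<equiv> \<lambda>(k::nat, a) j. X a j / sqrt 2"
abbreviation "N' \<equiv> R \<Otimes>\<^sub>M std_normal"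
abbreviation "X' \<equiv> \<lambda>(x, g) j. v x j + g * u x j"

lemma coordinate_measurable [measurable]: "(\<lambda>a. X a j) \<in> borel_measurable N"
  by (rule RV_component[OF X_measurable])

lemma prob_space_R: "prob_space R" and prob_space_N': "prob_space N'"
proof -
  interpret pair_prob_space "measure_pmf xi_pmf" N by unfold_locales
  show R: "prob_space R" by (rule prob_space_axioms)
  interpret R: prob_space R by (rule R)
  interpret G: prob_space std_normal by (rule prob_space_std_normal)
  interpret P: pair_prob_space R std_normal by unfold_locales
  show "prob_space N'" by (rule P.prob_space_axioms)
qed

lemma uv_measurable: "u \<in> R \<rightarrow>\<^sub>M RV" "v \<in> R \<rightarrow>\<^sub>M RV" and X'_measurable: "X' \<in> N' \<rightarrow>\<^sub>M RV"
proof -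
  have [measurable]: "xi \<in> borel_measurable (measure_pmf xi_pmf)" by simp
  show u: "u \<in> R \<rightarrow>\<^sub>M RV" unfolding split_def by measurable
  show v: "v \<in> R \<rightarrow>\<^sub>M RV" unfolding split_def by measurable
  have [measurable]: "(\<lambda>x. u x j) \<in> borel_measurable R" "(\<lambda>x. v x j) \<in> borel_measurable R" for j
    by (rule RV_component, fact)+
  have "(\<lambda>p j. v (fst p) j + snd p * u (fst p) j) \<in> N' \<rightarrow>\<^sub>M RV" by measurable
  thus "X' \<in> N' \<rightarrow>\<^sub>M RV" by (simp add: split_def)
qed

abbreviation "e \<equiv> \<lambda>(x :: nat \<times> 'a, g). xi (fst x) + g / sqrt 2"

lemma multiplier_product:
  assumes \<phi>: "integrable N \<phi>"
  shows "integrable N' (\<lambda>p. xi (fst (fst p)) ^ i * \<phi> (snd (fst p)) * (snd p) ^ l)"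
    and "(\<integral>p. xi (fst (fst p)) ^ i * \<phi> (snd (fst p)) * (snd p) ^ l \<partial>N') =
      (\<integral>k. xi k ^ i \<partial>xi_pmf) * (\<integral>a. \<phi> a \<partial>N) * (\<integral>g. g ^ l \<partial>std_normal)"
proof -
  note 1 = integrable_product_pair[OF measure_pmf.prob_space_axioms prob_space_axioms xi_moments(1) \<phi>, of i]
  note 2 = integrable_product_pair[OF prob_space_R prob_space_std_normal 1(1) std_normal_moments(1), of l]
  show "integrable N' (\<lambda>p. xi (fst (fst p)) ^ i * \<phi> (snd (fst p)) * (snd p) ^ l)" by (rule 2(1))
  show "(\<integral>p. xi (fst (fst p)) ^ i * \<phi> (snd (fst p)) * (snd p) ^ l \<partial>N') =
      (\<integral>k. xi k ^ i \<partial>xi_pmf) * (\<integral>a. \<phi> a \<partial>N) * (\<integral>g. g ^ l \<partial>std_normal)"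
    unfolding 2(2) 1(2) ..
qed

text \<open>Each power of the multiplier is expanded and every monomial factorises by independence.
  Odd Gaussian moments vanish, and the fourth moment is
  \<open>7/2 + 6 * (1/2) * (1/2) + 3/4 = 23/4\<close>.\<close>

lemma multiplier_moments:
  assumes \<phi>: "integrable N \<phi>"
  shows "(\<integral>p. e p * \<phi> (snd (fst p)) \<partial>N') = 0"
    and "(\<integral>p. e p ^ 2 * \<phi> (snd (fst p)) \<partial>N') = (\<integral>a. \<phi> a \<partial>N)"
    and "(\<integral>p. e p ^ 3 * \<phi> (snd (fst p)) \<partial>N') = (\<integral>a. \<phi> a \<partial>N)"
    and "integrable N' (\<lambda>p. e p ^ 4 * \<phi> (snd (fst p)))"
    and "(\<integral>p. e p ^ 4 * \<phi> (snd (fst p)) \<partial>N') = 23/4 * (\<integral>a. \<phi> a \<partial>N)"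
proof -
  define t where "t = (\<lambda>i l (p :: (nat \<times> 'a) \<times> real). xi (fst (fst p)) ^ i * \<phi> (snd (fst p)) * (snd p) ^ l)"
  have it[simp]: "integrable N' (t i l)" for i l unfolding t_def by (rule multiplier_product(1)[OF \<phi>])
  have I: "(\<integral>p. t i l p \<partial>N') = (\<integral>k. xi k ^ i \<partial>xi_pmf) * (\<integral>a. \<phi> a \<partial>N) * (\<integral>g. g ^ l \<partial>std_normal)" for i l
    unfolding t_def by (rule multiplier_product(2)[OF \<phi>])
  have one: "(\<integral>g. 1 \<partial>std_normal) = (1::real)" "(\<integral>k. 1 \<partial>xi_pmf) = (1::real)"
    using prob_space.prob_space[OF prob_space_std_normal] by simp_all
  have s2: "sqrt 2 * sqrt 2 = (2::real)" by simp
  have e1: "(\<lambda>p. e p * \<phi> (snd (fst p))) = (\<lambda>p. t 1 0 p + 1 / sqrt 2 * t 0 1 p)"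
    by (auto simp: t_def fun_eq_iff algebra_simps)
  have e2: "(\<lambda>p. e p ^ 2 * \<phi> (snd (fst p))) = (\<lambda>p. t 2 0 p + 2 / sqrt 2 * t 1 1 p + 1 / 2 * t 0 2 p)"
    by (auto simp: t_def fun_eq_iff field_simps power2_eq_square)
  have e3: "(\<lambda>p. e p ^ 3 * \<phi> (snd (fst p))) = (\<lambda>p. t 3 0 p + 3 / sqrt 2 * t 2 1 p + 3 / 2 * t 1 2 p + 1 / (2 * sqrt 2) * t 0 3 p)"
  proof
    fix p :: "(nat \<times> 'a) \<times> real"
    have *: "(x + g / sqrt 2) ^ 3 = x^3 + 3 / sqrt 2 * x^2 * g + 3 / 2 * x * g^2 + 1 / (2 * sqrt 2) * g^3" for x g :: real
    proof -
      define q where "q = 1 / sqrt (2::real)"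
      have q: "q * q = 1/2" by (simp add: q_def)
      have "(x + g * q) ^ 3 = x^3 + 3 * q * x^2 * g + 3 * (q * q) * x * g^2 + (q * q) * q * g^3"
        by (simp add: power3_eq_cube power2_eq_square algebra_simps)
      thus ?thesis unfolding q by (simp add: q_def)
    qed
    show "e p ^ 3 * \<phi> (snd (fst p)) = t 3 0 p + 3 / sqrt 2 * t 2 1 p + 3 / 2 * t 1 2 p + 1 / (2 * sqrt 2) * t 0 3 p"
      unfolding t_def split_def * by (simp add: algebra_simps)
  qed
  have e4: "(\<lambda>p. e p ^ 4 * \<phi> (snd (fst p))) = (\<lambda>p. t 4 0 p + 4 / sqrt 2 * t 3 1 p + 3 * t 2 2 p + 2 / sqrt 2 * t 1 3 p + 1 / 4 * t 0 4 p)"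
  proof
    fix p :: "(nat \<times> 'a) \<times> real"
    have *: "(x + g / sqrt 2) ^ 4 = x^4 + 4 / sqrt 2 * x^3 * g + 3 * x^2 * g^2 + 2 / sqrt 2 * x * g^3 + 1 / 4 * g^4" for x g :: real
    proof -
      define q where "q = 1 / sqrt (2::real)"
      have q: "q * q = 1/2" by (simp add: q_def)
      have "(x + g * q) ^ 4 = x^4 + 4 * q * x^3 * g + 6 * (q * q) * x^2 * g^2 + 4 * (q * q) * q * x * g^3 + (q * q) * (q * q) * g^4"
        by (simp add: power_numeral_reduce algebra_simps)
      thus ?thesis unfolding q by (simp add: q_def)
    qed
    show "e p ^ 4 * \<phi> (snd (fst p)) = t 4 0 p + 4 / sqrt 2 * t 3 1 p + 3 * t 2 2 p + 2 / sqrt 2 * t 1 3 p + 1 / 4 * t 0 4 p"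
      unfolding t_def split_def * by (simp add: algebra_simps)
  qed
  note II = I[of 1 0] I[of 0 1] I[of 2 0] I[of 1 1] I[of 0 2] I[of 3 0] I[of 2 1] I[of 1 2] I[of 0 3]
     I[of 4 0] I[of 3 1] I[of 2 2] I[of 1 3] I[of 0 4]
  note II' = II[unfolded power_0 power_one_right one xi_moments std_normal_moments]
  show "(\<integral>p. e p * \<phi> (snd (fst p)) \<partial>N') = 0" unfolding e1 by (simp add: II' II'[unfolded One_nat_def])
  show "(\<integral>p. e p ^ 2 * \<phi> (snd (fst p)) \<partial>N') = (\<integral>a. \<phi> a \<partial>N)" unfolding e2 by (simp add: II' II'[unfolded One_nat_def])
  show "(\<integral>p. e p ^ 3 * \<phi> (snd (fst p)) \<partial>N') = (\<integral>a. \<phi> a \<partial>N)" unfolding e3 by (simp add: II' II'[unfolded One_nat_def])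
  show "integrable N' (\<lambda>p. e p ^ 4 * \<phi> (snd (fst p)))" unfolding e4 by simp
  show "(\<integral>p. e p ^ 4 * \<phi> (snd (fst p)) \<partial>N') = 23/4 * (\<integral>a. \<phi> a \<partial>N)" unfolding e4 by (simp add: II' II'[unfolded One_nat_def])
qed

lemma dominated: "dominated_vector N X J (\<lambda>_. b) (b ^ 4)"
  by unfold_locales (auto simp: X_measurable finite_J bound b_nonneg prob_space)

lemma X'_eq: "X' p j = e p * X (snd (fst p)) j"
  by (simp add: split_def algebra_simps)

lemma dominated': "dominated_vector N' X' J (\<lambda>p. \<bar>e p\<bar> * b) (6 * b ^ 4)"
proof -
  have c: "(\<lambda>p. (\<bar>e p\<bar> * b) ^ 4) = (\<lambda>p. e p ^ 4 * b ^ 4)" by (simp add: power_mult_distrib power_even_abs)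
  have i: "integrable N (\<lambda>_. b ^ 4)" by simp
  interpret N': prob_space N' by (rule prob_space_N')
  show ?thesis
  proof
    show "AE a in N'. \<forall>j\<in>J. \<bar>X' a j\<bar> \<le> \<bar>e a\<bar> * b"
      unfolding X'_eq by (auto simp: abs_mult intro!: AE_I2 mult_left_mono bound)
    show "integrable N' (\<lambda>a. (\<bar>e a\<bar> * b) ^ 4)" unfolding c by (rule multiplier_moments(4)[OF i])
    show "(\<integral>a. (\<bar>e a\<bar> * b) ^ 4 \<partial>N') \<le> 6 * b ^ 4" unfolding c multiplier_moments(5)[OF i] by (simp add: prob_space)
  qed (use X'_measurable finite_J b_nonneg in auto)
qed

text \<open>All three moments agree, so only the two Taylor remainders survive:
  \<open>75/24 * (1 + 6) = 175/8\<close>, which is at most 22.\<close>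

lemma multiplier_cv_close:
  assumes "0 \<le> \<beta>" "0 \<le> c"
  shows "\<bar>cv c N X (gum J \<beta> t) w - cv c N' X' (gum J \<beta> t) w\<bar> \<le> 22 * (\<beta> * c)^4 * b^4"
proof -
  interpret D: dominated_vector N X J "\<lambda>_. b" "b ^ 4" by (rule dominated)
  have "\<bar>cv c N X (gum J \<beta> t) w - cv c N' X' (gum J \<beta> t) w\<bar> \<le>
     3/2 * (\<beta> * c)^2 * 0 + 13/6 * (\<beta> * c)^3 * 0 + 75/24 * (\<beta> * c)^4 * (b^4 + 6 * b^4)"
  proof (rule gum_moment_comparison[OF dominated dominated' assms])
    fix j assume j: "j \<in> J"
    show "(\<integral>a. X a j \<partial>N) = (\<integral>a. X' a j \<partial>N')"
      unfolding X'_eq multiplier_moments(1)[OF D.int1[OF j]] by (rule centred[OF j])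
    fix k assume k: "k \<in> J"
    have "(\<lambda>a. X' a j * X' a k) = (\<lambda>p. e p ^ 2 * (X (snd (fst p)) j * X (snd (fst p)) k))"
      by (simp only: X'_eq) (simp add: power2_eq_square ac_simps)
    thus "\<bar>(\<integral>a. X a j * X a k \<partial>N) - (\<integral>a. X' a j * X' a k \<partial>N')\<bar> \<le> 0"
      using multiplier_moments(2)[OF D.int2[OF j k]] by simp
    fix l assume l: "l \<in> J"
    have "(\<lambda>a. X' a j * X' a k * X' a l) = (\<lambda>p. e p ^ 3 * (X (snd (fst p)) j * X (snd (fst p)) k * X (snd (fst p)) l))"
      by (simp only: X'_eq) (simp add: power3_eq_cube ac_simps)
    thus "\<bar>(\<integral>a. X a j * X a k * X a l \<partial>N) - (\<integral>a. X' a j * X' a k * X' a l \<partial>N')\<bar> \<le> 0"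
      using multiplier_moments(3)[OF D.int3[OF j k l]] by simp
  qed auto
  also have "\<dots> = 175/8 * ((\<beta> * c)^4 * b^4)" by simp
  also have "\<dots> \<le> 22 * ((\<beta> * c)^4 * b^4)" by (intro mult_right_mono) (auto simp: zero_le_even_power')
  finally show ?thesis by simp
qed

end

section \<open>Tails of the conditional offset and the conditional scale of the multiplier
  sums\<close>

lemma indep_vars_PiM_coordinates:
  assumes R: "prob_space R" and n: "n \<ge> (1::nat)"
  shows "prob_space.indep_vars (Pi\<^sub>M {..<n} (\<lambda>_. R)) (\<lambda>_. R) (\<lambda>i x. x i) {..<n}"
proof -
  interpret P: prob_space "Pi\<^sub>M {..<n} (\<lambda>_. R)" by (rule prob_space_PiM) (rule R)
  have "distr (Pi\<^sub>M {..<n} (\<lambda>_. R)) (Pi\<^sub>M {..<n} (\<lambda>_. R)) (\<lambda>x. \<lambda>i\<in>{..<n}. x i) =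
     distr (Pi\<^sub>M {..<n} (\<lambda>_. R)) (Pi\<^sub>M {..<n} (\<lambda>_. R)) (\<lambda>x. x)"
    by (rule distr_cong) (auto simp: space_PiM PiE_def extensional_restrict)
  also have "\<dots> = Pi\<^sub>M {..<n} (\<lambda>_. R)" by (rule distr_id2) simp
  also have "\<dots> = Pi\<^sub>M {..<n} (\<lambda>i. distr (Pi\<^sub>M {..<n} (\<lambda>_. R)) R (\<lambda>x. x i))"
    by (rule PiM_cong) (auto simp: distr_PiM_component[OF R])
  finally show ?thesis
    using n by (subst P.indep_vars_iff_distr_eq_PiM') (auto simp: lessThan_empty_iff)
qed

lemma iid_upper_tail:
  fixes f :: "'a \<Rightarrow> real"
  assumes M: "prob_space M" and ind: "prob_space.indep_vars M (\<lambda>_. S) Y {..<n}" and n: "n \<ge> 1"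
    and law: "\<And>i. i < n \<Longrightarrow> distr M S (Y i) = P" and f: "f \<in> borel_measurable P" and sP: "sets P = sets S"
    and b: "AE a in P. \<bar>f a\<bar> \<le> b" and mean: "(\<integral>a. f a \<partial>P) = 0" and var: "(\<integral>a. (f a)^2 \<partial>P) \<le> v"
    and l: "0 < l" "l * b \<le> sqrt (real n)"
  shows "measure M {\<omega> \<in> space M. x \<le> (\<Sum>i<n. f (Y i \<omega>)) / sqrt (real n)} \<le> exp (l^2 * v - l * x)"
proof -
  interpret M: prob_space M by (rule M)
  have rv: "Y i \<in> M \<rightarrow>\<^sub>M S" if "i < n" for i using ind that unfolding M.indep_vars_def by auto
  have fS: "f \<in> borel_measurable S" using f measurable_cong_sets[OF sP refl] by blast
  have law': "P = distr M S (Y i)" if "i < n" for i using law[OF that] by simp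
  show ?thesis
  proof (rule M.sum_upper_tail[OF _ n _ _ _ l])
    show "M.indep_vars (\<lambda>_. borel) (\<lambda>i \<omega>. f (Y i \<omega>)) {..<n}"
      by (rule M.indep_vars_compose2[OF ind]) (use fS in auto)
    fix i assume i: "i < n"
    show "AE \<omega> in M. \<bar>f (Y i \<omega>)\<bar> \<le> b" using b unfolding law'[OF i] by (rule AE_distrD[OF rv[OF i]])
    show "M.expectation (\<lambda>\<omega>. f (Y i \<omega>)) = 0" using mean unfolding law'[OF i] by (subst (asm) integral_distr[OF rv[OF i] fS])
    have "(\<lambda>a. (f a)^2) \<in> borel_measurable S" using fS by simp
    from integral_distr[OF rv[OF i] this] show "M.expectation (\<lambda>\<omega>. (f (Y i \<omega>))^2) \<le> v"
      using var unfolding law'[OF i] by simp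
  qed
qed

context centred_bounded_vector
begin

abbreviation "QR n \<equiv> Pi\<^sub>M {..<n} (\<lambda>_. R)"
abbreviation "QG n \<equiv> Pi\<^sub>M {..<n} (\<lambda>_::nat. std_normal)"

definition W :: "nat \<Rightarrow> (nat \<Rightarrow> nat \<times> 'a) \<times> (nat \<Rightarrow> real) \<Rightarrow> nat \<Rightarrow> real" where
  "W n = (\<lambda>(x, g) j. 1 / sqrt (real n) * (\<Sum>i<n. v (x i) j + g i * u (x i) j))"

lemma prob_space_QR: "prob_space (QR n)" and prob_space_QG: "prob_space (QG n)"
  by (rule prob_space_PiM, rule prob_space_R) (rule prob_space_PiM, rule prob_space_std_normal)

lemma prob_space_Q: "prob_space (QR n \<Otimes>\<^sub>M QG n)"
proof -
  interpret R: prob_space "QR n" by (rule prob_space_QR)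
  interpret G: prob_space "QG n" by (rule prob_space_QG)
  interpret P: pair_prob_space "QR n" "QG n" by unfold_locales
  show ?thesis by (rule P.prob_space_axioms)
qed

lemma uv_component_measurable [measurable]:
  "(\<lambda>x. u x j) \<in> borel_measurable R" "(\<lambda>x. v x j) \<in> borel_measurable R"
  using uv_measurable by (auto intro: RV_component)

lemma W_measurable: "W n \<in> (QR n \<Otimes>\<^sub>M QG n) \<rightarrow>\<^sub>M RV"
proof -
  have "(\<lambda>p j. 1 / sqrt (real n) * (\<Sum>i<n. v (fst p i) j + snd p i * u (fst p i) j)) \<in> (QR n \<Otimes>\<^sub>M QG n) \<rightarrow>\<^sub>M RV"
    by measurable
  thus ?thesis by (simp add: W_def split_def)
qed

lemma integral_gum_W:
  "(\<integral>p. gum J \<beta> t (W n p) \<partial>(QR n \<Otimes>\<^sub>M QG n)) = (cv (1 / sqrt (real n)) N' X' ^^ n) (gum J \<beta> t) (\<lambda>_. 0)"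
proof -
  interpret R: prob_space "QR n" by (rule prob_space_QR)
  interpret G: prob_space "QG n" by (rule prob_space_QG)
  interpret P: pair_prob_space "QR n" "QG n" by unfold_locales
  note [measurable] = W_measurable
  have "(\<lambda>p. gum J \<beta> t (W n p)) \<in> borel_measurable (QR n \<Otimes>\<^sub>M QG n)" by measurable
  from bounded_integrable[OF prob_space_Q this gum_abs]
  have "(\<integral>p. gum J \<beta> t (W n p) \<partial>(QR n \<Otimes>\<^sub>M QG n)) = (\<integral>x. \<integral>g. gum J \<beta> t (W n (x, g)) \<partial>QG n \<partial>QR n)"
    by (subst P.integral_fst'[symmetric]) auto
  also have "\<dots> = (cv (1 / sqrt (real n)) N' X' ^^ n) (gum J \<beta> t) (\<lambda>_. 0)"
    using multiplier_integral_eq_funpow_cv[where h="gum J \<beta> t" and w="\<lambda>_. 0" and c="1 / sqrt (real n)" and n=n and K=1,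
      OF prob_space_R prob_space_std_normal _ uv_measurable gum_measurable gum_abs]
    by (simp add: W_def)
  finally show ?thesis .
qed

lemma cdf_max_multiplier_close:
  assumes M: "prob_space M" and S: "S \<in> M \<rightarrow>\<^sub>M RV"
    and ES: "\<And>t. (\<integral>\<omega>. gum J \<beta> t (S \<omega>) \<partial>M) = (cv (1 / sqrt (real n)) N X ^^ n) (gum J \<beta> t) (\<lambda>_. 0)"
    and J: "real (card J) \<le> real n ^ 3" and n: "n \<ge> 1" and \<beta>: "\<beta> > 0"
  shows "cdf_max M S J t \<le> cdf_max (QR n \<Otimes>\<^sub>M QG n) (W n) J (t + 8 * ln (real n) / \<beta>) + 22 * \<beta>^4 * b^4 / real n + 2 / real n"
    and "cdf_max (QR n \<Otimes>\<^sub>M QG n) (W n) J t \<le> cdf_max M S J (t + 8 * ln (real n) / \<beta>) + 22 * \<beta>^4 * b^4 / real n + 2 / real n"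
proof -
  have eps: "\<bar>(\<integral>\<omega>. gum J \<beta> t (S \<omega>) \<partial>M) - (\<integral>p. gum J \<beta> t (W n p) \<partial>(QR n \<Otimes>\<^sub>M QG n))\<bar> \<le> 22 * \<beta>^4 * b^4 / real n" for t
  proof -
    have "\<bar>(cv (1 / sqrt (real n)) N X ^^ n) (gum J \<beta> t) (\<lambda>_. 0) - (cv (1 / sqrt (real n)) N' X' ^^ n) (gum J \<beta> t) (\<lambda>_. 0)\<bar>
      \<le> real n * (22 * (\<beta> * (1 / sqrt (real n)))^4 * b^4)"
      by (rule lindeberg_telescope[OF prob_space_axioms prob_space_N' X_measurable X'_measurable gum_measurable gum_abs])
         (rule multiplier_cv_close, use \<beta> in auto)
    also have "real n * (22 * (\<beta> * (1 / sqrt (real n)))^4 * b^4) = 22 * \<beta>^4 * b^4 / real n"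
    proof -
      have "(sqrt (real n))^4 = (real n)^2" by (simp add: power_mult[of "sqrt (real n)" 2 2, simplified])
      thus ?thesis using n by (simp add: power_mult_distrib power_divide field_simps power2_eq_square)
    qed
    finally show ?thesis unfolding ES integral_gum_W .
  qed
  note J' = finite_J J
  show "cdf_max M S J t \<le> cdf_max (QR n \<Otimes>\<^sub>M QG n) (W n) J (t + 8 * ln (real n) / \<beta>) + 22 * \<beta>^4 * b^4 / real n + 2 / real n"
    by (rule cdf_max_comparison[OF M prob_space_Q S W_measurable J' n \<beta> eps])
  show "cdf_max (QR n \<Otimes>\<^sub>M QG n) (W n) J t \<le> cdf_max M S J (t + 8 * ln (real n) / \<beta>) + 22 * \<beta>^4 * b^4 / real n + 2 / real n"
    by (rule cdf_max_comparison[OF prob_space_Q M W_measurable S J' n \<beta>]) (use eps in \<open>simp add: abs_minus_commute\<close>)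
qed

text \<open>The discrete part of the multiplier sum has centred summands bounded by
  \<open>3 * b\<close> with variance at most \<open>b^2 / 2\<close>; Chernoff's bound at
  \<open>l = 1\<close> applies to it and to its negative.\<close>

lemma offset_tail:
  assumes j: "j \<in> J" and n: "n \<ge> 1" "3 * b \<le> sqrt (real n)"
  shows "measure (QR n) {x \<in> space (QR n). L \<le> \<bar>(\<Sum>i<n. v (x i) j) / sqrt (real n)\<bar>} \<le> 2 * exp (b^2 - L)"
proof -
  interpret QR: prob_space "QR n" by (rule prob_space_QR)
  interpret D: dominated_vector N X J "\<lambda>_. b" "b ^ 4" by (rule dominated)
  note ind = indep_vars_PiM_coordinates[OF prob_space_R n(1)]
  have law: "distr (QR n) R (\<lambda>x. x i) = R" if "i < n" for i
    by (rule distr_PiM_component[OF prob_space_R]) (use that in auto)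
  have sq: "integrable N (\<lambda>a. (X a j)^2)" using D.int2[OF j j] by (simp add: power2_eq_square)
  have m: "(\<integral>x. v x j \<partial>R) = 0"
    using integrable_product_pair(2)[OF measure_pmf.prob_space_axioms prob_space_axioms xi_moments(1)[of 1] D.int1[OF j]]
    by (simp add: split_def xi_moments)
  have vv: "(\<integral>x. (v x j)^2 \<partial>R) \<le> b^2"
  proof -
    have "(\<integral>x. (v x j)^2 \<partial>R) = 1/2 * (\<integral>a. (X a j)^2 \<partial>N)"
      using integrable_product_pair(2)[OF measure_pmf.prob_space_axioms prob_space_axioms xi_moments(1)[of 2] sq]
      by (simp add: split_def xi_moments power_mult_distrib)
    also have "\<dots> \<le> 1/2 * b^2"
      using bound[OF j] by (intro mult_left_mono integral_le_const[OF sq]) (auto intro!: AE_I2 power2_le_iff_abs_le[THEN iffD2] b_nonneg)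
    finally show ?thesis using zero_le_power2[of b] by linarith
  qed
  have bb: "\<bar>v x j\<bar> \<le> 3 * b" for x
    using mult_mono[OF xi_abs[of "fst x"] bound[OF j, of "snd x"]] by (simp add: split_def abs_mult)
  have 1: "QR.prob {x \<in> space (QR n). L \<le> (\<Sum>i<n. v (x i) j) / sqrt (real n)} \<le> exp (1^2 * b^2 - 1 * L)"
    by (rule iid_upper_tail[OF prob_space_QR ind n(1) law _ refl AE_I2[OF bb] m vv]) (use n in auto)
  have 2: "QR.prob {x \<in> space (QR n). L \<le> (\<Sum>i<n. - v (x i) j) / sqrt (real n)} \<le> exp (1^2 * b^2 - 1 * L)"
    by (rule iid_upper_tail[OF prob_space_QR ind n(1) law, where b="3*b"]) (use n m vv bb in auto)
  have "QR.prob {x \<in> space (QR n). L \<le> \<bar>(\<Sum>i<n. v (x i) j) / sqrt (real n)\<bar>} \<le>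
     QR.prob ({x \<in> space (QR n). L \<le> (\<Sum>i<n. v (x i) j) / sqrt (real n)} \<union> {x \<in> space (QR n). L \<le> (\<Sum>i<n. - v (x i) j) / sqrt (real n)})"
    by (rule QR.finite_measure_mono) (auto simp: abs_if sum_negf split: if_splits)
  also have "\<dots> \<le> QR.prob {x \<in> space (QR n). L \<le> (\<Sum>i<n. v (x i) j) / sqrt (real n)} + QR.prob {x \<in> space (QR n). L \<le> (\<Sum>i<n. - v (x i) j) / sqrt (real n)}"
    by (rule measure_Un_le) measurable
  finally show ?thesis using 1 2 by simp
qed

text \<open>The conditional variance is half the average of the squares of \<open>X\<close>, hence
  at least \<open>\<rho>^2 / 2\<close> in mean. A fall to \<open>\<rho>^2 / 4\<close> means that
  this average of squares deviates by \<open>\<rho>^2 / 2\<close>, which explains the term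
  \<open>sqrt n * \<rho>^2 / 2\<close>.\<close>

lemma scale_tail:
  assumes j: "j \<in> J" and n: "n \<ge> 1" "b^2 \<le> sqrt (real n)" and \<rho>: "\<rho>^2 \<le> (\<integral>a. (X a j)^2 \<partial>N)"
  shows "measure (QR n) {x \<in> space (QR n). (\<Sum>i<n. (u (x i) j)^2) / real n \<le> (\<rho>/2)^2} \<le> exp (b^4 - sqrt (real n) * \<rho>^2 / 2)"
proof -
  interpret QR: prob_space "QR n" by (rule prob_space_QR)
  interpret R: prob_space R by (rule prob_space_R)
  interpret D: dominated_vector N X J "\<lambda>_. b" "b ^ 4" by (rule dominated)
  note ind = indep_vars_PiM_coordinates[OF prob_space_R n(1)]
  have law: "distr (QR n) R (\<lambda>x. x i) = R" if "i < n" for i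
    by (rule distr_PiM_component[OF prob_space_R]) (use that in auto)
  have sq: "integrable N (\<lambda>a. (X a j)^2)" using D.int2[OF j j] by (simp add: power2_eq_square)
  have b2: "(X a j)^2 \<le> b^2" for a using bound[OF j] b_nonneg by (intro power2_le_iff_abs_le[THEN iffD2]) auto
  define s where "s = (\<integral>a. (X a j)^2 \<partial>N)"
  have s: "0 \<le> s" "s \<le> b^2" unfolding s_def using b2 by (auto intro!: integral_le_const[OF sq])
  define f where "f = (\<lambda>x :: nat \<times> 'a. s - (X (snd x) j)^2)"
  have fm: "f \<in> borel_measurable R" unfolding f_def by measurable
  have fb: "\<bar>f x\<bar> \<le> b^2" for x using s b2[of "snd x"] zero_le_power2[of "X (snd x) j"] unfolding f_def by linarith
  have mf: "(\<integral>x. f x \<partial>R) = 0"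
  proof -
    have sR: "integrable R (\<lambda>x. (X (snd x) j)^2)" "(\<integral>x. (X (snd x) j)^2 \<partial>R) = s"
      using integrable_product_pair[OF measure_pmf.prob_space_axioms prob_space_axioms xi_moments(1)[of 0] sq]
      by (simp_all add: s_def)
    show ?thesis unfolding f_def using sR by (simp add: R.prob_space)
  qed
  have fv: "(\<integral>x. (f x)^2 \<partial>R) \<le> b^4"
  proof -
    have q: "(f x)^2 \<le> b^4" for x
    proof -
      have "\<bar>f x\<bar>^2 \<le> (b^2)^2" by (rule power_mono[OF fb]) simp
      thus ?thesis by simp
    qed
    have "integrable R (\<lambda>x. (f x)^2)" by (rule bounded_integrable[OF prob_space_R, where K="b^4"]) (use fm q in auto)
    thus ?thesis using q by (intro R.integral_le_const) auto
  qed
  have "QR.prob {x \<in> space (QR n). sqrt (real n) * \<rho>^2 / 2 \<le> (\<Sum>i<n. f (x i)) / sqrt (real n)} \<le> exp (1^2 * b^4 - 1 * (sqrt (real n) * \<rho>^2 / 2))"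
    by (rule iid_upper_tail[OF prob_space_QR ind n(1) law fm refl AE_I2[OF fb] mf fv]) (use n in auto)
  moreover have "QR.prob {x \<in> space (QR n). (\<Sum>i<n. (u (x i) j)^2) / real n \<le> (\<rho>/2)^2} \<le>
    QR.prob {x \<in> space (QR n). sqrt (real n) * \<rho>^2 / 2 \<le> (\<Sum>i<n. f (x i)) / sqrt (real n)}"
  proof (rule QR.finite_measure_mono)
    show "{x \<in> space (QR n). sqrt (real n) * \<rho>^2 / 2 \<le> (\<Sum>i<n. f (x i)) / sqrt (real n)} \<in> QR.events"
      using fm by measurable
    have "sqrt (real n) * \<rho>^2 / 2 \<le> (\<Sum>i<n. f (x i)) / sqrt (real n)" if h: "(\<Sum>i<n. (u (x i) j)^2) / real n \<le> (\<rho>/2)^2" for x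
    proof -
      have "(\<Sum>i<n. (u (x i) j)^2) = (\<Sum>i<n. (X (snd (x i)) j)^2) / 2" by (simp add: split_def power_divide sum_divide_distrib)
      hence "(\<Sum>i<n. (X (snd (x i)) j)^2) \<le> real n * (\<rho>^2 / 2)" using h n(1) by (simp add: field_simps power_divide)
      moreover have "(\<Sum>i<n. f (x i)) = real n * s - (\<Sum>i<n. (X (snd (x i)) j)^2)" unfolding f_def by (simp add: sum_subtractf)
      moreover have "real n * \<rho>^2 \<le> real n * s" using \<rho> by (intro mult_left_mono) (auto simp: s_def)
      ultimately have "real n * \<rho>^2 / 2 \<le> (\<Sum>i<n. f (x i))" by simp
      hence "(real n * \<rho>^2 / 2) / sqrt (real n) \<le> (\<Sum>i<n. f (x i)) / sqrt (real n)" by (intro divide_right_mono) auto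
      moreover have "(real n * \<rho>^2 / 2) / sqrt (real n) = sqrt (real n) * \<rho>^2 / 2" using n(1) by (simp add: field_simps)
      ultimately show ?thesis by linarith
    qed
    thus "{x \<in> space (QR n). (\<Sum>i<n. (u (x i) j)^2) / real n \<le> (\<rho>/2)^2} \<subseteq> {x \<in> space (QR n). sqrt (real n) * \<rho>^2 / 2 \<le> (\<Sum>i<n. f (x i)) / sqrt (real n)}" by auto
  qed
  ultimately show ?thesis by simp
qed

end

section \<open>Anti-concentration of maxima of sums\<close>

context centred_bounded_vector
begin

text \<open>Given \<open>x\<close>, coordinate \<open>j\<close> is \<open>w j\<close> plus
  \<open>s j\<close> times a unit linear form in \<open>g\<close>. Dividing by the different scales
  \<open>s j > \<rho>\<close> turns the common level \<open>t\<close> into levels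
  \<open>\<tau> j\<close> depending on \<open>j\<close> and the width into at most
  \<open>\<delta> / \<rho>\<close>; for this reason the Gaussian bound admits a separate level in
  each coordinate.\<close>

lemma conditional_slab:
  assumes J: "\<And>j. j \<in> J \<Longrightarrow> \<rho> < sqrt ((\<Sum>i<n. (u (x i) j)^2) / real n)"
    and L: "\<And>j. j \<in> J \<Longrightarrow> \<bar>(\<Sum>i<n. v (x i) j) / sqrt (real n)\<bar> \<le> L" "0 \<le> L"
    and \<rho>: "0 < \<rho>" and \<delta>: "0 < \<delta>" and n: "n \<ge> 1"
  shows "measure (QG n) {g \<in> space (QG n). (\<exists>j\<in>J. t < W n (x, g) j) \<and> (\<forall>j\<in>J. W n (x, g) j \<le> t + \<delta>)}
     \<le> exp 2 * (\<delta> / \<rho> * ((\<bar>t\<bar> + L) / \<rho> + \<delta> / \<rho> + 1))"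
proof -
  interpret QG: prob_space "QG n" by (rule prob_space_QG)
  define s where "s = (\<lambda>j. sqrt ((\<Sum>i<n. (u (x i) j)^2) / real n))"
  have s: "\<rho> < s j" "0 < s j" if "j \<in> J" for j using J[OF that] \<rho> unfolding s_def by linarith+
  define w where "w = (\<lambda>j. (\<Sum>i<n. v (x i) j) / sqrt (real n))"
  define a where "a = (\<lambda>j i. u (x i) j / (sqrt (real n) * s j))"
  define \<tau> where "\<tau> = (\<lambda>j. (t - w j) / s j)"
  have W: "W n (x, g) j = w j + s j * (\<Sum>i<n. a j i * g i)" if "j \<in> J" for g j
  proof -
    have "s j * (\<Sum>i<n. a j i * g i) = (\<Sum>i<n. g i * u (x i) j) / sqrt (real n)"
      using s(2)[OF that] by (simp add: a_def sum_distrib_left sum_divide_distrib mult.commute)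
    thus ?thesis by (simp add: W_def w_def sum.distrib add_divide_distrib)
  qed
  have unit: "(\<Sum>i<n. (a j i)^2) = 1" if "j \<in> J" for j
  proof -
    have "(s j)^2 = (\<Sum>i<n. (u (x i) j)^2) / real n" unfolding s_def by (simp add: sum_nonneg)
    hence "(\<Sum>i<n. (u (x i) j)^2) = (s j)^2 * real n" using n by (simp add: field_simps)
    moreover have "(\<Sum>i<n. (a j i)^2) = (\<Sum>i<n. (u (x i) j)^2) / (real n * (s j)^2)"
      by (simp add: a_def power_divide power_mult_distrib sum_divide_distrib)
    ultimately show ?thesis using s(2)[OF that] n by simp
  qed
  have T: "\<bar>\<tau> j\<bar> \<le> (\<bar>t\<bar> + L) / \<rho>" if "j \<in> J" for j
  proof -
    have "\<bar>\<tau> j\<bar> = \<bar>t - w j\<bar> / s j" using s(2)[OF that] by (simp add: \<tau>_def abs_divide)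
    also have "\<dots> \<le> (\<bar>t\<bar> + L) / \<rho>"
    proof (rule frac_le)
      have "\<bar>w j\<bar> \<le> L" using L(1)[OF that] by (simp add: w_def)
      thus "\<bar>t - w j\<bar> \<le> \<bar>t\<bar> + L" "0 \<le> \<bar>t\<bar> + L" by linarith+
    qed (use s[OF that] \<rho> in auto)
    finally show ?thesis .
  qed
  have sub: "{g \<in> space (QG n). (\<exists>j\<in>J. t < W n (x, g) j) \<and> (\<forall>j\<in>J. W n (x, g) j \<le> t + \<delta>)} \<subseteq>
     {g \<in> space (QG n). (\<exists>j\<in>J. 0 < (\<Sum>i<n. a j i * g i) - \<tau> j) \<and> (\<forall>j\<in>J. (\<Sum>i<n. a j i * g i) - \<tau> j \<le> \<delta> / \<rho>)}"
  proof safe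
    fix g j assume j: "j \<in> J" and h: "t < W n (x, g) j"
    have "0 < (\<Sum>i<n. a j i * g i) - \<tau> j"
      using h s(2)[OF j] unfolding W[OF j] \<tau>_def by (simp add: field_simps)
    thus "\<exists>j\<in>J. 0 < (\<Sum>i<n. a j i * g i) - \<tau> j" using j by blast
  next
    fix g j assume j: "j \<in> J" and h: "\<forall>j\<in>J. W n (x, g) j \<le> t + \<delta>"
    have "s j * (\<Sum>i<n. a j i * g i) \<le> t + \<delta> - w j" using h[rule_format, OF j] unfolding W[OF j] by linarith
    hence "(\<Sum>i<n. a j i * g i) \<le> (t + \<delta> - w j) / s j" using s(2)[OF j] by (simp add: pos_le_divide_eq mult.commute)
    hence "(\<Sum>i<n. a j i * g i) - \<tau> j \<le> \<delta> / s j"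
      unfolding \<tau>_def by (simp add: add_divide_distrib diff_divide_distrib)
    also have "\<dots> \<le> \<delta> / \<rho>" using s[OF j] \<delta> \<rho> by (intro divide_left_mono) auto
    finally show "(\<Sum>i<n. a j i * g i) - \<tau> j \<le> \<delta> / \<rho>" .
  qed
  have sb: "sets (QG n) = sets (Pi\<^sub>M {..<n} (\<lambda>_. borel))" by (intro sets_PiM_cong) auto
  note sb[measurable_cong] note [measurable] = finite_J
  have "QG.prob {g \<in> space (QG n). (\<exists>j\<in>J. t < W n (x, g) j) \<and> (\<forall>j\<in>J. W n (x, g) j \<le> t + \<delta>)} \<le>
     QG.prob {g \<in> space (QG n). (\<exists>j\<in>J. 0 < (\<Sum>i<n. a j i * g i) - \<tau> j) \<and> (\<forall>j\<in>J. (\<Sum>i<n. a j i * g i) - \<tau> j \<le> \<delta> / \<rho>)}"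
    by (rule QG.finite_measure_mono[OF sub]) measurable
  also have "\<dots> \<le> exp 2 * (\<delta> / \<rho> * ((\<bar>t\<bar> + L) / \<rho> + \<delta> / \<rho> + 1))"
    by (rule gaussian_max_anticoncentration[OF finite_J unit T]) (use L \<rho> \<delta> in auto)
  finally show ?thesis .
qed

text \<open>The conditional bound is integrated over \<open>x\<close>. The number of coordinates
  enters only through \<open>Bad\<close>, the set of \<open>x\<close> for which some coordinate has
  a large offset or a small scale.\<close>

lemma multiplier_slab:
  assumes var: "\<And>j. j \<in> J \<Longrightarrow> \<rho>^2 \<le> (\<integral>a. (X a j)^2 \<partial>N)" and \<rho>: "0 < \<rho>" and \<delta>: "0 < \<delta>" and L: "0 \<le> L"
    and n: "n \<ge> 1" "b^2 \<le> sqrt (real n)" "3 * b \<le> sqrt (real n)"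
  shows "cdf_max (QR n \<Otimes>\<^sub>M QG n) (W n) J (t + \<delta>) - cdf_max (QR n \<Otimes>\<^sub>M QG n) (W n) J t
    \<le> exp 2 * (2 * \<delta> / \<rho> * (2 * (\<bar>t\<bar> + L + \<delta>) / \<rho> + 1))
      + real (card J) * (2 * exp (b^2 - L) + exp (b^4 - sqrt (real n) * \<rho>^2 / 2))"
proof -
  interpret QR: prob_space "QR n" by (rule prob_space_QR)
  interpret QG: prob_space "QG n" by (rule prob_space_QG)
  interpret P: pair_prob_space "QR n" "QG n" by unfold_locales
  have Wj[measurable]: "(\<lambda>p. W n p j) \<in> borel_measurable (QR n \<Otimes>\<^sub>M QG n)" for j by (rule RV_component[OF W_measurable])
  note [measurable] = finite_J
  let ?Q = "QR n \<Otimes>\<^sub>M QG n"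
  \<comment> \<open>The conditional bound at \<open>\<rho> / 2\<close>, the scale below which
    \<open>scale_tail\<close> makes a coordinate unlikely to fall.\<close>
  define \<kappa> where "\<kappa> = exp 2 * (\<delta> / (\<rho>/2) * ((\<bar>t\<bar> + L) / (\<rho>/2) + \<delta> / (\<rho>/2) + 1))"
  have \<kappa>0: "0 \<le> \<kappa>" unfolding \<kappa>_def using \<delta> \<rho> L by (intro mult_nonneg_nonneg add_nonneg_nonneg) auto
  define A where "A = {p \<in> space ?Q. (\<exists>j\<in>J. t < W n p j) \<and> (\<forall>j\<in>J. W n p j \<le> t + \<delta>)}"
  have A[measurable]: "A \<in> sets ?Q" unfolding A_def by measurable
  define bad where "bad = (\<lambda>j. {x \<in> space (QR n). L \<le> \<bar>(\<Sum>i<n. v (x i) j) / sqrt (real n)\<bar>} \<union>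
     {x \<in> space (QR n). (\<Sum>i<n. (u (x i) j)^2) / real n \<le> (\<rho>/2)^2})"
  have bad_m[measurable]: "bad j \<in> QR.events" for j unfolding bad_def by measurable
  define Bad where "Bad = (\<Union>j\<in>J. bad j)"
  have Bad_m[measurable]: "Bad \<in> QR.events" unfolding Bad_def using finite_J by measurable
  have "QR.prob Bad \<le> (\<Sum>j\<in>J. QR.prob (bad j))"
    unfolding Bad_def by (rule QR.finite_measure_subadditive_finite) (use finite_J in auto)
  also have "\<dots> \<le> (\<Sum>j\<in>J. 2 * exp (b^2 - L) + exp (b^4 - sqrt (real n) * \<rho>^2 / 2))"
  proof (rule sum_mono)
    fix j assume j: "j \<in> J"
    have "QR.prob (bad j) \<le> QR.prob {x \<in> space (QR n). L \<le> \<bar>(\<Sum>i<n. v (x i) j) / sqrt (real n)\<bar>} +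
      QR.prob {x \<in> space (QR n). (\<Sum>i<n. (u (x i) j)^2) / real n \<le> (\<rho>/2)^2}"
      unfolding bad_def by (rule measure_Un_le) measurable
    also have "\<dots> \<le> 2 * exp (b^2 - L) + exp (b^4 - sqrt (real n) * \<rho>^2 / 2)"
      by (intro add_mono offset_tail scale_tail j n var)
    finally show "QR.prob (bad j) \<le> 2 * exp (b^2 - L) + exp (b^4 - sqrt (real n) * \<rho>^2 / 2)" .
  qed
  finally have Bad: "QR.prob Bad \<le> real (card J) * (2 * exp (b^2 - L) + exp (b^4 - sqrt (real n) * \<rho>^2 / 2))"
    by simp
  have cond: "QG.prob {g \<in> space (QG n). (x, g) \<in> A} \<le> \<kappa> + indicator Bad x" if x: "x \<in> space (QR n)" for x
  proof (cases "x \<in> Bad")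
    case True thus ?thesis using \<kappa>0 QG.prob_le_1 by (simp add: add_increasing)
  next
    case False
    have "{g \<in> space (QG n). (x, g) \<in> A} = {g \<in> space (QG n). (\<exists>j\<in>J. t < W n (x, g) j) \<and> (\<forall>j\<in>J. W n (x, g) j \<le> t + \<delta>)}"
      using x by (auto simp: A_def space_pair_measure)
    also have "QG.prob \<dots> \<le> \<kappa>" unfolding \<kappa>_def
    proof (rule conditional_slab)
      fix j assume j: "j \<in> J"
      have nb: "x \<notin> bad j" using False j by (auto simp: Bad_def)
      show "\<rho> / 2 < sqrt ((\<Sum>i<n. (u (x i) j)^2) / real n)"
        by (rule real_less_rsqrt) (use nb x in \<open>auto simp: bad_def not_le\<close>)
      show "\<bar>(\<Sum>i<n. v (x i) j) / sqrt (real n)\<bar> \<le> L" using nb x by (auto simp: bad_def not_le)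
    qed (use \<rho> \<delta> n L in auto)
    finally show ?thesis by (simp add: indicator_def)
  qed
  have "P.prob A = (\<integral>p. indicator A p \<partial>?Q)" by simp
  also have "\<dots> = (\<integral>x. \<integral>g. indicator A (x, g) \<partial>QG n \<partial>QR n)"
    by (rule P.integral_fst'[symmetric]) (simp add: P.emeasure_eq_measure)
  also have "\<dots> = (\<integral>x. QG.prob {g \<in> space (QG n). (x, g) \<in> A} \<partial>QR n)"
  proof (rule Bochner_Integration.integral_cong[OF refl])
    fix x assume "x \<in> space (QR n)"
    have "(\<integral>g. indicator A (x, g) \<partial>QG n) = (\<integral>g. indicator {g \<in> space (QG n). (x, g) \<in> A} g \<partial>QG n)"
      by (rule Bochner_Integration.integral_cong) (auto simp: indicator_def)
    also have "\<dots> = QG.prob ({g \<in> space (QG n). (x, g) \<in> A} \<inter> space (QG n))" by simp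
    also have "\<dots> = QG.prob {g \<in> space (QG n). (x, g) \<in> A}" by (rule arg_cong[where f=QG.prob]) auto
    finally show "(\<integral>g. indicator A (x, g) \<partial>QG n) = QG.prob {g \<in> space (QG n). (x, g) \<in> A}" .
  qed
  also have "\<dots> \<le> (\<integral>x. \<kappa> + indicator Bad x \<partial>QR n)"
  proof (rule integral_mono[OF _ _ cond])
    have "(\<lambda>x. QG.prob (Pair x -` A)) \<in> borel_measurable (QR n)" 
      unfolding measure_def using QG.measurable_emeasure_Pair[OF A] by measurable
    moreover have "QG.prob (Pair x -` A) = QG.prob {g \<in> space (QG n). (x, g) \<in> A}" for x
      by (rule arg_cong[where f=QG.prob]) (auto simp: A_def space_pair_measure)
    ultimately have "(\<lambda>x. QG.prob {g \<in> space (QG n). (x, g) \<in> A}) \<in> borel_measurable (QR n)" by simp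
    thus "integrable (QR n) (\<lambda>x. QG.prob {g \<in> space (QG n). (x, g) \<in> A})"
      by (rule bounded_integrable[OF prob_space_QR, where K=1]) (auto simp: abs_le_iff)
  qed (auto simp: QR.emeasure_eq_measure)
  also have "\<dots> = \<kappa> + QR.prob Bad" by (simp add: QR.prob_space QR.emeasure_eq_measure)
  finally have "P.prob A \<le> \<kappa> + real (card J) * (2 * exp (b^2 - L) + exp (b^4 - sqrt (real n) * \<rho>^2 / 2))"
    using Bad by linarith
  moreover have "cdf_max ?Q (W n) J (t + \<delta>) \<le> cdf_max ?Q (W n) J t + P.prob A"
  proof -
    have "cdf_max ?Q (W n) J (t + \<delta>) \<le> P.prob ({p \<in> space ?Q. \<forall>j\<in>J. W n p j \<le> t} \<union> A)"
      unfolding cdf_max_def by (rule P.finite_measure_mono) (auto simp: A_def not_le)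
    also have "\<dots> \<le> cdf_max ?Q (W n) J t + P.prob A" unfolding cdf_max_def by (rule measure_Un_le) measurable
    finally show ?thesis .
  qed
  moreover have "\<kappa> = exp 2 * (2 * \<delta> / \<rho> * (2 * (\<bar>t\<bar> + L + \<delta>) / \<rho> + 1))"
    unfolding \<kappa>_def using \<rho> by (simp add: field_simps)
  ultimately show ?thesis by linarith
qed

text \<open>Both ends of the slab are moved to the multiplier sum at the cost of one
  \<open>H\<close> each, so the Gaussian bound is applied to the slab from \<open>t - H\<close> to
  \<open>t + \<delta> + H\<close>.\<close>

lemma slab:
  assumes M: "prob_space M" and S: "S \<in> M \<rightarrow>\<^sub>M RV"
    and ES: "\<And>t. (\<integral>\<omega>. gum J \<beta> t (S \<omega>) \<partial>M) = (cv (1 / sqrt (real n)) N X ^^ n) (gum J \<beta> t) (\<lambda>_. 0)"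
    and J: "real (card J) \<le> real n ^ 3" and \<beta>: "\<beta> > 0"
    and var: "\<And>j. j \<in> J \<Longrightarrow> \<rho>^2 \<le> (\<integral>a. (X a j)^2 \<partial>N)" and \<rho>: "0 < \<rho>" and \<delta>: "0 < \<delta>" and L: "0 \<le> L"
    and n: "n \<ge> 1" "b^2 \<le> sqrt (real n)" "3 * b \<le> sqrt (real n)"
  defines "H \<equiv> 8 * ln (real n) / \<beta>"
  shows "cdf_max M S J (t + \<delta>) - cdf_max M S J t
    \<le> exp 2 * (2 * (\<delta> + 2 * H) / \<rho> * (2 * (\<bar>t\<bar> + L + \<delta> + 3 * H) / \<rho> + 1))
      + real (card J) * (2 * exp (b^2 - L) + exp (b^4 - sqrt (real n) * \<rho>^2 / 2)) + 44 * \<beta>^4 * b^4 / real n + 4 / real n"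
proof -
  let ?F = "cdf_max (QR n \<Otimes>\<^sub>M QG n) (W n) J"
  have H: "0 \<le> H" unfolding H_def using n \<beta> by simp
  note c = cdf_max_multiplier_close[OF M S ES J n(1) \<beta>]
  have 1: "cdf_max M S J (t + \<delta>) \<le> ?F (t + \<delta> + H) + 22 * \<beta>^4 * b^4 / real n + 2 / real n"
    using c(1)[of "t + \<delta>"] by (simp add: H_def)
  have 2: "?F (t - H) \<le> cdf_max M S J t + 22 * \<beta>^4 * b^4 / real n + 2 / real n"
    using c(2)[of "t - H"] by (simp add: H_def)
  have 3: "?F ((t - H) + (\<delta> + 2 * H)) - ?F (t - H) \<le> exp 2 * (2 * (\<delta> + 2 * H) / \<rho> * (2 * (\<bar>t - H\<bar> + L + (\<delta> + 2 * H)) / \<rho> + 1))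
      + real (card J) * (2 * exp (b^2 - L) + exp (b^4 - sqrt (real n) * \<rho>^2 / 2))"
    by (rule multiplier_slab[OF var \<rho> _ L n]) (use \<delta> H in auto)
  have 4: "exp 2 * (2 * (\<delta> + 2 * H) / \<rho> * (2 * (\<bar>t - H\<bar> + L + (\<delta> + 2 * H)) / \<rho> + 1)) \<le>
    exp 2 * (2 * (\<delta> + 2 * H) / \<rho> * (2 * (\<bar>t\<bar> + L + \<delta> + 3 * H) / \<rho> + 1))"
  proof -
    have "\<bar>t - H\<bar> + L + (\<delta> + 2 * H) \<le> \<bar>t\<bar> + L + \<delta> + 3 * H" using H by linarith
    hence "2 * (\<bar>t - H\<bar> + L + (\<delta> + 2 * H)) / \<rho> \<le> 2 * (\<bar>t\<bar> + L + \<delta> + 3 * H) / \<rho>"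
      using \<rho> by (intro divide_right_mono) auto
    thus ?thesis using \<delta> H \<rho> by (intro mult_left_mono add_right_mono) auto
  qed
  have 5: "t - H + (\<delta> + 2 * H) = t + \<delta> + H" by simp
  have "cdf_max M S J (t + \<delta>) - cdf_max M S J t \<le> (?F (t + \<delta> + H) - ?F (t - H)) + 2 * (22 * \<beta>^4 * b^4 / real n) + 2 * (2 / real n)"
    using 1 2 by linarith
  with 3 4 show ?thesis unfolding 5 by linarith
qed

end

section \<open>Sums of bounded independent vectors\<close>

locale iid_sum = centred_bounded_vector N X J b for N :: "'a measure" and X J b +
  fixes M :: "'w measure" and Y :: "nat \<Rightarrow> 'w \<Rightarrow> 'a" and n :: nat
  assumes M: "prob_space M" and indep: "prob_space.indep_vars M (\<lambda>_. N) Y {..<n}"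
    and law: "\<And>i. i < n \<Longrightarrow> distr M N (Y i) = N" and n: "n \<ge> 1"
begin

sublocale M: prob_space M by (rule M)

definition S :: "'w \<Rightarrow> nat \<Rightarrow> real" where
  "S \<omega> j = 1 / sqrt (real n) * (\<Sum>i<n. X (Y i \<omega>) j)"

lemma Y_measurable [measurable]: "i < n \<Longrightarrow> Y i \<in> M \<rightarrow>\<^sub>M N"
  using indep unfolding M.indep_vars_def by auto

lemma S_measurable: "S \<in> M \<rightarrow>\<^sub>M RV"
  unfolding S_def by measurable

lemma S_component [measurable]: "(\<lambda>\<omega>. S \<omega> j) \<in> borel_measurable M"
  by (rule RV_component[OF S_measurable])

lemma integral_gum_S:
  "(\<integral>\<omega>. gum I \<beta> t (S \<omega>) \<partial>M) = (cv (1 / sqrt (real n)) N X ^^ n) (gum I \<beta> t) (\<lambda>_. 0)"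
  using iid_integral_eq_funpow_cv[OF M indep law prob_space_axioms refl X_measurable gum_measurable gum_abs,
      where w="\<lambda>_. 0" and c="1 / sqrt (real n)"]
  by (simp add: S_def[abs_def])

lemma restrict_coordinates: "I \<subseteq> J \<Longrightarrow> centred_bounded_vector N X I b"
  by unfold_locales (use X_measurable finite_subset[OF _ finite_J] bound b_nonneg centred in auto)

lemma S_tail:
  assumes j: "j \<in> J" and var: "(\<integral>a. (X a j)^2 \<partial>N) \<le> s2" and l: "0 < l" "l * b \<le> sqrt (real n)"
  shows "M.prob {\<omega> \<in> space M. t < S \<omega> j} \<le> exp (l^2 * s2 - l * t)"
proof -
  have "M.prob {\<omega> \<in> space M. t < S \<omega> j} \<le> M.prob {\<omega> \<in> space M. t \<le> (\<Sum>i<n. X (Y i \<omega>) j) / sqrt (real n)}"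
    by (rule M.finite_measure_mono) (auto simp: S_def)
  also have "\<dots> \<le> exp (l^2 * s2 - l * t)"
    by (rule iid_upper_tail[OF M indep n law _ refl AE_I2[OF bound[OF j]] centred[OF j] var l]) (use n in auto)
  finally show ?thesis .
qed

text \<open>Coordinates of small variance are unlikely to exceed \<open>t\<^sub>0\<close>, so only the others matter in the slab.\<close>

lemma slab_all:
  assumes card: "real (card J) \<le> real n ^ 3" and \<beta>: "\<beta> > 0" and \<rho>: "0 < \<rho>" and \<delta>: "0 < \<delta>" and L: "0 \<le> L"
    and big: "b^2 \<le> sqrt (real n)" "3 * b \<le> sqrt (real n)" and l: "0 < l" "l * b \<le> sqrt (real n)"
    and t: "t\<^sub>0 \<le> t"
  defines "H \<equiv> 8 * ln (real n) / \<beta>"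
  shows "cdf_max M S J (t + \<delta>) - cdf_max M S J t
    \<le> exp 2 * (2 * (\<delta> + 2 * H) / \<rho> * (2 * (\<bar>t\<bar> + L + \<delta> + 3 * H) / \<rho> + 1))
      + real n ^ 3 * (2 * exp (b^2 - L) + exp (b^4 - sqrt (real n) * \<rho>^2 / 2)) + 44 * \<beta>^4 * b^4 / real n + 4 / real n
      + real n ^ 3 * exp (l^2 * \<rho>^2 - l * t\<^sub>0)"
proof -
  define I where "I = {j \<in> J. \<rho>^2 \<le> (\<integral>a. (X a j)^2 \<partial>N)}"
  have I: "I \<subseteq> J" "finite I" unfolding I_def using finite_J by auto
  have cI: "real (card I) \<le> real n ^ 3"
    using card card_mono[OF finite_J I(1)] by linarith
  interpret I: centred_bounded_vector N X I b by (rule restrict_coordinates[OF I(1)])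
  note [measurable] = finite_J I(2)
  have s: "cdf_max M S I (t + \<delta>) - cdf_max M S I t
    \<le> exp 2 * (2 * (\<delta> + 2 * H) / \<rho> * (2 * (\<bar>t\<bar> + L + \<delta> + 3 * H) / \<rho> + 1))
      + real (card I) * (2 * exp (b^2 - L) + exp (b^4 - sqrt (real n) * \<rho>^2 / 2)) + 44 * \<beta>^4 * b^4 / real n + 4 / real n"
    unfolding H_def
    by (rule I.slab[OF M S_measurable integral_gum_S cI \<beta> _ \<rho> \<delta> L n big]) (simp add: I_def)
  have cc: "real (card I) * (2 * exp (b^2 - L) + exp (b^4 - sqrt (real n) * \<rho>^2 / 2)) \<le>
      real n ^ 3 * (2 * exp (b^2 - L) + exp (b^4 - sqrt (real n) * \<rho>^2 / 2))"
    using cI by (intro mult_right_mono) (auto intro!: add_nonneg_nonneg)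
  have K: "M.prob (\<Union>j\<in>J - I. {\<omega> \<in> space M. t < S \<omega> j}) \<le> real n ^ 3 * exp (l^2 * \<rho>^2 - l * t\<^sub>0)"
  proof -
    have "M.prob (\<Union>j\<in>J - I. {\<omega> \<in> space M. t < S \<omega> j}) \<le> (\<Sum>j\<in>J - I. M.prob {\<omega> \<in> space M. t < S \<omega> j})"
      by (rule M.finite_measure_subadditive_finite) (use finite_J in auto)
    also have "\<dots> \<le> (\<Sum>j\<in>J - I. exp (l^2 * \<rho>^2 - l * t\<^sub>0))"
    proof (rule sum_mono)
      fix j assume j: "j \<in> J - I"
      have "M.prob {\<omega> \<in> space M. t < S \<omega> j} \<le> exp (l^2 * \<rho>^2 - l * t)"
        by (rule S_tail[OF _ _ l]) (use j in \<open>auto simp: I_def\<close>)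
      also have "\<dots> \<le> exp (l^2 * \<rho>^2 - l * t\<^sub>0)" using t l by simp
      finally show "M.prob {\<omega> \<in> space M. t < S \<omega> j} \<le> exp (l^2 * \<rho>^2 - l * t\<^sub>0)" .
    qed
    also have "\<dots> = real (card (J - I)) * exp (l^2 * \<rho>^2 - l * t\<^sub>0)" by simp
    also have "\<dots> \<le> real n ^ 3 * exp (l^2 * \<rho>^2 - l * t\<^sub>0)"
    proof (intro mult_right_mono)
      have "card (J - I) \<le> card J" by (rule card_mono[OF finite_J]) auto
      thus "real (card (J - I)) \<le> real n ^ 3" using card by linarith
    qed simp
    finally show ?thesis .
  qed
  define E where "E = (\<lambda>I t. {\<omega> \<in> space M. \<forall>j\<in>I. S \<omega> j \<le> t})"
  have E[measurable]: "E J t \<in> M.events" "E I t \<in> M.events" for t unfolding E_def by measurable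
  \<comment> \<open>If the maximum over \<open>J\<close> lies in the slab, then so does the maximum
    over \<open>I\<close>, unless a coordinate outside \<open>I\<close> exceeds
    \<open>t\<close>.\<close>
  have "cdf_max M S J (t + \<delta>) \<le> M.prob ((E J t \<union> (E I (t + \<delta>) - E I t)) \<union> (\<Union>j\<in>J - I. {\<omega> \<in> space M. t < S \<omega> j}))"
    unfolding cdf_max_def
  proof (rule M.finite_measure_mono)
    show "{\<omega> \<in> space M. \<forall>j\<in>J. S \<omega> j \<le> t + \<delta>} \<subseteq> (E J t \<union> (E I (t + \<delta>) - E I t)) \<union> (\<Union>j\<in>J - I. {\<omega> \<in> space M. t < S \<omega> j})"
      using I(1) unfolding E_def by (auto simp: not_le)
  qed (use finite_J in measurable)
  also have "\<dots> \<le> M.prob (E J t \<union> (E I (t + \<delta>) - E I t)) + M.prob (\<Union>j\<in>J - I. {\<omega> \<in> space M. t < S \<omega> j})"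
    by (rule measure_Un_le) (use finite_J in measurable)
  also have "M.prob (E J t \<union> (E I (t + \<delta>) - E I t)) \<le> M.prob (E J t) + M.prob (E I (t + \<delta>) - E I t)"
    by (rule measure_Un_le) measurable
  also have "M.prob (E I (t + \<delta>) - E I t) = M.prob (E I (t + \<delta>)) - M.prob (E I t)"
    by (rule M.finite_measure_Diff) (use \<delta> in \<open>auto simp: E_def intro: order_trans\<close>)
  finally have "cdf_max M S J (t + \<delta>) \<le> cdf_max M S J t + (cdf_max M S I (t + \<delta>) - cdf_max M S I t) + real n ^ 3 * exp (l^2 * \<rho>^2 - l * t\<^sub>0)"
    using K unfolding cdf_max_def E_def by linarith
  with s cc show ?thesis by linarith
qed

text \<open>Because the opposite coordinate also belongs to \<open>J\<close>, a maximum of at most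
  \<open>c\<close> confines \<open>S q\<close> to the interval from \<open>-c\<close> to
  \<open>c\<close>. This lies inside a slab of width \<open>3 * c\<close> starting at
  \<open>- 2 * c\<close>, and a slab for one coordinate needs no factor \<open>card J\<close>. The
  lemma will keep the bootstrap quantile away from 0.\<close>

lemma cdf_max_lower_tail:
  assumes q: "q \<in> J" "q' \<in> J" and opp: "\<And>a. X a q' = - X a q" and c: "0 < c"
    and \<beta>: "\<beta> > 0" and var: "\<rho>^2 \<le> (\<integral>a. (X a q)^2 \<partial>N)" and \<rho>: "0 < \<rho>" and L: "0 \<le> L"
    and big: "b^2 \<le> sqrt (real n)" "3 * b \<le> sqrt (real n)"
  defines "H \<equiv> 8 * ln (real n) / \<beta>"
  shows "cdf_max M S J c \<le> exp 2 * (2 * (3 * c + 2 * H) / \<rho> * (2 * (5 * c + L + 3 * H) / \<rho> + 1))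
      + 2 * exp (b^2 - L) + exp (b^4 - sqrt (real n) * \<rho>^2 / 2) + 44 * \<beta>^4 * b^4 / real n + 4 / real n"
proof -
  interpret I: centred_bounded_vector N X "{q}" b by (rule restrict_coordinates) (use q in auto)
  have n1: "real (card {q}) \<le> real n ^ 3" using n by simp
  have "cdf_max M S {q} (- 2 * c + 3 * c) - cdf_max M S {q} (- 2 * c)
    \<le> exp 2 * (2 * (3 * c + 2 * H) / \<rho> * (2 * (\<bar>- 2 * c\<bar> + L + 3 * c + 3 * H) / \<rho> + 1))
      + real (card {q}) * (2 * exp (b^2 - L) + exp (b^4 - sqrt (real n) * \<rho>^2 / 2)) + 44 * \<beta>^4 * b^4 / real n + 4 / real n"
    unfolding H_def
    by (rule I.slab[OF M S_measurable integral_gum_S n1 \<beta> _ \<rho> _ L n big]) (use var c in auto)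
  moreover have "\<bar>- 2 * c\<bar> + L + 3 * c + 3 * H = 5 * c + L + 3 * H" using c by simp
  moreover have "cdf_max M S J c \<le> cdf_max M S {q} (- 2 * c + 3 * c) - cdf_max M S {q} (- 2 * c)"
  proof -
    have S': "S \<omega> q' = - S \<omega> q" for \<omega> unfolding S_def opp by (simp add: sum_negf)
    note [measurable] = finite_J
    have "cdf_max M S J c \<le> M.prob ({\<omega> \<in> space M. S \<omega> q \<le> c} - {\<omega> \<in> space M. S \<omega> q \<le> - 2 * c})"
      unfolding cdf_max_def
    proof (rule M.finite_measure_mono)
      show "{\<omega> \<in> space M. \<forall>j\<in>J. S \<omega> j \<le> c} \<subseteq> {\<omega> \<in> space M. S \<omega> q \<le> c} - {\<omega> \<in> space M. S \<omega> q \<le> - 2 * c}"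
      proof
        fix \<omega> assume h: "\<omega> \<in> {\<omega> \<in> space M. \<forall>j\<in>J. S \<omega> j \<le> c}"
        hence "S \<omega> q \<le> c" "S \<omega> q' \<le> c" using q by auto
        thus "\<omega> \<in> {\<omega> \<in> space M. S \<omega> q \<le> c} - {\<omega> \<in> space M. S \<omega> q \<le> - 2 * c}" using h c S'[of \<omega>] by auto
      qed
    qed measurable
    also have "\<dots> = M.prob {\<omega> \<in> space M. S \<omega> q \<le> c} - M.prob {\<omega> \<in> space M. S \<omega> q \<le> - 2 * c}"
      by (rule M.finite_measure_Diff) (use c in auto)
    finally show ?thesis unfolding cdf_max_def by simp
  qed
  ultimately show ?thesis by (simp add: add.assoc)
qed

end

section \<open>Centred products of the observations\<close>

lemma vec_borel_coordinate: "j < D \<Longrightarrow> (\<lambda>y. y $ j) \<in> borel_measurable (vec_borel D)"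
proof -
  assume j: "j < D"
  have "(\<lambda>v. \<lambda>j\<in>{..<D}. v $ j) \<in> vec_borel D \<rightarrow>\<^sub>M (Pi\<^sub>M {..<D} (\<lambda>_. borel))"
    unfolding vec_borel_def by (rule measurable_vimage_algebra1) (auto simp: space_PiM)
  from measurable_compose[OF this measurable_component_singleton[of j]] j
  show ?thesis by simp
qed

lemma space_vec_borel [simp]: "space (vec_borel D) = carrier_vec D"
  by (simp add: vec_borel_def)

text \<open>Chernoff's bound at \<open>l = 1\<close> for \<open>f\<close> minus its mean and for the
  negative, both bounded by \<open>2 * b\<close>; normalising the sum turns
  \<open>\<epsilon>\<close> into \<open>sqrt n * \<epsilon>\<close>.\<close>

lemma mean_deviation_tail:
  fixes f :: "'a \<Rightarrow> real"
  assumes M: "prob_space M" and N: "prob_space N" and ind: "prob_space.indep_vars M (\<lambda>_. N) Y {..<n}" and n: "n \<ge> 1"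
    and law: "\<And>i. i < n \<Longrightarrow> distr M N (Y i) = N" and f: "f \<in> borel_measurable N"
    and b: "AE a in N. \<bar>f a\<bar> \<le> b" and big: "2 * b \<le> sqrt (real n)"
  shows "measure M {\<omega> \<in> space M. \<epsilon> < \<bar>(\<Sum>i<n. f (Y i \<omega>)) / real n - (\<integral>a. f a \<partial>N)\<bar>} \<le> 2 * exp (4 * b^2 - sqrt (real n) * \<epsilon>)"
proof -
  interpret M: prob_space M by (rule M)
  interpret N: prob_space N by (rule N)
  have [measurable]: "Y i \<in> M \<rightarrow>\<^sub>M N" if "i < n" for i using ind that unfolding M.indep_vars_def by auto
  note [measurable] = f
  have fi: "integrable N f" by (rule N.integrable_const_bound[OF _ f]) (use b in auto)
  define m where "m = (\<integral>a. f a \<partial>N)"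
  have m: "\<bar>m\<bar> \<le> b"
  proof -
    have "m \<le> b" unfolding m_def by (rule N.integral_le_const[OF fi]) (use b in \<open>eventually_elim, auto\<close>)
    moreover have "- b \<le> m" unfolding m_def by (rule N.integral_ge_const[OF fi]) (use b in \<open>eventually_elim, auto\<close>)
    ultimately show ?thesis by auto
  qed
  have tail: "M.prob {\<omega> \<in> space M. sqrt (real n) * \<epsilon> \<le> (\<Sum>i<n. s * (f (Y i \<omega>) - m)) / sqrt (real n)} \<le> exp (1^2 * (4 * b^2) - 1 * (sqrt (real n) * \<epsilon>))"
    if s: "\<bar>s\<bar> = 1" for s :: real
  proof (rule iid_upper_tail[OF M ind n law, where f="\<lambda>a. s * (f a - m)" and b="2 * b"])
    show bb: "AE a in N. \<bar>s * (f a - m)\<bar> \<le> 2 * b"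
      using b
    proof eventually_elim
      case (elim a)
      have "\<bar>f a - m\<bar> \<le> 2 * b" using elim m by linarith
      thus ?case using s by (simp add: abs_mult)
    qed
    show "(\<integral>a. s * (f a - m) \<partial>N) = 0" using fi by (simp add: N.prob_space m_def)
    have sq: "AE a in N. (s * (f a - m))^2 \<le> 4 * b^2"
      using bb
    proof eventually_elim
      case (elim a)
      have "\<bar>s * (f a - m)\<bar>^2 \<le> (2 * b)^2" using elim by (intro power_mono) auto
      thus ?case by (simp add: power_mult_distrib)
    qed
    have "integrable N (\<lambda>a. (s * (f a - m))^2)" by (rule N.integrable_const_bound[where B="4 * b^2"]) (use sq in auto)
    thus "(\<integral>a. (s * (f a - m))^2 \<partial>N) \<le> 4 * b^2" by (rule N.integral_le_const) (rule sq)
  qed (use big in auto)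
  have "M.prob {\<omega> \<in> space M. \<epsilon> < \<bar>(\<Sum>i<n. f (Y i \<omega>)) / real n - m\<bar>} \<le>
    M.prob ({\<omega> \<in> space M. sqrt (real n) * \<epsilon> \<le> (\<Sum>i<n. 1 * (f (Y i \<omega>) - m)) / sqrt (real n)} \<union>
     {\<omega> \<in> space M. sqrt (real n) * \<epsilon> \<le> (\<Sum>i<n. (-1) * (f (Y i \<omega>) - m)) / sqrt (real n)})"
  proof (rule M.finite_measure_mono)
    show "{\<omega> \<in> space M. \<epsilon> < \<bar>(\<Sum>i<n. f (Y i \<omega>)) / real n - m\<bar>} \<subseteq>
     {\<omega> \<in> space M. sqrt (real n) * \<epsilon> \<le> (\<Sum>i<n. 1 * (f (Y i \<omega>) - m)) / sqrt (real n)} \<union>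
     {\<omega> \<in> space M. sqrt (real n) * \<epsilon> \<le> (\<Sum>i<n. (-1) * (f (Y i \<omega>) - m)) / sqrt (real n)}"
    proof
      fix \<omega> assume h: "\<omega> \<in> {\<omega> \<in> space M. \<epsilon> < \<bar>(\<Sum>i<n. f (Y i \<omega>)) / real n - m\<bar>}"
      define x where "x = (\<Sum>i<n. f (Y i \<omega>)) / real n - m"
      have "(\<Sum>i<n. f (Y i \<omega>) - m) = real n * x" using n by (simp add: x_def sum_subtractf field_simps)
      also have "\<dots> / sqrt (real n) = sqrt (real n) * x" using n by (simp add: field_simps)
      finally have e: "(\<Sum>i<n. f (Y i \<omega>) - m) / sqrt (real n) = sqrt (real n) * x" .
      have e': "(\<Sum>i<n. (-1) * (f (Y i \<omega>) - m)) / sqrt (real n) = sqrt (real n) * (- x)"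
        using e by (simp only: mult_minus1 sum_negf minus_divide_left[symmetric] mult_minus_right)
      have "\<epsilon> < \<bar>x\<bar>" using h by (simp add: x_def)
      hence "\<epsilon> \<le> x \<or> \<epsilon> \<le> - x" by linarith
      hence x: "sqrt (real n) * \<epsilon> \<le> sqrt (real n) * x \<or> sqrt (real n) * \<epsilon> \<le> sqrt (real n) * (- x)"
        by (meson mult_left_mono of_nat_0_le_iff real_sqrt_ge_zero)
      have e1: "(\<Sum>i<n. 1 * (f (Y i \<omega>) - m)) / sqrt (real n) = sqrt (real n) * x" using e by simp
      thus "\<omega> \<in> {\<omega> \<in> space M. sqrt (real n) * \<epsilon> \<le> (\<Sum>i<n. 1 * (f (Y i \<omega>) - m)) / sqrt (real n)} \<union>
        {\<omega> \<in> space M. sqrt (real n) * \<epsilon> \<le> (\<Sum>i<n. (-1) * (f (Y i \<omega>) - m)) / sqrt (real n)}"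
        unfolding Un_iff mem_Collect_eq e1 e' using h x by auto
    qed
  qed measurable
  also have "\<dots> \<le> M.prob {\<omega> \<in> space M. sqrt (real n) * \<epsilon> \<le> (\<Sum>i<n. 1 * (f (Y i \<omega>) - m)) / sqrt (real n)} +
     M.prob {\<omega> \<in> space M. sqrt (real n) * \<epsilon> \<le> (\<Sum>i<n. (-1) * (f (Y i \<omega>) - m)) / sqrt (real n)}"
    by (rule measure_Un_le) measurable
  also have "\<dots> \<le> 2 * exp (4 * b^2 - sqrt (real n) * \<epsilon>)" using tail[of 1] tail[of "-1"] by simp
  finally show ?thesis unfolding m_def .
qed

text \<open>Here \<open>c\<close> will be the covariance of two squares and the second hypothesis
  the nonnegativity of the variance of their sum. The combination of \<open>v01\<close>,
  \<open>v00\<close>, \<open>v11\<close> with weights 1, 1/2, 1/2 is at least \<open>z\<close>, and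
  the weights add up to 2.\<close>

lemma half_le_one_of_three:
  "z \<le> v01 - c \<Longrightarrow> 0 \<le> v00 + v11 + 2 * c \<Longrightarrow> z / 2 \<le> v01 \<or> z / 2 \<le> v00 \<or> z / 2 \<le> (v11 :: real)"
  by linarith

section \<open>The sampling model at a fixed sample size\<close>

locale sample_setting =
  fixes n D :: nat and P :: "real vec measure" and M :: "'w measure" and Y :: "nat \<Rightarrow> 'w \<Rightarrow> real vec" and B :: real
  assumes n2: "n \<ge> 2" and D1: "1 \<le> D" and Dn: "D < n" and iid: "iid_sample n D P M Y"
    and bounded: "AE y in P. \<forall>j<D. \<bar>y $ j\<bar> \<le> B"
begin

lemma prob_space_M: "prob_space M" using iid by (simp add: iid_sample_def)

sublocale M: prob_space M by (rule prob_space_M)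

lemma law: "i < n \<Longrightarrow> distr M (vec_borel D) (Y i) = P" using iid by (simp add: iid_sample_def)

lemma sets_P: "sets P = sets (vec_borel D)" using law[of 0] n2 by (metis gr0I not_numeral_le_zero sets_distr)

lemma Y_measurable: "i < n \<Longrightarrow> Y i \<in> M \<rightarrow>\<^sub>M vec_borel D"
  using iid unfolding iid_sample_def M.indep_vars_def by auto

lemma Y_measurable' [measurable]: "i < n \<Longrightarrow> Y i \<in> M \<rightarrow>\<^sub>M P"
  using Y_measurable measurable_cong_sets[OF refl sets_P] by blast

lemma indep: "M.indep_vars (\<lambda>_. P) Y {..<n}"
  using iid unfolding iid_sample_def M.indep_vars_def
  by (simp add: sets_P measurable_cong_sets[OF refl sets_P])

lemma law': "i < n \<Longrightarrow> distr M P (Y i) = P"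
  using law[of i] distr_cong[OF refl sets_P, of M "Y i" "Y i"] by simp

lemma prob_space_P: "prob_space P"
  using M.prob_space_distr[OF Y_measurable'[of 0]] law'[of 0] n2 by simp

sublocale P: prob_space P by (rule prob_space_P)

lemma coordinate_measurable [measurable]: "j < D \<Longrightarrow> (\<lambda>y. y $ j) \<in> borel_measurable P"
  using vec_borel_coordinate measurable_cong_sets[OF sets_P refl] by blast

lemma AE_Y: "AE \<omega> in M. \<forall>i<n. \<forall>j<D. \<bar>Y i \<omega> $ j\<bar> \<le> B"
proof -
  have "AE \<omega> in M. \<forall>j<D. \<bar>Y i \<omega> $ j\<bar> \<le> B" if i: "i < n" for i
    by (rule AE_distrD[OF Y_measurable'[OF i]]) (simp only: law'[OF i] bounded)
  hence "AE \<omega> in M. \<forall>i\<in>{..<n}. \<forall>j<D. \<bar>Y i \<omega> $ j\<bar> \<le> B" by (intro AE_finite_allI) auto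
  thus ?thesis by eventually_elim auto
qed

lemma B_nonneg: "0 \<le> B"
proof (rule ccontr)
  assume "\<not> 0 \<le> B"
  hence "AE y in P. False"
    using D1 by (intro eventually_mono[OF bounded]) (metis abs_ge_zero less_eq_Suc_le One_nat_def order_trans)
  thus False by simp
qed

abbreviation \<mu> :: "nat \<Rightarrow> real" where "\<mu> j \<equiv> mean_vec D P (\<lambda>x. x) $ j"
abbreviation \<Sigma> :: "nat \<Rightarrow> nat \<Rightarrow> real" where "\<Sigma> j k \<equiv> pop_cov D P $$ (j, k)"

text \<open>Clipping at \<open>B\<close> changes nothing almost surely but makes the centred observations bounded everywhere.\<close>

definition cu :: "real vec \<Rightarrow> nat \<Rightarrow> real" where
  "cu y j = max (- B) (min B (y $ j)) - \<mu> j"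

lemma mu_eq: "j < D \<Longrightarrow> \<mu> j = (\<integral>y. y $ j \<partial>P)" by (simp add: mean_vec_def)

lemma mu_bound: assumes j: "j < D" shows "\<bar>\<mu> j\<bar> \<le> B"
proof -
  have b: "AE y in P. \<bar>y $ j\<bar> \<le> B" using bounded by eventually_elim (use j in auto)
  have i: "integrable P (\<lambda>y. y $ j)" by (rule P.integrable_const_bound[where B=B]) (use b j in auto)
  have "\<mu> j \<le> B" unfolding mu_eq[OF j] by (rule P.integral_le_const[OF i]) (use b in \<open>eventually_elim, auto\<close>)
  moreover have "- B \<le> \<mu> j" unfolding mu_eq[OF j] by (rule P.integral_ge_const[OF i]) (use b in \<open>eventually_elim, auto\<close>)
  ultimately show ?thesis by auto
qed

lemma cu_bound: "j < D \<Longrightarrow> \<bar>cu y j\<bar> \<le> 2 * B"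
  using mu_bound[of j] B_nonneg unfolding cu_def by (auto simp: abs_le_iff max_def min_def)

lemma cu_eq: "\<bar>y $ j\<bar> \<le> B \<Longrightarrow> cu y j = y $ j - \<mu> j"
  unfolding cu_def by (auto simp: abs_le_iff max_def min_def)

lemma cu_measurable [measurable]: "j < D \<Longrightarrow> (\<lambda>y. cu y j) \<in> borel_measurable P"
  unfolding cu_def by measurable

lemma Sigma_eq: "j < D \<Longrightarrow> k < D \<Longrightarrow> \<Sigma> j k = (\<integral>y. cu y j * cu y k \<partial>P)"
proof -
  assume j: "j < D" and k: "k < D"
  have "\<Sigma> j k = (\<integral>y. (y $ j - \<mu> j) * (y $ k - \<mu> k) \<partial>P)" using j k by (simp add: pop_cov_def cov_mat_def)
  also have "\<dots> = (\<integral>y. cu y j * cu y k \<partial>P)"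
    by (rule integral_cong_AE) (use j k bounded in \<open>auto simp: cu_eq elim!: eventually_mono\<close>)
  finally show ?thesis .
qed

lemma uu_bound: "j < D \<Longrightarrow> k < D \<Longrightarrow> \<bar>cu y j * cu y k\<bar> \<le> 4 * B^2"
  using mult_mono[OF cu_bound[of j y] cu_bound[of k y]] B_nonneg by (simp add: abs_mult power2_eq_square)

lemma uu_integrable: "j < D \<Longrightarrow> k < D \<Longrightarrow> integrable P (\<lambda>y. cu y j * cu y k)"
  by (rule bounded_integrable[OF prob_space_P _ uu_bound]) auto

lemma Sigma_bound: assumes "j < D" "k < D" shows "\<bar>\<Sigma> j k\<bar> \<le> 4 * B^2"
  unfolding Sigma_eq[OF assms] by (rule abs_integral_le[OF prob_space_P]) (use assms uu_bound in auto)

definition ji :: "nat \<Rightarrow> nat" where "ji q = q mod (D * D) mod D"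
definition ki :: "nat \<Rightarrow> nat" where "ki q = q mod (D * D) div D"
definition sg :: "nat \<Rightarrow> real" where "sg q = (if q < D * D then 1 else - 1)"

lemma ji: "ji q < D" and ki: "ki q < D"
proof -
  have D: "0 < D * D" "0 < D" using D1 by auto
  show "ji q < D" unfolding ji_def using D by simp
  show "ki q < D" unfolding ki_def using mod_less_divisor[OF D(1), of q] by (simp add: less_mult_imp_div_less)
qed

lemma sg: "\<bar>sg q\<bar> = 1" by (simp add: sg_def)

text \<open>
  Coordinate \<open>q\<close> is the pair \<open>(ji q, ki q)\<close>; the coordinates from \<open>D * D\<close> on carry the opposite sign, so that the
  maximum over \<open>J\<close> is the supremum norm.
\<close>

definition X :: "real vec \<Rightarrow> nat \<Rightarrow> real" where
  "X y q = sg q * (cu y (ji q) * cu y (ki q) - \<Sigma> (ji q) (ki q))"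

definition b :: real where "b = 8 * B^2"

definition J :: "nat set" where "J = {..<2 * (D * D)}"

lemma X_bound: "\<bar>X y q\<bar> \<le> b"
proof -
  have "\<bar>cu y (ji q) * cu y (ki q) - \<Sigma> (ji q) (ki q)\<bar> \<le> 8 * B^2"
    using uu_bound[OF ji[of q] ki[of q], of y] Sigma_bound[OF ji[of q] ki[of q]] by linarith
  thus ?thesis using sg[of q] by (simp add: X_def b_def abs_mult)
qed

lemma X_measurable: "X \<in> P \<rightarrow>\<^sub>M RV"
proof -
  have "(\<lambda>y. X y q) \<in> borel_measurable P" for q using ji[of q] ki[of q] unfolding X_def by measurable
  thus ?thesis by (intro measurable_abs_UNIV)
qed

lemma card_J: "real (card J) \<le> real n ^ 3"
proof -
  have "2 * (D * D) \<le> n * (n * n)" using Dn n2 by (intro mult_mono) auto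
  hence "real (2 * (D * D)) \<le> real (n * (n * n))" by (rule of_nat_mono)
  thus ?thesis by (simp add: J_def power3_eq_cube)
qed

sublocale iid_sum P X J b M Y n
proof unfold_locales
  show "X \<in> P \<rightarrow>\<^sub>M RV" by (rule X_measurable)
  show "finite J" by (simp add: J_def)
  show "\<bar>X a j\<bar> \<le> b" for a j by (rule X_bound)
  show "0 \<le> b" by (simp add: b_def)
  show "(\<integral>a. X a q \<partial>P) = 0" for q
    unfolding X_def using uu_integrable[OF ji ki] by (simp add: Sigma_eq[OF ji ki] P.prob_space)
  show "M.indep_vars (\<lambda>_. P) Y {..<n}" by (rule indep)
  show "distr M P (Y i) = P" if "i < n" for i by (rule law'[OF that])
  show "n \<ge> 1" using n2 by simp
qed

lemma index: assumes "j < D" "k < D" shows "k * D + j < D * D" "ji (k * D + j) = j" "ki (k * D + j) = k" "k * D + j \<in> J"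
proof -
  have "k * D + j < k * D + D" using assms by simp
  also have "\<dots> = (k + 1) * D" by simp
  also have "\<dots> \<le> D * D" using assms by (intro mult_right_mono) auto
  finally show l: "k * D + j < D * D" .
  show "ji (k * D + j) = j" "ki (k * D + j) = k" using l assms by (simp_all add: ji_def ki_def)
  show "k * D + j \<in> J" using l by (simp add: J_def)
qed

lemma opposite: assumes "q < D * D" shows "q + D * D \<in> J" "X y (q + D * D) = - X y q"
proof -
  show "q + D * D \<in> J" using assms by (simp add: J_def)
  show "X y (q + D * D) = - X y q" using assms by (simp add: X_def sg_def ji_def ki_def)
qed

text \<open>
  The determinant of the covariance matrix of centred variables \<open>u\<close> and \<open>v\<close> equals
  \<open>Var (u * v) - Cov (u^2, v^2)\<close>, so a lower bound for it prevents all three products from being almost constant.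
\<close>

lemma nondegenerate:
  assumes D2: "2 \<le> D" and a: "0 < a"
    and q: "\<And>x y. a * (x^2 + y^2) \<le> x^2 * \<Sigma> 0 0 + 2 * x * y * \<Sigma> 0 1 + y^2 * \<Sigma> 1 1"
  shows "\<exists>q<D * D. a^2 / 2 \<le> (\<integral>y. (X y q)^2 \<partial>P)"
proof -
  have d: "0 < D" "1 < D" using D2 by auto
  define V where "V = (\<lambda>j k y. cu y j * cu y k - \<Sigma> j k)"
  have Vm[measurable]: "V j k \<in> borel_measurable P" if "j < D" "k < D" for j k unfolding V_def using that by measurable
  have Vb: "\<bar>V j k y\<bar> \<le> b" if "j < D" "k < D" for j k y
    using uu_bound[OF that, of y] Sigma_bound[OF that] unfolding V_def b_def by (simp add: abs_le_iff)
  have VVb: "\<bar>V j k y * V l m y\<bar> \<le> b * b" if "j < D" "k < D" "l < D" "m < D" for j k l m y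
    using mult_mono[OF Vb[OF that(1,2), of y] Vb[OF that(3,4), of y]] b_nonneg by (simp add: abs_mult)
  have VVi: "integrable P (\<lambda>y. V j k y * V l m y)" if "j < D" "k < D" "l < D" "m < D" for j k l m
    by (rule bounded_integrable[OF prob_space_P _ VVb]) (use that in auto)
  have X: "(\<integral>y. (X y (k * D + j))^2 \<partial>P) = (\<integral>y. V j k y * V j k y \<partial>P)" if "j < D" "k < D" for j k
    using index[OF that] by (simp add: X_def V_def sg_def power2_eq_square)
  \<comment> \<open>Subtracting \<open>a\<close> from the diagonal leaves a positive semidefinite
    form with entries \<open>s\<close>, \<open>z\<close>, \<open>t\<close>; its determinant is
    nonnegative.\<close>
  have det: "a^2 \<le> \<Sigma> 0 0 * \<Sigma> 1 1 - (\<Sigma> 0 1)^2"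
  proof -
    define s where "s = \<Sigma> 0 0 - a" define t where "t = \<Sigma> 1 1 - a" define z where "z = \<Sigma> 0 1"
    have qq: "0 \<le> x^2 * s + 2 * x * y * z + y^2 * t" for x y using q[of x y] by (simp add: s_def t_def z_def algebra_simps)
    have s: "0 \<le> s" using qq[of 1 0] by simp
    have t: "0 \<le> t" using qq[of 0 1] by simp
    have "z^2 \<le> s * t"
    proof (cases "t = 0")
      case True
      have "0 \<le> s + 2 * y * z" for y using qq[of 1 y] True by simp
      \<comment> \<open>If \<open>z\<close> were nonzero, the form would take the value -1 at this
        point.\<close>
      from this[of "- (s + 1) / (2 * z)"] have "z = 0" by (cases "z = 0") (auto simp: field_simps)
      thus ?thesis using True by simp
    next
      case False
      hence t0: "0 < t" using t by simp
      \<comment> \<open>The form at \<open>(t, - z)\<close> is \<open>t\<close> times the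
        determinant.\<close>
      have "0 \<le> t^2 * s + 2 * t * (-z) * z + (-z)^2 * t" by (rule qq)
      also have "\<dots> = t * (s * t - z^2)" by (simp add: algebra_simps power2_eq_square)
      finally have "0 \<le> s * t - z^2" using t0 by (simp add: zero_le_mult_iff)
      thus ?thesis by simp
    qed
    moreover have "\<Sigma> 0 0 * \<Sigma> 1 1 = s * t + a * s + a * t + a^2" by (simp add: s_def t_def algebra_simps power2_eq_square)
    moreover have "0 \<le> a * s" "0 \<le> a * t" using a s t by auto
    ultimately show ?thesis by (simp add: z_def)
  qed
  define v00 where "v00 = (\<integral>y. V 0 0 y * V 0 0 y \<partial>P)"
  define v01 where "v01 = (\<integral>y. V 0 1 y * V 0 1 y \<partial>P)"
  define v11 where "v11 = (\<integral>y. V 1 1 y * V 1 1 y \<partial>P)"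
  define cc where "cc = (\<integral>y. V 0 0 y * V 1 1 y \<partial>P)"
  have Vi: "integrable P (V j k)" "(\<integral>y. V j k y \<partial>P) = 0" if "j < D" "k < D" for j k
    unfolding V_def using uu_integrable[OF that] by (simp_all add: Sigma_eq[OF that] P.prob_space)
  \<comment> \<open>The quartic terms, both equal to the square of \<open>cu y 0 * cu y 1\<close>,
    cancel; what remains is the determinant plus terms of mean 0.\<close>
  have id: "V 0 1 y * V 0 1 y - V 0 0 y * V 1 1 y =
     \<Sigma> 0 0 * \<Sigma> 1 1 - (\<Sigma> 0 1)^2 + (\<Sigma> 0 0 * V 1 1 y + \<Sigma> 1 1 * V 0 0 y - 2 * \<Sigma> 0 1 * V 0 1 y)" for y
    unfolding V_def by (simp add: algebra_simps power2_eq_square)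
  have "v01 - cc = (\<integral>y. V 0 1 y * V 0 1 y - V 0 0 y * V 1 1 y \<partial>P)"
    unfolding v01_def cc_def using VVi d by simp
  also have "\<dots> = \<Sigma> 0 0 * \<Sigma> 1 1 - (\<Sigma> 0 1)^2"
    unfolding id using Vi d by (simp add: P.prob_space)
  finally have 1: "a^2 \<le> v01 - cc" using det by simp
  have "0 \<le> (\<integral>y. (V 0 0 y + V 1 1 y)^2 \<partial>P)" by simp
  also have "\<dots> = (\<integral>y. V 0 0 y * V 0 0 y + V 1 1 y * V 1 1 y + 2 * (V 0 0 y * V 1 1 y) \<partial>P)"
    by (rule Bochner_Integration.integral_cong) (auto simp: power2_eq_square algebra_simps)
  also have "\<dots> = v00 + v11 + 2 * cc" unfolding v00_def v11_def cc_def using VVi d by simp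
  finally have 2: "0 \<le> v00 + v11 + 2 * cc" .
  have disj: "a^2 / 2 \<le> v01 \<or> a^2 / 2 \<le> v00 \<or> a^2 / 2 \<le> v11" by (rule half_le_one_of_three[OF 1 2])
  have fin: ?thesis if "a^2 / 2 \<le> (\<integral>y. V j k y * V j k y \<partial>P)" "j < D" "k < D" for j k
  proof -
    have "a^2 / 2 \<le> (\<integral>y. (X y (k * D + j))^2 \<partial>P)" using that(1) X[OF that(2,3)] by simp
    thus ?thesis using index(1)[OF that(2,3)] by blast
  qed
  from disj show ?thesis
  proof (elim disjE)
    assume "a^2 / 2 \<le> v01" thus ?thesis unfolding v01_def by (rule fin[OF _ d])
  next
    assume "a^2 / 2 \<le> v00" thus ?thesis unfolding v00_def by (rule fin[OF _ d(1) d(1)])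
  next
    assume "a^2 / 2 \<le> v11" thus ?thesis unfolding v11_def by (rule fin[OF _ d(2) d(2)])
  qed
qed

end

section \<open>Typical samples\<close>

text \<open>Changing the centres alters the mean product by the product of the two displacements of
  the means. The identity is used around the population mean for the data and around the mean of the
  data for the resample.\<close>

lemma sample_cov_shift:
  assumes n: "n \<ge> 1" and j: "j < D" and k: "k < D"
  shows "sample_cov n D y $$ (j, k) = (\<Sum>i<n. (y i $ j - a) * (y i $ k - b)) / real n
    - (sample_mean n D y $ j - a) * (sample_mean n D y $ k - b)"
proof -
  define mj where "mj = (\<Sum>i<n. y i $ j) / real n"
  define mk where "mk = (\<Sum>i<n. y i $ k) / real n"
  have s: "(\<Sum>i<n. y i $ j) = real n * mj" "(\<Sum>i<n. y i $ k) = real n * mk" using n by (simp_all add: mj_def mk_def)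
  have exp: "(\<Sum>i<n. (y i $ j - p) * (y i $ k - q)) = (\<Sum>i<n. y i $ j * y i $ k) - real n * (q * mj + p * mk - p * q)" for p q
  proof -
    have "(\<Sum>i<n. (y i $ j - p) * (y i $ k - q)) = (\<Sum>i<n. y i $ j * y i $ k - q * (y i $ j) - p * (y i $ k) + p * q)"
      by (intro sum.cong refl) (simp add: algebra_simps)
    also have "\<dots> = (\<Sum>i<n. y i $ j * y i $ k) - q * (\<Sum>i<n. y i $ j) - p * (\<Sum>i<n. y i $ k) + real n * (p * q)"
      by (simp add: sum.distrib sum_subtractf sum_distrib_left)
    finally show ?thesis unfolding s by (simp add: algebra_simps)
  qed
  have m: "sample_mean n D y $ j = mj" "sample_mean n D y $ k = mk" using j k by (simp_all add: sample_mean_def mj_def mk_def)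
  have "sample_cov n D y $$ (j, k) = (\<Sum>i<n. (y i $ j - mj) * (y i $ k - mk)) / real n"
    using j k m by (simp add: sample_cov_def)
  thus ?thesis unfolding m exp using n by (simp add: field_simps)
qed

lemma (in prob_space) prob_UN_le:
  assumes "finite I" "\<And>i. i \<in> I \<Longrightarrow> A i \<in> events" "\<And>i. i \<in> I \<Longrightarrow> prob (A i) \<le> p"
  shows "prob (\<Union>i\<in>I. A i) \<le> real (card I) * p"
proof -
  have "prob (\<Union>i\<in>I. A i) \<le> (\<Sum>i\<in>I. prob (A i))"
    by (rule finite_measure_subadditive_finite) (use assms in auto)
  also have "\<dots> \<le> (\<Sum>i\<in>I. p)" by (intro sum_mono assms(3))
  finally show ?thesis by simp
qed

lemma abs_mult_diff_le:
  fixes x y x' y' :: real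
  assumes "\<bar>x - x'\<bar> \<le> p" "\<bar>y - y'\<bar> \<le> q" "\<bar>x\<bar> \<le> s" "\<bar>y'\<bar> \<le> t"
  shows "\<bar>x * y - x' * y'\<bar> \<le> s * q + p * t"
proof -
  have "x * y - x' * y' = x * (y - y') + (x - x') * y'" by (simp add: algebra_simps)
  moreover have "\<bar>x * (y - y')\<bar> \<le> s * q" unfolding abs_mult using assms by (intro mult_mono) auto
  moreover have "\<bar>(x - x') * y'\<bar> \<le> p * t" unfolding abs_mult using assms by (intro mult_mono) auto
  ultimately show ?thesis by linarith
qed

context sample_setting
begin

definition dd :: "(nat \<Rightarrow> real vec) \<Rightarrow> nat \<Rightarrow> real" where
  "dd y j = sample_mean n D y $ j - \<mu> j"

text \<open>A deterministic condition on the data under which the bootstrap law can be compared with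
  the sampling law. The bound by \<open>B\<close> makes clipping inactive, and the last three
  clauses control the moments that a third-order expansion compares.\<close>

definition good :: "real \<Rightarrow> (nat \<Rightarrow> real vec) \<Rightarrow> bool" where
  "good \<epsilon> y \<longleftrightarrow> (\<forall>i<n. \<forall>j<D. \<bar>y i $ j\<bar> \<le> B) \<and> (\<forall>j<D. \<bar>dd y j\<bar> \<le> \<epsilon>) \<and>
     (\<forall>q\<in>J. \<bar>(\<Sum>i<n. X (y i) q) / real n\<bar> \<le> \<epsilon>) \<and>
     (\<forall>q\<in>J. \<forall>r\<in>J. \<bar>(\<Sum>i<n. X (y i) q * X (y i) r) / real n - (\<integral>z. X z q * X z r \<partial>P)\<bar> \<le> \<epsilon>) \<and>
     (\<forall>q\<in>J. \<forall>r\<in>J. \<forall>s\<in>J. \<bar>(\<Sum>i<n. X (y i) q * X (y i) r * X (y i) s) / real n - (\<integral>z. X z q * X z r * X z s \<partial>P)\<bar> \<le> \<epsilon>)"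

lemma X_component [measurable]: "(\<lambda>y. X y q) \<in> borel_measurable P"
  by (rule RV_component[OF X_measurable])

text \<open>A union bound over \<open>D + card J + (card J)^2 + (card J)^3\<close> averages with
  \<open>card J \<le> 2 * n^2\<close>: the counts \<open>1 + 2 + 4 + 8\<close>, times 2 for the
  two-sided tails, give 30. The conclusion uses an exceptional event and an almost sure statement
  because the bound by \<open>B\<close> itself holds only almost surely.\<close>

lemma good_data:
  assumes bm: "B \<le> bm" "b \<le> bm" "b * b \<le> bm" "b * b * b \<le> bm" "2 * bm \<le> sqrt (real n)"
  obtains Bad where "Bad \<in> M.events" "M.prob Bad \<le> 30 * real n ^ 6 * exp (4 * bm^2 - sqrt (real n) * \<epsilon>)"
    "AE \<omega> in M. \<omega> \<notin> Bad \<longrightarrow> good \<epsilon> (\<lambda>i. Y i \<omega>)"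
proof -
  define p where "p = 2 * exp (4 * bm^2 - sqrt (real n) * \<epsilon>)"
  define dev where "dev = (\<lambda>f. {\<omega> \<in> space M. \<epsilon> < \<bar>(\<Sum>i<n. f (Y i \<omega>)) / real n - (\<integral>a. f a \<partial>P)\<bar>})"
  have dev_m[measurable]: "dev f \<in> M.events" if "f \<in> borel_measurable P" for f
    unfolding dev_def using that by measurable
  have dev_p: "M.prob (dev f) \<le> p" if "f \<in> borel_measurable P" "AE a in P. \<bar>f a\<bar> \<le> bm" for f
    unfolding dev_def p_def by (rule mean_deviation_tail[OF M.prob_space_axioms prob_space_P indep n law' that bm(5)])
  have f1: "(\<lambda>z. z $ j) \<in> borel_measurable P" "AE z in P. \<bar>z $ j\<bar> \<le> bm" if "j < D" for j
    using that bm(1) by (auto intro: eventually_mono[OF bounded] order_trans)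
  have f2: "(\<lambda>z. X z q) \<in> borel_measurable P" "AE z in P. \<bar>X z q\<bar> \<le> bm" for q
    using order_trans[OF X_bound bm(2)] by auto
  have x3: "\<bar>X z q * X z r\<bar> \<le> b * b" for z q r
    unfolding abs_mult by (intro mult_mono X_bound) (auto simp: b_nonneg)
  have f3: "(\<lambda>z. X z q * X z r) \<in> borel_measurable P" "AE z in P. \<bar>X z q * X z r\<bar> \<le> bm" for q r
    using order_trans[OF x3 bm(3)] by (auto intro!: AE_I2)
  have x4: "\<bar>X z q * X z r * X z s\<bar> \<le> b * b * b" for z q r s
    unfolding abs_mult[of "X z q * X z r"] by (intro mult_mono x3 X_bound) (auto simp: b_nonneg)
  have f4: "(\<lambda>z. X z q * X z r * X z s) \<in> borel_measurable P" "AE z in P. \<bar>X z q * X z r * X z s\<bar> \<le> bm" for q r s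
    using order_trans[OF x4 bm(4)] by (auto intro!: AE_I2)
  have fJ: "finite J" by (rule finite_J)
  define A1 where "A1 = (\<Union>j\<in>{..<D}. dev (\<lambda>z. z $ j))"
  define A2 where "A2 = (\<Union>q\<in>J. dev (\<lambda>z. X z q))"
  define A3 where "A3 = (\<Union>v\<in>J\<times>J. dev (\<lambda>z. X z (fst v) * X z (snd v)))"
  define A4 where "A4 = (\<Union>v\<in>J\<times>J\<times>J. dev (\<lambda>z. X z (fst v) * X z (fst (snd v)) * X z (snd (snd v))))"
  have m1[measurable]: "A1 \<in> M.events" unfolding A1_def using f1 by (intro sets.finite_UN) auto
  have m2[measurable]: "A2 \<in> M.events" unfolding A2_def using fJ f2 by (intro sets.finite_UN) auto
  have m3[measurable]: "A3 \<in> M.events" unfolding A3_def using fJ f3 by (intro sets.finite_UN) auto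
  have m4[measurable]: "A4 \<in> M.events" unfolding A4_def using fJ f4 by (intro sets.finite_UN) auto
  have p1: "M.prob A1 \<le> real (card {..<D}) * p" unfolding A1_def by (rule M.prob_UN_le) (auto intro!: dev_m dev_p f1)
  have p2: "M.prob A2 \<le> real (card J) * p" unfolding A2_def using fJ by (rule M.prob_UN_le) (auto intro!: dev_m dev_p f2)
  have p3: "M.prob A3 \<le> real (card (J \<times> J)) * p" unfolding A3_def by (rule M.prob_UN_le) (use fJ in \<open>auto intro!: dev_m dev_p f3\<close>)
  have p4: "M.prob A4 \<le> real (card (J \<times> J \<times> J)) * p" unfolding A4_def by (rule M.prob_UN_le) (use fJ in \<open>auto intro!: dev_m dev_p f4\<close>)
  define Bad where "Bad = (A1 \<union> A2) \<union> (A3 \<union> A4)"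
  have Bm: "Bad \<in> M.events" unfolding Bad_def by measurable
  have p0: "0 \<le> p" by (simp add: p_def)
  have n1: "1 \<le> real n" using n2 by simp
  have D': "real D \<le> real n" using Dn by simp
  have cJ: "real (card J) \<le> 2 * real n ^ 2"
    using mult_mono[OF D' D'] by (simp add: J_def power2_eq_square)
  have pw: "real n ^ k \<le> real n ^ 6" if "k \<le> 6" for k using n1 that by (rule power_increasing[rotated])
  have q1: "real (card {..<D}) \<le> real n ^ 6" using D' pw[of 1] by simp
  have q2: "real (card J) \<le> 2 * real n ^ 6" using cJ pw[of 2] by simp
  have q3: "real (card (J \<times> J)) \<le> 4 * real n ^ 6"
  proof -
    have "real (card (J \<times> J)) \<le> (2 * real n ^ 2) * (2 * real n ^ 2)"
      unfolding card_cartesian_product of_nat_mult by (intro mult_mono cJ) auto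
    also have "\<dots> = 4 * real n ^ 4" by (simp add: power_numeral_reduce)
    finally show ?thesis using pw[of 4] by simp
  qed
  have q4: "real (card (J \<times> J \<times> J)) \<le> 8 * real n ^ 6"
  proof -
    have "real (card (J \<times> J \<times> J)) \<le> (2 * real n ^ 2) * ((2 * real n ^ 2) * (2 * real n ^ 2))"
      unfolding card_cartesian_product of_nat_mult by (intro mult_mono cJ) auto
    also have "\<dots> = 8 * real n ^ 6" by (simp add: power_numeral_reduce)
    finally show ?thesis .
  qed
  have "M.prob Bad \<le> M.prob A1 + M.prob A2 + (M.prob A3 + M.prob A4)"
    unfolding Bad_def
    by (rule order_trans[OF measure_Un_le], measurable, intro add_mono measure_Un_le) measurable
  also have "\<dots> \<le> real n ^ 6 * p + 2 * real n ^ 6 * p + (4 * real n ^ 6 * p + 8 * real n ^ 6 * p)"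
    using p1 p2 p3 p4 mult_right_mono[OF q1 p0] mult_right_mono[OF q2 p0] mult_right_mono[OF q3 p0] mult_right_mono[OF q4 p0]
    by linarith
  also have "\<dots> = 30 * real n ^ 6 * exp (4 * bm^2 - sqrt (real n) * \<epsilon>)" by (simp add: p_def)
  finally have Bp: "M.prob Bad \<le> 30 * real n ^ 6 * exp (4 * bm^2 - sqrt (real n) * \<epsilon>)" .
  have "AE \<omega> in M. \<omega> \<notin> Bad \<longrightarrow> good \<epsilon> (\<lambda>i. Y i \<omega>)"
    using AE_Y AE_space
  proof eventually_elim
    case (elim \<omega>)
    show ?case
    proof
      assume nb: "\<omega> \<notin> Bad"
      have nd: "\<bar>(\<Sum>i<n. f (Y i \<omega>)) / real n - (\<integral>a. f a \<partial>P)\<bar> \<le> \<epsilon>" if "\<omega> \<notin> dev f" for f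
        using that elim(2) by (auto simp: dev_def)
      show "good \<epsilon> (\<lambda>i. Y i \<omega>)" unfolding good_def
      proof (intro conjI ballI allI impI)
        show "\<bar>Y i \<omega> $ j\<bar> \<le> B" if "i < n" "j < D" for i j using elim(1) that by auto
        show "\<bar>dd (\<lambda>i. Y i \<omega>) j\<bar> \<le> \<epsilon>" if j: "j < D" for j
        proof -
          have "\<omega> \<notin> dev (\<lambda>z. z $ j)" using nb j by (auto simp: Bad_def A1_def)
          from nd[OF this] show ?thesis using j by (simp add: dd_def sample_mean_def mu_eq)
        qed
        show "\<bar>(\<Sum>i<n. X (Y i \<omega>) q) / real n\<bar> \<le> \<epsilon>" if q: "q \<in> J" for q
        proof -
          have "\<omega> \<notin> dev (\<lambda>z. X z q)" using nb q by (auto simp: Bad_def A2_def)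
          from nd[OF this] show ?thesis using centred[OF q] by simp
        qed
        show "\<bar>(\<Sum>i<n. X (Y i \<omega>) q * X (Y i \<omega>) r) / real n - (\<integral>z. X z q * X z r \<partial>P)\<bar> \<le> \<epsilon>" if q: "q \<in> J" "r \<in> J" for q r
        proof -
          have "\<omega> \<notin> dev (\<lambda>z. X z q * X z r)" using nb q by (force simp: Bad_def A3_def)
          from nd[OF this] show ?thesis .
        qed
        show "\<bar>(\<Sum>i<n. X (Y i \<omega>) q * X (Y i \<omega>) r * X (Y i \<omega>) s) / real n - (\<integral>z. X z q * X z r * X z s \<partial>P)\<bar> \<le> \<epsilon>"
          if q: "q \<in> J" "r \<in> J" "s \<in> J" for q r s
        proof -
          have "\<omega> \<notin> dev (\<lambda>z. X z q * X z r * X z s)" using nb q by (force simp: Bad_def A4_def)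
          from nd[OF this] show ?thesis .
        qed
      qed
    qed
  qed
  with Bm Bp show ?thesis by (rule that)
qed

end

section \<open>The bootstrap distribution\<close>

lemma sup_norm_le_iff:
  assumes "dim_vec v = m" "1 \<le> m" shows "sup_norm v \<le> x \<longleftrightarrow> (\<forall>p<m. \<bar>v $ p\<bar> \<le> x)"
  unfolding sup_norm_def using assms by (subst Max_le_iff) (auto simp: lessThan_empty_iff)

lemma dim_sample_cov_vec [simp]: "dim_vec (sample_cov_vec n D y) = D * D"
  by (simp add: sample_cov_vec_def vectorize_def sample_cov_def)

lemma sample_cov_vec_index:
  assumes "p < D * D" shows "sample_cov_vec n D y $ p = sample_cov n D y $$ (p mod D, p div D)"
  using assms by (simp add: sample_cov_vec_def vectorize_def sample_cov_def)

lemma abs_diff_trans: "\<bar>x - y\<bar> \<le> p \<Longrightarrow> \<bar>y - z\<bar> \<le> q \<Longrightarrow> p + q \<le> r \<Longrightarrow> \<bar>x - z\<bar> \<le> (r::real)"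
  by linarith

lemma abs_perturb_le: "\<bar>d\<bar> \<le> e \<Longrightarrow> \<bar>a + d - c\<bar> \<le> \<bar>a - c\<bar> + (e::real)"
  by linarith

context sample_setting
begin

abbreviation emp :: "(nat \<Rightarrow> real vec) \<Rightarrow> real vec pmf" where "emp y \<equiv> empirical_pmf n y"

lemma set_emp: "set_pmf (emp y) = y ` {..<n}"
  using n2 by (simp add: empirical_pmf_def set_pmf_of_set lessThan_empty_iff)

lemma integral_emp: "(\<integral>z. f z \<partial>(emp y)) = (\<Sum>i<n. f (y i)) / real n" for f :: "real vec \<Rightarrow> real"
proof -
  have "(\<integral>z. f z \<partial>(emp y)) = (\<integral>i. f (y i) \<partial>(measure_pmf (pmf_of_set {..<n})))"
    by (simp add: empirical_pmf_def)
  also have "\<dots> = (\<Sum>i<n. f (y i)) / real n"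
    using n2 by (subst integral_pmf_of_set) (auto simp: lessThan_empty_iff)
  finally show ?thesis .
qed

definition ybar :: "(nat \<Rightarrow> real vec) \<Rightarrow> nat \<Rightarrow> real" where "ybar y j = sample_mean n D y $ j"
definition sc :: "(nat \<Rightarrow> real vec) \<Rightarrow> nat \<Rightarrow> nat \<Rightarrow> real" where "sc y j k = sample_cov n D y $$ (j, k)"

lemma ybar_eq: "j < D \<Longrightarrow> ybar y j = (\<Sum>i<n. y i $ j) / real n" by (simp add: ybar_def sample_mean_def)

lemma sc_eq: "j < D \<Longrightarrow> k < D \<Longrightarrow> sc y j k = (\<Sum>i<n. (y i $ j - ybar y j) * (y i $ k - ybar y k)) / real n"
  by (simp add: sc_def sample_cov_def ybar_def)

lemma sc_shift: "j < D \<Longrightarrow> k < D \<Longrightarrow>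
  sc y j k = (\<Sum>i<n. (y i $ j - a) * (y i $ k - c)) / real n - (ybar y j - a) * (ybar y k - c)"
  unfolding sc_def ybar_def by (rule sample_cov_shift[OF n])

text \<open>The analogue of \<open>X\<close> for the empirical law, with sample means and sample
  covariances as centres. The value 0 away from the data makes it bounded everywhere, as
  \<open>centred_bounded_vector\<close> requires.\<close>

definition Xs :: "(nat \<Rightarrow> real vec) \<Rightarrow> real vec \<Rightarrow> nat \<Rightarrow> real" where
  "Xs y z q = (if z \<in> y ` {..<n} then sg q * ((z $ ji q - ybar y (ji q)) * (z $ ki q - ybar y (ki q)) - sc y (ji q) (ki q)) else 0)"

lemma mean_abs_le: "(\<And>i. i < n \<Longrightarrow> \<bar>f i\<bar> \<le> K) \<Longrightarrow> \<bar>(\<Sum>i<n. f i) / real n\<bar> \<le> (K::real)"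
proof -
  assume h: "\<And>i. i < n \<Longrightarrow> \<bar>f i\<bar> \<le> K"
  have "\<bar>\<Sum>i<n. f i\<bar> \<le> (\<Sum>i<n. \<bar>f i\<bar>)" by (rule sum_abs)
  also have "\<dots> \<le> (\<Sum>i<n. K)" using h by (intro sum_mono) auto
  finally show ?thesis using n by (simp add: field_simps)
qed

text \<open>The error of replacing population centres by sample centres:
  \<open>4 * B * \<epsilon>\<close> from the two factors of a product, each bounded by
  \<open>2 * B\<close>, and \<open>2 * \<epsilon>\<close> from the covariance.\<close>

definition \<eta> :: "real \<Rightarrow> real" where "\<eta> \<epsilon> = (4 * B + 2) * \<epsilon>"

context
  fixes y :: "nat \<Rightarrow> real vec" and \<epsilon> :: real
  assumes good: "good \<epsilon> y" and \<epsilon>: "0 \<le> \<epsilon>" "\<epsilon> \<le> 1"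
begin

lemma yB: "i < n \<Longrightarrow> j < D \<Longrightarrow> \<bar>y i $ j\<bar> \<le> B" using good by (simp add: good_def)

lemma ybar_B: "j < D \<Longrightarrow> \<bar>ybar y j\<bar> \<le> B"
  unfolding ybar_eq by (rule mean_abs_le) (rule yB)

lemma y_ybar: "i < n \<Longrightarrow> j < D \<Longrightarrow> \<bar>y i $ j - ybar y j\<bar> \<le> 2 * B"
  using yB[of i j] ybar_B[of j] by linarith

lemma yy_bound: "i < n \<Longrightarrow> j < D \<Longrightarrow> k < D \<Longrightarrow> \<bar>(y i $ j - ybar y j) * (y i $ k - ybar y k)\<bar> \<le> 4 * B^2"
  using mult_mono[OF y_ybar[of i j] y_ybar[of i k]] B_nonneg by (simp add: abs_mult power2_eq_square)

lemma sc_bound: "j < D \<Longrightarrow> k < D \<Longrightarrow> \<bar>sc y j k\<bar> \<le> 4 * B^2"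
  unfolding sc_eq by (rule mean_abs_le) (rule yy_bound)

lemma Xs_bound: "\<bar>Xs y z q\<bar> \<le> b"
proof (cases "z \<in> y ` {..<n}")
  case True
  then obtain i where i: "i < n" "z = y i" by auto
  have "\<bar>(z $ ji q - ybar y (ji q)) * (z $ ki q - ybar y (ki q)) - sc y (ji q) (ki q)\<bar> \<le> 8 * B^2"
    using yy_bound[OF i(1) ji[of q] ki[of q]] sc_bound[OF ji[of q] ki[of q]] unfolding i(2) by linarith
  thus ?thesis using sg[of q] True by (simp add: Xs_def b_def abs_mult)
qed (simp add: Xs_def b_nonneg)

lemma Xs_y: "i < n \<Longrightarrow> Xs y (y i) q = sg q * ((y i $ ji q - ybar y (ji q)) * (y i $ ki q - ybar y (ki q)) - sc y (ji q) (ki q))"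
  by (auto simp: Xs_def)

text \<open>Given the data, resampling is another instance of the same locale with the empirical law
  in place of \<open>P\<close>, so the facts about sums can be used on both sides of the
  comparison.\<close>

lemma boot_iid: "iid_sum (measure_pmf (emp y)) (Xs y) J b (measure_pmf (bootstrap_pmf n y)) (\<lambda>i y'. y' i) n"
proof -
  show ?thesis
  proof unfold_locales
    show "Xs y \<in> measure_pmf (emp y) \<rightarrow>\<^sub>M RV" by (simp add: space_PiM)
    show "finite J" by (rule finite_J)
    show "\<bar>Xs y a j\<bar> \<le> b" for a j by (rule Xs_bound)
    show "0 \<le> b" by (rule b_nonneg)
    show "(\<integral>a. Xs y a q \<partial>(emp y)) = 0" for q
    proof -
      have "(\<Sum>i<n. Xs y (y i) q) = (\<Sum>i<n. sg q * ((y i $ ji q - ybar y (ji q)) * (y i $ ki q - ybar y (ki q)) - sc y (ji q) (ki q)))"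
        by (intro sum.cong refl) (simp add: Xs_y)
      also have "\<dots> = sg q * ((\<Sum>i<n. (y i $ ji q - ybar y (ji q)) * (y i $ ki q - ybar y (ki q))) - real n * sc y (ji q) (ki q))"
        by (simp add: sum_distrib_left[symmetric] sum_subtractf)
      also have "\<dots> = 0" unfolding sc_eq[OF ji[of q] ki[of q]] using n by simp
      finally show ?thesis unfolding integral_emp by simp
    qed
    have "prob_space.indep_vars (measure_pmf (bootstrap_pmf n y)) (\<lambda>_. count_space UNIV) (\<lambda>i y'. y' i) {..<n}"
      unfolding bootstrap_pmf_def by (rule indep_vars_Pi_pmf) simp
    thus "prob_space.indep_vars (measure_pmf (bootstrap_pmf n y)) (\<lambda>_. measure_pmf (emp y)) (\<lambda>i y'. y' i) {..<n}"
      unfolding prob_space.indep_vars_def[OF measure_pmf.prob_space_axioms] by simp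
    show "distr (measure_pmf (bootstrap_pmf n y)) (measure_pmf (emp y)) (\<lambda>y'. y' i) = measure_pmf (emp y)" if i: "i < n" for i
    proof -
      have "distr (measure_pmf (bootstrap_pmf n y)) (measure_pmf (emp y)) (\<lambda>y'. y' i) =
        distr (measure_pmf (bootstrap_pmf n y)) (count_space UNIV) (\<lambda>y'. y' i)" by (rule distr_cong) auto
      also have "\<dots> = measure_pmf (map_pmf (\<lambda>y'. y' i) (bootstrap_pmf n y))" by (simp add: map_pmf_rep_eq)
      also have "map_pmf (\<lambda>y'. y' i) (bootstrap_pmf n y) = emp y"
        unfolding bootstrap_pmf_def using i by (subst Pi_pmf_component) auto
      finally show ?thesis .
    qed
    show "n \<ge> 1" by (rule n)
  qed
qed

interpretation Bt: iid_sum "measure_pmf (emp y)" "Xs y" J b "measure_pmf (bootstrap_pmf n y)" "\<lambda>i y'. y' i" n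
  by (rule boot_iid)

lemma Xs_X: "i < n \<Longrightarrow> \<bar>Xs y (y i) q - X (y i) q\<bar> \<le> (4 * B + 2) * \<epsilon>"
proof -
  assume i: "i < n"
  let ?j = "ji q" and ?k = "ki q"
  have d: "\<bar>ybar y j - \<mu> j\<bar> \<le> \<epsilon>" if "j < D" for j using good that by (simp add: good_def dd_def ybar_def)
  have u: "cu (y l) j = y l $ j - \<mu> j" if "l < n" "j < D" for l j by (rule cu_eq[OF yB[OF that]])
  have 1: "\<bar>cu (y i) ?j * cu (y i) ?k - (y i $ ?j - ybar y ?j) * (y i $ ?k - ybar y ?k)\<bar> \<le> 2 * B * \<epsilon> + \<epsilon> * (2 * B)"
    by (rule abs_mult_diff_le) (use d[OF ji[of q]] d[OF ki[of q]] u[OF i ji[of q]] u[OF i ki[of q]] cu_bound[OF ji[of q], of "y i"] y_ybar[OF i ki[of q]] in auto)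
  \<comment> \<open>One \<open>\<epsilon>\<close> comes from the average of \<open>X\<close>, the
    other from \<open>\<epsilon>^2 \<le> \<epsilon>\<close> in changing the centre.\<close>
  have 2: "\<bar>sc y ?j ?k - \<Sigma> ?j ?k\<bar> \<le> 2 * \<epsilon>"
  proof -
    have h: "?k * D + ?j \<in> J" "sg (?k * D + ?j) = 1" "ji (?k * D + ?j) = ?j" "ki (?k * D + ?j) = ?k"
      using index[OF ji[of q] ki[of q]] by (auto simp: sg_def)
    have X: "X z (?k * D + ?j) = cu z ?j * cu z ?k - \<Sigma> ?j ?k" for z unfolding X_def h by simp
    have "\<forall>r\<in>J. \<bar>(\<Sum>l<n. X (y l) r) / real n\<bar> \<le> \<epsilon>" using good unfolding good_def by blast
    hence m: "\<bar>(\<Sum>l<n. X (y l) (?k * D + ?j)) / real n\<bar> \<le> \<epsilon>" using h(1) by (rule bspec)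
    have e1: "(\<Sum>l<n. X (y l) (?k * D + ?j)) = (\<Sum>l<n. (y l $ ?j - \<mu> ?j) * (y l $ ?k - \<mu> ?k) - \<Sigma> ?j ?k)"
      by (intro sum.cong refl) (simp add: X u ji ki)
    have e2: "(\<Sum>l<n. (y l $ ?j - \<mu> ?j) * (y l $ ?k - \<mu> ?k) - \<Sigma> ?j ?k) / real n = (\<Sum>l<n. (y l $ ?j - \<mu> ?j) * (y l $ ?k - \<mu> ?k)) / real n - \<Sigma> ?j ?k"
      using n by (simp add: sum_subtractf diff_divide_distrib)
    have e3: "(\<Sum>l<n. (y l $ ?j - \<mu> ?j) * (y l $ ?k - \<mu> ?k)) / real n = sc y ?j ?k + (ybar y ?j - \<mu> ?j) * (ybar y ?k - \<mu> ?k)"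
      by (simp only: sc_shift[OF ji[of q] ki[of q], of y "\<mu> ?j" "\<mu> ?k"] diff_add_cancel)
    have "\<bar>sc y ?j ?k + (ybar y ?j - \<mu> ?j) * (ybar y ?k - \<mu> ?k) - \<Sigma> ?j ?k\<bar> \<le> \<epsilon>" using m unfolding e1 e2 e3 .
    moreover have "\<bar>(ybar y ?j - \<mu> ?j) * (ybar y ?k - \<mu> ?k)\<bar> \<le> \<epsilon> * 1"
      unfolding abs_mult using d[OF ji[of q]] d[OF ki[of q]] \<epsilon> by (intro mult_mono) auto
    ultimately show ?thesis by linarith
  qed
  have "Xs y (y i) q - X (y i) q = sg q * (((y i $ ?j - ybar y ?j) * (y i $ ?k - ybar y ?k) - cu (y i) ?j * cu (y i) ?k) - (sc y ?j ?k - \<Sigma> ?j ?k))"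
    unfolding Xs_y[OF i] X_def by (simp add: algebra_simps)
  hence "\<bar>Xs y (y i) q - X (y i) q\<bar> = \<bar>((y i $ ?j - ybar y ?j) * (y i $ ?k - ybar y ?k) - cu (y i) ?j * cu (y i) ?k) - (sc y ?j ?k - \<Sigma> ?j ?k)\<bar>"
    using sg[of q] by (simp add: abs_mult)
  also have "\<dots> \<le> 2 * B * \<epsilon> + \<epsilon> * (2 * B) + 2 * \<epsilon>" using 1 2 by linarith
  finally show ?thesis by (simp add: algebra_simps)
qed

lemma moments2: "q \<in> J \<Longrightarrow> r \<in> J \<Longrightarrow>
  \<bar>(\<integral>z. Xs y z q * Xs y z r \<partial>(emp y)) - (\<integral>z. X z q * X z r \<partial>P)\<bar> \<le> \<epsilon> + 2 * b * \<eta> \<epsilon>"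
proof -
  assume J: "q \<in> J" "r \<in> J"
  have "\<bar>(\<Sum>i<n. Xs y (y i) q * Xs y (y i) r - X (y i) q * X (y i) r) / real n\<bar> \<le> b * \<eta> \<epsilon> + \<eta> \<epsilon> * b"
    by (rule mean_abs_le, rule abs_mult_diff_le) (auto simp: \<eta>_def intro: Xs_X Xs_bound X_bound)
  moreover have "\<bar>(\<Sum>i<n. X (y i) q * X (y i) r) / real n - (\<integral>z. X z q * X z r \<partial>P)\<bar> \<le> \<epsilon>" using good J by (simp add: good_def)
  ultimately show ?thesis unfolding integral_emp sum_subtractf diff_divide_distrib
    by (rule abs_diff_trans) (simp add: algebra_simps)
qed

lemma moments3: "q \<in> J \<Longrightarrow> r \<in> J \<Longrightarrow> s \<in> J \<Longrightarrow>
  \<bar>(\<integral>z. Xs y z q * Xs y z r * Xs y z s \<partial>(emp y)) - (\<integral>z. X z q * X z r * X z s \<partial>P)\<bar> \<le> \<epsilon> + 3 * (b * b) * \<eta> \<epsilon>"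
proof -
  assume J: "q \<in> J" "r \<in> J" "s \<in> J"
  have bb: "\<bar>Xs y (y i) q * Xs y (y i) r\<bar> \<le> b * b" for i unfolding abs_mult by (intro mult_mono Xs_bound) (auto simp: b_nonneg)
  have "\<bar>(\<Sum>i<n. Xs y (y i) q * Xs y (y i) r * Xs y (y i) s - X (y i) q * X (y i) r * X (y i) s) / real n\<bar> \<le> (b * b) * \<eta> \<epsilon> + (b * \<eta> \<epsilon> + \<eta> \<epsilon> * b) * b"
    by (rule mean_abs_le, rule abs_mult_diff_le, rule abs_mult_diff_le) (auto simp: \<eta>_def intro: Xs_X Xs_bound X_bound bb)
  moreover have "\<bar>(\<Sum>i<n. X (y i) q * X (y i) r * X (y i) s) / real n - (\<integral>z. X z q * X z r * X z s \<partial>P)\<bar> \<le> \<epsilon>" using good J by (simp add: good_def)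
  ultimately show ?thesis unfolding integral_emp sum_subtractf diff_divide_distrib
    by (rule abs_diff_trans) (simp add: algebra_simps)
qed

text \<open>Lindeberg replacement between the bootstrap sum and the true sum. An upper bound for the
  bootstrap distribution function is the useful direction: it bounds the quantile, and with it the
  coverage, from below.\<close>

lemma boot_cdf_max:
  assumes \<beta>: "\<beta> > 0"
  shows "cdf_max (measure_pmf (bootstrap_pmf n y)) Bt.S J t \<le> cdf_max M S J (t + 8 * ln (real n) / \<beta>)
     + real n * (3/2 * (\<beta> * (1 / sqrt (real n)))^2 * (\<epsilon> + 2 * b * \<eta> \<epsilon>) + 13/6 * (\<beta> * (1 / sqrt (real n)))^3 * (\<epsilon> + 3 * (b * b) * \<eta> \<epsilon>) + 75/24 * (\<beta> * (1 / sqrt (real n)))^4 * (b^4 + b^4))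
     + 2 / real n"
proof (rule cdf_max_comparison[OF measure_pmf.prob_space_axioms M.prob_space_axioms Bt.S_measurable S_measurable finite_J card_J n \<beta>])
  fix t
  have \<eta>: "0 \<le> \<eta> \<epsilon>" unfolding \<eta>_def using B_nonneg \<epsilon> by simp
  show "\<bar>(\<integral>\<omega>. gum J \<beta> t (Bt.S \<omega>) \<partial>(bootstrap_pmf n y)) - (\<integral>\<omega>. gum J \<beta> t (S \<omega>) \<partial>M)\<bar> \<le>
     real n * (3/2 * (\<beta> * (1 / sqrt (real n)))^2 * (\<epsilon> + 2 * b * \<eta> \<epsilon>) + 13/6 * (\<beta> * (1 / sqrt (real n)))^3 * (\<epsilon> + 3 * (b * b) * \<eta> \<epsilon>) + 75/24 * (\<beta> * (1 / sqrt (real n)))^4 * (b^4 + b^4))"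
    unfolding Bt.integral_gum_S integral_gum_S
    by (rule lindeberg_telescope[OF measure_pmf.prob_space_axioms prob_space_P Bt.X_measurable X_measurable gum_measurable gum_abs],
        rule gum_moment_comparison[OF Bt.dominated dominated])
       (use \<beta> \<epsilon> \<eta> b_nonneg in \<open>auto simp: Bt.centred centred intro: moments2 moments3\<close>)
qed

text \<open>The covariance of the resample is centred at the mean of the resample, while
  \<open>Bt.S\<close> is centred at the mean of the data. The difference is a product of two mean
  deviations, at most \<open>\<epsilon>^2\<close> outside an event whose probability is the last
  summand; scaling turns it into \<open>sqrt n * \<epsilon>^2\<close>.\<close>

lemma boot_root:
  assumes \<beta>: "\<beta> > 0" and big: "2 * B \<le> sqrt (real n)"
  shows "measure_pmf.prob (bootstrap_pmf n y) {y'. sqrt (real n) * sup_norm (sample_cov_vec n D y' - sample_cov_vec n D y) \<le> t}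
    \<le> cdf_max M S J (t + sqrt (real n) * \<epsilon>^2 + 8 * ln (real n) / \<beta>)
     + real n * (3/2 * (\<beta> * (1 / sqrt (real n)))^2 * (\<epsilon> + 2 * b * \<eta> \<epsilon>) + 13/6 * (\<beta> * (1 / sqrt (real n)))^3 * (\<epsilon> + 3 * (b * b) * \<eta> \<epsilon>) + 75/24 * (\<beta> * (1 / sqrt (real n)))^4 * (b^4 + b^4))
     + 2 / real n + real D * (2 * exp (4 * B^2 - sqrt (real n) * \<epsilon>))"
proof -
  let ?Q = "measure_pmf (bootstrap_pmf n y)"
  define dev where "dev = (\<lambda>j. {y'. \<epsilon> < \<bar>ybar y' j - ybar y j\<bar>})"
  have dev: "measure_pmf.prob (bootstrap_pmf n y) (dev j) \<le> 2 * exp (4 * B^2 - sqrt (real n) * \<epsilon>)" if j: "j < D" for j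
  proof -
    have "measure_pmf.prob (bootstrap_pmf n y) {\<omega> \<in> space ?Q. \<epsilon> < \<bar>(\<Sum>i<n. \<omega> i $ j) / real n - (\<integral>z. z $ j \<partial>(emp y))\<bar>} \<le> 2 * exp (4 * B^2 - sqrt (real n) * \<epsilon>)"
      by (rule mean_deviation_tail[OF measure_pmf.prob_space_axioms measure_pmf.prob_space_axioms Bt.indep n Bt.law _ _ big])
         (use yB j in \<open>auto simp: AE_measure_pmf_iff set_emp\<close>)
    thus ?thesis using j by (simp add: integral_emp dev_def ybar_eq)
  qed
  have D: "measure_pmf.prob (bootstrap_pmf n y) (\<Union>j\<in>{..<D}. dev j) \<le> real (card {..<D}) * (2 * exp (4 * B^2 - sqrt (real n) * \<epsilon>))"
    by (rule measure_pmf.prob_UN_le) (use dev in auto)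
  have "measure_pmf.prob (bootstrap_pmf n y) {y'. sqrt (real n) * sup_norm (sample_cov_vec n D y' - sample_cov_vec n D y) \<le> t} \<le>
     measure_pmf.prob (bootstrap_pmf n y) ({y'. \<forall>q\<in>J. Bt.S y' q \<le> t + sqrt (real n) * \<epsilon>^2} \<union> (\<Union>j\<in>{..<D}. dev j))"
  \<comment> \<open>The inclusion is claimed only on the support, where every resampled point is a
    data point and \<open>Xs\<close> has its proper value.\<close>
  proof (rule measure_pmf.finite_measure_mono_AE)
    have "set_pmf (bootstrap_pmf n y) = PiE_dflt {..<n} undefined (set_pmf \<circ> (\<lambda>_. emp y))"
      unfolding bootstrap_pmf_def by (rule set_Pi_pmf) simp
    hence supp: "y' i \<in> y ` {..<n}" if "y' \<in> set_pmf (bootstrap_pmf n y)" "i < n" for y' i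
      using that set_emp[of y] by (fastforce simp: PiE_dflt_def)
    show "AE y' in ?Q. y' \<in> {y'. sqrt (real n) * sup_norm (sample_cov_vec n D y' - sample_cov_vec n D y) \<le> t} \<longrightarrow>
      y' \<in> {y'. \<forall>q\<in>J. Bt.S y' q \<le> t + sqrt (real n) * \<epsilon>^2} \<union> (\<Union>j\<in>{..<D}. dev j)"
      unfolding AE_measure_pmf_iff
    proof (intro ballI impI)
      fix y' assume y': "y' \<in> set_pmf (bootstrap_pmf n y)"
        and h: "y' \<in> {y'. sqrt (real n) * sup_norm (sample_cov_vec n D y' - sample_cov_vec n D y) \<le> t}"
      show "y' \<in> {y'. \<forall>q\<in>J. Bt.S y' q \<le> t + sqrt (real n) * \<epsilon>^2} \<union> (\<Union>j\<in>{..<D}. dev j)"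
      proof (cases "y' \<in> (\<Union>j\<in>{..<D}. dev j)")
        case False
        hence d: "\<bar>ybar y' j - ybar y j\<bar> \<le> \<epsilon>" if "j < D" for j using that by (auto simp: dev_def not_less)
        have "Bt.S y' q \<le> t + sqrt (real n) * \<epsilon>^2" for q
        proof -
          let ?j = "ji q" and ?k = "ki q"
          have jk: "?k * D + ?j < D * D" by (rule index(1)[OF ji ki])
          have pm: "(?k * D + ?j) mod D = ?j" "(?k * D + ?j) div D = ?k" using ji[of q] by auto
          have "sup_norm (sample_cov_vec n D y' - sample_cov_vec n D y) \<le> t / sqrt (real n)"
            using h n by (simp add: field_simps)
          hence "\<bar>(sample_cov_vec n D y' - sample_cov_vec n D y) $ (?k * D + ?j)\<bar> \<le> t / sqrt (real n)"
            using jk D1 by (subst (asm) sup_norm_le_iff[where m="D * D"]) auto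
          moreover have "(sample_cov_vec n D y' - sample_cov_vec n D y) $ (?k * D + ?j) = sc y' ?j ?k - sc y ?j ?k"
            using jk by (subst index_minus_vec) (simp_all only: dim_sample_cov_vec sample_cov_vec_index pm sc_def)
          ultimately have "\<bar>sc y' ?j ?k - sc y ?j ?k\<bar> \<le> t / sqrt (real n)" by simp
          hence s: "sqrt (real n) * \<bar>sc y' ?j ?k - sc y ?j ?k\<bar> \<le> t"
            using n by (simp add: pos_le_divide_eq mult.commute)
          have "(\<Sum>i<n. Xs y (y' i) q) = (\<Sum>i<n. sg q * ((y' i $ ?j - ybar y ?j) * (y' i $ ?k - ybar y ?k) - sc y ?j ?k))"
            by (intro sum.cong refl) (use supp[OF y'] in \<open>auto simp: Xs_def\<close>)
          also have "\<dots> = sg q * ((\<Sum>i<n. (y' i $ ?j - ybar y ?j) * (y' i $ ?k - ybar y ?k)) - real n * sc y ?j ?k)"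
            by (simp add: sum_distrib_left[symmetric] sum_subtractf)
          also have "(\<Sum>i<n. (y' i $ ?j - ybar y ?j) * (y' i $ ?k - ybar y ?k)) =
              real n * (sc y' ?j ?k + (ybar y' ?j - ybar y ?j) * (ybar y' ?k - ybar y ?k))"
            using n by (simp add: sc_shift[OF ji[of q] ki[of q], of y' "ybar y ?j" "ybar y ?k"])
          finally have "(\<Sum>i<n. Xs y (y' i) q) = real n * (sg q * (sc y' ?j ?k + (ybar y' ?j - ybar y ?j) * (ybar y' ?k - ybar y ?k) - sc y ?j ?k))"
            by (simp only: right_diff_distrib mult.left_commute)
          hence "Bt.S y' q = real n / sqrt (real n) * (sg q * (sc y' ?j ?k + (ybar y' ?j - ybar y ?j) * (ybar y' ?k - ybar y ?k) - sc y ?j ?k))"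
            unfolding Bt.S_def by simp
          also have "real n / sqrt (real n) = sqrt (real n)" using n by (simp add: field_simps)
          finally have S: "Bt.S y' q = sqrt (real n) * (sg q * (sc y' ?j ?k + (ybar y' ?j - ybar y ?j) * (ybar y' ?k - ybar y ?k) - sc y ?j ?k))" .
          have dd: "\<bar>(ybar y' ?j - ybar y ?j) * (ybar y' ?k - ybar y ?k)\<bar> \<le> \<epsilon> * \<epsilon>"
            unfolding abs_mult using d[OF ji[of q]] d[OF ki[of q]] \<epsilon> by (intro mult_mono) auto
          have "Bt.S y' q \<le> \<bar>Bt.S y' q\<bar>" by simp
          also have "\<dots> = sqrt (real n) * \<bar>sc y' ?j ?k + (ybar y' ?j - ybar y ?j) * (ybar y' ?k - ybar y ?k) - sc y ?j ?k\<bar>"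
            unfolding S using sg[of q] by (simp add: abs_mult)
          also have "\<dots> \<le> sqrt (real n) * (\<bar>sc y' ?j ?k - sc y ?j ?k\<bar> + \<epsilon>^2)"
            using abs_perturb_le[OF dd] by (intro mult_left_mono) (auto simp: power2_eq_square)
          also have "\<dots> \<le> t + sqrt (real n) * \<epsilon>^2" using s by (simp add: distrib_left)
          finally show ?thesis .
        qed
        thus ?thesis by simp
      qed simp
    qed
  qed simp
  also have "\<dots> \<le> measure_pmf.prob (bootstrap_pmf n y) {y'. \<forall>q\<in>J. Bt.S y' q \<le> t + sqrt (real n) * \<epsilon>^2} + measure_pmf.prob (bootstrap_pmf n y) (\<Union>j\<in>{..<D}. dev j)"
    by (rule measure_Un_le) auto
  finally have F: "measure_pmf.prob (bootstrap_pmf n y) {y'. sqrt (real n) * sup_norm (sample_cov_vec n D y' - sample_cov_vec n D y) \<le> t} \<le>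
    measure_pmf.prob (bootstrap_pmf n y) {y'. \<forall>q\<in>J. Bt.S y' q \<le> t + sqrt (real n) * \<epsilon>^2} + measure_pmf.prob (bootstrap_pmf n y) (\<Union>j\<in>{..<D}. dev j)" .
  have A: "cdf_max ?Q Bt.S J u = measure_pmf.prob (bootstrap_pmf n y) {y'. \<forall>q\<in>J. Bt.S y' q \<le> u}" for u
    by (simp add: cdf_max_def)
  show ?thesis
    by (rule order_trans[OF F add_mono[OF boot_cdf_max[OF \<beta>, of "t + sqrt (real n) * \<epsilon>^2", unfolded A] D[unfolded card_lessThan]]])
qed

end

section \<open>Coverage of the rectangle\<close>


abbreviation root :: "(nat \<Rightarrow> real vec) \<Rightarrow> (nat \<Rightarrow> real vec) \<Rightarrow> real" where
  "root y y' \<equiv> sqrt (real n) * sup_norm (sample_cov_vec n D y' - sample_cov_vec n D y)"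

lemma quantile_set_nonempty:
  assumes \<alpha>: "0 < \<alpha>" shows "\<exists>z. measure_pmf.prob (bootstrap_pmf n y) {y'. root y y' > z} \<le> \<alpha>"
proof -
  have "set_pmf (bootstrap_pmf n y) = PiE_dflt {..<n} undefined (set_pmf \<circ> (\<lambda>_. emp y))"
    unfolding bootstrap_pmf_def by (rule set_Pi_pmf) simp
  moreover have "finite (PiE_dflt {..<n} undefined (set_pmf \<circ> (\<lambda>_. emp y)))"
    by (rule finite_PiE_dflt) (auto simp: set_emp)
  ultimately have fin: "finite (set_pmf (bootstrap_pmf n y))" by simp
  define z where "z = Max (root y ` set_pmf (bootstrap_pmf n y))"
  have "root y y' \<le> z" if "y' \<in> set_pmf (bootstrap_pmf n y)" for y'
    unfolding z_def using fin that by (intro Max_ge finite_imageI imageI)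
  hence "set_pmf (bootstrap_pmf n y) \<inter> {y'. root y y' > z} = {}" by (auto simp: not_less[symmetric])
  hence "measure_pmf.prob (bootstrap_pmf n y) {y'. root y y' > z} = 0" by (simp add: measure_pmf_zero_iff)
  thus ?thesis using \<alpha> by (intro exI[of _ z]) simp
qed

text \<open>If the distribution function at \<open>t\<close> is below \<open>1 - \<alpha>\<close>,
  then every \<open>z < t\<close> has a tail above \<open>\<alpha>\<close>, so \<open>t\<close> is a
  lower bound of the set whose infimum is taken.\<close>

lemma quantile_ge:
  assumes \<alpha>: "0 < \<alpha>" and h: "measure_pmf.prob (bootstrap_pmf n y) {y'. root y y' \<le> t} < 1 - \<alpha>"
  shows "t \<le> bootstrap_quantile n D \<alpha> y"
  unfolding bootstrap_quantile_def
proof (rule cInf_greatest)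
  show "{z. measure_pmf.prob (bootstrap_pmf n y) {y'. root y y' > z} \<le> \<alpha>} \<noteq> {}"
    using quantile_set_nonempty[OF \<alpha>] by auto
  fix z assume "z \<in> {z. measure_pmf.prob (bootstrap_pmf n y) {y'. root y y' > z} \<le> \<alpha>}"
  hence z: "measure_pmf.prob (bootstrap_pmf n y) {y'. root y y' > z} \<le> \<alpha>" by simp
  show "t \<le> z"
  proof (rule ccontr)
    assume "\<not> t \<le> z"
    hence "{y'. root y y' \<le> z} \<subseteq> {y'. root y y' \<le> t}" by auto
    hence 1: "measure_pmf.prob (bootstrap_pmf n y) {y'. root y y' \<le> z} \<le> measure_pmf.prob (bootstrap_pmf n y) {y'. root y y' \<le> t}"
      by (intro measure_pmf.finite_measure_mono) auto
    have "{y'. root y y' > z} = UNIV - {y'. root y y' \<le> z}" by auto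
    hence "measure_pmf.prob (bootstrap_pmf n y) {y'. root y y' > z} = 1 - measure_pmf.prob (bootstrap_pmf n y) {y'. root y y' \<le> z}"
      using measure_pmf.prob_compl[of "{y'. root y y' \<le> z}" "bootstrap_pmf n y"] by simp
    thus False using z h 1 by simp
  qed
qed

lemma pop_cov_vec_index: "p < D * D \<Longrightarrow> pop_cov_vec D P $ p = \<Sigma> (p mod D) (p div D)"
  and dim_pop_cov_vec: "dim_vec (pop_cov_vec D P) = D * D"
  by (simp_all add: pop_cov_vec_def vectorize_def pop_cov_def cov_mat_def)

lemma sum_X_data:
  assumes "\<forall>i<n. \<forall>j<D. \<bar>y i $ j\<bar> \<le> B"
  shows "(\<Sum>i<n. X (y i) q) / real n = sg q * (sc y (ji q) (ki q) + dd y (ji q) * dd y (ki q) - \<Sigma> (ji q) (ki q))"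
proof -
  let ?j = "ji q" and ?k = "ki q"
  have u: "cu (y l) j = y l $ j - \<mu> j" if "l < n" "j < D" for l j by (rule cu_eq) (use assms that in auto)
  have e1: "(\<Sum>l<n. X (y l) q) = sg q * ((\<Sum>l<n. (y l $ ?j - \<mu> ?j) * (y l $ ?k - \<mu> ?k)) - real n * \<Sigma> ?j ?k)"
  proof -
    have "(\<Sum>l<n. X (y l) q) = (\<Sum>l<n. sg q * ((y l $ ?j - \<mu> ?j) * (y l $ ?k - \<mu> ?k) - \<Sigma> ?j ?k))"
      by (intro sum.cong refl) (simp add: X_def u ji ki)
    thus ?thesis by (simp add: sum_distrib_left[symmetric] sum_subtractf)
  qed
  have e3: "(\<Sum>l<n. (y l $ ?j - \<mu> ?j) * (y l $ ?k - \<mu> ?k)) / real n = sc y ?j ?k + dd y ?j * dd y ?k"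
    unfolding dd_def ybar_def[symmetric] by (simp only: sc_shift[OF ji[of q] ki[of q], of y "\<mu> ?j" "\<mu> ?k"] diff_add_cancel)
  have "(\<Sum>l<n. X (y l) q) / real n = sg q * ((\<Sum>l<n. (y l $ ?j - \<mu> ?j) * (y l $ ?k - \<mu> ?k)) / real n - \<Sigma> ?j ?k)"
    unfolding e1 using n by (simp add: field_simps)
  thus ?thesis unfolding e3 .
qed

text \<open>The opposite coordinates turn the one-sided bounds on \<open>S\<close> into bounds on
  absolute values. The loss \<open>sqrt n * \<epsilon>^2\<close> pays for centring at the sample
  mean instead of the population mean.\<close>

lemma covered_if:
  assumes good: "good \<epsilon> (\<lambda>i. Y i \<omega>)" and \<epsilon>: "0 \<le> \<epsilon>" and S: "\<forall>q\<in>J. S \<omega> q \<le> t - sqrt (real n) * \<epsilon>^2"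
    and Z: "t \<le> bootstrap_quantile n D \<alpha> (\<lambda>i. Y i \<omega>)"
  shows "pop_cov_vec D P \<in> bootstrap_rectangle n D \<alpha> (\<lambda>i. Y i \<omega>)"
proof -
  define y where "y = (\<lambda>i. Y i \<omega>)"
  have yB: "\<forall>i<n. \<forall>j<D. \<bar>y i $ j\<bar> \<le> B" and d: "\<And>j. j < D \<Longrightarrow> \<bar>dd y j\<bar> \<le> \<epsilon>"
    using good unfolding y_def[symmetric] good_def by blast+
  have "\<bar>(pop_cov_vec D P - sample_cov_vec n D y) $ p\<bar> \<le> t / sqrt (real n)" if p: "p < D * D" for p
  proof -
    have pj: "ji p = p mod D" "ki p = p div D" "sg p = 1" "p \<in> J" using p by (auto simp: ji_def ki_def sg_def J_def)
    have e: "(pop_cov_vec D P - sample_cov_vec n D y) $ p = \<Sigma> (ji p) (ki p) - sc y (ji p) (ki p)"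
      using p by (simp add: pop_cov_vec_index sample_cov_vec_index pj sc_def)
    have Sq: "S \<omega> p = sqrt (real n) * (sc y (ji p) (ki p) + dd y (ji p) * dd y (ki p) - \<Sigma> (ji p) (ki p))"
    proof -
      have "S \<omega> p = sqrt (real n) * ((\<Sum>i<n. X (y i) p) / real n)"
        using n by (simp add: S_def y_def field_simps)
      thus ?thesis unfolding sum_X_data[OF yB] pj(3) by simp
    qed
    have S': "S \<omega> (p + D * D) = - S \<omega> p" unfolding S_def by (simp add: opposite[OF p] sum_negf)
    have "\<bar>S \<omega> p\<bar> \<le> t - sqrt (real n) * \<epsilon>^2"
      using S[rule_format, OF pj(4)] S[rule_format, OF opposite(1)[OF p]] S' by (simp add: abs_le_iff)
    hence "sqrt (real n) * \<bar>sc y (ji p) (ki p) + dd y (ji p) * dd y (ki p) - \<Sigma> (ji p) (ki p)\<bar> \<le> t - sqrt (real n) * \<epsilon>^2"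
      unfolding Sq by (simp add: abs_mult)
    moreover have "\<bar>dd y (ji p) * dd y (ki p)\<bar> \<le> \<epsilon> * \<epsilon>"
      unfolding abs_mult using d[OF ji[of p]] d[OF ki[of p]] \<epsilon> by (intro mult_mono) auto
    hence dde: "\<bar>- (dd y (ji p) * dd y (ki p))\<bar> \<le> \<epsilon>^2" by (simp add: power2_eq_square)
    have "\<bar>sc y (ji p) (ki p) - \<Sigma> (ji p) (ki p)\<bar> \<le> \<bar>sc y (ji p) (ki p) + dd y (ji p) * dd y (ki p) - \<Sigma> (ji p) (ki p)\<bar> + \<epsilon>^2"
      using abs_perturb_le[OF dde, of "sc y (ji p) (ki p) + dd y (ji p) * dd y (ki p)" "\<Sigma> (ji p) (ki p)"] by simp
    hence "sqrt (real n) * \<bar>sc y (ji p) (ki p) - \<Sigma> (ji p) (ki p)\<bar> \<le> sqrt (real n) * (\<bar>sc y (ji p) (ki p) + dd y (ji p) * dd y (ki p) - \<Sigma> (ji p) (ki p)\<bar> + \<epsilon>^2)"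
      by (rule mult_left_mono) simp
    ultimately have "sqrt (real n) * \<bar>sc y (ji p) (ki p) - \<Sigma> (ji p) (ki p)\<bar> \<le> t" by (simp add: distrib_left)
    thus ?thesis unfolding e using n by (simp add: pos_le_divide_eq mult.commute abs_minus_commute)
  qed
  moreover have "dim_vec (pop_cov_vec D P - sample_cov_vec n D y) = D * D" by simp
  ultimately have "sup_norm (pop_cov_vec D P - sample_cov_vec n D y) \<le> t / sqrt (real n)"
    using D1 by (subst sup_norm_le_iff[where m="D * D"]) auto
  also have "\<dots> \<le> bootstrap_quantile n D \<alpha> y / sqrt (real n)" using Z by (intro divide_right_mono) (auto simp: y_def)
  finally have F: "sup_norm (pop_cov_vec D P - sample_cov_vec n D y) \<le> bootstrap_quantile n D \<alpha> y / sqrt (real n)" .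
  show ?thesis
    unfolding bootstrap_rectangle_def y_def[symmetric] by (intro CollectI conjI carrier_vecI dim_pop_cov_vec F)
qed

definition boot_err :: "real \<Rightarrow> real \<Rightarrow> real" where
  "boot_err \<epsilon> \<beta> = real n * (3/2 * (\<beta> * (1 / sqrt (real n)))^2 * (\<epsilon> + 2 * b * \<eta> \<epsilon>) + 13/6 * (\<beta> * (1 / sqrt (real n)))^3 * (\<epsilon> + 3 * (b * b) * \<eta> \<epsilon>) + 75/24 * (\<beta> * (1 / sqrt (real n)))^4 * (b^4 + b^4))
     + 2 / real n + real D * (2 * exp (4 * B^2 - sqrt (real n) * \<epsilon>))"

text \<open>The bound of \<open>slab_all\<close> with the absolute value of \<open>t\<close>
  replaced by \<open>L\<close>, so that it no longer depends on the level.\<close>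

definition slab_err :: "real \<Rightarrow> real \<Rightarrow> real \<Rightarrow> real \<Rightarrow> real \<Rightarrow> real \<Rightarrow> real" where
  "slab_err \<beta> \<rho> L l c \<delta> = exp 2 * (2 * (\<delta> + 2 * (8 * ln (real n) / \<beta>)) / \<rho> * (2 * (L + L + \<delta> + 3 * (8 * ln (real n) / \<beta>)) / \<rho> + 1))
      + real n ^ 3 * (2 * exp (b^2 - L) + exp (b^4 - sqrt (real n) * \<rho>^2 / 2)) + 44 * \<beta>^4 * b^4 / real n + 4 / real n
      + real n ^ 3 * exp (l^2 * \<rho>^2 - l * c)"

text \<open>Trivial above \<open>L\<close>, where the distribution function is already close to this
  bound.\<close>

lemma cdf_le_1: "cdf_max M S J t \<le> 1" unfolding cdf_max_def by simp

lemma slab_uniform: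
  assumes c: "0 \<le> c" "c \<le> t" and par: "\<beta> > 0" "0 < \<rho>" "0 < \<delta>" "0 \<le> L" "0 < l"
    and big: "b^2 \<le> sqrt (real n)" "3 * b \<le> sqrt (real n)" "l * b \<le> sqrt (real n)"
  shows "cdf_max M S J (t + \<delta>) - cdf_max M S J t \<le> slab_err \<beta> \<rho> L l c \<delta>"
proof -
  have H: "0 \<le> 8 * ln (real n) / \<beta>" using n par by simp
  show ?thesis
  proof (cases "t \<le> L")
    case True
    have "cdf_max M S J (t + \<delta>) - cdf_max M S J t
      \<le> exp 2 * (2 * (\<delta> + 2 * (8 * ln (real n) / \<beta>)) / \<rho> * (2 * (\<bar>t\<bar> + L + \<delta> + 3 * (8 * ln (real n) / \<beta>)) / \<rho> + 1))
      + real n ^ 3 * (2 * exp (b^2 - L) + exp (b^4 - sqrt (real n) * \<rho>^2 / 2)) + 44 * \<beta>^4 * b^4 / real n + 4 / real n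
      + real n ^ 3 * exp (l^2 * \<rho>^2 - l * c)"
      by (rule slab_all[OF card_J par(1,2,3,4) big(1,2) par(5) big(3) c(2)])
    also have "\<dots> \<le> slab_err \<beta> \<rho> L l c \<delta>"
      unfolding slab_err_def using par H c True
      by (intro add_right_mono mult_left_mono divide_right_mono) auto
    finally show ?thesis .
  next
    case False
    have "1 - cdf_max M S J t \<le> real n ^ 3 * exp (b^2 - L)"
    proof -
      note [measurable] = finite_J
      have "1 - cdf_max M S J t = M.prob (space M - {\<omega> \<in> space M. \<forall>j\<in>J. S \<omega> j \<le> t})"
        unfolding cdf_max_def by (rule M.prob_compl[symmetric]) measurable
      also have "\<dots> \<le> M.prob (\<Union>j\<in>J. {\<omega> \<in> space M. L < S \<omega> j})"
        by (rule M.finite_measure_mono) (use False finite_J in auto)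
      also have "\<dots> \<le> real (card J) * exp (1^2 * b^2 - 1 * L)"
      proof (rule M.prob_UN_le[OF finite_J])
        fix j assume j: "j \<in> J"
        have "(\<integral>a. (X a j)^2 \<partial>P) \<le> b^2"
        proof (rule order_trans[OF abs_ge_self abs_integral_le[OF prob_space_P]])
          fix a show "\<bar>(X a j)^2\<bar> \<le> b^2" using power_mono[OF X_bound[of a j], of 2] by simp
        qed measurable
        moreover have "1 * b \<le> sqrt (real n)" using big(2) b_nonneg by linarith
        ultimately show "M.prob {\<omega> \<in> space M. L < S \<omega> j} \<le> exp (1^2 * b^2 - 1 * L)" by (intro S_tail[OF j]) auto
      qed measurable
      also have "\<dots> \<le> real n ^ 3 * exp (b^2 - L)" using card_J by (simp add: mult_right_mono)
      finally show ?thesis .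
    qed
    moreover have "real n ^ 3 * exp (b^2 - L) \<le> slab_err \<beta> \<rho> L l c \<delta>"
    proof -
      have "0 \<le> exp 2 * (2 * (\<delta> + 2 * (8 * ln (real n) / \<beta>)) / \<rho> * (2 * (L + L + \<delta> + 3 * (8 * ln (real n) / \<beta>)) / \<rho> + 1))"
        using par n by (intro mult_nonneg_nonneg divide_nonneg_nonneg add_nonneg_nonneg) auto
      moreover have "real n ^ 3 * exp (b^2 - L) \<le> real n ^ 3 * (2 * exp (b^2 - L) + exp (b^4 - sqrt (real n) * \<rho>^2 / 2))"
        by (intro mult_left_mono) (auto intro: add_increasing2)
      moreover have "0 \<le> 44 * \<beta>^4 * b^4 / real n" "0 \<le> 4 / real n" "0 \<le> real n ^ 3 * exp (l^2 * \<rho>^2 - l * c)"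
        using par b_nonneg by auto
      ultimately show ?thesis unfolding slab_err_def by linarith
    qed
    ultimately show ?thesis using cdf_le_1[of "t + \<delta>"] by linarith
  qed
qed

text \<open>
  Let \<open>t1\<close> be the last point of the grid \<open>2 * c + k * h\<close> at which the distribution function is below
  \<open>1 - \<alpha> - boot_err \<epsilon> \<beta>\<close>. On good data the bootstrap quantile is at least \<open>t1 - \<zeta> - H\<close>, so the coverage is
  almost the value of the distribution function there, which by anti-concentration is almost its value at the next
  grid point. The grid makes continuity of the distribution function unnecessary.
\<close>

lemma coverage_bound:
  assumes \<alpha>: "0 < \<alpha>" and par: "\<beta> > 0" "0 < \<rho>" "0 \<le> L" "0 < l" "0 < c" and \<epsilon>: "0 < \<epsilon>" "\<epsilon> \<le> 1"
    and big: "b^2 \<le> sqrt (real n)" "3 * b \<le> sqrt (real n)" "l * b \<le> sqrt (real n)"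
    and bm: "B \<le> bm" "b \<le> bm" "b * b \<le> bm" "b * b * b \<le> bm" "2 * bm \<le> sqrt (real n)"
    and low: "cdf_max M S J (2 * c) < 1 - \<alpha> - boot_err \<epsilon> \<beta>"
    and small: "2 * (sqrt (real n) * \<epsilon>^2) + 8 * ln (real n) / \<beta> \<le> c"
    and E: "E \<in> M.events" "\<And>\<omega>. \<omega> \<in> space M \<Longrightarrow> pop_cov_vec D P \<in> bootstrap_rectangle n D \<alpha> (\<lambda>i. Y i \<omega>) \<Longrightarrow> \<omega> \<in> E"
  shows "1 - \<alpha> - (boot_err \<epsilon> \<beta> + slab_err \<beta> \<rho> L l c (3 * (sqrt (real n) * \<epsilon>^2) + 2 * (8 * ln (real n) / \<beta>))
     + 30 * real n ^ 6 * exp (4 * bm^2 - sqrt (real n) * \<epsilon>)) \<le> M.prob E"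
proof -
  define \<zeta> where "\<zeta> = sqrt (real n) * \<epsilon>^2"
  define H where "H = 8 * ln (real n) / \<beta>"
  define h where "h = \<zeta> + H"
  define \<theta> where "\<theta> = 1 - \<alpha> - boot_err \<epsilon> \<beta>"
  let ?F = "cdf_max M S J"
  have \<zeta>: "0 < \<zeta>" unfolding \<zeta>_def using n \<epsilon> by simp
  have H: "0 \<le> H" unfolding H_def using n par by simp
  have h: "0 < h" using \<zeta> H by (simp add: h_def)
  have be: "0 \<le> boot_err \<epsilon> \<beta>"
  proof -
    have "0 \<le> \<eta> \<epsilon>" unfolding \<eta>_def using B_nonneg \<epsilon> by simp
    thus ?thesis unfolding boot_err_def using b_nonneg par \<epsilon>
      by (intro add_nonneg_nonneg mult_nonneg_nonneg divide_nonneg_nonneg) auto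
  qed
  \<comment> \<open>The sums never exceed \<open>sqrt n * b\<close>, so the distribution function
    equals 1 from some grid point on.\<close>
  have ex: "\<exists>k. \<theta> \<le> ?F (2 * c + real k * h)"
  proof -
    obtain k :: nat where k: "sqrt (real n) * b / h \<le> real k" using real_arch_simple by blast
    hence "sqrt (real n) * b \<le> real k * h" using h by (simp add: pos_divide_le_eq)
    moreover have "S \<omega> q \<le> sqrt (real n) * b" for \<omega> q
    proof -
      have "(\<Sum>i<n. X (Y i \<omega>) q) \<le> (\<Sum>i<n. b)" by (intro sum_mono) (use X_bound in \<open>auto simp: abs_le_iff\<close>)
      hence "S \<omega> q \<le> 1 / sqrt (real n) * (real n * b)" unfolding S_def by (intro mult_left_mono) auto
      also have "\<dots> = sqrt (real n) * b" using n by (simp add: field_simps)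
      finally show ?thesis .
    qed
    ultimately have Sb: "S \<omega> q \<le> 2 * c + real k * h" for \<omega> q
      using par(5) by (intro order_trans[OF _ add_increasing[of "2 * c"]]) (auto intro: order_trans)
    hence "{\<omega> \<in> space M. \<forall>q\<in>J. S \<omega> q \<le> 2 * c + real k * h} = space M" by auto
    hence "?F (2 * c + real k * h) = 1" unfolding cdf_max_def by (simp add: M.prob_space)
    thus ?thesis using \<alpha> be by (intro exI[of _ k]) (simp add: \<theta>_def)
  qed
  define k where "k = (LEAST k. \<theta> \<le> ?F (2 * c + real k * h))"
  have k: "\<theta> \<le> ?F (2 * c + real k * h)" unfolding k_def by (rule LeastI_ex[OF ex])
  \<comment> \<open>By \<open>low\<close> the first grid point lies below the required level, so the
    least \<open>k\<close> has a predecessor.\<close>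
  have k0: "k \<noteq> 0" using k low by (intro notI) (simp add: \<theta>_def)
  then obtain m where m: "k = Suc m" by (cases k) auto
  have m': "?F (2 * c + real m * h) < \<theta>" using not_less_Least[of m "\<lambda>k. \<theta> \<le> ?F (2 * c + real k * h)"] m by (simp add: k_def)
  define t1 where "t1 = 2 * c + real m * h"
  \<comment> \<open>Below \<open>t1\<close> by the recentring error \<open>\<zeta>\<close> and the
    smoothing margin \<open>H\<close> of \<open>boot_root\<close>, so that the bootstrap
    distribution function at \<open>t0\<close> is below \<open>1 - \<alpha>\<close>.\<close>
  define t0 where "t0 = t1 - \<zeta> - H"
  have t1: "2 * c \<le> t1" "?F t1 < \<theta>" "\<theta> \<le> ?F (t1 + h)"
    using m' k h m by (simp_all add: t1_def algebra_simps)
  have low_t: "c \<le> t0 - \<zeta>" using t1(1) small by (simp add: t0_def \<zeta>_def H_def)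
  \<comment> \<open>Another \<open>\<zeta>\<close> is lost in \<open>covered_if\<close>. With the
    grid width \<open>h = \<zeta> + H\<close> this makes a slab of width
    \<open>3 * \<zeta> + 2 * H\<close>.\<close>
  have eq: "t0 - \<zeta> + (3 * \<zeta> + 2 * H) = t1 + h" by (simp add: t0_def h_def)
  have "?F (t0 - \<zeta> + (3 * \<zeta> + 2 * H)) - ?F (t0 - \<zeta>) \<le> slab_err \<beta> \<rho> L l c (3 * \<zeta> + 2 * H)"
    by (rule slab_uniform[OF _ low_t par(1,2) _ par(3,4) big]) (use par \<zeta> H in auto)
  hence Fl: "\<theta> - slab_err \<beta> \<rho> L l c (3 * \<zeta> + 2 * H) \<le> ?F (t0 - \<zeta>)" using t1(3) unfolding eq by linarith
  obtain Bad where Bad: "Bad \<in> M.events" "M.prob Bad \<le> 30 * real n ^ 6 * exp (4 * bm^2 - sqrt (real n) * \<epsilon>)"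
    "AE \<omega> in M. \<omega> \<notin> Bad \<longrightarrow> good \<epsilon> (\<lambda>i. Y i \<omega>)"
    by (rule good_data[OF bm, of \<epsilon>])
  have B2: "2 * B \<le> sqrt (real n)" using bm by linarith
  have Z: "t0 \<le> bootstrap_quantile n D \<alpha> y" if "good \<epsilon> y" for y
  proof (rule quantile_ge[OF \<alpha>])
    have "measure_pmf.prob (bootstrap_pmf n y) {y'. root y y' \<le> t0} \<le> ?F (t0 + \<zeta> + H) + boot_err \<epsilon> \<beta>"
      using boot_root[OF that _ \<epsilon>(2) par(1) B2, of t0] \<epsilon> unfolding boot_err_def \<zeta>_def H_def by simp
    also have "t0 + \<zeta> + H = t1" by (simp add: t0_def)
    finally show "measure_pmf.prob (bootstrap_pmf n y) {y'. root y y' \<le> t0} < 1 - \<alpha>" using t1(2) by (simp add: \<theta>_def)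
  qed
  have "?F (t0 - \<zeta>) \<le> M.prob (E \<union> Bad)"
    unfolding cdf_max_def
  proof (rule M.finite_measure_mono_AE)
    show "AE \<omega> in M. \<omega> \<in> {\<omega> \<in> space M. \<forall>j\<in>J. S \<omega> j \<le> t0 - \<zeta>} \<longrightarrow> \<omega> \<in> E \<union> Bad"
      using Bad(3)
    proof eventually_elim
      case (elim \<omega>)
      show ?case
      proof (intro impI UnCI)
        assume h: "\<omega> \<in> {\<omega> \<in> space M. \<forall>j\<in>J. S \<omega> j \<le> t0 - \<zeta>}" and nb: "\<omega> \<notin> Bad"
        hence g: "good \<epsilon> (\<lambda>i. Y i \<omega>)" using elim by blast
        have "pop_cov_vec D P \<in> bootstrap_rectangle n D \<alpha> (\<lambda>i. Y i \<omega>)"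
          by (rule covered_if[OF g _ _ Z[OF g]]) (use h \<epsilon> in \<open>auto simp: \<zeta>_def\<close>)
        thus "\<omega> \<in> E" using E(2) h by blast
      qed
    qed
    show "E \<union> Bad \<in> M.events" using E(1) Bad(1) by blast
  qed
  also have "\<dots> \<le> M.prob E + M.prob Bad" by (rule measure_Un_le[OF E(1) Bad(1)])
  finally have "?F (t0 - \<zeta>) \<le> M.prob E + 30 * real n ^ 6 * exp (4 * bm^2 - sqrt (real n) * \<epsilon>)" using Bad(2) by linarith
  with Fl show ?thesis unfolding \<theta>_def \<zeta>_def H_def by linarith
qed

end

section \<open>Compactness and positive definite matrices\<close>

text \<open>Tychonoff's theorem. Vectors of any dimension live in
  \<open>nat \<Rightarrow> real\<close>, and padding with zeros keeps the box compact.\<close>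

lemma compact_box: "compact {x :: nat \<Rightarrow> real. (\<forall>p<m. \<bar>x p\<bar> \<le> R) \<and> (\<forall>p\<ge>m. x p = 0)}"
proof -
  have "compactin (product_topology (\<lambda>i::nat. euclidean) UNIV) (PiE UNIV (\<lambda>p. if p < m then {- R..R} else {0 :: real}))"
    by (subst compactin_PiE) auto
  hence "compact (PiE UNIV (\<lambda>p. if p < m then {- R..R} else {0 :: real}))"
    by (simp add: euclidean_product_topology)
  moreover have "PiE UNIV (\<lambda>p. if p < m then {- R..R} else {0 :: real}) = {x. (\<forall>p<m. \<bar>x p\<bar> \<le> R) \<and> (\<forall>p\<ge>m. x p = 0)}"
  proof (rule Set.set_eqI)
    fix x :: "nat \<Rightarrow> real"
    have "x p \<in> (if p < m then {- R..R} else {0}) \<longleftrightarrow> (p < m \<longrightarrow> \<bar>x p\<bar> \<le> R) \<and> (p \<ge> m \<longrightarrow> x p = 0)" for p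
      by auto
    thus "x \<in> PiE UNIV (\<lambda>p. if p < m then {- R..R} else {0}) \<longleftrightarrow> x \<in> {x. (\<forall>p<m. \<bar>x p\<bar> \<le> R) \<and> (\<forall>p\<ge>m. x p = 0)}"
      unfolding PiE_UNIV_domain Pi_iff mem_Collect_eq by blast
  qed
  ultimately show ?thesis by simp
qed

text \<open>The tube lemma: projection along a compact factor maps closed sets to closed sets. It
  makes an existential quantifier over an uncountable set harmless for measurability.\<close>

lemma closed_projection:
  fixes K :: "'a::topological_space set" and T :: "('a \<times> 'b::topological_space) set"
  assumes K: "compact K" and T: "closed T"
  shows "closed {y. \<exists>x\<in>K. (x, y) \<in> T}"
proof -
  define Q where "Q = {y. \<exists>x\<in>K. (x, y) \<in> T}"
  have "\<exists>B. open B \<and> y \<in> B \<and> B \<subseteq> - Q" if y: "y \<notin> Q" for y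
  proof -
    have "\<exists>A B. open A \<and> open B \<and> x \<in> A \<and> y \<in> B \<and> A \<times> B \<subseteq> - T" if x: "x \<in> K" for x
    proof -
      have "open (- T)" "(x, y) \<in> - T" using T y x by (auto simp: Q_def)
      thus ?thesis by (rule open_prod_elim) auto
    qed
    then obtain A B where AB: "\<And>x. x \<in> K \<Longrightarrow> open (A x)" "\<And>x. x \<in> K \<Longrightarrow> open (B x)" "\<And>x. x \<in> K \<Longrightarrow> x \<in> A x"
      "\<And>x. x \<in> K \<Longrightarrow> y \<in> B x" "\<And>x. x \<in> K \<Longrightarrow> A x \<times> B x \<subseteq> - T" by metis
    obtain C where C: "C \<subseteq> K" "finite C" "K \<subseteq> (\<Union>x\<in>C. A x)"
      by (rule compactE_image[OF K, of K A]) (use AB in auto)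
    have "open (\<Inter>x\<in>C. B x)" using C AB by (intro open_INT) auto
    moreover have "y \<in> (\<Inter>x\<in>C. B x)" using C AB by auto
    moreover have "(\<Inter>x\<in>C. B x) \<subseteq> - Q"
    proof
      fix z assume z: "z \<in> (\<Inter>x\<in>C. B x)"
      show "z \<in> - Q"
      proof
        assume "z \<in> Q"
        then obtain x where x: "x \<in> K" "(x, z) \<in> T" by (auto simp: Q_def)
        then obtain c where c: "c \<in> C" "x \<in> A c" using C(3) by blast
        hence "(x, z) \<in> A c \<times> B c" using z by blast
        thus False using AB(5)[of c] c(1) C(1) x(2) by blast
      qed
    qed
    ultimately show ?thesis by blast
  qed
  hence "open (- Q)" unfolding open_subopen[of "- Q"] by simp
  thus ?thesis unfolding Q_def[symmetric] closed_def .
qed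

lemma continuous_on_coordinate [continuous_intros]: "continuous_on A (\<lambda>x :: nat \<Rightarrow> real. x p)"
  by (rule continuous_on_subset[OF continuous_on_product_coordinates]) simp

section \<open>Rayleigh quotients and the domain of the partial correlation map\<close>

definition quad :: "nat \<Rightarrow> real mat \<Rightarrow> (nat \<Rightarrow> real) \<Rightarrow> real" where
  "quad D S x = (\<Sum>j<D. \<Sum>k<D. x j * x k * S $$ (j, k))"

text \<open>The minimiser of the Rayleigh quotient on the unit sphere is an eigenvector.\<close>

lemma lambda_min_quad:
  assumes S: "S \<in> carrier_mat D D" and sym: "\<And>j k. j < D \<Longrightarrow> k < D \<Longrightarrow> S $$ (j, k) = S $$ (k, j)" and D: "1 \<le> D"
  shows "lambda_min S * (\<Sum>j<D. (x j)^2) \<le> quad D S x"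
proof -
  let ?N = "\<lambda>x :: nat \<Rightarrow> real. \<Sum>j<D. (x j)^2"
  let ?K = "{x :: nat \<Rightarrow> real. (\<forall>p<D. \<bar>x p\<bar> \<le> 1) \<and> (\<forall>p\<ge>D. x p = 0)} \<inter> {x. ?N x = 1}"
  have cN: "continuous_on UNIV ?N" by (intro continuous_intros)
  have "closed {x. ?N x = 1}" by (intro closed_Collect_eq cN continuous_intros)
  hence K: "compact ?K" by (rule compact_Int_closed[OF compact_box])
  define e0 :: "nat \<Rightarrow> real" where "e0 = (\<lambda>p. if p = 0 then 1 else 0)"
  have "?N e0 = (\<Sum>j<D. if j = 0 then 1 else 0)" by (intro sum.cong) (auto simp: e0_def)
  also have "\<dots> = 1" using D by simp
  finally have "e0 \<in> ?K" using D by (simp add: e0_def)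
  hence ne: "?K \<noteq> {}" by (rule ex_in_conv[THEN iffD1, OF exI])
  have "continuous_on ?K (quad D S)" unfolding quad_def by (intro continuous_intros)
  from continuous_attains_inf[OF K ne this] obtain z where zK: "z \<in> ?K" and z: "\<forall>y\<in>?K. quad D S z \<le> quad D S y"
    by (elim bexE)
  define l where "l = quad D S z"
  have zN: "?N z = 1" using zK by blast
  have cong: "quad D S y = quad D S y'" "?N y = ?N y'" if "\<And>j. j < D \<Longrightarrow> y j = y' j" for y y'
    unfolding quad_def using that by (auto intro!: sum.cong)
  have scale: "quad D S (\<lambda>j. c * y j) = c^2 * quad D S y" "?N (\<lambda>j. c * y j) = c^2 * ?N y" for c y
    unfolding quad_def by (simp_all add: sum_distrib_left power2_eq_square ac_simps)
  have low: "l * ?N y \<le> quad D S y" for y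
  proof (cases "?N y = 0")
    case True
    hence "\<forall>j<D. y j = 0" by (simp add: sum_nonneg_eq_0_iff)
    hence "quad D S y = 0" unfolding quad_def by simp
    thus ?thesis using True by simp
  next
    case False
    have N0: "0 < ?N y" using False by (metis order_le_less sum_nonneg zero_le_power2)
    define c where "c = 1 / sqrt (?N y)"
    define y' where "y' = (\<lambda>j. if j < D then c * y j else 0)"
    have c2: "c^2 = 1 / ?N y" using N0 by (simp add: c_def power_divide)
    have N1: "?N y' = 1" using cong(2)[of y' "\<lambda>j. c * y j"] scale(2)[of c y] c2 N0 by (simp add: y'_def)
    have "\<bar>y' p\<bar> \<le> 1" if "p < D" for p
    proof -
      have "(y' p)^2 \<le> ?N y'" by (rule member_le_sum) (use that in auto)
      thus ?thesis using N1 by (simp add: abs_square_le_1)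
    qed
    hence "y' \<in> ?K" using N1 by (auto simp: y'_def)
    hence "l \<le> quad D S y'" unfolding l_def by (rule z[rule_format])
    also have "\<dots> = quad D S y / ?N y" using cong(1)[of y' "\<lambda>j. c * y j"] scale(1)[of c y] c2 by (simp add: y'_def)
    finally show ?thesis using N0 by (simp add: field_simps)
  qed
  define w where "w = (\<lambda>j. (\<Sum>k<D. S $$ (j, k) * z k) - l * z j)"
  \<comment> \<open>Moving from the minimiser \<open>z\<close> along its residual \<open>w\<close>
    changes the form to first order by \<open>2 * t\<close> times the squared norm of
    \<open>w\<close>, so minimality will force \<open>w\<close> to vanish on the first
    \<open>D\<close> coordinates.\<close>
  have exp: "quad D S (\<lambda>j. z j + t * w j) - l * ?N (\<lambda>j. z j + t * w j) = 2 * t * ?N w + t^2 * (quad D S w - l * ?N w)" for t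
  proof -
    have q: "quad D S (\<lambda>j. z j + t * w j) = quad D S z + 2 * t * (\<Sum>j<D. w j * (\<Sum>k<D. S $$ (j, k) * z k)) + t^2 * quad D S w"
    proof -
      have s: "(\<Sum>j<D. \<Sum>k<D. z j * w k * S $$ (j, k)) = (\<Sum>j<D. \<Sum>k<D. w j * z k * S $$ (j, k))"
        by (subst sum.swap) (auto intro!: sum.cong simp: sym ac_simps)
      have "quad D S (\<lambda>j. z j + t * w j) = (\<Sum>j<D. \<Sum>k<D. z j * z k * S $$ (j, k)) + t * (\<Sum>j<D. \<Sum>k<D. z j * w k * S $$ (j, k))
         + t * (\<Sum>j<D. \<Sum>k<D. w j * z k * S $$ (j, k)) + t^2 * (\<Sum>j<D. \<Sum>k<D. w j * w k * S $$ (j, k))"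
        unfolding quad_def by (simp add: sum.distrib sum_distrib_left algebra_simps power2_eq_square)
      also have "(\<Sum>j<D. \<Sum>k<D. w j * z k * S $$ (j, k)) = (\<Sum>j<D. w j * (\<Sum>k<D. S $$ (j, k) * z k))"
        by (simp add: sum_distrib_left ac_simps)
      finally show ?thesis unfolding s by (simp add: quad_def sum_distrib_left ac_simps)
    qed
    have n: "?N (\<lambda>j. z j + t * w j) = ?N z + 2 * t * (\<Sum>j<D. w j * z j) + t^2 * ?N w"
      by (simp add: power2_sum sum.distrib sum_distrib_left power_mult_distrib ac_simps)
    have "(\<Sum>j<D. w j * (\<Sum>k<D. S $$ (j, k) * z k)) - l * (\<Sum>j<D. w j * z j) = ?N w"
    proof -
      have "w j * (\<Sum>k<D. S $$ (j, k) * z k) - l * (w j * z j) = (w j)^2" for j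
        unfolding w_def by (simp add: power2_eq_square algebra_simps)
      thus ?thesis by (simp add: sum_subtractf[symmetric] sum_distrib_left)
    qed
    thus ?thesis unfolding q n zN by (simp add: l_def algebra_simps)
  qed
  have Nw: "?N w = 0"
  proof (rule ccontr)
    assume "?N w \<noteq> 0"
    hence N0: "0 < ?N w" by (metis order_le_less sum_nonneg zero_le_power2)
    define C where "C = quad D S w - l * ?N w"
    \<comment> \<open>Negative, and so small that the quadratic term cannot outweigh the linear one;
      the summand 1 avoids a division by zero.\<close>
    define t where "t = - ?N w / (\<bar>C\<bar> + 1)"
    have t0: "t < 0" unfolding t_def using N0 by (simp add: divide_neg_pos)
    have "0 \<le> 2 * t * ?N w + t^2 * C" using exp[of t] low[of "\<lambda>j. z j + t * w j"] unfolding C_def by linarith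
    hence "0 \<le> t * (2 * ?N w + t * C)" by (simp add: algebra_simps power2_eq_square)
    hence "2 * ?N w + t * C \<le> 0" using t0 by (simp add: zero_le_mult_iff)
    moreover have "\<bar>t * C\<bar> \<le> ?N w"
    proof -
      have "\<bar>t * C\<bar> = ?N w * (\<bar>C\<bar> / (\<bar>C\<bar> + 1))" using N0 by (simp add: t_def abs_mult)
      also have "\<dots> \<le> ?N w * 1" using N0 by (intro mult_left_mono) auto
      finally show ?thesis by simp
    qed
    ultimately show False using N0 by linarith
  qed
  hence w0: "w j = 0" if "j < D" for j using that by (simp add: sum_nonneg_eq_0_iff)
  have "eigenvector S (vec D z) l"
    unfolding eigenvector_def
  proof (intro conjI)
    show "vec D z \<in> carrier_vec (dim_row S)" using S by auto
    show "vec D z \<noteq> 0\<^sub>v (dim_row S)"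
    proof
      assume "vec D z = 0\<^sub>v (dim_row S)"
      hence "vec D z $ j = 0" if "j < D" for j using S that by simp
      hence "?N z = 0" by simp
      thus False using zN by simp
    qed
    show "S *\<^sub>v vec D z = l \<cdot>\<^sub>v vec D z"
    proof (rule eq_vecI)
      fix j assume "j < dim_vec (l \<cdot>\<^sub>v vec D z)"
      hence j: "j < D" by simp
      have "(S *\<^sub>v vec D z) $ j = (\<Sum>k<D. S $$ (j, k) * z k)"
        using S j by (simp add: scalar_prod_def atLeast0LessThan)
      thus "(S *\<^sub>v vec D z) $ j = (l \<cdot>\<^sub>v vec D z) $ j" using w0[OF j] j by (simp add: w_def)
    qed (use S in auto)
  qed
  hence "l \<in> spectrum S" by (auto simp: spectrum_def eigenvalue_def)
  hence "lambda_min S \<le> l" unfolding lambda_min_def using card_finite_spectrum(1)[OF S] by simp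
  hence "lambda_min S * ?N x \<le> l * ?N x" by (intro mult_right_mono) (auto intro: sum_nonneg)
  thus ?thesis using low[of x] by linarith
qed

text \<open>The kernel is trivial, so an inverse exists. Its column \<open>x\<close> number
  \<open>j\<close> satisfies \<open>S x = unit_vec D j\<close>, so the diagonal entry of the inverse
  is the value of the positive form at \<open>x\<close>.\<close>

lemma positive_definite_G_dom:
  assumes S: "S \<in> carrier_mat D D" and pos: "\<And>x. (\<exists>j<D. x j \<noteq> 0) \<Longrightarrow> 0 < quad D S x"
  shows "vectorize S \<in> G_dom D"
proof -
  have quad: "vec D x \<bullet> (S *\<^sub>v vec D x) = quad D S x" for x
    using S by (simp add: scalar_prod_def quad_def atLeast0LessThan sum_distrib_left ac_simps)
  have det: "det S \<noteq> 0"
  proof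
    assume "det S = 0"
    then obtain v where v: "v \<in> carrier_vec D" "v \<noteq> 0\<^sub>v D" "S *\<^sub>v v = 0\<^sub>v D"
      using det_0_iff_vec_prod_zero_field[OF S] by blast
    have e: "v = vec D (\<lambda>j. v $ j)" using v by auto
    have "\<exists>j<D. v $ j \<noteq> 0" using v(1,2) by (metis carrier_vecD eq_vecI index_zero_vec)
    from pos[OF this] quad[of "\<lambda>j. v $ j"] have "0 < v \<bullet> (S *\<^sub>v v)" using e by simp
    thus False using v by simp
  qed
  then obtain Om where Om: "mat_inverse S = Some Om"
    using mat_inverse(1)[OF S, of "()"] det_non_zero_imp_unit[OF S det, of "()"] by (cases "mat_inverse S") auto
  have inv: "S * Om = 1\<^sub>m D" "Om \<in> carrier_mat D D" using mat_inverse(2)[OF S Om] by auto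
  have dpos: "0 < Om $$ (j, j)" if j: "j < D" for j
  proof -
    let ?x = "col Om j"
    have x: "?x \<in> carrier_vec D" "?x = vec D (\<lambda>i. ?x $ i)" using inv j by auto
    have Sx: "S *\<^sub>v ?x = unit_vec D j"
    proof -
      have "col (S * Om) j = S *\<^sub>v ?x" by (rule col_mult2[OF S inv(2) j])
      thus ?thesis unfolding inv(1) using j by simp
    qed
    have "\<exists>i<D. ?x $ i \<noteq> 0"
    proof (rule ccontr)
      assume "\<not> ?thesis"
      hence "?x = 0\<^sub>v D" using x inv(2) by (intro eq_vecI) auto
      moreover have "S *\<^sub>v 0\<^sub>v D = 0\<^sub>v D" using S by (intro eq_vecI) (auto simp: scalar_prod_def)
      ultimately have "S *\<^sub>v ?x = 0\<^sub>v D" by simp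
      hence "unit_vec D j $ j = (0 :: real)" using Sx j by simp
      thus False using j by simp
    qed
    from pos[OF this] have "0 < ?x \<bullet> (S *\<^sub>v ?x)" using quad[of "\<lambda>i. ?x $ i"] x(2) by simp
    thus ?thesis unfolding Sx using x j inv by simp
  qed
  have un: "unvectorize D (vectorize S) = S"
  proof (rule eq_matI)
    fix j k assume "j < dim_row S" "k < dim_col S"
    hence jk: "j < D" "k < D" using S by auto
    have "k * D + j < k * D + D" using jk by simp
    also have "\<dots> = (k + 1) * D" by simp
    also have "\<dots> \<le> D * D" using jk by (intro mult_right_mono) auto
    finally have "k * D + j < D * D" .
    thus "unvectorize D (vectorize S) $$ (j, k) = S $$ (j, k)" using S jk by (simp add: unvectorize_def vectorize_def)
  qed (use S in \<open>auto simp: unvectorize_def\<close>)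
  have "vectorize S \<in> carrier_vec (D * D)" using S by (simp add: vectorize_def)
  thus ?thesis unfolding G_dom_def mem_Collect_eq un using Om dpos by auto
qed

section \<open>Measurability of the coverage event\<close>

lemma continuous_on_det:
  assumes "\<And>i j. i < m \<Longrightarrow> j < m \<Longrightarrow> continuous_on S (\<lambda>x :: nat \<Rightarrow> real. F x $$ (i, j))"
    and "\<And>x. F x \<in> carrier_mat m m"
  shows "continuous_on S (\<lambda>x. det (F x) :: real)"
proof -
  have d: "det (F x) = (\<Sum>p | p permutes {0..<m}. signof p * (\<Prod>i = 0..<m. F x $$ (i, p i)))" for x
    using assms(2)[of x] by (simp add: det_def)
  show ?thesis unfolding d
    by (intro continuous_intros assms(1)) (auto dest: permutes_in_image)
qed

lemma continuous_on_adj_mat: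
  assumes F: "\<And>i j. i < m \<Longrightarrow> j < m \<Longrightarrow> continuous_on S (\<lambda>x :: nat \<Rightarrow> real. F x $$ (i, j))"
    and c: "\<And>x. F x \<in> carrier_mat m m" and ij: "i < m" "j < m"
  shows "continuous_on S (\<lambda>x. adj_mat (F x) $$ (i, j) :: real)"
proof -
  have e: "adj_mat (F x) $$ (i, j) = (- 1) ^ (j + i) * det (mat_delete (F x) j i)" for x
    using c[of x] ij by (simp add: adj_mat_def cofactor_def)
  have "continuous_on S (\<lambda>x. det (mat_delete (F x) j i))"
  proof (rule continuous_on_det[where m="m - 1"])
    fix k l assume kl: "k < m - 1" "l < m - 1"
    have "mat_delete (F x) j i $$ (k, l) = F x $$ (if k < j then k else Suc k, if l < i then l else Suc l)" for x
      using c[of x] kl by (simp add: mat_delete_def)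
    thus "continuous_on S (\<lambda>x. mat_delete (F x) j i $$ (k, l))"
      using F kl by (auto intro: F)
  next
    show "mat_delete (F x) j i \<in> carrier_mat (m - 1) (m - 1)" for x using mat_delete_carrier[OF c] .
  qed
  thus ?thesis unfolding e by (intro continuous_intros)
qed

text \<open>\<open>unvectorize\<close> on coordinate functions, where the product topology is at
  hand.\<close>

definition mat_of :: "nat \<Rightarrow> (nat \<Rightarrow> real) \<Rightarrow> real mat" where
  "mat_of D x = mat D D (\<lambda>(j, k). x (k * D + j))"

lemma mat_of_carrier [simp]: "mat_of D x \<in> carrier_mat D D" by (simp add: mat_of_def)

lemma continuous_on_mat_of: "j < D \<Longrightarrow> k < D \<Longrightarrow> continuous_on S (\<lambda>x. mat_of D x $$ (j, k))"
  by (simp add: mat_of_def continuous_intros)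

text \<open>Cramer's rule. It expresses the partial correlations by polynomials in the entries,
  which are continuous everywhere.\<close>

lemma mat_inverse_adj:
  assumes A: "A \<in> carrier_mat D D" and d: "det A \<noteq> (0::real)"
  shows "\<exists>Om. mat_inverse A = Some Om \<and> (\<forall>j<D. \<forall>k<D. Om $$ (j, k) = adj_mat A $$ (j, k) / det A)"
proof -
  obtain Om where Om: "mat_inverse A = Some Om"
    using mat_inverse(1)[OF A, of "()"] det_non_zero_imp_unit[OF A d, of "()"] by (cases "mat_inverse A") auto
  have inv: "A * Om = 1\<^sub>m D" "Om \<in> carrier_mat D D" using mat_inverse(2)[OF A Om] by auto
  note adj = adj_mat[OF A]
  have "adj_mat A * (A * Om) = (adj_mat A * A) * Om" by (rule assoc_mult_mat[symmetric, OF adj(1) A inv(2)])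
  moreover have "adj_mat A * 1\<^sub>m D = adj_mat A" using adj(1) by simp
  moreover have "(det A \<cdot>\<^sub>m 1\<^sub>m D) * Om = det A \<cdot>\<^sub>m (1\<^sub>m D * Om)"
    by (rule mult_smult_assoc_mat[OF one_carrier_mat inv(2)])
  moreover have "1\<^sub>m D * Om = Om" using inv(2) by simp
  ultimately have "adj_mat A = det A \<cdot>\<^sub>m Om" using adj inv by simp
  hence "adj_mat A $$ (j, k) = det A * Om $$ (j, k)" if "j < D" "k < D" for j k using that inv by simp
  thus ?thesis using Om d by auto
qed

lemma det_nonzero_if_mat_inverse:
  assumes A: "A \<in> carrier_mat D D" and Om: "mat_inverse A = Some Om"
  shows "det A \<noteq> (0::real)"
proof -
  have inv: "A * Om = 1\<^sub>m D" "Om \<in> carrier_mat D D" using mat_inverse(2)[OF A Om] by auto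
  have "det A * det Om = 1" using det_mult[OF A inv(2)] inv(1) by simp
  thus ?thesis by auto
qed

text \<open>
  The fibre of \<open>G_map\<close> over \<open>\<theta>\<close> is not closed, but it is a countable union of compact sets: bound the entries
  and keep the determinant and the products of diagonal cofactors away from 0.
\<close>

definition fibre :: "nat \<Rightarrow> real vec \<Rightarrow> nat \<Rightarrow> (nat \<Rightarrow> real) set" where
  "fibre D \<theta> m = {x. (\<forall>p<D * D. \<bar>x p\<bar> \<le> real m) \<and> (\<forall>p\<ge>D * D. x p = 0)} \<inter>
     {x. 1 / real (Suc m) \<le> \<bar>det (mat_of D x)\<bar>} \<inter>
     (\<Inter>j\<in>{..<D}. \<Inter>k\<in>{..<D}. {x. 1 / real (Suc m) \<le> adj_mat (mat_of D x) $$ (j, j) * adj_mat (mat_of D x) $$ (k, k)}) \<inter>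
     (\<Inter>j\<in>{..<D}. \<Inter>k\<in>{..<D}. {x. - adj_mat (mat_of D x) $$ (j, k) * \<bar>det (mat_of D x)\<bar> =
        \<theta> $ (k * D + j) * (det (mat_of D x) * sqrt (adj_mat (mat_of D x) $$ (j, j) * adj_mat (mat_of D x) $$ (k, k)))})"

lemma compact_fibre: "compact (fibre D \<theta> m)"
proof -
  have cd: "continuous_on UNIV (\<lambda>x. det (mat_of D x))"
    by (rule continuous_on_det[OF continuous_on_mat_of mat_of_carrier])
  have ca: "continuous_on UNIV (\<lambda>x. adj_mat (mat_of D x) $$ (j, k))" if "j < D" "k < D" for j k
    by (rule continuous_on_adj_mat[OF continuous_on_mat_of mat_of_carrier that])
  have 1: "closed {x. 1 / real (Suc m) \<le> \<bar>det (mat_of D x)\<bar>}"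
    by (intro closed_Collect_le continuous_intros cd)
  have 2: "closed {x. 1 / real (Suc m) \<le> adj_mat (mat_of D x) $$ (j, j) * adj_mat (mat_of D x) $$ (k, k)}" if "j < D" "k < D" for j k
    by (intro closed_Collect_le continuous_intros ca that)
  have 3: "closed {x. - adj_mat (mat_of D x) $$ (j, k) * \<bar>det (mat_of D x)\<bar> =
        \<theta> $ (k * D + j) * (det (mat_of D x) * sqrt (adj_mat (mat_of D x) $$ (j, j) * adj_mat (mat_of D x) $$ (k, k)))}" if "j < D" "k < D" for j k
    by (intro closed_Collect_eq continuous_intros ca cd that)
  show ?thesis unfolding fibre_def
    by (intro compact_Int_closed compact_box 1 closed_INT ballI 2 3) auto
qed

lemma mat_of_unvectorize:
  assumes "a \<in> carrier_vec (D * D)" "\<And>p. p < D * D \<Longrightarrow> a $ p = x p"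
  shows "unvectorize D a = mat_of D x"
proof (rule eq_matI)
  fix j k assume "j < dim_row (mat_of D x)" "k < dim_col (mat_of D x)"
  hence jk: "j < D" "k < D" by (auto simp: mat_of_def)
  have "k * D + j < k * D + D" using jk by simp
  also have "\<dots> = (k + 1) * D" by simp
  also have "\<dots> \<le> D * D" using jk by (intro mult_right_mono) auto
  finally have "k * D + j < D * D" .
  thus "unvectorize D a $$ (j, k) = mat_of D x $$ (j, k)" using assms jk by (simp add: unvectorize_def mat_of_def)
qed (auto simp: unvectorize_def mat_of_def)

text \<open>The square root of \<open>d^2\<close> is the absolute value of \<open>d\<close>. After
  clearing denominators both sides are continuous even where \<open>d\<close> vanishes, as
  closedness of the fibre requires.\<close>

lemma partial_corr_ratio:
  fixes d p q r s t :: real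
  assumes "d \<noteq> 0" "0 < p * q"
  shows "- (r / d) / sqrt (p / d * (q / d)) = t \<longleftrightarrow> - r * \<bar>d\<bar> = t * (d * sqrt (p * q))"
proof -
  have e: "sqrt (p / d * (q / d)) = sqrt (p * q) / \<bar>d\<bar>" by (simp add: real_sqrt_divide)
  define s where "s = sqrt (p * q)"
  have "s \<noteq> 0" using assms by (auto simp: s_def)
  thus ?thesis unfolding e s_def[symmetric] using assms(1) by (simp add: field_simps)
qed

text \<open>Membership in the image becomes the existence of a point of some compact fibre near the
  sample covariance, the form to which \<open>closed_projection\<close> applies.\<close>

lemma partial_corr_region_iff:
  assumes \<theta>: "\<theta> \<in> carrier_vec (D * D)" and D: "1 \<le> D"
  shows "\<theta> \<in> partial_corr_region n D \<alpha> y \<longleftrightarrow>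
    (\<exists>m. \<exists>x\<in>fibre D \<theta> m. \<forall>p<D * D. \<bar>x p - sample_cov_vec n D y $ p\<bar> \<le> bootstrap_quantile n D \<alpha> y / sqrt (real n))"
    (is "_ = (\<exists>m. \<exists>x\<in>fibre D \<theta> m. ?near x)")
proof -
  have rect: "a \<in> bootstrap_rectangle n D \<alpha> y \<longleftrightarrow> ?near x" if a: "a \<in> carrier_vec (D * D)" "\<forall>p<D * D. a $ p = x p" for a x
    unfolding bootstrap_rectangle_def using a D by (simp add: sup_norm_le_iff[where m="D * D"])
  have G: "a \<in> G_dom D \<and> G_map D a = \<theta> \<longleftrightarrow> det (mat_of D x) \<noteq> 0 \<and>
      (\<forall>j<D. \<forall>k<D. 0 < adj_mat (mat_of D x) $$ (j, j) * adj_mat (mat_of D x) $$ (k, k)) \<and>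
      (\<forall>j<D. \<forall>k<D. - adj_mat (mat_of D x) $$ (j, k) * \<bar>det (mat_of D x)\<bar> =
        \<theta> $ (k * D + j) * (det (mat_of D x) * sqrt (adj_mat (mat_of D x) $$ (j, j) * adj_mat (mat_of D x) $$ (k, k))))"
    if a: "a \<in> carrier_vec (D * D)" "\<forall>p<D * D. a $ p = x p" for a x
  proof -
    have un: "unvectorize D a = mat_of D x" by (rule mat_of_unvectorize[OF a(1)]) (use a(2) in auto)
    show ?thesis
  proof (cases "det (mat_of D x) = 0")
    case True
    have "a \<notin> G_dom D"
      unfolding G_dom_def mem_Collect_eq un using det_nonzero_if_mat_inverse[OF mat_of_carrier, of D x] True by auto
    thus ?thesis using True by simp
  next
    case False
    obtain Om where Om: "mat_inverse (mat_of D x) = Some Om"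
      "\<And>j k. j < D \<Longrightarrow> k < D \<Longrightarrow> Om $$ (j, k) = adj_mat (mat_of D x) $$ (j, k) / det (mat_of D x)"
      using mat_inverse_adj[OF mat_of_carrier False] by blast
    have dom: "a \<in> G_dom D \<longleftrightarrow> (\<forall>j<D. \<forall>k<D. 0 < adj_mat (mat_of D x) $$ (j, j) * adj_mat (mat_of D x) $$ (k, k))"
    proof -
      have "a \<in> G_dom D \<longleftrightarrow> (\<forall>j<D. \<forall>k<D. Om $$ (j, j) * Om $$ (k, k) > 0)"
        unfolding G_dom_def using a(1) Om(1) un by simp
      also have "\<dots> \<longleftrightarrow> (\<forall>j<D. \<forall>k<D. 0 < adj_mat (mat_of D x) $$ (j, j) * adj_mat (mat_of D x) $$ (k, k))"
      proof -
        have "0 < p / d * (q / d) \<longleftrightarrow> 0 < p * q" if "d \<noteq> 0" for p q d :: real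
          using that by (auto simp: zero_less_mult_iff zero_less_divide_iff)
        thus ?thesis using False by (simp add: Om(2))
      qed
      finally show ?thesis .
    qed
    have map: "G_map D a = \<theta> \<longleftrightarrow> (\<forall>j<D. \<forall>k<D. - (Om $$ (j, k)) / sqrt (Om $$ (j, j) * Om $$ (k, k)) = \<theta> $ (k * D + j))"
    proof -
      have Gv: "G_map D a = vec (D * D) (\<lambda>p. - (Om $$ (p mod D, p div D)) / sqrt (Om $$ (p mod D, p mod D) * Om $$ (p div D, p div D)))"
        unfolding G_map_def vectorize_def partial_corr_def un Let_def Om(1)
        using D by (auto simp: less_mult_imp_div_less)
      show ?thesis
      proof
        assume g: "G_map D a = \<theta>"
        show "\<forall>j<D. \<forall>k<D. - (Om $$ (j, k)) / sqrt (Om $$ (j, j) * Om $$ (k, k)) = \<theta> $ (k * D + j)"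
        proof (intro allI impI)
          fix j k assume jk: "j < D" "k < D"
          have "k * D + j < k * D + D" using jk by simp
          also have "\<dots> = (k + 1) * D" by simp
          also have "\<dots> \<le> D * D" using jk by (intro mult_right_mono) auto
          finally have l: "k * D + j < D * D" .
          have md: "(k * D + j) mod D = j" "(k * D + j) div D = k" using jk by auto
          have "\<theta> $ (k * D + j) = G_map D a $ (k * D + j)" using g by simp
          also have "\<dots> = - (Om $$ (j, k)) / sqrt (Om $$ (j, j) * Om $$ (k, k))"
            unfolding Gv index_vec[OF l] md ..
          finally show "- (Om $$ (j, k)) / sqrt (Om $$ (j, j) * Om $$ (k, k)) = \<theta> $ (k * D + j)" by simp
        qed
      next
        assume h: "\<forall>j<D. \<forall>k<D. - (Om $$ (j, k)) / sqrt (Om $$ (j, j) * Om $$ (k, k)) = \<theta> $ (k * D + j)"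
        show "G_map D a = \<theta>"
        proof (rule eq_vecI)
          show "dim_vec (G_map D a) = dim_vec \<theta>" using \<theta> Gv by simp
          fix p assume "p < dim_vec \<theta>"
          hence p: "p < D * D" using \<theta> by simp
          hence "p mod D < D" "p div D < D" using D by (auto simp: less_mult_imp_div_less)
          from h[rule_format, OF this] show "G_map D a $ p = \<theta> $ p"
            unfolding Gv index_vec[OF p] by simp
        qed
      qed
    qed
    have r: "(- (Om $$ (j, k)) / sqrt (Om $$ (j, j) * Om $$ (k, k)) = \<theta> $ (k * D + j)) \<longleftrightarrow>
      (- adj_mat (mat_of D x) $$ (j, k) * \<bar>det (mat_of D x)\<bar> =
        \<theta> $ (k * D + j) * (det (mat_of D x) * sqrt (adj_mat (mat_of D x) $$ (j, j) * adj_mat (mat_of D x) $$ (k, k))))"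
      if "j < D" "k < D" "0 < adj_mat (mat_of D x) $$ (j, j) * adj_mat (mat_of D x) $$ (k, k)" for j k
      unfolding Om(2)[OF that(1,2)] Om(2)[OF that(1) that(1)] Om(2)[OF that(2) that(2)]
      by (rule partial_corr_ratio[OF False that(3)])
    have "(\<forall>j<D. \<forall>k<D. - (Om $$ (j, k)) / sqrt (Om $$ (j, j) * Om $$ (k, k)) = \<theta> $ (k * D + j)) \<longleftrightarrow>
      (\<forall>j<D. \<forall>k<D. - adj_mat (mat_of D x) $$ (j, k) * \<bar>det (mat_of D x)\<bar> =
        \<theta> $ (k * D + j) * (det (mat_of D x) * sqrt (adj_mat (mat_of D x) $$ (j, j) * adj_mat (mat_of D x) $$ (k, k))))"
      if P: "\<forall>j<D. \<forall>k<D. 0 < adj_mat (mat_of D x) $$ (j, j) * adj_mat (mat_of D x) $$ (k, k)"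
      by (intro all_cong1 imp_cong refl r P[rule_format])
    thus ?thesis unfolding dom map using False by blast
  qed
  qed
  show ?thesis
  proof
    assume "\<theta> \<in> partial_corr_region n D \<alpha> y"
    then obtain a where a: "a \<in> bootstrap_rectangle n D \<alpha> y" "a \<in> G_dom D" "\<theta> = G_map D a"
      unfolding partial_corr_region_def by auto
    hence ac: "a \<in> carrier_vec (D * D)" by (simp add: bootstrap_rectangle_def)
    define x where "x = (\<lambda>p. if p < D * D then a $ p else 0)"
    have ax: "\<forall>p<D * D. a $ p = x p" by (simp add: x_def)
    note g = G[OF ac ax, THEN iffD1, OF conjI[OF a(2) a(3)[symmetric]]]
    define V where "V = (\<lambda>p. \<bar>x p\<bar>) ` {..<D * D}"
    \<comment> \<open>All numbers that \<open>m\<close> has to dominate: the absolute entries, and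
      the reciprocals of the absolute determinant and of the products of diagonal cofactors.\<close>
    define U where "U = insert (1 / \<bar>det (mat_of D x)\<bar>) (V \<union> (\<lambda>(j, k). 1 / (adj_mat (mat_of D x) $$ (j, j) * adj_mat (mat_of D x) $$ (k, k))) ` ({..<D} \<times> {..<D}))"
    have fU: "finite U" by (simp add: U_def V_def)
    obtain m :: nat where m: "Max U \<le> real m" using real_arch_simple by blast
    have Um: "z \<le> real m" if "z \<in> U" for z using Max_ge[OF fU that] m by linarith
    have inv: "1 / real (Suc m) \<le> z" if "1 / z \<le> real m" "0 < z" for z :: real
    proof -
      have "1 \<le> real m * z" using that by (simp add: divide_le_eq)
      also have "\<dots> \<le> real (Suc m) * z" using that by (intro mult_right_mono) auto
      finally show ?thesis by (simp add: divide_le_eq mult.commute)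
    qed
    have "x \<in> fibre D \<theta> m"
      unfolding fibre_def
    proof (intro IntI INT_I CollectI conjI allI impI)
      show "\<bar>x p\<bar> \<le> real m" if "p < D * D" for p by (rule Um) (use that in \<open>auto simp: U_def V_def\<close>)
      show "x p = 0" if "D * D \<le> p" for p using that by (simp add: x_def)
      show "1 / real (Suc m) \<le> \<bar>det (mat_of D x)\<bar>" by (rule inv, rule Um) (use g in \<open>auto simp: U_def\<close>)
      fix j k assume jk: "j \<in> {..<D}" "k \<in> {..<D}"
      show "1 / real (Suc m) \<le> adj_mat (mat_of D x) $$ (j, j) * adj_mat (mat_of D x) $$ (k, k)"
        by (rule inv, rule Um) (use g jk in \<open>auto simp: U_def\<close>)
      show "- adj_mat (mat_of D x) $$ (j, k) * \<bar>det (mat_of D x)\<bar> =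
        \<theta> $ (k * D + j) * (det (mat_of D x) * sqrt (adj_mat (mat_of D x) $$ (j, j) * adj_mat (mat_of D x) $$ (k, k)))"
        using g jk by blast
    qed
    moreover have "?near x" using rect[OF ac ax] a(1) by simp
    ultimately show "\<exists>m. \<exists>x\<in>fibre D \<theta> m. ?near x" by blast
  next
    assume "\<exists>m. \<exists>x\<in>fibre D \<theta> m. ?near x"
    then obtain m x where x: "x \<in> fibre D \<theta> m" "?near x" by blast
    define a where "a = vec (D * D) x"
    have ac: "a \<in> carrier_vec (D * D)" and ax: "\<forall>p<D * D. a $ p = x p" by (auto simp: a_def)
    have pos: "0 < z" if "1 / real (Suc m) \<le> z" for z :: real
      by (rule less_le_trans[OF _ that]) simp
    have "a \<in> G_dom D \<and> G_map D a = \<theta>"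
    proof (rule G[OF ac ax, THEN iffD2], intro conjI allI impI)
      have "0 < \<bar>det (mat_of D x)\<bar>" by (rule pos) (use x(1) in \<open>simp add: fibre_def\<close>)
      thus "det (mat_of D x) \<noteq> 0" by simp
      fix j k assume jk: "j < D" "k < D"
      show "0 < adj_mat (mat_of D x) $$ (j, j) * adj_mat (mat_of D x) $$ (k, k)"
        by (rule pos) (use x(1) jk in \<open>auto simp: fibre_def\<close>)
      show "- adj_mat (mat_of D x) $$ (j, k) * \<bar>det (mat_of D x)\<bar> =
        \<theta> $ (k * D + j) * (det (mat_of D x) * sqrt (adj_mat (mat_of D x) $$ (j, j) * adj_mat (mat_of D x) $$ (k, k)))"
        using x(1) jk unfolding fibre_def by blast
    qed
    moreover have "a \<in> bootstrap_rectangle n D \<alpha> y" using rect[OF ac ax] x(2) by simp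
    ultimately show "\<theta> \<in> partial_corr_region n D \<alpha> y" unfolding partial_corr_region_def by auto
  qed
qed

lemma sample_cov_vec_cong:
  assumes "\<And>i. i < n \<Longrightarrow> y i = z i" shows "sample_cov_vec n D y = sample_cov_vec n D z"
  using assms by (auto simp: sample_cov_vec_def sample_cov_def sample_mean_def vectorize_def intro!: eq_vecI sum.cong)

section \<open>Measurability of the bootstrap quantile and of the coverage event\<close>

context sample_setting
begin

lemma Y_component [measurable]: "i < n \<Longrightarrow> j < D \<Longrightarrow> (\<lambda>\<omega>. Y i \<omega> $ j) \<in> borel_measurable M"
  by (rule measurable_compose[OF Y_measurable' coordinate_measurable])

lemma sample_cov_vec_component:
  assumes f: "\<And>i. i < n \<Longrightarrow> f i < n" and p: "p < D * D"
  shows "(\<lambda>\<omega>. sample_cov_vec n D (\<lambda>i. Y (f i) \<omega>) $ p) \<in> borel_measurable M"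
proof -
  have jk: "p mod D < D" "p div D < D" using p D1 by (auto simp: less_mult_imp_div_less)
  have "sample_cov_vec n D (\<lambda>i. Y (f i) \<omega>) $ p =
    (\<Sum>i<n. (Y (f i) \<omega> $ (p mod D) - (\<Sum>i<n. Y (f i) \<omega> $ (p mod D)) / real n) * (Y (f i) \<omega> $ (p div D) - (\<Sum>i<n. Y (f i) \<omega> $ (p div D)) / real n)) / real n" for \<omega>
    using p jk by (simp add: sample_cov_vec_index sample_cov_def sample_mean_def)
  moreover have "(\<lambda>\<omega>. (\<Sum>i<n. (Y (f i) \<omega> $ (p mod D) - (\<Sum>i<n. Y (f i) \<omega> $ (p mod D)) / real n) * (Y (f i) \<omega> $ (p div D) - (\<Sum>i<n. Y (f i) \<omega> $ (p div D)) / real n)) / real n) \<in> borel_measurable M"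
    using f jk by (intro borel_measurable_divide borel_measurable_sum borel_measurable_times borel_measurable_diff borel_measurable_const Y_component) auto
  ultimately show ?thesis by simp
qed

text \<open>Resampling indices instead of observations makes the randomness independent of the data.\<close>

definition resample :: "(nat \<Rightarrow> nat) pmf" where
  "resample = Pi_pmf {..<n} n (\<lambda>_. pmf_of_set {..<n})"

lemma set_resample: "finite (set_pmf resample)" "h \<in> set_pmf resample \<Longrightarrow> i < n \<Longrightarrow> h i < n"
proof -
  have ne: "{..<n} \<noteq> {}" "finite {..<n}" using n2 by (auto simp: lessThan_empty_iff)
  have s: "set_pmf resample = PiE_dflt {..<n} n (set_pmf \<circ> (\<lambda>_. pmf_of_set {..<n}))"
    unfolding resample_def by (rule set_Pi_pmf) simp
  show "finite (set_pmf resample)" unfolding s by (rule finite_PiE_dflt) (auto simp: set_pmf_of_set[OF ne])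
  show "h i < n" if "h \<in> set_pmf resample" "i < n"
    using that unfolding s by (auto simp: PiE_dflt_def set_pmf_of_set[OF ne])
qed

lemma bootstrap_prob:
  "measure_pmf.prob (bootstrap_pmf n y) {y'. root y y' > q} =
    (\<Sum>h\<in>set_pmf resample. if root y (\<lambda>i. y (h i)) > q then pmf resample h else 0)"
proof -
  have ne: "{..<n} \<noteq> {}" "finite {..<n}" using n2 by (auto simp: lessThan_empty_iff)
  \<comment> \<open>The default index \<open>n\<close> of \<open>resample\<close> is out of range,
    and \<open>f n = undefined\<close> is the default of \<open>bootstrap_pmf\<close>; so
    composition with \<open>f\<close> maps one product law to the other.\<close>
  define f where "f = (\<lambda>i. if i < n then y i else undefined)"
  have e: "empirical_pmf n y = map_pmf f (pmf_of_set {..<n})"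
    unfolding empirical_pmf_def by (rule map_pmf_cong) (auto simp: f_def set_pmf_of_set[OF ne])
  have "bootstrap_pmf n y = Pi_pmf {..<n} (f n) (\<lambda>_. map_pmf f (pmf_of_set {..<n}))"
    unfolding bootstrap_pmf_def e by (simp add: f_def)
  also have "\<dots> = map_pmf (\<lambda>h. f \<circ> h) resample"
    unfolding resample_def by (rule Pi_pmf_map) auto
  finally have b: "bootstrap_pmf n y = map_pmf (\<lambda>h. f \<circ> h) resample" .
  have r: "root y (f \<circ> h) = root y (\<lambda>i. y (h i))" if "h \<in> set_pmf resample" for h
    using set_resample(2)[OF that] by (subst sample_cov_vec_cong[where z="\<lambda>i. y (h i)"]) (auto simp: f_def)
  have "measure_pmf.prob (bootstrap_pmf n y) {y'. root y y' > q} = measure_pmf.prob resample {h. root y (f \<circ> h) > q}"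
    unfolding b by (simp add: vimage_def)
  also have "\<dots> = measure_pmf.prob resample ({h. root y (f \<circ> h) > q} \<inter> set_pmf resample)"
    by (rule measure_Int_set_pmf[symmetric])
  also have "\<dots> = (\<Sum>h\<in>{h. root y (f \<circ> h) > q} \<inter> set_pmf resample. pmf resample h)"
    by (rule measure_measure_pmf_finite) (use set_resample(1) in auto)
  also have "\<dots> = (\<Sum>h\<in>set_pmf resample. if root y (f \<circ> h) > q then pmf resample h else 0)"
    using set_resample(1) by (simp add: sum.inter_restrict[symmetric] Int_commute sum.If_cases Int_def)
  also have "\<dots> = (\<Sum>h\<in>set_pmf resample. if root y (\<lambda>i. y (h i)) > q then pmf resample h else 0)"
    by (intro sum.cong refl) (simp only: r)
  finally show ?thesis .
qed

lemma root_less_measurable: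
  assumes h: "h \<in> set_pmf resample"
  shows "{\<omega> \<in> space M. root (\<lambda>i. Y i \<omega>) (\<lambda>i. Y (h i) \<omega>) > q} \<in> M.events"
proof -
  have hn: "\<And>i. i < n \<Longrightarrow> h i < n" using set_resample(2)[OF h] .
  have "root (\<lambda>i. Y i \<omega>) (\<lambda>i. Y (h i) \<omega>) > q \<longleftrightarrow>
    \<not> (\<forall>p\<in>{..<D * D}. \<bar>sample_cov_vec n D (\<lambda>i. Y (h i) \<omega>) $ p - sample_cov_vec n D (\<lambda>i. Y i \<omega>) $ p\<bar> \<le> q / sqrt (real n))" for \<omega>
  proof -
    have "root (\<lambda>i. Y i \<omega>) (\<lambda>i. Y (h i) \<omega>) \<le> q \<longleftrightarrow> sup_norm (sample_cov_vec n D (\<lambda>i. Y (h i) \<omega>) - sample_cov_vec n D (\<lambda>i. Y i \<omega>)) \<le> q / sqrt (real n)"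
      using n by (simp add: pos_le_divide_eq mult.commute)
    also have "\<dots> \<longleftrightarrow> (\<forall>p\<in>{..<D * D}. \<bar>sample_cov_vec n D (\<lambda>i. Y (h i) \<omega>) $ p - sample_cov_vec n D (\<lambda>i. Y i \<omega>) $ p\<bar> \<le> q / sqrt (real n))"
      using D1 by (subst sup_norm_le_iff[where m="D * D"]) auto
    finally show ?thesis by (simp add: not_le[symmetric])
  qed
  moreover have "{\<omega> \<in> space M. \<not> (\<forall>p\<in>{..<D * D}. \<bar>sample_cov_vec n D (\<lambda>i. Y (h i) \<omega>) $ p - sample_cov_vec n D (\<lambda>i. Y i \<omega>) $ p\<bar> \<le> q / sqrt (real n))} \<in> M.events"
  proof (rule sets.sets_Collect_neg, rule sets.sets_Collect_finite_All)
    fix p assume "p \<in> {..<D * D}"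
    hence "(\<lambda>\<omega>. sample_cov_vec n D (\<lambda>i. Y (h i) \<omega>) $ p) \<in> borel_measurable M" "(\<lambda>\<omega>. sample_cov_vec n D (\<lambda>i. Y i \<omega>) $ p) \<in> borel_measurable M"
      using sample_cov_vec_component[of h p] sample_cov_vec_component[of "\<lambda>i. i" p] hn by auto
    thus "{\<omega> \<in> space M. \<bar>sample_cov_vec n D (\<lambda>i. Y (h i) \<omega>) $ p - sample_cov_vec n D (\<lambda>i. Y i \<omega>) $ p\<bar> \<le> q / sqrt (real n)} \<in> M.events"
      by measurable
  qed simp
  ultimately show ?thesis by simp
qed

lemma quantile_bdd_below:
  assumes \<alpha>: "\<alpha> < 1" shows "bdd_below {z. measure_pmf.prob (bootstrap_pmf n y) {y'. root y y' > z} \<le> \<alpha>}"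
    and "measure_pmf.prob (bootstrap_pmf n y) {y'. root y y' > z} \<le> \<alpha> \<Longrightarrow> 0 \<le> z"
proof -
  have nn: "0 \<le> root y y'" for y'
  proof -
    have "\<bar>(sample_cov_vec n D y' - sample_cov_vec n D y) $ 0\<bar> \<le> sup_norm (sample_cov_vec n D y' - sample_cov_vec n D y)"
      using sup_norm_le_iff[of "sample_cov_vec n D y' - sample_cov_vec n D y" "D * D" "sup_norm (sample_cov_vec n D y' - sample_cov_vec n D y)"] D1 by auto
    hence "0 \<le> sup_norm (sample_cov_vec n D y' - sample_cov_vec n D y)" by (rule order_trans[OF abs_ge_zero])
    thus ?thesis by simp
  qed
  show z: "0 \<le> z" if "measure_pmf.prob (bootstrap_pmf n y) {y'. root y y' > z} \<le> \<alpha>" for z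
  proof (rule ccontr)
    assume "\<not> 0 \<le> z"
    hence "z < 0" by simp
    hence "z < root y y'" for y' using nn[of y'] by (rule less_le_trans)
    hence "{y'. root y y' > z} = UNIV" by blast
    thus False using that \<alpha> by simp
  qed
  show "bdd_below {z. measure_pmf.prob (bootstrap_pmf n y) {y'. root y y' > z} \<le> \<alpha>}"
    using z by (intro bdd_belowI[of _ 0]) auto
qed

lemma quantile_nonneg: "0 < \<alpha> \<Longrightarrow> \<alpha> < 1 \<Longrightarrow> 0 \<le> bootstrap_quantile n D \<alpha> y"
  unfolding bootstrap_quantile_def using quantile_set_nonempty quantile_bdd_below(2) by (intro cInf_greatest) auto

text \<open>The tail decreases in \<open>z\<close>, so the quantile is below \<open>c\<close>
  exactly when some rational \<open>q < c\<close> has a tail of at most \<open>\<alpha>\<close>: a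
  countable union of events.\<close>

lemma quantile_measurable:
  assumes \<alpha>: "0 < \<alpha>" "\<alpha> < 1"
  shows "(\<lambda>\<omega>. bootstrap_quantile n D \<alpha> (\<lambda>i. Y i \<omega>)) \<in> borel_measurable M"
  unfolding borel_measurable_iff_less
proof
  fix c :: real
  define tail where "tail = (\<lambda>\<omega> q. measure_pmf.prob (bootstrap_pmf n (\<lambda>i. Y i \<omega>)) {y'. root (\<lambda>i. Y i \<omega>) y' > q})"
  have tm: "(\<lambda>\<omega>. tail \<omega> q) \<in> borel_measurable M" for q
    unfolding tail_def bootstrap_prob
    by (intro borel_measurable_sum measurable_If borel_measurable_const root_less_measurable)
  have mono: "tail \<omega> q \<le> tail \<omega> z" if "z \<le> q" for \<omega> q z
    unfolding tail_def using that by (intro measure_pmf.finite_measure_mono) auto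
  have "bootstrap_quantile n D \<alpha> (\<lambda>i. Y i \<omega>) < c \<longleftrightarrow> (\<exists>q\<in>\<rat>. q < c \<and> tail \<omega> q \<le> \<alpha>)" for \<omega>
  proof
    assume "bootstrap_quantile n D \<alpha> (\<lambda>i. Y i \<omega>) < c"
    hence "\<exists>z\<in>{z. tail \<omega> z \<le> \<alpha>}. z < c"
      unfolding bootstrap_quantile_def tail_def by (intro cInf_lessD) (use quantile_set_nonempty[OF \<alpha>(1)] in auto)
    then obtain z where z: "tail \<omega> z \<le> \<alpha>" "z < c" by auto
    obtain q where q: "q \<in> \<rat>" "z < q" "q < c" using Rats_dense_in_real[OF z(2)] by auto
    show "\<exists>q\<in>\<rat>. q < c \<and> tail \<omega> q \<le> \<alpha>" using q z(1) mono[of z q \<omega>] by (intro bexI[of _ q]) auto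
  next
    assume "\<exists>q\<in>\<rat>. q < c \<and> tail \<omega> q \<le> \<alpha>"
    then obtain q where q: "q < c" "tail \<omega> q \<le> \<alpha>" by auto
    have "bootstrap_quantile n D \<alpha> (\<lambda>i. Y i \<omega>) \<le> q"
      unfolding bootstrap_quantile_def by (rule cInf_lower) (use q(2) quantile_bdd_below(1)[OF \<alpha>(2)] in \<open>auto simp: tail_def\<close>)
    thus "bootstrap_quantile n D \<alpha> (\<lambda>i. Y i \<omega>) < c" using q(1) by simp
  qed
  hence "{w \<in> space M. bootstrap_quantile n D \<alpha> (\<lambda>i. Y i w) < c} = (\<Union>q\<in>{q\<in>\<rat>. q < c}. {w \<in> space M. tail w q \<le> \<alpha>})" by auto
  also have "\<dots> \<in> M.events"
  proof (rule sets.countable_UN'')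
    show "countable {q \<in> \<rat>. q < (c::real)}" by (rule countable_subset[OF _ countable_rat]) auto
    show "{w \<in> space M. tail w q \<le> \<alpha>} \<in> M.events" for q using tm[of q] by measurable
  qed
  finally show "{w \<in> space M. bootstrap_quantile n D \<alpha> (\<lambda>i. Y i w) < c} \<in> M.events" .
qed

text \<open>The event is the preimage, under the measurable pair of sample covariance and radius, of
  a countable union over \<open>m\<close> of closed sets; each of them is a projection along the
  compact set \<open>fibre D \<theta> m\<close>.\<close>

lemma region_event:
  assumes \<alpha>: "0 < \<alpha>" "\<alpha> < 1" and \<theta>: "\<theta> \<in> carrier_vec (D * D)"
  shows "{\<omega> \<in> space M. \<theta> \<in> partial_corr_region n D \<alpha> (\<lambda>i. Y i \<omega>)} \<in> M.events"
proof -
  define s where "s = (\<lambda>\<omega> p. if p < D * D then sample_cov_vec n D (\<lambda>i. Y i \<omega>) $ p else 0)"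
  define r where "r = (\<lambda>\<omega>. bootstrap_quantile n D \<alpha> (\<lambda>i. Y i \<omega>) / sqrt (real n))"
  define C where "C = (\<lambda>m. {sr :: (nat \<Rightarrow> real) \<times> real. \<exists>x\<in>fibre D \<theta> m. (x, sr) \<in> (\<Inter>p\<in>{..<D * D}. {t. \<bar>fst t p - fst (snd t) p\<bar> \<le> snd (snd t)})})"
  have c1: "continuous_on UNIV (\<lambda>t :: (nat \<Rightarrow> real) \<times> (nat \<Rightarrow> real) \<times> real. fst t p)" for p
    by (rule continuous_on_compose2[OF continuous_on_coordinate[of UNIV p]]) (auto intro: continuous_intros)
  have c2: "continuous_on UNIV (\<lambda>t :: (nat \<Rightarrow> real) \<times> (nat \<Rightarrow> real) \<times> real. fst (snd t) p)" for p
    by (rule continuous_on_compose2[OF continuous_on_coordinate[of UNIV p]]) (auto intro!: continuous_on_fst continuous_on_snd continuous_on_id)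
  have C: "closed (C m)" for m
    unfolding C_def
    by (intro closed_projection compact_fibre closed_INT ballI closed_Collect_le continuous_intros c1 c2)
  have "s \<in> borel_measurable M"
    unfolding s_def
  proof (rule measurable_coordinatewise_then_product)
    fix p show "(\<lambda>\<omega>. if p < D * D then sample_cov_vec n D (\<lambda>i. Y i \<omega>) $ p else 0) \<in> borel_measurable M"
      using sample_cov_vec_component[of "\<lambda>i. i" p] by (cases "p < D * D") auto
  qed
  moreover have "r \<in> borel_measurable M" unfolding r_def using quantile_measurable[OF \<alpha>] by measurable
  ultimately have "(\<lambda>\<omega>. (s \<omega>, r \<omega>)) \<in> borel_measurable M" by (rule borel_measurable_Pair)
  hence "(\<lambda>\<omega>. (s \<omega>, r \<omega>)) -` (\<Union>m. C m) \<inter> space M \<in> M.events"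
    by (rule measurable_sets) (intro sets.countable_UN image_subsetI borel_closed C)
  moreover have Cm: "(s \<omega>, r \<omega>) \<in> C m \<longleftrightarrow> (\<exists>x\<in>fibre D \<theta> m. \<forall>p<D * D. \<bar>x p - sample_cov_vec n D (\<lambda>i. Y i \<omega>) $ p\<bar> \<le> bootstrap_quantile n D \<alpha> (\<lambda>i. Y i \<omega>) / sqrt (real n))" for \<omega> m
    unfolding C_def mem_Collect_eq INT_iff fst_conv snd_conv s_def r_def Ball_def lessThan_iff by (simp cong: imp_cong)
  moreover have "{\<omega> \<in> space M. \<theta> \<in> partial_corr_region n D \<alpha> (\<lambda>i. Y i \<omega>)} = (\<lambda>\<omega>. (s \<omega>, r \<omega>)) -` (\<Union>m. C m) \<inter> space M"
    unfolding partial_corr_region_iff[OF \<theta> D1] by (simp only: vimage_def Int_def UN_iff mem_Collect_eq Cm) blast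
  ultimately show ?thesis by simp
qed

end

section \<open>Rates\<close>

text \<open>\<open>boot_err\<close> at the final parameters, with \<open>D\<close> enlarged to
  \<open>n\<close>. The value of \<open>\<epsilon>\<close> makes
  \<open>exp (- sqrt n * \<epsilon>)\<close> equal to \<open>n powr (-16)\<close>, which also beats
  the factor \<open>n^6\<close> in \<open>data_bound\<close>.\<close>

definition boot_bound :: "real \<Rightarrow> nat \<Rightarrow> real" where
  "boot_bound B n = (let b = 8 * B^2; \<beta> = real n powr (1/6); \<epsilon> = 16 * ln (real n) / sqrt (real n) in
     real n * (3/2 * (\<beta> * (1 / sqrt (real n)))^2 * (\<epsilon> + 2 * b * ((4 * B + 2) * \<epsilon>)) + 13/6 * (\<beta> * (1 / sqrt (real n)))^3 * (\<epsilon> + 3 * (b * b) * ((4 * B + 2) * \<epsilon>)) + 75/24 * (\<beta> * (1 / sqrt (real n)))^4 * (b^4 + b^4))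
     + 2 / real n + real n * (2 * exp (4 * B^2 - sqrt (real n) * \<epsilon>)))"

lemma boot_bound_asymp: "boot_bound B \<in> O(\<lambda>n. real n powr (- 1 / 8))"
  unfolding boot_bound_def Let_def by real_asymp

text \<open>\<open>slab_err\<close> at the final parameters, \<open>\<delta>\<close> being the slab
  width of \<open>coverage_bound\<close>. The choice \<open>L = 8 * ln n\<close> beats
  \<open>n^3\<close>. The variance threshold \<open>\<rho>\<close> shrinks only like
  \<open>1 / ln n\<close>; with \<open>l = 1 / \<rho>\<close> the discarded coordinates contribute
  \<open>n^3 * exp (1 - 5 * ln n)\<close>. The leading term is of order
  \<open>(ln n)^4 * n powr (-1/6)\<close>.\<close>

definition slab_bound :: "real \<Rightarrow> real \<Rightarrow> nat \<Rightarrow> real" where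
  "slab_bound B c n = (let b = 8 * B^2; \<beta> = real n powr (1/6); \<epsilon> = 16 * ln (real n) / sqrt (real n);
      \<delta> = 3 * (sqrt (real n) * \<epsilon>^2) + 2 * (8 * ln (real n) / \<beta>); \<rho> = c / (5 * ln (real n)); L = 8 * ln (real n); l = 5 * ln (real n) / c in
      exp 2 * (2 * (\<delta> + 2 * (8 * ln (real n) / \<beta>)) / \<rho> * (2 * (L + L + \<delta> + 3 * (8 * ln (real n) / \<beta>)) / \<rho> + 1))
      + real n ^ 3 * (2 * exp (b^2 - L) + exp (b^4 - sqrt (real n) * \<rho>^2 / 2)) + 44 * \<beta>^4 * b^4 / real n + 4 / real n
      + real n ^ 3 * exp (l^2 * \<rho>^2 - l * c))"

lemma slab_bound_asymp: assumes c: "0 < c" shows "slab_bound B c \<in> O(\<lambda>n. real n powr (- 1 / 8))"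
proof -
  have "(\<lambda>n. real n ^ 3 * exp ((5 * ln (real n) / c)^2 * (c / (5 * ln (real n)))^2 - 5 * ln (real n) / c * c)) \<in> \<Theta>(\<lambda>n. real n ^ 3 * exp (1 - 5 * ln (real n)))"
  proof (intro bigthetaI_cong eventually_sequentiallyI[of 2])
    fix n :: nat assume "2 \<le> n"
    hence "0 < ln (real n)" by simp
    thus "real n ^ 3 * exp ((5 * ln (real n) / c)^2 * (c / (5 * ln (real n)))^2 - 5 * ln (real n) / c * c) = real n ^ 3 * exp (1 - 5 * ln (real n))"
      using c by (simp add: power_mult_distrib[symmetric])
  qed
  hence th: "(\<lambda>n. real n ^ 3 * exp ((5 * ln (real n) / c)^2 * (c / (5 * ln (real n)))^2 - 5 * ln (real n) / c * c)) \<in> O(\<lambda>n. real n ^ 3 * exp (1 - 5 * ln (real n)))"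
    by (rule bigthetaD1)
  have e: "(\<lambda>n. real n ^ 3 * exp ((5 * ln (real n) / c)^2 * (c / (5 * ln (real n)))^2 - 5 * ln (real n) / c * c)) \<in> O(\<lambda>n. real n powr (- 1 / 8))"
    by (rule landau_o.big_trans[OF th]) real_asymp
  have t1: "(\<lambda>n::nat. exp 2 * (2 * (3 * (sqrt (real n) * (16 * ln (real n) / sqrt (real n))^2) + 2 * (8 * ln (real n) / real n powr (1 / 6)) +
            2 * (8 * ln (real n) / real n powr (1 / 6))) / (c / (5 * ln (real n))) *
           (2 * (8 * ln (real n) + 8 * ln (real n) + (3 * (sqrt (real n) * (16 * ln (real n) / sqrt (real n))^2) + 2 * (8 * ln (real n) / real n powr (1 / 6))) +
             3 * (8 * ln (real n) / real n powr (1 / 6))) / (c / (5 * ln (real n))) + 1))) \<in> O(\<lambda>n. real n powr (- 1 / 8))"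
    using c by real_asymp
  have t2: "(\<lambda>n::nat. real n ^ 3 * (2 * exp ((8 * B^2)^2 - 8 * ln (real n)))) \<in> O(\<lambda>n. real n powr (- 1 / 8))"
    by real_asymp
  have t3: "(\<lambda>n::nat. real n ^ 3 * exp ((8 * B^2) ^ 4 - sqrt (real n) * (c / (5 * ln (real n)))^2 / 2)) \<in> O(\<lambda>n. real n powr (- 1 / 8))"
    using c by real_asymp
  have t4: "(\<lambda>n::nat. 44 * (real n powr (1/6))^4 * (8 * B^2)^4 / real n) \<in> O(\<lambda>n. real n powr (- 1 / 8))"
    by real_asymp
  have t5: "(\<lambda>n::nat. 4 / real n) \<in> O(\<lambda>n. real n powr (- 1 / 8))"
    by real_asymp
  show ?thesis
    unfolding slab_bound_def Let_def distrib_left[of "real _ ^ 3"] by (intro sum_in_bigo(1) e t1 t2 t3 t4 t5)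
qed

definition data_bound :: "real \<Rightarrow> nat \<Rightarrow> real" where
  "data_bound bm n = 30 * real n ^ 6 * exp (4 * bm^2 - sqrt (real n) * (16 * ln (real n) / sqrt (real n)))"

lemma data_bound_asymp: "data_bound bm \<in> O(\<lambda>n. real n powr (- 1 / 8))"
  unfolding data_bound_def by real_asymp

definition low_bound :: "real \<Rightarrow> real \<Rightarrow> real \<Rightarrow> real \<Rightarrow> nat \<Rightarrow> real" where
  "low_bound B \<rho> c L n = (let b = 8 * B^2; \<beta> = real n powr (1/6); H = 8 * ln (real n) / \<beta> in
      exp 2 * (2 * (3 * (2 * c) + 2 * H) / \<rho> * (2 * (5 * (2 * c) + L + 3 * H) / \<rho> + 1))
      + 2 * exp (b^2 - L) + exp (b^4 - sqrt (real n) * \<rho>^2 / 2) + 44 * \<beta>^4 * b^4 / real n + 4 / real n)"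

lemma low_bound_limit:
  assumes \<rho>: "0 < \<rho>"
  shows "low_bound B \<rho> c L \<longlonglongrightarrow> exp 2 * (2 * (6 * c) / \<rho> * (2 * (10 * c + L) / \<rho> + 1)) + 2 * exp ((8 * B^2)^2 - L)"
proof -
  have h: "(\<lambda>n::nat. 8 * ln (real n) / real n powr (1/6)) \<longlonglongrightarrow> 0" by real_asymp
  have e: "(\<lambda>n::nat. exp ((8 * B^2)^4 - sqrt (real n) * \<rho>^2 / 2)) \<longlonglongrightarrow> 0" using \<rho> by real_asymp
  have f: "(\<lambda>n::nat. 44 * (real n powr (1/6))^4 * (8 * B^2)^4 / real n) \<longlonglongrightarrow> 0" by real_asymp
  have g: "(\<lambda>n::nat. 4 / real n) \<longlonglongrightarrow> 0" by real_asymp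
  have "low_bound B \<rho> c L \<longlonglongrightarrow> exp 2 * (2 * (3 * (2 * c) + 2 * 0) / \<rho> * (2 * (5 * (2 * c) + L + 3 * 0) / \<rho> + 1)) + 2 * exp ((8 * B^2)^2 - L) + 0 + 0 + 0"
    unfolding low_bound_def Let_def using \<rho> by (intro tendsto_intros h e f g) auto
  thus ?thesis by simp
qed

text \<open>\<open>L\<close> comes first, to make the exponential term small; then \<open>c\<close>
  shrinks against the fixed \<open>L\<close>. Neither depends on the sample size.\<close>

lemma ex_low_constants:
  assumes \<rho>: "(0::real) < \<rho>" and p: "0 < p"
  shows "\<exists>c>0. \<exists>L\<ge>0. exp 2 * (2 * (6 * c) / \<rho> * (2 * (10 * c + L) / \<rho> + 1)) + 2 * exp (x - L) < (p::real)"
proof -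
  have "((\<lambda>L. 2 * exp (x - L)) \<longlongrightarrow> 0) at_top" by real_asymp
  hence "eventually (\<lambda>L. 2 * exp (x - L) < p / 2) at_top" by (rule order_tendstoD) (use p in simp)
  hence "eventually (\<lambda>L. 0 \<le> L \<and> 2 * exp (x - L) < p / 2) at_top" by (intro eventually_conj eventually_ge_at_top)
  then obtain L where L: "0 \<le> L" "2 * exp (x - L) < p / 2" by (auto dest!: eventually_happens)
  have "((\<lambda>c. exp 2 * (2 * (6 * c) / \<rho> * (2 * (10 * c + L) / \<rho> + 1))) \<longlongrightarrow> exp 2 * (2 * (6 * 0) / \<rho> * (2 * (10 * 0 + L) / \<rho> + 1))) (at_right 0)"
    using \<rho> by (intro tendsto_intros) auto
  hence "eventually (\<lambda>c. exp 2 * (2 * (6 * c) / \<rho> * (2 * (10 * c + L) / \<rho> + 1)) < p / 2) (at_right 0)"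
    by (rule order_tendstoD) (use p in simp)
  hence "eventually (\<lambda>c. 0 < c \<and> exp 2 * (2 * (6 * c) / \<rho> * (2 * (10 * c + L) / \<rho> + 1)) < p / 2) (at_right 0)"
    by (intro eventually_conj eventually_at_right_less)
  then obtain c where c: "0 < c" "exp 2 * (2 * (6 * c) / \<rho> * (2 * (10 * c + L) / \<rho> + 1)) < p / 2"
    by (auto dest!: eventually_happens)
  show ?thesis using L c by (intro exI[of _ c] exI[of _ L] conjI) auto
qed

definition large_sample :: "real \<Rightarrow> real \<Rightarrow> real \<Rightarrow> nat \<Rightarrow> bool" where
  "large_sample B bm c n \<longleftrightarrow> (8 * B^2)^2 \<le> sqrt (real n) \<and> 3 * (8 * B^2) \<le> sqrt (real n) \<and>
     5 * ln (real n) / c * (8 * B^2) \<le> sqrt (real n) \<and> 2 * bm \<le> sqrt (real n) \<and> 16 * ln (real n) / sqrt (real n) \<le> 1 \<and>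
     2 * (sqrt (real n) * (16 * ln (real n) / sqrt (real n))^2) + 8 * ln (real n) / real n powr (1/6) \<le> c"

lemma eventually_large_sample:
  assumes c: "0 < c" shows "eventually (large_sample B bm c) sequentially"
  unfolding large_sample_def
proof (intro eventually_conj)
  show "eventually (\<lambda>n. (8 * B^2)^2 \<le> sqrt (real n)) sequentially" "eventually (\<lambda>n. 3 * (8 * B^2) \<le> sqrt (real n)) sequentially"
    "eventually (\<lambda>n. 2 * bm \<le> sqrt (real n)) sequentially"
    by (rule filterlim_at_top[THEN iffD1, rule_format], real_asymp)+
  show "eventually (\<lambda>n. 16 * ln (real n) / sqrt (real n) \<le> 1) sequentially" by real_asymp
  have "(\<lambda>n::nat. 2 * (sqrt (real n) * (16 * ln (real n) / sqrt (real n))^2) + 8 * ln (real n) / real n powr (1/6)) \<longlonglongrightarrow> 0" by real_asymp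
  from order_tendstoD(2)[OF this c]
  show "eventually (\<lambda>n. 2 * (sqrt (real n) * (16 * ln (real n) / sqrt (real n))^2) + 8 * ln (real n) / real n powr (1/6) \<le> c) sequentially"
    by eventually_elim simp
  have "(\<lambda>n::nat. 5 * ln (real n) / c * (8 * B^2) / sqrt (real n)) \<longlonglongrightarrow> 0" using c by real_asymp
  from order_tendstoD(2)[OF this, of 1]
  have "eventually (\<lambda>n. 5 * ln (real n) / c * (8 * B^2) / sqrt (real n) < 1) sequentially" by simp
  thus "eventually (\<lambda>n. 5 * ln (real n) / c * (8 * B^2) \<le> sqrt (real n)) sequentially"
    using eventually_gt_at_top[of 0]
  proof eventually_elim
    case (elim n)
    thus ?case by (simp only: pos_divide_less_eq[of "sqrt (real n)"] real_sqrt_gt_0_iff of_nat_0_less_iff)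
  qed
qed

text \<open>The constants depend only on \<open>\<alpha>\<close>, \<open>\<rho>\<close>,
  \<open>B\<close> and \<open>bm\<close>, so the estimates are uniform in the dimension and in the
  law of the observations.\<close>

lemma asymptotic_constants:
  assumes \<alpha>: "0 < \<alpha>" "\<alpha> < 1" and \<rho>: "0 < \<rho>"
  obtains c L K where "0 < c" "0 \<le> L" "0 < K" "eventually (\<lambda>n. large_sample B bm c n \<and> low_bound B \<rho> c L n + boot_bound B n < 1 - \<alpha> \<and>
     data_bound bm n \<le> \<alpha> \<and> boot_bound B n + slab_bound B c n + data_bound bm n \<le> K * real n powr (- 1 / 8)) sequentially"
proof -
  obtain c L where cL: "0 < c" "0 \<le> L" "exp 2 * (2 * (6 * c) / \<rho> * (2 * (10 * c + L) / \<rho> + 1)) + 2 * exp ((8 * B^2)^2 - L) < 1 - \<alpha>"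
    using ex_low_constants[OF \<rho>, of "1 - \<alpha>" "(8 * B^2)^2"] \<alpha> by auto
  have "(\<lambda>n. boot_bound B n + slab_bound B c n + data_bound bm n) \<in> O(\<lambda>n. real n powr (- 1 / 8))"
    by (intro sum_in_bigo(1) boot_bound_asymp slab_bound_asymp data_bound_asymp cL)
  then obtain K where K: "0 < K" "eventually (\<lambda>n. norm (boot_bound B n + slab_bound B c n + data_bound bm n) \<le> K * norm (real n powr (- 1 / 8))) sequentially"
    by (elim landau_o.bigE)
  have small: "f \<longlonglongrightarrow> 0" if "f \<in> O(\<lambda>n. real n powr (- 1 / 8))" for f :: "nat \<Rightarrow> real"
  proof -
    have "(\<lambda>n. real n powr (- 1 / 8)) \<in> o(\<lambda>_. 1 :: real)" by real_asymp
    from landau_o.big_small_trans[OF that this] show ?thesis by (rule smalloD_tendsto[of f _ "\<lambda>_. 1", simplified])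
  qed
  have "(\<lambda>n. low_bound B \<rho> c L n + boot_bound B n) \<longlonglongrightarrow> exp 2 * (2 * (6 * c) / \<rho> * (2 * (10 * c + L) / \<rho> + 1)) + 2 * exp ((8 * B^2)^2 - L) + 0"
    by (intro tendsto_add low_bound_limit \<rho> small boot_bound_asymp)
  hence l: "eventually (\<lambda>n. low_bound B \<rho> c L n + boot_bound B n < 1 - \<alpha>) sequentially"
    by (rule order_tendstoD) (use cL in simp)
  have d: "eventually (\<lambda>n. data_bound bm n < \<alpha>) sequentially"
    by (rule order_tendstoD(2)[OF small[OF data_bound_asymp] \<alpha>(1)])
  show ?thesis
  proof (rule that[OF cL(1,2), of K])
    show "eventually (\<lambda>n. large_sample B bm c n \<and> low_bound B \<rho> c L n + boot_bound B n < 1 - \<alpha> \<and>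
     data_bound bm n \<le> \<alpha> \<and> boot_bound B n + slab_bound B c n + data_bound bm n \<le> K * real n powr (- 1 / 8)) sequentially"
      using eventually_large_sample[OF cL(1), of B bm] l d K(2)
      by eventually_elim (auto simp: abs_le_iff)
  qed (use K in simp)
qed

section \<open>Coverage of the partial correlations\<close>

lemma sum_supported_below_two:
  fixes f :: "nat \<Rightarrow> real"
  assumes "2 \<le> D" "\<And>j. 2 \<le> j \<Longrightarrow> f j = 0" shows "(\<Sum>j<D. f j) = f 0 + f 1"
proof -
  have "(\<Sum>j<D. f j) = (\<Sum>j<2. f j)" by (rule sum.mono_neutral_right) (use assms in auto)
  thus ?thesis by (simp add: numeral_2_eq_2)
qed

lemma G_map_one:
  assumes a: "a \<in> carrier_vec 1" "0 < a $ 0"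
  shows "a \<in> G_dom 1" "G_map 1 a = vec 1 (\<lambda>_. - 1)"
proof -
  define S where "S = unvectorize 1 a"
  have S: "S \<in> carrier_mat 1 1" "S $$ (0, 0) = a $ 0" by (simp_all add: S_def unvectorize_def)
  have v: "vectorize S = a" by (rule eq_vecI) (use a S in \<open>auto simp: vectorize_def\<close>)
  have "vectorize S \<in> G_dom 1" by (rule positive_definite_G_dom[OF S(1)]) (use a S in \<open>auto simp: quad_def zero_less_mult_iff\<close>)
  thus d: "a \<in> G_dom 1" unfolding v .
  then obtain Om where Om: "mat_inverse S = Some Om" by (auto simp: G_dom_def S_def)
  have O: "Om \<in> carrier_mat 1 1" "S * Om = 1\<^sub>m 1" using mat_inverse(2)[OF S(1) Om] by auto
  have "(S * Om) $$ (0, 0) = a $ 0 * Om $$ (0, 0)" using S O(1) by (simp add: scalar_prod_def)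
  hence m: "a $ 0 * Om $$ (0, 0) = 1" unfolding O(2) by simp
  hence "0 < a $ 0 * Om $$ (0, 0)" by simp
  hence p: "0 < Om $$ (0, 0)" using a(2) by (simp add: zero_less_mult_iff)
  show "G_map 1 a = vec 1 (\<lambda>_. - 1)"
    unfolding G_map_def S_def[symmetric] partial_corr_def Om using p
    by (intro eq_vecI) (auto simp: vectorize_def)
qed

lemma G_map_carrier: "G_map D a \<in> carrier_vec (D * D)"
  by (simp add: G_map_def vectorize_def partial_corr_def Let_def)

context sample_setting
begin

lemma boot_err_le: "boot_err (16 * ln (real n) / sqrt (real n)) (real n powr (1/6)) \<le> boot_bound B n"
proof -
  have "real D \<le> real n" using Dn by simp
  hence "real D * (2 * exp x) \<le> real n * (2 * exp x)" for x by (rule mult_right_mono) simp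
  from add_left_mono[OF this] show ?thesis unfolding boot_err_def boot_bound_def Let_def b_def \<eta>_def .
qed

lemma slab_err_eq:
  "slab_err (real n powr (1/6)) (c / (5 * ln (real n))) (8 * ln (real n)) (5 * ln (real n) / c) c
    (3 * (sqrt (real n) * (16 * ln (real n) / sqrt (real n))^2) + 2 * (8 * ln (real n) / real n powr (1/6))) = slab_bound B c n"
  unfolding slab_err_def slab_bound_def Let_def b_def by (rule refl)

lemma coverage_rate:
  assumes \<alpha>: "0 < \<alpha>" and a: "0 < a" and cL: "0 < c" "0 \<le> L"
    and q: "\<exists>q<D * D. a^2 / 2 \<le> (\<integral>y. (X y q)^2 \<partial>P)"
    and bm: "bm = B + 8 * B^2 + (8 * B^2)^2 + (8 * B^2)^3"
    and large: "large_sample B bm c n" and low: "low_bound B (a / sqrt 2) c L n + boot_bound B n < 1 - \<alpha>"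
    and E: "E \<in> M.events" "\<And>\<omega>. \<omega> \<in> space M \<Longrightarrow> pop_cov_vec D P \<in> bootstrap_rectangle n D \<alpha> (\<lambda>i. Y i \<omega>) \<Longrightarrow> \<omega> \<in> E"
  shows "1 - \<alpha> - (boot_bound B n + slab_bound B c n + data_bound bm n) \<le> M.prob E"
proof -
  define \<epsilon> where "\<epsilon> = 16 * ln (real n) / sqrt (real n)"
  define \<beta> where "\<beta> = real n powr (1/6)"
  have ln: "0 < ln (real n)" and n0: "0 < real n" using n2 by auto
  have pos: "0 < \<beta>" "0 < \<epsilon>" "0 < c / (5 * ln (real n))" "0 \<le> 8 * ln (real n)" "0 < 5 * ln (real n) / c"
    using ln n0 cL by (auto simp: \<beta>_def \<epsilon>_def)
  have lg: "b^2 \<le> sqrt (real n)" "3 * b \<le> sqrt (real n)" "5 * ln (real n) / c * b \<le> sqrt (real n)" "2 * bm \<le> sqrt (real n)" "\<epsilon> \<le> 1"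
    "2 * (sqrt (real n) * \<epsilon>^2) + 8 * ln (real n) / \<beta> \<le> c"
    using large unfolding large_sample_def b_def \<epsilon>_def \<beta>_def by blast+
  have bms: "B \<le> bm" "b \<le> bm" "b * b \<le> bm" "b * b * b \<le> bm"
    unfolding bm b_def power2_eq_square[of "8 * B^2"] power3_eq_cube using B_nonneg by auto
  obtain q where q: "q < D * D" "(a / sqrt 2)^2 \<le> (\<integral>y. (X y q)^2 \<partial>P)"
    using q by (auto simp: power_divide)
  have qJ: "q \<in> J" using q(1) by (simp add: J_def)
  have \<rho>: "0 < a / sqrt 2" using a by simp
  have c2: "0 < 2 * c" using cL by simp
  have lo: "cdf_max M S J (2 * c) \<le> low_bound B (a / sqrt 2) c L n"
    using cdf_max_lower_tail[OF qJ opposite[OF q(1)] c2 pos(1) q(2) \<rho> cL(2) lg(1,2)]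
    unfolding low_bound_def Let_def b_def \<beta>_def .
  have be: "boot_err \<epsilon> \<beta> \<le> boot_bound B n" unfolding \<epsilon>_def \<beta>_def by (rule boot_err_le)
  have low': "cdf_max M S J (2 * c) < 1 - \<alpha> - boot_err \<epsilon> \<beta>" using lo be low by linarith
  show ?thesis
    using coverage_bound[OF \<alpha> pos(1,3,4,5) cL(1) pos(2) lg(5,1,2,3) bms lg(4) low' lg(6) E] be
    unfolding \<epsilon>_def \<beta>_def slab_err_eq data_bound_def by linarith
qed

lemma quad_pop_cov_ge:
  assumes "a \<le> lambda_min (pop_cov D P)"
  shows "a * (\<Sum>j<D. (x j)^2) \<le> quad D (pop_cov D P) x"
proof -
  have "a * (\<Sum>j<D. (x j)^2) \<le> lambda_min (pop_cov D P) * (\<Sum>j<D. (x j)^2)"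
    using assms by (intro mult_right_mono sum_nonneg) auto
  also have "\<dots> \<le> quad D (pop_cov D P) x"
    by (rule lambda_min_quad[OF _ _ D1]) (auto simp: pop_cov_def cov_mat_def mult.commute)
  finally show ?thesis .
qed

lemma pop_cov_vec_G_dom:
  assumes a: "0 < a" "a \<le> lambda_min (pop_cov D P)" shows "pop_cov_vec D P \<in> G_dom D"
  unfolding pop_cov_vec_def
proof (rule positive_definite_G_dom)
  show "pop_cov D P \<in> carrier_mat D D" by (simp add: pop_cov_def cov_mat_def)
  fix x :: "nat \<Rightarrow> real" assume "\<exists>j<D. x j \<noteq> 0"
  then obtain j where j: "j < D" "x j \<noteq> 0" by auto
  hence "0 < (\<Sum>j<D. (x j)^2)" by (intro sum_pos2[of _ j]) auto
  hence "0 < a * (\<Sum>j<D. (x j)^2)" using a by simp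
  thus "0 < quad D (pop_cov D P) x" using quad_pop_cov_ge[OF a(2), of x] by (rule less_le_trans)
qed

lemma nondegenerate_coordinate:
  assumes D2: "2 \<le> D" and a: "0 < a" "a \<le> lambda_min (pop_cov D P)"
  shows "\<exists>q<D * D. a^2 / 2 \<le> (\<integral>y. (X y q)^2 \<partial>P)"
proof (rule nondegenerate[OF D2 a(1)])
  fix x y :: real
  \<comment> \<open>Vectors supported on the first two coordinates reduce the eigenvalue bound to
    the leading two by two block.\<close>
  define z where "z = (\<lambda>j :: nat. if j = 0 then x else if j = 1 then y else 0)"
  have z: "z 0 = x" "z 1 = y" "\<And>j. 2 \<le> j \<Longrightarrow> z j = 0" by (auto simp: z_def)
  have s: "\<Sigma> 1 0 = \<Sigma> 0 1" using D2 by (simp add: pop_cov_def cov_mat_def mult.commute)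
  have "(\<Sum>j<D. (z j)^2) = x^2 + y^2" using sum_supported_below_two[OF D2, of "\<lambda>j. (z j)^2"] z by simp
  moreover have "quad D (pop_cov D P) z = x * x * \<Sigma> 0 0 + x * y * \<Sigma> 0 1 + (y * x * \<Sigma> 1 0 + y * y * \<Sigma> 1 1)"
  proof -
    have "(\<Sum>k<D. z j * z k * \<Sigma> j k) = z j * x * \<Sigma> j 0 + z j * y * \<Sigma> j 1" for j
      using sum_supported_below_two[OF D2, of "\<lambda>k. z j * z k * \<Sigma> j k"] z by simp
    thus ?thesis
      using sum_supported_below_two[OF D2, of "\<lambda>j. z j * x * \<Sigma> j 0 + z j * y * \<Sigma> j 1"] z unfolding quad_def by simp
  qed
  ultimately show "a * (x^2 + y^2) \<le> x^2 * \<Sigma> 0 0 + 2 * x * y * \<Sigma> 0 1 + y^2 * \<Sigma> 1 1"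
    using quad_pop_cov_ge[OF a(2), of z] unfolding s by (simp add: power2_eq_square algebra_simps)
qed

text \<open>In dimension one \<open>G_map\<close> takes the single value -1 on positive variances,
  so it suffices that the rectangle contains a positive number. On good data its centre, the sample
  variance, is one, and the exceptional event has probability at most
  \<open>\<alpha>\<close>.\<close>

lemma coverage_dimension_one:
  assumes D: "D = 1" and \<alpha>: "0 < \<alpha>" "\<alpha> < 1" and a: "0 < a" "a \<le> lambda_min (pop_cov D P)"
    and bm: "bm = B + 8 * B^2 + (8 * B^2)^2 + (8 * B^2)^3" "2 * bm \<le> sqrt (real n)"
    and \<epsilon>: "16 * ln (real n) / sqrt (real n) \<le> 1" "16 * ln (real n) / sqrt (real n) < a / 2"
    and data: "data_bound bm n \<le> \<alpha>"
  shows "1 - \<alpha> \<le> M.prob {\<omega> \<in> space M. G_map D (pop_cov_vec D P) \<in> partial_corr_region n D \<alpha> (\<lambda>i. Y i \<omega>)}"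
    (is "_ \<le> M.prob ?E")
proof -
  define \<epsilon> where "\<epsilon> = 16 * ln (real n) / sqrt (real n)"
  have \<epsilon>0: "0 \<le> \<epsilon>" using n2 by (simp add: \<epsilon>_def)
  have bms: "B \<le> bm" "b \<le> bm" "b * b \<le> bm" "b * b * b \<le> bm"
    unfolding bm b_def power2_eq_square[of "8 * B^2"] power3_eq_cube using B_nonneg by auto
  obtain Bad where Bad: "Bad \<in> M.events" "M.prob Bad \<le> 30 * real n ^ 6 * exp (4 * bm^2 - sqrt (real n) * \<epsilon>)"
    "AE \<omega> in M. \<omega> \<notin> Bad \<longrightarrow> good \<epsilon> (\<lambda>i. Y i \<omega>)"
    by (rule good_data[OF bms bm(2), of \<epsilon>])
  have S0: "a \<le> \<Sigma> 0 0" using quad_pop_cov_ge[OF a(2), of "\<lambda>_. 1"] D by (simp add: quad_def)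
  have p0: "0 < pop_cov_vec D P $ 0" using S0 a(1) pop_cov_vec_index[of 0] D by simp
  have pc: "pop_cov_vec D P \<in> carrier_vec 1" by (rule carrier_vecI[OF trans[OF dim_pop_cov_vec]]) (simp add: D)
  have d0: "0 < D" using D by simp
  have J0: "0 \<in> J" using index(4)[OF d0 d0] by simp
  have region: "G_map D (pop_cov_vec D P) \<in> partial_corr_region n D \<alpha> y" if g: "good \<epsilon> y" for y
  proof -
    have yB: "\<forall>i<n. \<forall>j<D. \<bar>y i $ j\<bar> \<le> B" and d: "\<bar>dd y 0\<bar> \<le> \<epsilon>" and X0: "\<bar>(\<Sum>i<n. X (y i) 0) / real n\<bar> \<le> \<epsilon>"
      using g d0 J0 unfolding good_def by blast+
    have i0: "ji 0 = 0" "ki 0 = 0" "sg 0 = 1" unfolding ji_def ki_def sg_def by (simp_all add: D)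
    have X0': "\<bar>sc y 0 0 + dd y 0 * dd y 0 - \<Sigma> 0 0\<bar> \<le> \<epsilon>" using X0 unfolding sum_X_data[OF yB] i0 by simp
    have "\<bar>dd y 0 * dd y 0\<bar> \<le> \<epsilon> * 1" unfolding abs_mult using d \<epsilon>(1) \<epsilon>0 by (intro mult_mono) (auto simp: \<epsilon>_def)
    \<comment> \<open>The sample variance differs from the population variance by at most
      \<open>2 * \<epsilon>\<close>, which is less than \<open>a\<close>.\<close>
    hence sc: "0 < sc y 0 0" using X0' S0 \<epsilon>(2) unfolding \<epsilon>_def[symmetric] by (simp add: abs_le_iff)
    define s where "s = sample_cov_vec n D y"
    have s: "s \<in> carrier_vec 1" "0 < s $ 0"
      by (rule carrier_vecI, simp add: s_def D) (use sc sample_cov_vec_index[of 0 D n y] in \<open>simp add: s_def sc_def d0\<close>)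
    have "sup_norm (s - s) \<le> bootstrap_quantile n D \<alpha> y / sqrt (real n)"
      using quantile_nonneg[OF \<alpha>, of y] s(1) by (subst sup_norm_le_iff[where m=1]) auto
    hence "s \<in> bootstrap_rectangle n D \<alpha> y" unfolding bootstrap_rectangle_def s_def[symmetric]
      by (intro CollectI conjI) (use s(1) in \<open>simp_all add: D\<close>)
    thus ?thesis
      unfolding partial_corr_region_def using G_map_one[OF s] G_map_one(2)[OF pc p0] unfolding D by (intro image_eqI[of _ _ s]) auto
  qed
  have E: "?E \<in> M.events" by (rule region_event[OF \<alpha> G_map_carrier])
  have "M.prob (space M) \<le> M.prob (?E \<union> Bad)"
  proof (rule M.finite_measure_mono_AE)
    show "AE \<omega> in M. \<omega> \<in> space M \<longrightarrow> \<omega> \<in> ?E \<union> Bad"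
      using Bad(3) by eventually_elim (use region in blast)
    show "?E \<union> Bad \<in> M.events" using E Bad(1) by blast
  qed
  also have "\<dots> \<le> M.prob ?E + M.prob Bad" by (rule measure_Un_le[OF E Bad(1)])
  finally show ?thesis using Bad(2) data unfolding M.prob_space data_bound_def \<epsilon>_def by linarith
qed

lemma coverage_dimension_ge_two:
  assumes \<alpha>: "0 < \<alpha>" "\<alpha> < 1" and D2: "2 \<le> D" and a: "0 < a" "a \<le> lambda_min (pop_cov D P)" and cL: "0 < c" "0 \<le> L"
    and bm: "bm = B + 8 * B^2 + (8 * B^2)^2 + (8 * B^2)^3"
    and large: "large_sample B bm c n" and low: "low_bound B (a / sqrt 2) c L n + boot_bound B n < 1 - \<alpha>"
  shows "1 - \<alpha> - (boot_bound B n + slab_bound B c n + data_bound bm n) \<le>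
    M.prob {\<omega> \<in> space M. G_map D (pop_cov_vec D P) \<in> partial_corr_region n D \<alpha> (\<lambda>i. Y i \<omega>)}"
proof (rule coverage_rate[OF \<alpha>(1) a(1) cL nondegenerate_coordinate[OF D2 a] bm large low region_event[OF \<alpha> G_map_carrier]])
  fix \<omega> assume "\<omega> \<in> space M" "pop_cov_vec D P \<in> bootstrap_rectangle n D \<alpha> (\<lambda>i. Y i \<omega>)"
  thus "\<omega> \<in> {\<omega> \<in> space M. G_map D (pop_cov_vec D P) \<in> partial_corr_region n D \<alpha> (\<lambda>i. Y i \<omega>)}"
    using pop_cov_vec_G_dom[OF a] by (auto simp: partial_corr_region_def)
qed

end

theorem corollary19:
  fixes D :: "nat \<Rightarrow> nat"
    and P :: "nat \<Rightarrow> real vec measure"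
    and M :: "nat \<Rightarrow> 'w measure"
    and Y :: "nat \<Rightarrow> nat \<Rightarrow> 'w \<Rightarrow> real vec"
    and \<alpha> B a A c\<^sub>0 C :: real
  assumes alpha: "0 < \<alpha>" "\<alpha> < 1"
    and dim: "\<And>n. n \<ge> 2 \<Longrightarrow> 1 \<le> D n \<and> D n < n"
    and iid: "\<And>n. n \<ge> 2 \<Longrightarrow> iid_sample n (D n) (P n) (M n) (Y n)"
    and bounded: "\<And>n. n \<ge> 2 \<Longrightarrow> AE y in P n. \<forall>j<D n. \<bar>y $ j\<bar> \<le> B"
    and A1: "\<And>n. n \<ge> 2 \<Longrightarrow> sub_gaussian (D n) (P n) (\<lambda>y. y)"
      "\<And>n. n \<ge> 2 \<Longrightarrow> sub_gaussian (D n * D n) (P n) (\<lambda>y. vectorize (outer y y))"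
    and A2: "0 < a" "\<And>n. n \<ge> 2 \<Longrightarrow> a \<le> lambda_min (pop_cov (D n) (P n))"
      "\<And>n. n \<ge> 2 \<Longrightarrow> lambda_max (pop_cov (D n) (P n)) \<le> A"
    and A3: "0 < c\<^sub>0" "\<And>n. n \<ge> 2 \<Longrightarrow> c\<^sub>0 \<le> lambda_min_sym (D n) (T_mat (D n) (pop_cov (D n) (P n)))"
      \<comment> \<open>the diagonal partial correlations are constant, so only pairs of distinct indices count\<close>
      "\<And>n p. n \<ge> 2 \<Longrightarrow> p < D n * D n \<Longrightarrow> p mod D n \<noteq> p div D n \<Longrightarrow>
         0 < delta_cov n (D n) (P n) (M n) (Y n) $$ (p, p)"
    and A4: "\<And>n p. n \<ge> 2 \<Longrightarrow> p < D n * D n \<Longrightarrow>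
         (\<integral>y. \<bar>centred_square (D n) (P n) y $ p\<bar> ^ 3 \<partial>(P n)) \<le> C"
  shows "\<exists>r\<^sub>1 r\<^sub>2 :: nat \<Rightarrow> real.
      r\<^sub>1 \<in> O(\<lambda>n. ln (real (D n)) / real n powr (1 / 8)) \<and>
      r\<^sub>2 \<in> O(\<lambda>n. (ln (real (D n)) / real n) powr (1 / 6)) \<and>
      (\<forall>n\<ge>2. measure (M n) {\<omega> \<in> space (M n).
           G_map (D n) (pop_cov_vec (D n) (P n)) \<in> partial_corr_region n (D n) \<alpha> (\<lambda>i. Y n i \<omega>)}
         \<ge> 1 - \<alpha> - r\<^sub>1 n - r\<^sub>2 n)"
proof -
  define bm where "bm = B + 8 * B^2 + (8 * B^2)^2 + (8 * B^2)^3"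
  define \<rho> where "\<rho> = a / sqrt 2"
  have \<rho>: "0 < \<rho>" using A2(1) by (simp add: \<rho>_def)
  obtain c L K where cL: "0 < c" "0 \<le> L" "0 < K" and ev: "eventually (\<lambda>n. large_sample B bm c n \<and> low_bound B \<rho> c L n + boot_bound B n < 1 - \<alpha> \<and>
     data_bound bm n \<le> \<alpha> \<and> boot_bound B n + slab_bound B c n + data_bound bm n \<le> K * real n powr (- 1 / 8)) sequentially"
    by (rule asymptotic_constants[OF alpha \<rho>])
  define cov where "cov = (\<lambda>n. measure (M n) {\<omega> \<in> space (M n).
           G_map (D n) (pop_cov_vec (D n) (P n)) \<in> partial_corr_region n (D n) \<alpha> (\<lambda>i. Y n i \<omega>)})"
  \<comment> \<open>The coverage deficit itself, so that the inequality holds for every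
    \<open>n\<close> and only the order of \<open>r\<close> at infinity remains to be
    estimated.\<close>
  define r where "r = (\<lambda>n. max 0 (1 - \<alpha> - cov n))"
  have "(\<lambda>n::nat. 16 * ln (real n) / sqrt (real n)) \<longlonglongrightarrow> 0" by real_asymp
  hence eps: "eventually (\<lambda>n. 16 * ln (real n) / sqrt (real n) < a / 2) sequentially" by (rule order_tendstoD) (use A2(1) in simp)
  have "eventually (\<lambda>n. norm (r n) \<le> K / ln 2 * norm (ln (real (D n)) / real n powr (1 / 8))) sequentially"
    using ev eps eventually_ge_at_top[of 2]
  proof eventually_elim
    case (elim n)
    interpret sample_setting n "D n" "P n" "M n" "Y n" B
      by unfold_locales (use elim dim[of n] iid[of n] bounded[of n] in auto)
    show ?case
    proof (cases "D n = 1")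
      \<comment> \<open>Here \<open>ln (real (D n)) = 0\<close>, so \<open>r n\<close> has to vanish
        exactly.\<close>
      case True
      have "1 - \<alpha> \<le> cov n" unfolding cov_def
        by (rule coverage_dimension_one[OF True alpha A2(1,2) bm_def]) (use elim in \<open>auto simp: large_sample_def\<close>)
      thus ?thesis using True by (simp add: r_def)
    next
      case False
      hence D2: "2 \<le> D n" using D1 by simp
      have "1 - \<alpha> - (boot_bound B n + slab_bound B c n + data_bound bm n) \<le> cov n" unfolding cov_def
        by (rule coverage_dimension_ge_two[OF alpha D2 A2(1,2) cL(1,2) bm_def]) (use elim in \<open>auto simp: \<rho>_def\<close>)
      hence "1 - \<alpha> - cov n \<le> K * real n powr (- 1 / 8)" using elim by linarith
      hence "r n \<le> K * real n powr (- 1 / 8)" using cL(3) by (simp add: r_def)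
      also have "\<dots> = K * (1 / real n powr (1 / 8))" using powr_minus_divide[of "real n" "1 / 8"] by simp
      \<comment> \<open>\<open>ln 2 \<le> ln (real (D n))\<close> brings the dimension into a bound
        that was free of it.\<close>
      also have "\<dots> \<le> K * (ln (real (D n)) / ln 2 / real n powr (1 / 8))"
        using D2 cL(3) by (intro mult_left_mono divide_right_mono) auto
      finally have "r n \<le> K / ln 2 * (ln (real (D n)) / real n powr (1 / 8))" by simp
      moreover have "norm (r n) = r n" "norm (ln (real (D n)) / real n powr (1 / 8)) = ln (real (D n)) / real n powr (1 / 8)"
        using D2 by (simp_all add: r_def)
      ultimately show ?thesis by (simp only:)
    qed
  qed
  hence O: "r \<in> O(\<lambda>n. ln (real (D n)) / real n powr (1 / 8))" by (rule landau_o.bigI[rotated]) (use cL in simp)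
  show ?thesis
  proof (rule exI[of _ r], rule exI[of _ "\<lambda>_. 0"], intro conjI allI impI O)
    fix n :: nat
    have "1 - \<alpha> - r n - 0 \<le> cov n" by (simp add: r_def)
    thus "1 - \<alpha> - r n - 0 \<le> measure (M n) {\<omega> \<in> space (M n).
           G_map (D n) (pop_cov_vec (D n) (P n)) \<in> partial_corr_region n (D n) \<alpha> (\<lambda>i. Y n i \<omega>)}"
      unfolding cov_def .
  qed simp
qed

end
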